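(* Work in the setting of the context (in particular $R_0=\infty$, and $X$, $\widehat X$ are conservative). Let $z_0\in\mathfrak X$ and suppose that, in addition to (A), (B), (C), the assumptions (V1), (V2), ($\Phi$), (B2-a), (B2-b), (C2), (D2) listed in the context hold for $z_0$ and some $r_0>0$. Then there exists $C_2=C_2(z_0)>1$ such that for any $r\ge 2r_0$, any open set $D\subset \overline{B}(z_0,r)^c$ and any non-negative functions $u$ and $v$ on $\mathfrak X$ which are regular harmonic with respect to $X$ in $D$ and vanish on $\overline{B}(z_0,r)^c\cap\left(\overline{D}^c\cup D^{\mathrm{reg}}\right)$, it holds that $$C_2^{-1} \frac{u(y)}{v(y)} \le \frac{u(x)}{v(x)}\le C_2 \frac{u(y)}{v(y)}\qquad \text{for all }x,y\in D\cap \overline{B}(z_0,8r)^c.$$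
   Context: **Space.** $(\mathfrak X,d)$ is a metric space in which all bounded closed sets are compact; $m$ is a $\sigma$-finite measure on $\mathfrak X$ with full support. The localization radius $R_0\in(0,\infty]$ is such that $\mathfrak X\setminus B(x,2r)\ne\emptyset$ for all $x\in\mathfrak X$ and $r<R_0$. $B(x,r)$ is the open ball and $\overline B(x,r)$ its closure; $A(x,r,R)=\{y: r<d(x,y)<R\}$ and $\overline A(x,r,R)$ is its closure; complements are in $\mathfrak X$. $C_0(\mathfrak X)$ is the space of bounded continuous functions vanishing at infinity. **Process.** $X=(X_t,\mathbb P_x)$ is a Markov process on $\mathfrak X$ with semigroup $(P_t)$, cemetery $\partial$, lifetime $\zeta$; conventions $X_\zeta=\partial$ and $u(\partial)=0$ for every function $u$. For open $D$, $\tau_D=\inf\{t>0: X_t\notin D\}$. Objects for the dual process carry a hat. (A) $X$ is a Hunt process admitting a strong dual $\widehat X$ with respect to $m$, and $\widehat X$ is also a Hunt process. The semigroups $(P_t)$, $(\widehat P_t)$ are both Feller and strongly Feller. Every semi-polar set of $X$ is polar. Under (A), for open $D$ the process $X$ killed on exiting $D$ has a unique (possibly infinite) Green function $G_D(x,y)$ with $\mathbb E_x\int_0^{\tau_D}f(X_t)dt=\int_D f(y)G_D(x,y)m(dy)$ for non-negative Borel $f$, and $G_D(x,y)=\widehat G_D(y,x)$. $D$ is Greenian if $G_D(x,y)<\infty$ for all $x,y\in D$, $x\ne y$. $\mathcal A$, $\widehat{\mathcal A}$ are the generators of $(P_t)$, $(\widehat P_t)$ in $C_0(\mathfrak X)$.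 (B) There is a linear subspace $\mathcal D$ of $\mathcal D(\mathcal A)\cap\mathcal D(\widehat{\mathcal A})$ such that for any compact $K$ and open $D$ with $K\subset D\subset\mathfrak X$, the collection $\mathcal D(K,D)$ of all $f\in\mathcal D$ with $f=1$ on $K$, $f=0$ on $\mathfrak X\setminus D$, $0\le f\le1$ on $\mathfrak X$, and $m(\partial\{f>0\})=0$, is nonempty. Under (B) the jumps of $X$ are described by a Lévy kernel $J$ (with $J(x,\{x\})=0$) satisfying $\int f(y)J(x,dy)=\lim_{t\downarrow0}\mathbb E_xf(X_t)/t$ for bounded continuous $f$ and $x\notin\mathrm{supp} f$; $\widehat J$ is defined similarly. (C) The Lévy kernels of $X$ and $\widehat X$ are $j(x,y)m(dy)$ and $\widehat j(x,y)m(dy)$, with $j(x,y)=\widehat j(y,x)>0$ for all $x\ne y$. **Harmonicity.** A non-negative $u$ is regular harmonic in open $D$ with respect to $X$ if $u(x)=\mathbb E_x(u(X_{\tau_D}))$ for all $x\in D$. $D^{\mathrm{reg}}$ is the set of $x\in\partial D$ with $\mathbb P_x(\tau_D=0)=1$. **Standing assumptions at infinity.** $R_0=\infty$; $X$ and $\widehat X$ are conservative: $P_t1=\widehat P_t1=1$ for all $t\ge0$. $C_\infty(\mathfrak X)$ is the Banach space of continuous functions on $\mathfrak X$ having a limit at infinity; $\mathcal A,\widehat{\mathcal A}$ also denote the generators in $C_\infty(\mathfrak X)$. Put $V(r)=m(B(z_0,r))$. (V1) There is $c>1$ with $V(2r)\le cV(r)$ for all $r>0$. (V2) There are $c>1$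 and $n_0\in\mathbb N$, $n_0\ge2$, with $V(n_0r)\ge cV(r)$ for all $r\ge r_0$. ($\Phi$) There is a non-decreasing function $\Phi:[0,\infty)\to[0,\infty)$ and $c>1$ with $\Phi(2r)\le c\,\Phi(r)$ for all $r>0$. (B2-a) For any $a\in(1,2]$ there is $c=c(z_0,a)$ such that for any $r\ge r_0$, $\inf_{f\in\mathcal D(\overline B(z_0,r),B(z_0,ar))}\sup_{x\in\mathfrak X}\max(\mathcal A(1-f)(x),\widehat{\mathcal A}(1-f)(x))\le c/\Phi(r)$. (B2-b) For any $a\in(1,2]$ there is $c=c(z_0,a)$ such that for any $r\ge r_0$ and any $f\in\mathcal D(\overline B(z_0,r),B(z_0,ar))$, $\max(\mathcal Af(x),\widehat{\mathcal A}f(x))\le cV(r)j(x,z_0)$ for $x\in\overline A(z_0,r,(a+1)r)$. (C2) For any $a\in(1,2]$ there are $c\geq 1$, $c'>0$ depending on $z_0,a$ such that for $r\ge r_0$, $x\in B(z_0,r)$, $y\in\mathfrak X\setminus B(z_0,ar)$: $c^{-1}j(z_0,y)\le j(x,y)\le c\,j(z_0,y)$, $c^{-1}\widehat j(z_0,y)\le\widehat j(x,y)\le c\,\widehat j(z_0,y)$, and $\inf_{y\in\overline A(z_0,r,ar)}\min(j(z_0,y),\widehat j(z_0,y))\ge \frac{c'}{V(r)\Phi(r)}$. (D2) $\overline B(z_0,r_0)^c$ is Greenian, and for every $a\in(1,2)$ there is $c=c(z_0,a)$ such that for all $r\ge r_0$, $\sup_{x\in\overline B(z_0,ar)}\sup_{y\in\overline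 A(z_0,2r,4r)}\max(G_{\overline B(z_0,r)^c}(x,y),\widehat G_{\overline B(z_0,r)^c}(x,y))\le c\,\Phi(r)/V(r)$. *)

theory Defs
  imports "HOL-Probability.Probability"
begin

section \<open>Markov processes with a cemetery\<close>

text \<open>
  Points of the state space with cemetery are of type \<^typ>\<open>'a option\<close>, with \<^term>\<open>None\<close> as the
  cemetery. It carries the topology of the one-point compactification, and its Borel sets.
  Time runs through \<open>[0,\<infinity>]\<close>, so that a random time is a function into \<^typ>\<open>ennreal\<close> and the process
  can be evaluated at it; the process is in the cemetery at time \<open>\<infinity>\<close>.
\<close>

abbreviation cem_top :: "'a::topological_space option topology" where
  "cem_top \<equiv> Alexandroff_compactification euclidean"

definition cem_borel :: "'a::topological_space option measure" where
  "cem_borel = sigma UNIV {U. openin cem_top U}"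

definition ext0 :: "('a \<Rightarrow> 'b::zero) \<Rightarrow> 'a option \<Rightarrow> 'b" where
  "ext0 u z = (case z of None \<Rightarrow> 0 | Some x \<Rightarrow> u x)"

text \<open>Only the measurable space underlying \<open>events\<close> is used.\<close>

record ('w, 'a) process =
  events :: "'w measure"
  pos :: "ennreal \<Rightarrow> 'w \<Rightarrow> 'a option"
  law :: "'a option \<Rightarrow> 'w measure"

definition natural_filtration :: "('w, 'a::topological_space) process \<Rightarrow> ennreal \<Rightarrow> 'w measure" where
  "natural_filtration X t = sigma (space (events X))
     {pos X s -` E \<inter> space (events X) |s E. s \<le> t \<and> E \<in> sets cem_borel}"

text \<open>At \<open>t = \<infinity>\<close> the set of later times is empty, whence the added \<open>\<infinity>\<close> below.\<close>

definition right_filtration :: "('w, 'a::topological_space) process \<Rightarrow> ennreal \<Rightarrow> 'w measure" where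
  "right_filtration X t = sigma (space (events X))
     (\<Inter>u\<in>insert \<infinity> {t<..}. sets (natural_filtration X u))"

definition strong_markov :: "('w, 'a::topological_space) process \<Rightarrow> bool" where
  "strong_markov X \<longleftrightarrow>
     (\<forall>T x s. \<forall>E\<in>sets cem_borel. stopping_time (right_filtration X) T \<longrightarrow>
       (\<forall>A\<in>sets (filtration.pre_sigma (space (events X)) (right_filtration X) T).
          emeasure (law X x) {\<omega>\<in>A. pos X (T \<omega> + s) \<omega> \<in> E} =
          (\<integral>\<^sup>+\<omega>\<in>A. emeasure (law X (pos X (T \<omega>) \<omega>)) {\<omega>'\<in>space (events X). pos X s \<omega>' \<in> E} \<partial>law X x)))"

definition quasi_left_continuous :: "('w, 'a::topological_space) process \<Rightarrow> bool" where
  "quasi_left_continuous X \<longleftrightarrow>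
     (\<forall>T :: nat \<Rightarrow> 'w \<Rightarrow> ennreal.
        (\<forall>n. stopping_time (right_filtration X) (T n)) \<and>
        (\<forall>\<omega>\<in>space (events X). incseq (\<lambda>n. T n \<omega>)) \<longrightarrow>
        (\<forall>x. AE \<omega> in law X x. (SUP n. T n \<omega>) < \<infinity> \<longrightarrow>
           limitin cem_top (\<lambda>n. pos X (T n \<omega>) \<omega>) (pos X (SUP n. T n \<omega>) \<omega>) sequentially))"

text \<open>
  No completion of the filtration is needed: if the strong Markov property and quasi-left continuity
  hold for some right-continuous filtration to which the process is adapted, then they hold for
  \<^const>\<open>right_filtration\<close>, the smallest one, and so for its augmentation.
\<close>

definition hunt_process :: "('w, 'a::topological_space) process \<Rightarrow> bool" where
  "hunt_process X \<longleftrightarrow>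
     (\<forall>x. prob_space (law X x) \<and> sets (law X x) = sets (events X)) \<and>
     (\<forall>t. pos X t \<in> events X \<rightarrow>\<^sub>M cem_borel) \<and>
     (\<forall>t. \<forall>E\<in>sets cem_borel.
        (\<lambda>x. emeasure (law X x) {\<omega>\<in>space (events X). pos X t \<omega> \<in> E}) \<in> borel_measurable cem_borel) \<and>
     (\<forall>x. AE \<omega> in law X x. pos X 0 \<omega> = x) \<and>
     (\<forall>\<omega>\<in>space (events X). pos X \<infinity> \<omega> = None) \<and>
     (\<forall>\<omega>\<in>space (events X). \<forall>s t. s \<le> t \<and> pos X s \<omega> = None \<longrightarrow> pos X t \<omega> = None) \<and>
     (\<exists>\<theta>. \<forall>t. \<forall>\<omega>\<in>space (events X). \<theta> t \<omega> \<in> space (events X) \<and> (\<forall>s. pos X s (\<theta> t \<omega>) = pos X (s + t) \<omega>)) \<and>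
     (\<forall>\<omega>\<in>space (events X). \<forall>t<\<infinity>. limitin cem_top (\<lambda>s. pos X s \<omega>) (pos X t \<omega>) (at_right t)) \<and>
     (\<forall>\<omega>\<in>space (events X). \<forall>t<\<infinity>. 0 < t \<longrightarrow> (\<exists>l. limitin cem_top (\<lambda>s. pos X s \<omega>) l (at_left t))) \<and>
     strong_markov X \<and> quasi_left_continuous X"

definition hitting_time :: "('w, 'a) process \<Rightarrow> 'a option set \<Rightarrow> 'w \<Rightarrow> ennreal" where
  "hitting_time X B \<omega> = Inf {t. 0 < t \<and> pos X t \<omega> \<in> B}"

definition exit_time :: "('w, 'a) process \<Rightarrow> 'a set \<Rightarrow> 'w \<Rightarrow> ennreal" where
  "exit_time X D = hitting_time X (- (Some ` D))"

text \<open>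
  Exit times are in general measurable only with respect to the completions of the laws. The
  integral \<open>\<integral>\<^sup>+\<close> and \<open>AE\<close> have the same values for a measure and for its completion.
\<close>

definition semigroup :: "('w, 'a) process \<Rightarrow> real \<Rightarrow> ('a \<Rightarrow> real) \<Rightarrow> 'a \<Rightarrow> real" where
  "semigroup X t f x = (\<integral>\<omega>. ext0 f (pos X (ennreal t) \<omega>) \<partial>law X (Some x))"

definition resolvent :: "('w, 'a) process \<Rightarrow> real \<Rightarrow> ('a \<Rightarrow> ennreal) \<Rightarrow> 'a \<Rightarrow> ennreal" where
  "resolvent X \<alpha> f x =
     (\<integral>\<^sup>+\<omega>. (\<integral>\<^sup>+t\<in>{0..}. ennreal (exp (- \<alpha> * t)) * ext0 f (pos X (ennreal t) \<omega>) \<partial>lborel) \<partial>law X (Some x))"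

definition conservative :: "('w, 'a) process \<Rightarrow> bool" where
  "conservative X \<longleftrightarrow> (\<forall>t\<ge>0. \<forall>x. semigroup X t (\<lambda>_. 1) x = 1)"


section \<open>Function spaces, Feller properties, generators\<close>

definition cocompact :: "'a::topological_space filter" where
  "cocompact = (INF K\<in>{K. compact K}. principal (- K))"

definition C0 :: "('a::metric_space \<Rightarrow> real) set" where
  "C0 = {f. continuous_on UNIV f \<and> bounded (range f) \<and> (f \<longlongrightarrow> 0) cocompact}"

definition C_inf :: "('a::metric_space \<Rightarrow> real) set" where
  "C_inf = {f. continuous_on UNIV f \<and> (\<exists>l. (f \<longlongrightarrow> l) cocompact)}"

definition feller :: "('w, 'a::metric_space) process \<Rightarrow> bool" where
  "feller X \<longleftrightarrow> (\<forall>f\<in>C0. (\<forall>t\<ge>0. semigroup X t f \<in> C0) \<and>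
     uniform_limit UNIV (\<lambda>t. semigroup X t f) f (at_right 0))"

definition strongly_feller :: "('w, 'a::metric_space) process \<Rightarrow> bool" where
  "strongly_feller X \<longleftrightarrow> (\<forall>t>0. \<forall>f\<in>borel_measurable borel.
     bounded (range f) \<longrightarrow> continuous_on UNIV (semigroup X t f))"

text \<open>
  \<open>S\<close> is the Banach space, with the supremum norm, in which the generator is taken:
  \<^const>\<open>C0\<close> or \<^const>\<open>C_inf\<close>.
\<close>

definition generates ::
  "('a::metric_space \<Rightarrow> real) set \<Rightarrow> ('w, 'a) process \<Rightarrow> ('a \<Rightarrow> real) \<Rightarrow> ('a \<Rightarrow> real) \<Rightarrow> bool" where
  "generates S X f g \<longleftrightarrow> f \<in> S \<and> g \<in> S \<and>
     uniform_limit UNIV (\<lambda>t x. (semigroup X t f x - f x) / t) g (at_right 0)"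

definition gen_dom :: "('a::metric_space \<Rightarrow> real) set \<Rightarrow> ('w, 'a) process \<Rightarrow> ('a \<Rightarrow> real) set" where
  "gen_dom S X = {f. \<exists>g. generates S X f g}"

definition gen :: "('a::metric_space \<Rightarrow> real) set \<Rightarrow> ('w, 'a) process \<Rightarrow> ('a \<Rightarrow> real) \<Rightarrow> 'a \<Rightarrow> real" where
  "gen S X f = (THE g. generates S X f g)"


section \<open>Duality and exceptional sets\<close>

text \<open>Duality relative to \<open>m\<close> in the sense of Blumenthal and Getoor, Chapter VI.\<close>

definition strong_dual ::
  "'a::metric_space measure \<Rightarrow> ('w, 'a) process \<Rightarrow> ('v, 'a) process \<Rightarrow> bool" where
  "strong_dual m X Xh \<longleftrightarrow>
     (\<forall>\<alpha>>0. \<forall>f\<in>borel_measurable borel. \<forall>g\<in>borel_measurable borel.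
        (\<integral>\<^sup>+x. f x * resolvent X \<alpha> g x \<partial>m) = (\<integral>\<^sup>+x. resolvent Xh \<alpha> f x * g x \<partial>m)) \<and>
     (\<forall>\<alpha>>0. \<forall>x. \<forall>N\<in>null_sets m. resolvent X \<alpha> (indicator N) x = 0 \<and> resolvent Xh \<alpha> (indicator N) x = 0)"

definition polar :: "('w, 'a::metric_space) process \<Rightarrow> 'a set \<Rightarrow> bool" where
  "polar X B \<longleftrightarrow> (\<exists>E\<in>sets borel. B \<subseteq> E \<and>
     (\<forall>x. AE \<omega> in law X (Some x). hitting_time X (Some ` E) \<omega> = \<infinity>))"

definition thin :: "('w, 'a::metric_space) process \<Rightarrow> 'a set \<Rightarrow> bool" where
  "thin X B \<longleftrightarrow> (\<exists>E\<in>sets borel. B \<subseteq> E \<and>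
     (\<forall>x. \<not> (AE \<omega> in law X (Some x). hitting_time X (Some ` E) \<omega> = 0)))"

definition semi_polar :: "('w, 'a::metric_space) process \<Rightarrow> 'a set \<Rightarrow> bool" where
  "semi_polar X B \<longleftrightarrow> (\<exists>N :: nat \<Rightarrow> 'a set. (\<forall>n. thin X (N n)) \<and> B \<subseteq> (\<Union>n. N n))"

definition assumption_A ::
  "'a::metric_space measure \<Rightarrow> ('w, 'a) process \<Rightarrow> ('v, 'a) process \<Rightarrow> bool" where
  "assumption_A m X Xh \<longleftrightarrow> hunt_process X \<and> hunt_process Xh \<and> strong_dual m X Xh \<and>
     feller X \<and> feller Xh \<and> strongly_feller X \<and> strongly_feller Xh \<and>
     (\<forall>B. semi_polar X B \<longrightarrow> polar X B)"


section \<open>Green functions\<close>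

definition killed_semigroup ::
  "('w, 'a) process \<Rightarrow> 'a set \<Rightarrow> real \<Rightarrow> ('a \<Rightarrow> ennreal) \<Rightarrow> 'a \<Rightarrow> ennreal" where
  "killed_semigroup X D t f x =
     (\<integral>\<^sup>+\<omega>. ext0 f (pos X (ennreal t) \<omega>) * indicator {\<omega>. ennreal t < exit_time X D \<omega>} \<omega> \<partial>law X (Some x))"

definition excessive :: "('w, 'a::metric_space) process \<Rightarrow> 'a set \<Rightarrow> ('a \<Rightarrow> ennreal) \<Rightarrow> bool" where
  "excessive X D f \<longleftrightarrow>
     (\<forall>t>0. \<forall>x\<in>D. killed_semigroup X D t f x \<le> f x) \<and>
     (\<forall>x\<in>D. ((\<lambda>t. killed_semigroup X D t f x) \<longlongrightarrow> f x) (at_right 0))"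

definition occupation :: "('w, 'a) process \<Rightarrow> 'a set \<Rightarrow> ('a \<Rightarrow> ennreal) \<Rightarrow> 'a \<Rightarrow> ennreal" where
  "occupation X D f x =
     (\<integral>\<^sup>+\<omega>. (\<integral>\<^sup>+t\<in>{t. 0 \<le> t \<and> ennreal t < exit_time X D \<omega>}.
        ext0 f (pos X (ennreal t) \<omega>) \<partial>lborel) \<partial>law X (Some x))"

text \<open>
  The occupation formula determines \<open>G(x,-)\<close> only up to null sets. The Green function is the version
  that is also the transposed density for the dual process, and that is excessive in the first and
  co-excessive in the second variable (Blumenthal and Getoor, Theorem VI.1.4); these properties
  determine it everywhere on \<open>D \<times> D\<close>. Off \<open>D \<times> D\<close> it is set to zero.
\<close>

definition is_green ::
  "'a::metric_space measure \<Rightarrow> ('w, 'a) process \<Rightarrow> ('v, 'a) process \<Rightarrow> 'a set \<Rightarrow> ('a \<Rightarrow> 'a \<Rightarrow> ennreal) \<Rightarrow> bool" where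
  "is_green m X Xh D G \<longleftrightarrow>
     (\<lambda>(x, y). G x y) \<in> borel_measurable (borel \<Otimes>\<^sub>M borel) \<and>
     (\<forall>x y. x \<notin> D \<or> y \<notin> D \<longrightarrow> G x y = 0) \<and>
     (\<forall>f\<in>borel_measurable borel. \<forall>x\<in>D. occupation X D f x = (\<integral>\<^sup>+y\<in>D. f y * G x y \<partial>m)) \<and>
     (\<forall>f\<in>borel_measurable borel. \<forall>y\<in>D. occupation Xh D f y = (\<integral>\<^sup>+x\<in>D. f x * G x y \<partial>m)) \<and>
     (\<forall>y\<in>D. excessive X D (\<lambda>x. G x y)) \<and>
     (\<forall>x\<in>D. excessive Xh D (\<lambda>y. G x y))"

definition green ::
  "'a::metric_space measure \<Rightarrow> ('w, 'a) process \<Rightarrow> ('v, 'a) process \<Rightarrow> 'a set \<Rightarrow> 'a \<Rightarrow> 'a \<Rightarrow> ennreal" where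
  "green m X Xh D = (THE G. is_green m X Xh D G)"

definition greenian ::
  "'a::metric_space measure \<Rightarrow> ('w, 'a) process \<Rightarrow> ('v, 'a) process \<Rightarrow> 'a set \<Rightarrow> bool" where
  "greenian m X Xh D \<longleftrightarrow> (\<forall>x\<in>D. \<forall>y\<in>D. x \<noteq> y \<longrightarrow> green m X Xh D x y < \<infinity>)"


section \<open>Bump functions and the Levy kernel\<close>

definition bump ::
  "'a::metric_space measure \<Rightarrow> ('a \<Rightarrow> real) set \<Rightarrow> 'a set \<Rightarrow> 'a set \<Rightarrow> ('a \<Rightarrow> real) set" where
  "bump m \<D> K D = {f\<in>\<D>. (\<forall>x\<in>K. f x = 1) \<and> (\<forall>x\<in>- D. f x = 0) \<and> (\<forall>x. 0 \<le> f x \<and> f x \<le> 1) \<and>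
     emeasure m (frontier {x. 0 < f x}) = 0}"

definition assumption_B ::
  "'a::metric_space measure \<Rightarrow> ('w, 'a) process \<Rightarrow> ('v, 'a) process \<Rightarrow> ('a \<Rightarrow> real) set \<Rightarrow> bool" where
  "assumption_B m X Xh \<D> \<longleftrightarrow>
     \<D> \<subseteq> gen_dom C0 X \<inter> gen_dom C0 Xh \<and>
     (\<lambda>_. 0) \<in> \<D> \<and> (\<forall>f\<in>\<D>. \<forall>g\<in>\<D>. (\<lambda>x. f x + g x) \<in> \<D>) \<and> (\<forall>c. \<forall>f\<in>\<D>. (\<lambda>x. c * f x) \<in> \<D>) \<and>
     (\<forall>K D. compact K \<and> open D \<and> K \<subseteq> D \<longrightarrow> bump m \<D> K D \<noteq> {})"

definition levy_kernel :: "('w, 'a::metric_space) process \<Rightarrow> ('a \<Rightarrow> 'a measure) \<Rightarrow> bool" where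
  "levy_kernel X J \<longleftrightarrow>
     (\<forall>x. sets (J x) = sets borel) \<and>
     (\<forall>E\<in>sets borel. (\<lambda>x. emeasure (J x) E) \<in> borel_measurable borel) \<and>
     (\<forall>x. emeasure (J x) {x} = 0) \<and>
     (\<forall>f x. continuous_on UNIV f \<and> bounded (range f) \<and> x \<notin> closure {y. f y \<noteq> 0} \<longrightarrow>
        integrable (J x) f \<and> ((\<lambda>t. semigroup X t f x / t) \<longlongrightarrow> (\<integral>y. f y \<partial>J x)) (at_right 0))"

definition assumption_C ::
  "'a::metric_space measure \<Rightarrow> ('w, 'a) process \<Rightarrow> ('v, 'a) process \<Rightarrow>
   ('a \<Rightarrow> 'a \<Rightarrow> real) \<Rightarrow> ('a \<Rightarrow> 'a \<Rightarrow> real) \<Rightarrow> bool" where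
  "assumption_C m X Xh j jh \<longleftrightarrow>
     (\<lambda>(x, y). j x y) \<in> borel_measurable (borel \<Otimes>\<^sub>M borel) \<and>
     (\<lambda>(x, y). jh x y) \<in> borel_measurable (borel \<Otimes>\<^sub>M borel) \<and>
     levy_kernel X (\<lambda>x. density m (\<lambda>y. ennreal (j x y))) \<and>
     levy_kernel Xh (\<lambda>x. density m (\<lambda>y. ennreal (jh x y))) \<and>
     (\<forall>x y. x \<noteq> y \<longrightarrow> j x y = jh y x \<and> 0 < j x y)"


section \<open>Assumptions at infinity\<close>

definition cl_ball :: "'a::metric_space \<Rightarrow> real \<Rightarrow> 'a set" where
  "cl_ball x r = closure (ball x r)"

definition cl_annulus :: "'a::metric_space \<Rightarrow> real \<Rightarrow> real \<Rightarrow> 'a set" where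
  "cl_annulus x r R = closure {y. r < dist x y \<and> dist x y < R}"

text \<open>Balls have finite measure, by duality and the strong Feller property.\<close>

definition vol :: "'a::metric_space measure \<Rightarrow> 'a \<Rightarrow> real \<Rightarrow> real" where
  "vol m z0 r = measure m (ball z0 r)"

definition assumption_V1 :: "'a::metric_space measure \<Rightarrow> 'a \<Rightarrow> bool" where
  "assumption_V1 m z0 \<longleftrightarrow> (\<exists>c>1. \<forall>r>0. vol m z0 (2 * r) \<le> c * vol m z0 r)"

definition assumption_V2 :: "'a::metric_space measure \<Rightarrow> 'a \<Rightarrow> real \<Rightarrow> bool" where
  "assumption_V2 m z0 r0 \<longleftrightarrow>
     (\<exists>c>1. \<exists>n0::nat. 2 \<le> n0 \<and> (\<forall>r\<ge>r0. vol m z0 (real n0 * r) \<ge> c * vol m z0 r))"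

definition assumption_Phi :: "(real \<Rightarrow> real) \<Rightarrow> bool" where
  "assumption_Phi \<Phi> \<longleftrightarrow> (\<forall>r\<ge>0. 0 \<le> \<Phi> r) \<and> mono_on {0..} \<Phi> \<and> (\<exists>c>1. \<forall>r>0. \<Phi> (2 * r) \<le> c * \<Phi> r)"

definition assumption_B2a ::
  "'a::metric_space measure \<Rightarrow> ('w, 'a) process \<Rightarrow> ('v, 'a) process \<Rightarrow> ('a \<Rightarrow> real) set \<Rightarrow>
   (real \<Rightarrow> real) \<Rightarrow> 'a \<Rightarrow> real \<Rightarrow> bool" where
  "assumption_B2a m X Xh \<D> \<Phi> z0 r0 \<longleftrightarrow>
     (\<forall>a. 1 < a \<and> a \<le> 2 \<longrightarrow> (\<exists>c>0. \<forall>r\<ge>r0.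
        (INF f\<in>bump m \<D> (cl_ball z0 r) (ball z0 (a * r)).
          SUP x. ereal (max (gen C_inf X (\<lambda>y. 1 - f y) x) (gen C_inf Xh (\<lambda>y. 1 - f y) x)))
        \<le> ereal c / ereal (\<Phi> r)))"

definition assumption_B2b ::
  "'a::metric_space measure \<Rightarrow> ('w, 'a) process \<Rightarrow> ('v, 'a) process \<Rightarrow> ('a \<Rightarrow> real) set \<Rightarrow>
   ('a \<Rightarrow> 'a \<Rightarrow> real) \<Rightarrow> 'a \<Rightarrow> real \<Rightarrow> bool" where
  "assumption_B2b m X Xh \<D> j z0 r0 \<longleftrightarrow>
     (\<forall>a. 1 < a \<and> a \<le> 2 \<longrightarrow> (\<exists>c>0. \<forall>r\<ge>r0.
        \<forall>f\<in>bump m \<D> (cl_ball z0 r) (ball z0 (a * r)). \<forall>x\<in>cl_annulus z0 r ((a + 1) * r).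
          max (gen C_inf X f x) (gen C_inf Xh f x) \<le> c * vol m z0 r * j x z0))"

definition assumption_C2 ::
  "'a::metric_space measure \<Rightarrow> ('a \<Rightarrow> 'a \<Rightarrow> real) \<Rightarrow> ('a \<Rightarrow> 'a \<Rightarrow> real) \<Rightarrow>
   (real \<Rightarrow> real) \<Rightarrow> 'a \<Rightarrow> real \<Rightarrow> bool" where
  "assumption_C2 m j jh \<Phi> z0 r0 \<longleftrightarrow>
     (\<forall>a. 1 < a \<and> a \<le> 2 \<longrightarrow> (\<exists>c\<ge>1. \<exists>c'>0. \<forall>r\<ge>r0.
        (\<forall>x\<in>ball z0 r. \<forall>y\<in>- ball z0 (a * r).
           inverse c * j z0 y \<le> j x y \<and> j x y \<le> c * j z0 y \<and>
           inverse c * jh z0 y \<le> jh x y \<and> jh x y \<le> c * jh z0 y) \<and>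
        (INF y\<in>cl_annulus z0 r (a * r). ennreal (min (j z0 y) (jh z0 y)))
          \<ge> ennreal c' / ennreal (vol m z0 r * \<Phi> r)))"

definition assumption_D2 ::
  "'a::metric_space measure \<Rightarrow> ('w, 'a) process \<Rightarrow> ('v, 'a) process \<Rightarrow>
   (real \<Rightarrow> real) \<Rightarrow> 'a \<Rightarrow> real \<Rightarrow> bool" where
  "assumption_D2 m X Xh \<Phi> z0 r0 \<longleftrightarrow>
     greenian m X Xh (- cl_ball z0 r0) \<and>
     (\<forall>a. 1 < a \<and> a < 2 \<longrightarrow> (\<exists>c>0. \<forall>r\<ge>r0.
        (SUP x\<in>cl_ball z0 (a * r). SUP y\<in>cl_annulus z0 (2 * r) (4 * r).
           max (green m X Xh (- cl_ball z0 r) x y) (green m Xh X (- cl_ball z0 r) x y))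
        \<le> ennreal (c * \<Phi> r / vol m z0 r)))"


section \<open>Harmonic functions\<close>

definition regular_harmonic :: "('w, 'a::metric_space) process \<Rightarrow> 'a set \<Rightarrow> ('a \<Rightarrow> real) \<Rightarrow> bool" where
  "regular_harmonic X D u \<longleftrightarrow>
     (\<forall>x\<in>D. ennreal (u x) = (\<integral>\<^sup>+\<omega>. ennreal (ext0 u (pos X (exit_time X D \<omega>) \<omega>)) \<partial>law X (Some x)))"

definition regular_points :: "('w, 'a::metric_space) process \<Rightarrow> 'a set \<Rightarrow> 'a set" where
  "regular_points X D = {x\<in>frontier D. AE \<omega> in law X (Some x). exit_time X D \<omega> = 0}"

end

theory Submission imports Defs begin

text \<open>Harmonicity in \<open>D\<close> is expressed through the exit operator \<open>HD 0 D\<close>, and \<open>RD 0 D\<close> is the potential operator of the process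
killed on leaving \<open>D\<close>; duality and the existence of excessive Green functions come from killing near the complement of \<open>D\<close> at a
rate tending to infinity. Two estimates give the theorem. First, on the shell between the radii \<open>2 r\<close> and \<open>4 r\<close>, a regular
harmonic \<open>w\<close> is at most a constant times \<open>1 / V r\<close> times its integral over \<open>ball z0 (1.8 r)\<close>. For this the dual
process is killed in \<open>ball z0 (1.8 r)\<close> at a rate that makes \<open>1 - f\<close> superharmonic up to a small error, with \<open>f\<close> a bump function
as in (B2-a); the Green function bound (D2) then propagates to that ball. Secondly, beyond the radius \<open>8 r\<close> the process leaves
\<open>D' = D \<inter> {y. 3 r < dist z0 y}\<close> either by a long jump, whose law is given by the Ikeda-Watanabe formula and (C2), or into the shell,
where the first estimate applies. Hence \<open>w x\<close> is comparable to the integral of \<open>w\<close> over \<open>ball z0 (2.5 r)\<close> times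
\<open>RD 0 D' (j _ z0) x\<close>, and the second factor does not depend on \<open>w\<close>.\<close>

text \<open>The obstacle is that (B2-a) bounds the generator from one side only:
  \<open>- A f <= d\<close> for one bump function at each radius. Hence
  \<open>k = 1 - f + ee\<close> becomes superharmonic only after killing at a rate of at least
  \<open>d / k\<close>. Twice this rate is used: one half compensates the generator, the other half
  pays for jumps beyond the ball. Where \<open>f = 1\<close> the rate is \<open>2 * d / ee\<close>;
  thus \<open>ee\<close> keeps it bounded, and it tends to 0 only after all constants are fixed. The
  process so killed is not constructed. Its potential is a Neumann series in \<open>RD al D\<close>
  whose weight, \<open>al\<close> minus the rate, is non-negative, so that supersolutions give upper
  bounds and duality holds term by term. Radii such as 1.1, 1.2, 1.8 and 1.9 times \<open>r\<close>
  leave gaps across which (C2) compares jump densities. Identities with subtractions are stated as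
  sums of extended non-negative terms, proved at positive discount rates for bounded functions,
  where finite terms cancel, and carried to rate 0 by monotone limits. Exit times are measurable
  only up to null sets and are replaced by \<open>TD\<close>, built from rational times.\<close>

abbreviation (input) "NI \<equiv> nn_integral"
abbreviation (input) "en \<equiv> ennreal"
abbreviation (input) "ix \<equiv> indicator"
abbreviation (input) "BM \<equiv> borel_measurable borel"

abbreviation (input) "SI M A f \<equiv> set_nn_integral M A f"
abbreviation (input) "xp a t \<equiv> ennreal (exp (- a * t))"
abbreviation (input) "rs n \<equiv> real (Suc n)"
abbreviation (input) "bf T \<equiv> {t. 0 \<le> t \<and> ennreal t < T}"
lemmas incle = incseq_def le_fun_def
lemmas mctSUP = nn_integral_monotone_convergence_SUP
lemmas nncong = nn_integral_cong and nnmono = nn_integral_mono and nncmult = nn_integral_cmult and splix = split_indicator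
  and mulL = mult_left_mono and mulR = mult_right_mono and mcomp = measurable_compose
abbreviation (input) LIMS ("((_)/ ----> (_))" [60, 60] 60) where "X ----> L \<equiv> (X \<longlonglongrightarrow> L)"
abbreviation (input) "bm \<equiv> borel_measurable"
abbreviation (input) "LI F \<equiv> nn_integral lborel F"
abbreviation (input) "iy \<equiv> (\<infinity> :: ennreal)"

section \<open>Borel structure of the state space with cemetery\<close>

lemma None_eq_Compl: "{None} = UNIV - Some ` UNIV"
proof (intro set_eqI)
 fix z :: "'a option" show "z : {None} \<longleftrightarrow> z : UNIV - Some ` UNIV" by (cases z) auto
qed

lemma option_set_split: "E = Some ` (Some -` E) Un (if None : E then {None} else {})"
proof (intro set_eqI)
 fix z show "z : E \<longleftrightarrow> z : Some ` (Some -` E) Un (if None : E then {None} else {})" by (cases z) auto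
qed

lemma openin_cem_Some: "open U ==> openin cem_top (Some ` U)"
 by simp

lemma openin_cem_None: "compact K ==> openin cem_top (insert None (Some ` (- K)))"
 for K :: "'a::t2_space set"
 unfolding openin_Alexandroff_compactification
 by (rule disjI2, rule exI[of _ K]) (auto simp: compact_imp_closed Compl_eq_Diff_UNIV)

lemma openin_cem_vimage: "openin cem_top U ==> open (Some -` U)"
 for U :: "'a::t2_space option set"
 unfolding openin_Alexandroff_compactification
proof (elim disjE exE conjE)
 fix V assume "openin euclidean V" "U = Some ` V"
 thus ?thesis by (simp add: inj_vimage_image_eq)
next
 fix C assume C: "compactin euclidean (C::'a set)" "closedin euclidean C"
  and U: "U = insert None (Some ` (topspace euclidean - C))"
 have "Some -` U = - C" using U by auto
 thus ?thesis using C by auto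
qed

lemma space_cem_borel [simp]: "space cem_borel = UNIV"
 unfolding cem_borel_def by simp

lemma Some_measurable: "Some : borel \<rightarrow>\<^sub>M (cem_borel :: 'a::t2_space option measure)"
 unfolding cem_borel_def
 by (rule measurable_measure_of) (auto intro!: openin_cem_vimage borel_open)

lemma cem_borel_open: "openin cem_top U ==> U : sets cem_borel"
 unfolding cem_borel_def by auto

lemma Some_image_sets:
 assumes "A : sets borel" shows "Some ` A : sets (cem_borel :: 'a::t2_space option measure)"
proof -
 have "A : sigma_sets UNIV {U::'a set. open U}"
  using assms by (simp add: borel_def)
 thus ?thesis
 proof induction
  case (Basic a) thus ?case by (auto intro: cem_borel_open)
 next
  case Empty thus ?case by simp
 next
  case (Compl a)
  have "Some ` (UNIV - a) = Some ` UNIV - Some ` a" by auto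
  moreover have "Some ` (UNIV :: 'a set) : sets cem_borel" by (rule cem_borel_open) simp
  ultimately show ?case using Compl.IH by simp
 next
  case (Union a)
  have "Some ` (\<Union>i. a i) = (\<Union>i. Some ` a i)" by auto
  thus ?case using Union.IH by auto
 qed
qed

text \<open>Since \<open>{None}\<close> is itself measurable, a set of extended states is measurable
  as soon as its trace on the space is. Measurability questions with a cemetery are reduced to
  \<open>borel\<close> in this way.\<close>

lemma sets_cem_borel:
 "E : sets (cem_borel :: 'a::t2_space option measure) \<longleftrightarrow> Some -` E : sets borel"
proof
 assume "E : sets cem_borel"
 thus "Some -` E : sets borel"
  using measurable_sets[OF Some_measurable] by force
next
 assume A: "Some -` E : sets borel"
 have "{None} = UNIV - Some ` (UNIV :: 'a set)" by (rule None_eq_Compl)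
 hence N: "{None} \<in> sets (cem_borel :: 'a option measure)"
  using Some_image_sets[of UNIV] by (metis sets.compl_sets space_cem_borel sets.top space_borel)
 have "E = Some ` (Some -` E) Un (if None : E then {None} else {})"
  by (rule option_set_split)
 thus "E : sets cem_borel"
  using sets.Un[OF Some_image_sets[OF A], of "if None : E then {None} else {}"] N by (simp split: if_splits)
qed

lemma ext0_simps [simp]: "ext0 u None = 0" "ext0 u (Some x) = u x"
 by (auto simp: ext0_def)

lemma ext0_measurable:
 assumes "g : borel \<rightarrow>\<^sub>M (borel :: 'b::{topological_space,zero} measure)"
 shows "ext0 g : (cem_borel :: 'a::t2_space option measure) \<rightarrow>\<^sub>M borel"
proof (rule measurableI)
 fix A assume "A : sets (borel :: 'b measure)"
 moreover have "Some -` (ext0 g -` A) = g -` A" by auto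
 ultimately show "ext0 g -` A Int space cem_borel : sets (cem_borel :: 'a option measure)"
  using measurable_sets[OF assms] by (simp add: sets_cem_borel)
qed simp

lemma measurable_ext0 [measurable (raw)]:
 assumes "Y : M \<rightarrow>\<^sub>M (cem_borel :: 'a::t2_space option measure)" "g : borel \<rightarrow>\<^sub>M (borel :: 'b::{topological_space,zero} measure)"
 shows "(%w. ext0 g (Y w)) : M \<rightarrow>\<^sub>M borel"
 using mcomp[OF assms(1) ext0_measurable[OF assms(2)]] .

text \<open>Off \<open>K\<close> the function already has its cemetery value 0, and complements of
  compact sets are neighbourhoods of \<open>None\<close>; compact support thus gives continuity at
  the cemetery.\<close>

lemma tendsto_ext0:
 fixes f :: "'a::t2_space => real"
 assumes lim: "limitin cem_top Y l F" and f: "continuous_on UNIV f"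
  and K: "compact K" "!!x. x ~: K ==> f x = 0"
 shows "((%s. ext0 f (Y s)) \<longlongrightarrow> ext0 f l) F"
proof (rule topological_tendstoI)
 fix V :: "real set" assume V: "open V" "ext0 f l : V"
 have cl: "closed {x. f x ~: V}"
  using open_vimage[OF V(1) f] by (simp add: closed_def vimage_def Collect_neg_eq)
 show "\<forall>\<^sub>F s in F. ext0 f (Y s) : V"
 proof (cases l)
  case (Some a)
  have "openin cem_top (Some ` (f -` V))"
   using open_vimage[OF V(1) f] by simp
  moreover have "l : Some ` (f -` V)" using V Some by auto
  ultimately have "\<forall>\<^sub>F s in F. Y s : Some ` (f -` V)" using lim unfolding limitin_def by blast
  thus ?thesis by eventually_elim auto
 next
  case None
  hence "0 : V" using V by simp
  hence "{x. f x ~: V} <= K" using K(2) by force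
  hence "compact {x. f x ~: V}" using cl K(1) by (metis compact_Int_closed inf.absorb2)
  hence "openin cem_top (insert None (Some ` (- {x. f x ~: V})))" by (rule openin_cem_None)
  hence "\<forall>\<^sub>F s in F. Y s : insert None (Some ` (- {x. f x ~: V}))"
   using lim None unfolding limitin_def by blast
  thus ?thesis by (rule eventually_mono) (use `0 : V` in auto)
 qed
qed

text \<open>Positive exactly on \<open>O \<inter> ball z k\<close>.\<close>

definition bumpf :: "'a::metric_space set => 'a => nat => 'a => real" where
 "bumpf A z k y = min (if A = UNIV then 1 else infdist y (- A)) (max 0 (real k - dist z y))"

lemma bumpf_continuous: "continuous_on UNIV (bumpf A z k)"
 unfolding bumpf_def by (cases "A = UNIV") (auto intro!: continuous_intros)

lemma bumpf_pos:
 assumes "open A" shows "0 < bumpf A z k y \<longleftrightarrow> y : A & dist z y < real k"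
proof (cases "A = UNIV")
 case False
 hence "0 < infdist y (- A) \<longleftrightarrow> y : A"
  using in_closed_iff_infdist_zero[of "-A" y] assms infdist_nonneg[of y "-A"] by force
 thus ?thesis using False by (auto simp: bumpf_def)
qed (auto simp: bumpf_def)

lemma bumpf_nonneg: "0 <= bumpf A z k y"
proof -
 have "0 <= infdist y (- A)" by (rule infdist_nonneg)
 thus ?thesis unfolding bumpf_def by simp
qed

lemma bumpf_outside: "y ~: cball z k ==> bumpf A z k y = 0"
 using infdist_nonneg[of y "-A"] by (auto simp: bumpf_def)

text \<open>An open set is the union over \<open>k\<close> of the sets where
  \<open>bumpf A z k\<close> is positive, and these functions have compact support because closed
  balls are compact. Real-valued limits can therefore be used to prove measurability of maps into
  the compactification.\<close>

lemma measurable_cemI: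
 fixes Y :: "'w => 'a::heine_borel option"
 assumes "!!f K. continuous_on UNIV f ==> compact K ==> (!!x. x ~: K ==> f x = 0) ==>
   (%w. ext0 f (Y w) :: real) : bm M"
 shows "Y : M \<rightarrow>\<^sub>M cem_borel"
proof -
 let ?b = "%w A z. \<Union>k. {w\<in>space M. 0 < ext0 (bumpf A z k) (Y w)}"
 fix z :: 'a
 have op: "Y -` (Some ` A) Int space M : sets M" if A: "open A" for A
 proof -
  have "Y -` (Some ` A) Int space M = (?b w A z)"
  proof (intro set_eqI iffI)
   fix w assume "w : Y -` (Some ` A) Int space M"
   then obtain y where "Y w = Some y" "y : A" "w : space M" by auto
   moreover obtain k where "dist z y < real k" using reals_Archimedean2 by blast
   ultimately show "w : (?b w A z)"
    using bumpf_pos[OF A] by auto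
  next
   fix w assume "w : (?b w A z)"
   then obtain k where k: "w : space M" "0 < ext0 (bumpf A z k) (Y w)" by auto
   thus "w : Y -` (Some ` A) Int space M"
    by (cases "Y w") (auto simp: bumpf_pos[OF A])
  qed
  moreover have "(%w. ext0 (bumpf A z k) (Y w)) : bm M" for k
   by (rule assms[of _ "cball z k"]) (auto simp: bumpf_continuous bumpf_outside compact_cball)
  ultimately show ?thesis by auto
 qed
 have "Y -` (Some ` A) Int space M : sets M" if "A : sets borel" for A
 proof -
  have "A : sigma_sets UNIV {U::'a set. open U}"
   using that by (simp add: borel_def)
  thus ?thesis
  proof induction
   case (Basic a) thus ?case using op by auto
  next
   case Empty thus ?case by simp
  next
   case (Compl a)
   have "Y -` Some ` (UNIV - a) Int space M = Y -` (Some ` UNIV) Int space M - (Y -` Some ` a Int space M)" by auto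
   thus ?case using Compl.IH op[of UNIV] by (metis open_UNIV sets.Diff)
  next
   case (Union a)
   have "Y -` Some ` (\<Union>i. a i) Int space M = (\<Union>i. Y -` Some ` a i Int space M)" by auto
   moreover have "(\<Union>i. Y -` Some ` a i Int space M) : sets M" using Union.IH by (intro sets.countable_UN) auto
   ultimately show ?case by simp
  qed
 qed note S = this
 have N: "Y -` {None} Int space M : sets M"
 proof -
  have "Y -` {None} Int space M = space M - (Y -` (Some ` UNIV) Int space M)"
   unfolding None_eq_Compl by blast
  thus ?thesis using op[of UNIV] by (metis open_UNIV sets.compl_sets)
 qed
 show ?thesis
 proof (rule measurableI)
  fix E assume "E : sets (cem_borel :: 'a option measure)"
  hence E: "Some -` E : sets borel" by (simp add: sets_cem_borel)
  have "Y -` E Int space M = (Y -` Some ` (Some -` E) Int space M) Un (if None : E then Y -` {None} Int space M else {})"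
   by (subst arg_cong[OF option_set_split[of E], where f="%E. Y -` E"]) auto
  thus "Y -` E Int space M : sets M" using sets.Un[OF S[OF E], of "if None : E then Y -` {None} Int space M else {}"] N by (simp split: if_splits)
 qed simp
qed

text \<open>Grid points decreasing to \<open>t\<close> from strictly above.\<close>

definition appr :: "nat => real => real" where
 "appr i t = (real_of_int \<lfloor>real (Suc i) * t\<rfloor> + 1) / real (Suc i)"

lemma appr_bounds: "t < appr i t" "appr i t <= t + 1 / real (Suc i)"
proof -
 have "real (Suc i) * t < real_of_int \<lfloor>real (Suc i) * t\<rfloor> + 1" by linarith
 thus "t < appr i t" unfolding appr_def by (simp add: field_simps)
 have "real_of_int \<lfloor>real (Suc i) * t\<rfloor> + 1 <= real (Suc i) * t + 1" by linarith
 hence "appr i t <= (real (Suc i) * t + 1) / real (Suc i)" unfolding appr_def by (intro divide_right_mono) auto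
 also have "... = t + 1 / real (Suc i)" by (simp add: add_divide_distrib)
 finally show "appr i t <= t + 1 / real (Suc i)" .
qed

lemma appr_lim: "(%i. appr i t) ----> t"
proof (rule tendsto_sandwich[of "%_. t" _ _ "%i. t + 1 / real (Suc i)"])
 have "(%i. t + 1 / real (Suc i)) ----> t + 0"
  by (intro tendsto_intros LIMSEQ_Suc[OF lim_1_over_n])
 thus "(%i. t + 1 / real (Suc i)) ----> t" by simp
qed (use appr_bounds in "auto intro!: always_eventually less_imp_le")

section \<open>Joint measurability of paths in time and event\<close>

locale hunt =
 fixes X :: "('w, 'a::heine_borel) process"
 assumes hunt: "hunt_process X" and cons: "conservative X"
begin

abbreviation "Om \<equiv> space (events X)"
abbreviation "P x \<equiv> law X (Some x)"
abbreviation (input) "px t \<equiv> pos X (ennreal t)"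
abbreviation (input) "xt g T w \<equiv> ext0 g (pos X T w)"
abbreviation (input) "PI x F \<equiv> nn_integral (P x) F"

lemma prob_law: "prob_space (law X x)" and sets_law [measurable_cong]: "sets (law X x) = sets (events X)"
 using hunt unfolding hunt_process_def by auto

lemma space_law: "space (law X x) = Om" by (rule sets_eq_imp_space_eq[OF sets_law])

lemma pos_measurable [measurable]: "pos X t : events X \<rightarrow>\<^sub>M cem_borel"
 using hunt unfolding hunt_process_def by auto

lemma law_kernel: "E : sets cem_borel ==>
 (%x. emeasure (law X x) {ww\<in>Om. pos X t ww : E}) : bm cem_borel"
 using hunt unfolding hunt_process_def by auto

lemma pos_0: "AE ww in law X x. pos X 0 ww = x"
 using hunt unfolding hunt_process_def by auto

lemma pos_infty: "ww : Om ==> pos X iy ww = None"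
 using hunt unfolding hunt_process_def by auto

lemma pos_absorb: "ww : Om ==> s <= t ==> pos X s ww = None ==> pos X t ww = None"
 using hunt unfolding hunt_process_def by blast

lemma pos_rc: "ww : Om ==> t < iy ==> limitin cem_top (%s. pos X s ww) (pos X t ww) (at_right t)"
 using hunt unfolding hunt_process_def by blast

lemma strong_markov: "strong_markov X" and qlc: "quasi_left_continuous X"
 using hunt unfolding hunt_process_def by auto

lemma pos_appr:
 fixes f :: "'a => real"
 assumes f: "continuous_on UNIV f" and K: "compact K" "!!x. x ~: K ==> f x = 0" and om: "ww : Om"
 shows "(%i. xt f (en (appr i t)) ww) ----> xt f (en t) ww"
proof (cases "0 <= t")
 case True
 have "filterlim (%i. en (appr i t)) (at_right (en t)) sequentially"
  unfolding at_within_def filterlim_inf filterlim_principal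
  using appr_lim[of t] appr_bounds(1)[of t] True
  by (auto intro!: tendsto_ennrealI always_eventually simp: ennreal_less_iff)
 from filterlim_compose[OF tendsto_ext0[OF pos_rc[OF om] f K] this] show ?thesis by simp
next
 \<comment> \<open>For negative \<open>t\<close> both sides are eventually the value at time 0,
   since \<open>ennreal\<close> truncates.\<close>
 case False
 hence "\<forall>\<^sub>F i in sequentially. appr i t < 0" using order_tendstoD(2)[OF appr_lim[of t], of 0] by simp
 hence "\<forall>\<^sub>F i in sequentially. xt f (en (appr i t)) ww = xt f (en t) ww"
  by eventually_elim (use False in "simp add: ennreal_neg")
 thus ?thesis by (simp add: tendsto_eventually)
qed

text \<open>At grid times only countably many coordinates occur, and measurability is immediate; the
  grid decreases to \<open>t\<close> strictly from above, so right continuity passes to the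
  limit.\<close>

lemma pos_joint: "(%(ww, t). px t ww) : events X \<Otimes>\<^sub>M borel \<rightarrow>\<^sub>M cem_borel"
proof (rule measurable_cemI)
 fix f :: "'a => real" and K
 assume f: "continuous_on UNIV f" and K: "compact K" "!!x. x ~: K ==> f x = 0"
 have [measurable]: "f : BM" using f by (rule borel_measurable_continuous_onI)
 show "(%w. ext0 f (case w of (ww, t) => px t ww)) : bm (events X \<Otimes>\<^sub>M borel)"
 proof (rule borel_measurable_LIMSEQ_real)
  fix i
  have "(%w. xt f (en ((real_of_int \<lfloor>real (Suc i) * snd w\<rfloor> + 1) / real (Suc i))) (fst w))
    \<in> bm (events X \<Otimes>\<^sub>M borel)"
   by (rule measurable_compose_countable[where f="%n w. xt f (en ((real_of_int n + 1) / real (Suc i))) (fst w)"])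
    measurable
  thus "(%w. xt f (en (appr i (snd w))) (fst w)) : bm (events X \<Otimes>\<^sub>M borel)"
   unfolding appr_def .
 next
  fix w assume "w : space (events X \<Otimes>\<^sub>M (borel :: real measure))"
  hence om: "fst w : Om" by (auto simp: space_pair_measure)
  show "(%i. xt f (en (appr i (snd w))) (fst w)) ----> ext0 f (case w of (ww, t) => px t ww)"
   using pos_appr[OF f K om, of "snd w"] by (simp add: case_prod_beta)
 qed
qed

lemma pos_random [measurable (raw)]:
 assumes [measurable]: "T : bm M" "Z : M \<rightarrow>\<^sub>M events X"
 shows "(%w. pos X (T w) (Z w)) : M \<rightarrow>\<^sub>M cem_borel"
proof -
 \<comment> \<open>Joint measurability covers real times only; at time \<open>iy\<close> the value
   \<open>None\<close> agrees with \<open>pos_infty\<close>.\<close>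
 let ?a = "%w. if T w = iy then None else (%(ww, t). px t ww) (Z w, enn2real (T w))"
 note pos_joint[measurable]
 have "(%w. ?a w) : M \<rightarrow>\<^sub>M cem_borel"
  by measurable
 also have "?this \<longleftrightarrow> ?thesis"
 proof (rule measurable_cong)
  fix w assume "w : space M"
  hence "Z w : Om" by (rule measurable_space[OF assms(2)])
  thus "(?a w) = pos X (T w) (Z w)"
   using pos_infty[of "Z w"] by (cases "T w") auto
 qed
 finally show ?thesis .
qed

end

text \<open>\<open>mfun L\<close>: the functional \<open>L\<close> is integration against a Borel measure.
  \<open>kop R\<close>: the operator \<open>R\<close> is given by a kernel and preserves measurability.\<close>

definition mfun :: "(('a::topological_space => ennreal) => ennreal) => bool" where
 "mfun L \<longleftrightarrow> (\<exists>mm. sets mm = sets borel & (\<forall>g\<in>BM. L g = (NI mm (%y. g y))))"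

definition kop :: "(('a::topological_space => ennreal) => 'a => ennreal) => bool" where
 "kop R \<longleftrightarrow> (\<forall>x. mfun (%g. R g x)) & (\<forall>g\<in>BM. R g : BM)"

lemma mfunD:
 assumes "mfun L"
 shows mfun_add: "f : BM ==> g : BM ==> L (%y. f y + g y) = L f + L g"
  and mfun_cmult: "g : BM ==> L (%y. c * g y) = c * L g"
  and mfun_zero: "L (%_. 0) = 0"
  and mfun_mono: "f : BM ==> g : BM ==> (!!y. f y <= g y) ==> L f <= L g"
  and mfun_SUP: "(!!i. h i : BM) ==> incseq h ==> L (%y. SUP i::nat. h i y) = (SUP i. L (h i))"
  and mfun_lim: "(!!i. h i : BM) ==> k : BM ==> l : BM ==>
    (!!i y. h i y <= k y) ==> L k < iy ==> (!!y. (%i::nat. h i y) ----> l y) ==> (%i. L (h i)) ----> L l"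
proof -
 obtain mm where mm: "sets mm = sets borel" "!!g. g : BM ==> L g = (NI mm (%y. g y))"
  using assms unfolding mfun_def by blast
 note s [measurable_cong] = mm(1)
 show "L (%y. f y + g y) = L f + L g" if [measurable]: "f : BM" "g : BM"
  by (simp add: mm(2) nn_integral_add)
 show "L (%y. c * g y) = c * L g" if [measurable]: "g : BM"
  by (simp add: mm(2) nncmult)
 show "L (%_. 0) = 0" by (simp add: mm(2))
 show "L f <= L g" if "f : BM" "g : BM" "!!y. f y <= g y"
  using that by (simp add: mm(2) nnmono)
 show "L (%y. SUP i::nat. h i y) = (SUP i. L (h i))" if [measurable]: "!!i. h i : BM" and "incseq h"
  using that(2) by (simp add: mm(2) mctSUP)
 show "(%i. L (h i)) ----> L l" if [measurable]: "!!i. h i : BM" "k : BM" "l : BM"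
  and "!!i y. h i y <= k y" "L k < iy" "!!y. (%i::nat. h i y) ----> l y"
  using that(4-) by (simp add: mm(2)) (rule nn_integral_dominated_convergence[where w=k], auto)
qed

lemma kop_mfun: "kop R ==> mfun (%g. R g x)"
 and kopm: "kop R ==> g : BM ==> R g : BM"
 unfolding kop_def by auto

lemmas kop_add = mfun_add[OF kop_mfun] and kop_cmult = mfun_cmult[OF kop_mfun]
 and kop_zero = mfun_zero[OF kop_mfun] and kop_mono = mfun_mono[OF kop_mfun]
 and kop_SUP = mfun_SUP[OF kop_mfun] and kop_lim = mfun_lim[OF kop_mfun]

section \<open>Transition kernels\<close>

lemma measurable_the_cem: "the : (cem_borel :: 'a::t2_space option measure) \<rightarrow>\<^sub>M borel"
proof (rule measurableI)
 fix A :: "'a set" assume "A : sets borel"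
 moreover have "Some -` (the -` A) = A" by auto
 ultimately show "the -` A Int space cem_borel : sets cem_borel" by (simp add: sets_cem_borel)
qed simp

text \<open>The generator contains no neighbourhood of the cemetery. It is stable under
  intersections, and its members are exhausted by continuous functions of compact support, which is
  the form needed in \<open>trans_joint\<close>.\<close>

lemma cem_borel_eq_sigma: "sets (cem_borel :: 'a::heine_borel option measure) = sigma_sets UNIV {Some ` A |A. open A}" (is "_ = ?S")
proof
 show "?S <= sets cem_borel"
  by (rule sets.sigma_sets_subset[of _ cem_borel, simplified]) (auto intro!: cem_borel_open)
next
 interpret S: sigma_algebra UNIV ?S by (rule sigma_algebra_sigma_sets) auto
 show "sets cem_borel <= ?S"
 proof
  fix E assume "E : sets (cem_borel :: 'a option measure)"
  hence E: "Some -` E : sets borel" by (simp add: sets_cem_borel)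
  have I: "Some ` A : ?S" if "A : sets borel" for A :: "'a set"
  proof -
   have "A : sigma_sets UNIV {U::'a set. open U}" using that by (simp add: borel_def)
   thus ?thesis
   proof induction
    case (Compl a)
    have "Some ` (UNIV - a) = Some ` UNIV - Some ` a" by auto
    moreover have "Some ` (UNIV :: 'a set) : ?S" by (rule sigma_sets.Basic) auto
    ultimately show ?case using Compl.IH by (simp add: S.Diff)
   next
    case (Union a)
    have "Some ` (\<Union>i. a i) = (\<Union>i. Some ` a i)" by auto
    thus ?case using Union.IH by auto
   qed auto
  qed
  have "{None :: 'a option} \<in> ?S"
   unfolding None_eq_Compl using I[of UNIV] S.compl_sets by simp
  thus "E : ?S"
   using S.Un[OF I[OF E], of "if None : E then {None} else {}"] option_set_split[of E] by (auto split: if_splits)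
 qed
qed

context hunt
begin

definition trans :: "ennreal => 'a option => 'a option measure" where
 "trans s z = distr (law X z) cem_borel (pos X s)"

lemma sets_trans [simp, measurable_cong]: "sets (trans s z) = sets cem_borel"
 by (simp add: trans_def)

lemma subprob_trans: "subprob_space (trans s z)"
proof -
 interpret prob_space "law X z" by (rule prob_law)
 show ?thesis unfolding trans_def by (intro prob_space_imp_subprob_space prob_space_distr) measurable
qed

lemma nn_integral_trans:
 "ph : bm cem_borel ==> (NI (trans s z) (%y. ph y)) = (NI (law X z) (%ww. ph (pos X s ww)))"
 unfolding trans_def by (rule nn_integral_distr) simp_all

lemma trans_measurable [measurable]: "trans s : cem_borel \<rightarrow>\<^sub>M subprob_algebra cem_borel"
proof (rule measurable_subprob_algebra)
 fix A :: "'a option set" assume A [measurable]: "A : sets cem_borel"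
 have "emeasure (trans s z) A = emeasure (law X z) {ww\<in>Om. pos X s ww : A}" for z
  unfolding trans_def by (subst emeasure_distr) (auto simp: space_law vimage_def Int_def conj_commute intro!: arg_cong2[where f=emeasure])
 thus "(%z. emeasure (trans s z) A) : bm cem_borel"
  using law_kernel[OF A] by simp
qed (auto simp: subprob_trans)

text \<open>Fubini's theorem for resolvents requires measurability in the starting point and the
  time together. Integrals of continuous functions of compact support are right-continuous in time,
  hence limits along the grid, and the mass of an open set is a supremum of such integrals.\<close>

lemma trans_joint: "(%(z, s). trans (en s) z) : cem_borel \<Otimes>\<^sub>M borel \<rightarrow>\<^sub>M subprob_algebra cem_borel"
proof (rule measurable_subprob_algebra_generated[OF cem_borel_eq_sigma])
 fix z0 :: 'a
 have c: "(%w. \<integral>y. ext0 f y \<partial>trans (en (snd w)) (fst w)) : bm (cem_borel \<Otimes>\<^sub>M (borel :: real measure))"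
  if f: "continuous_on UNIV f" and K: "compact K" "!!x. x ~: K ==> f x = 0" and B: "!!x. \<bar>f x\<bar> <= B" for f :: "'a => real" and K B
 proof (rule borel_measurable_LIMSEQ_real)
  have [measurable]: "f : BM" using f by (rule borel_measurable_continuous_onI)
  have B': "\<bar>ext0 f z\<bar> <= B" for z using B[of "the z"] B[of undefined] by (cases z) (auto intro: order_trans[OF abs_ge_zero])
  fix i
  have "(%w. \<integral>y. ext0 f y \<partial>trans (en ((real_of_int \<lfloor>real (Suc i) * snd w\<rfloor> + 1) / real (Suc i))) (fst w))
    \<in> bm (cem_borel \<Otimes>\<^sub>M borel)"
  proof (rule measurable_compose_countable[where f="%n w. \<integral>y. ext0 f y \<partial>trans (en ((real_of_int n + 1) / real (Suc i))) (fst w)"])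
   show "(%w. \<integral>y. ext0 f y \<partial>trans (en ((real_of_int n + 1) / real (Suc i))) (fst w)) : bm (cem_borel \<Otimes>\<^sub>M (borel::real measure))" for n
    by (rule mcomp[OF _ integral_measurable_subprob_algebra[of "ext0 f" cem_borel]]) measurable
  qed measurable
  thus "(%w. \<integral>y. ext0 f y \<partial>trans (en (appr i (snd w))) (fst w)) : bm (cem_borel \<Otimes>\<^sub>M (borel :: real measure))"
   unfolding appr_def .
  fix w :: "'a option \<times> real"
  interpret prob_space "law X (fst w)" by (rule prob_law)
  have "(%i. \<integral>ww. xt f (en (appr i (snd w))) ww \<partial>law X (fst w)) ----> (\<integral>ww. xt f (en (snd w)) ww \<partial>law X (fst w))"
   by (rule integral_dominated_convergence[where w="%_. B"])
    (auto simp: B' space_law intro!: pos_appr[OF f K])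
  thus "(%i. \<integral>y. ext0 f y \<partial>trans (en (appr i (snd w))) (fst w)) ----> (\<integral>y. ext0 f y \<partial>trans (en (snd w)) (fst w))"
   unfolding trans_def by (subst (1 2) integral_distr) measurable
 qed
 fix A assume "A : {Some ` A |A::'a set. open A}"
 then obtain U where U: "A = Some ` U" "open U" by auto
 have [measurable]: "U : sets borel" using U by auto
 \<comment> \<open>These functions increase to the indicator of \<open>U\<close>, and
   \<open>h k\<close> vanishes off the closed ball of radius \<open>k\<close>.\<close>
 define h where "h k y = min 1 (real k * bumpf U z0 k y)" for k y
 have h0: "0 <= bumpf U z0 k y" for k y by (rule bumpf_nonneg)
 have hc: "continuous_on UNIV (h k)" for k unfolding h_def by (intro continuous_intros bumpf_continuous)
 have [measurable]: "h k : BM" for k using hc by (rule borel_measurable_continuous_onI)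
 have hm: "incseq (%k. h k y)" for y
 proof (rule incseq_SucI)
  fix k have "bumpf U z0 k y <= bumpf U z0 (Suc k) y" unfolding bumpf_def by auto
  hence "real k * bumpf U z0 k y <= real (Suc k) * bumpf U z0 (Suc k) y" using h0 by (intro mult_mono) auto
  thus "h k y <= h (Suc k) y" unfolding h_def by auto
 qed
 have hl: "(SUP k. en (ext0 (h k) z)) = ix A z" for z
 proof (cases "z : A")
  case True
  then obtain y where y: "z = Some y" "y : U" using U by auto
  obtain k where k: "dist z0 y < real k" using reals_Archimedean2 by blast
  have p: "0 < bumpf U z0 k y" using bumpf_pos[OF U(2)] y k by auto
  obtain n where n: "1 / bumpf U z0 k y < real n" using reals_Archimedean2 by blast
  have "1 < real n * bumpf U z0 k y" using n p by (simp add: field_simps)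
  also have "... <= real (max n k) * bumpf U z0 (max n k) y"
  proof (rule mult_mono)
   show "bumpf U z0 k y <= bumpf U z0 (max n k) y" unfolding bumpf_def by auto
  qed (auto simp: h0)
  finally have "h (max n k) y = 1" unfolding h_def by simp
  hence "1 <= (SUP k. en (ext0 (h k) z))" unfolding y by (intro SUP_upper2[of "max n k"]) auto
  moreover have "(SUP k. en (ext0 (h k) z)) <= 1" unfolding y by (rule SUP_least) (auto simp: h_def)
  ultimately show ?thesis using True by simp
 next
  case False
  have "ext0 (h k) z = 0" for k
  proof (cases z)
   case (Some y)
   hence "\<not> 0 < bumpf U z0 k y" using False U bumpf_pos[OF U(2)] by auto
   thus ?thesis using Some h0[of k y] by (simp add: h_def)
  qed simp
  thus ?thesis using False by simp
 qed
 have hp: "0 <= h k y" for k y unfolding h_def using h0 by simp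
 have hb: "\<bar>h k y\<bar> <= 1" for k y using hp[of k y] by (simp add: h_def)
 have eq: "emeasure (trans (en s) z) A = (SUP k. en (\<integral>y. ext0 (h k) y \<partial>trans (en s) z))" for z s
 proof -
  interpret subprob_space "trans (en s) z" by (rule subprob_trans)
  have "emeasure (trans (en s) z) A = (NI (trans (en s) z) (%y. (SUP k. en (ext0 (h k) y))))"
   using Some_image_sets[of U] U by (simp add: hl)
  also have "... = (SUP k. NI (trans (en s) z) (%y. en (ext0 (h k) y)))"
  proof (rule mctSUP)
   show "incseq (%k y. en (ext0 (h k) y))"
    using hm unfolding incle by (auto simp: ext0_def split: option.splits intro!: ennreal_leI)
  qed measurable
  also have "... = (SUP k. en (\<integral>y. ext0 (h k) y \<partial>trans (en s) z))"
  proof (rule SUP_cong[OF refl], rule nn_integral_eq_integral)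
   fix k
   show "integrable (trans (en s) z) (ext0 (h k))"
    by (rule integrable_const_bound[where B=1]) (auto simp: ext0_def hb split: option.splits intro!: AE_I2)
  qed (auto simp: ext0_def hp split: option.splits)
  finally show ?thesis .
 qed
 show "(%a. emeasure (case a of (z, s) => trans (en s) z) A) : bm (cem_borel \<Otimes>\<^sub>M borel)"
  unfolding case_prod_beta eq
 proof (intro borel_measurable_SUP countableI_type mcomp[OF _ measurable_ennreal])
  fix k
  have "h k x = 0" if "x ~: cball z0 (real k)" for x using bumpf_outside[OF that] by (simp add: h_def)
  thus "(%w. \<integral>y. ext0 (h k) y \<partial>trans (en (snd w)) (fst w)) : bm (cem_borel \<Otimes>\<^sub>M (borel :: real measure))"
   by (rule c[OF hc compact_cball _ hb])
 qed
next
 have "emeasure (trans (en s) z) UNIV = 1" for z s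
 proof -
  interpret prob_space "law X z" by (rule prob_law)
  show ?thesis unfolding trans_def using sets.top[of "cem_borel :: 'a option measure"] by (subst emeasure_distr) (auto simp: emeasure_space_1)
 qed
 thus "(%a. emeasure (case a of (z, s) => trans (en s) z) UNIV) : bm (cem_borel \<Otimes>\<^sub>M borel)"
  by (simp add: case_prod_beta)
next
 show "Int_stable {Some ` A |A::'a set. open A}"
 proof (rule Int_stableI, clarify)
  fix A B :: "'a set" assume "open A" "open B"
  thus "\<exists>C. Some ` A Int Some ` B = Some ` C & open C"
   by (intro exI[of _ "A Int B"]) auto
 qed
qed (auto simp: subprob_trans)

end

section \<open>Filtrations, stopping times and the strong Markov property\<close>

context hunt
begin

lemma natural_gen: "{pos X s -` E Int Om |s E. s <= t & E : sets cem_borel} <= Pow Om"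
 by auto

lemma space_natural [simp]: "space (natural_filtration X t) = Om"
 unfolding natural_filtration_def using natural_gen by (simp add: space_measure_of)

lemma sets_natural: "sets (natural_filtration X t) = sigma_sets Om {pos X s -` E Int Om |s E. s <= t & E : sets cem_borel}"
 unfolding natural_filtration_def using natural_gen by (simp add: sets_measure_of)

lemma natural_pos: "s <= t ==> E : sets cem_borel ==> {ww\<in>Om. pos X s ww : E} \<in> sets (natural_filtration X t)"
 unfolding sets_natural by (rule sigma_sets.Basic) auto

lemma natural_mono: "s <= t ==> sets (natural_filtration X s) <= sets (natural_filtration X t)"
 unfolding sets_natural by (rule sigma_sets_mono') (auto intro: order_trans)

lemma natural_events: "sets (natural_filtration X s) <= sets (events X)"
 unfolding sets_natural by (rule sets.sigma_sets_subset) (auto intro!: measurable_sets[OF pos_measurable])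

lemma right_gen: "(\<Inter>u\<in>insert iy {t<..}. sets (natural_filtration X u)) <= Pow Om"
 using sets.space_closed[of "natural_filtration X iy"] by auto

lemma space_right [simp]: "space (right_filtration X t) = Om"
 unfolding right_filtration_def using right_gen by (simp add: space_measure_of)

lemma sets_right: "sets (right_filtration X t) = sigma_sets Om (\<Inter>u\<in>insert iy {t<..}. sets (natural_filtration X u))"
 unfolding right_filtration_def using right_gen by (simp add: sets_measure_of)

lemma right_I: "(!!u. t < u \<or> u = iy ==> A : sets (natural_filtration X u)) ==> A : sets (right_filtration X t)"
 unfolding sets_right by (rule sigma_sets.Basic) auto

lemma right_events: "sets (right_filtration X t) <= sets (events X)"
 unfolding sets_right by (rule sets.sigma_sets_subset) (use natural_events in auto)

lemma filtration_right: "filtration Om (right_filtration X)"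
proof
 fix i j :: ennreal assume ij: "i <= j"
 show "sets (right_filtration X i) <= sets (right_filtration X j)"
  unfolding sets_right by (rule sigma_sets_mono') (use ij in auto)
qed simp

abbreviation "stop \<equiv> stopping_time (right_filtration X)"
abbreviation "pre \<equiv> filtration.pre_sigma Om (right_filtration X)"

lemma stopm: "stop T ==> T : bm (events X)"
 by (erule measurable_stopping_time) (auto simp: right_events[THEN subsetD])

text \<open>Right continuity of the filtration turns strict inequalities into weak ones:
  \<open>T <= t\<close> is the intersection of the events \<open>T < t + 1/n\<close>, and each of
  these, cut off at \<open>u\<close>, is known at time \<open>u > t\<close>.\<close>

lemma stopI:
 assumes "!!s. {ww\<in>Om. T ww < s} \<in> sets (natural_filtration X s)"
 shows "stop T"
proof
 let ?a = "%ww u t. \<Inter>n. {ww\<in>Om. T ww < min u (t + en (1 / Suc n))}"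
 fix t
 have "{ww\<in>Om. T ww <= t} \<in> sets (right_filtration X t)"
 proof (rule right_I)
  fix u assume u: "t < u \<or> u = iy"
  show "{ww\<in>Om. T ww <= t} \<in> sets (natural_filtration X u)"
  proof (cases "t < u")
   case False
   hence "t = iy" using u by (cases t) auto
   hence "{ww\<in>Om. T ww <= t} = space (natural_filtration X u)" by auto
   thus ?thesis by (metis sets.top)
  next
   case True
   have "{ww\<in>Om. T ww <= t} = (?a ww u t)"
   proof (intro set_eqI iffI)
    fix ww assume "ww : {ww\<in>Om. T ww <= t}"
    moreover have "t < t + en (1 / Suc n)" for n
     using True by (cases t) (auto simp flip: ennreal_plus simp: ennreal_less_iff)
    ultimately show "ww : (?a ww u t)"
     using True by (auto intro: le_less_trans)
   next
    fix ww assume *: "ww : (?a ww u t)"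
    have "T ww <= t"
    proof (rule ennreal_le_epsilon)
     fix e :: real assume "0 < e"
     then obtain n where n: "1 / Suc n < e" using nat_approx_posE by blast
     have "T ww <= t + en (1 / Suc n)" using * by (auto intro: less_imp_le)
     also have "... <= t + en e" using n by (intro add_left_mono ennreal_leI) auto
     finally show "T ww <= t + en e" .
    qed
    thus "ww : {ww\<in>Om. T ww <= t}" using * by auto
   qed
   moreover have "{ww\<in>Om. T ww < min u (t + en (1 / Suc n))} \<in> sets (natural_filtration X u)" for n
    by (rule subsetD[OF natural_mono assms]) simp
   ultimately show ?thesis by (simp only:) (rule sets.countable_INT, auto)
  qed
 qed
 thus "Measurable.pred (right_filtration X t) (%ww. T ww <= t)" by (simp add: Measurable.pred_def)
qed

text \<open>Only the times of \<open>Q\<close> are inspected. For countable \<open>Q\<close> the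
  event \<open>hit Q A < s\<close> is a countable union of events at single times, so a stopping
  time results.\<close>

definition hit :: "ennreal set => 'a set => 'w => ennreal" where
 "hit Q A ww = Inf {t\<in>Q. pos X t ww : Some ` A}"

lemma stop_hit:
 assumes "countable Q" "A : sets borel" shows "stop (hit Q A)"
proof (rule stopI)
 fix s
 have "{ww\<in>Om. hit Q A ww < s} = (\<Union>q\<in>{q\<in>Q. q < s}. {ww\<in>Om. pos X q ww : Some ` A})"
  unfolding hit_def by (auto simp: Inf_less_iff)
 also have "... \<in> sets (natural_filtration X s)"
  using assms by (intro sets.countable_UN') (auto intro!: natural_pos Some_image_sets)
 finally show "{ww\<in>Om. hit Q A ww < s} \<in> sets (natural_filtration X s)" .
qed

lemma stop_SUP: "(!!k::nat. stop (T k)) ==> stop (%ww. SUP k. T k ww)"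
 unfolding stopping_time_def SUP_le_iff ball_UNIV by (intro allI pred_intros_countable(1)) blast

lemma pre_events: "stop T ==> A : sets (pre T) ==> A : sets (events X)"
 using filtration.sets_pre_sigmaD[OF filtration_right, of T A iy] right_events[of iy] by auto

lemma space_pre: "space (pre T) = Om"
 by (rule filtration.space_pre_sigma[OF filtration_right])

lemma pre_measurable:
 fixes w :: "'w => 'c::topological_space"
 assumes "stop T" "w : bm (pre T)"
 shows "w : bm (events X)"
proof (rule measurableI)
 fix B :: "'c set" assume "B : sets borel"
 from measurable_sets[OF assms(2) this] have "w -` B Int Om : sets (pre T)"
  unfolding space_pre .
 thus "w -` B Int Om : sets (events X)" by (rule pre_events[OF assms(1)])
qed simp

lemma SM_sets:
 assumes T: "stop T" and A: "A : sets (pre T)" and E: "E : sets cem_borel"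
 shows "(NI (law X z) (%ww. ix A ww * ix E (pos X (T ww + s) ww))) =
  (NI (law X z) (%ww. ix A ww * emeasure (trans s (pos X (T ww) ww)) E))"
proof -
 note [measurable] = stopm[OF T] pre_events[OF T A] E
 have AO: "A <= Om" using pre_events[OF T A] sets.sets_into_space by blast
 have [measurable]: "{ww\<in>A. pos X (T ww + s) ww : E} \<in> sets (events X)"
 proof -
  have "{ww\<in>A. pos X (T ww + s) ww : E} = A Int {ww\<in>Om. pos X (T ww + s) ww : E}" using AO by auto
  also have "... \<in> sets (events X)" by measurable
  finally show ?thesis .
 qed
 have "(NI (law X z) (%ww. ix A ww * ix E (pos X (T ww + s) ww))) =
   (NI (law X z) (%ww. ix {ww\<in>A. pos X (T ww + s) ww : E} ww))"
  by (rule nncong) (auto split: splix)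
 also have "... = emeasure (law X z) {ww\<in>A. pos X (T ww + s) ww : E}"
  by (rule nn_integral_indicator) measurable
 also have "... = (SI (law X z) A (%ww. emeasure (law X (pos X (T ww) ww)) {ww'\<in>Om. pos X s ww' : E}))"
  using strong_markov T A E unfolding strong_markov_def by blast
 also have "... = (NI (law X z) (%ww. ix A ww * emeasure (trans s (pos X (T ww) ww)) E))"
  unfolding trans_def
  by (subst emeasure_distr) (auto simp: space_law vimage_def Int_def conj_commute mult.commute intro!: nncong)
 finally show ?thesis .
qed

lemma SM_fun1:
 assumes T: "stop T" and A: "A : sets (pre T)" and ph: "ph : bm cem_borel"
 shows "(NI (law X z) (%ww. ix A ww * ph (pos X (T ww + s) ww))) =
  (NI (law X z) (%ww. ix A ww * (NI (trans s (pos X (T ww) ww)) (%y. ph y))))"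
 using ph
proof induction
 case (cong f g)
 hence "f = g" by auto
 thus ?case using cong by simp
next
 case (set E) thus ?case using SM_sets[OF T A] by simp
next
 case (mult u c)
 note [measurable] = stopm[OF T] pre_events[OF T A] mult(2)
 show ?case by (simp add: mult.left_commute[of _ c] nncmult mult.IH)
next
 case (add u v)
 note [measurable] = stopm[OF T] pre_events[OF T A] add(1,3)
 show ?case by (simp add: distrib_left nn_integral_add add.IH)
next
 case (seq U)
 note [measurable] = stopm[OF T] pre_events[OF T A] seq(1)
 have "(NI (law X z) (%ww. ix A ww * (SUP i. U i (pos X (T ww + s) ww)))) =
  (SUP i. NI (law X z) (%ww. ix A ww * U i (pos X (T ww + s) ww)))"
  unfolding SUP_mult_left_ennreal
  by (rule mctSUP) (use seq(3) in "auto simp: incle intro!: mulL")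
 also have "... = (SUP i. NI (law X z) (%ww. ix A ww * (NI (trans s (pos X (T ww) ww)) (%y. U i y))))"
  by (simp add: seq.IH)
 also have "... = (NI (law X z) (%ww. ix A ww * (SUP i. NI (trans s (pos X (T ww) ww)) (%y. U i y))))"
  unfolding SUP_mult_left_ennreal
  by (rule mctSUP[symmetric])
   (use seq(3) in "auto simp: incle intro!: mulL nnmono")
 also have "... = (NI (law X z) (%ww. ix A ww * (NI (trans s (pos X (T ww) ww)) (%y. (SUP i. U i y)))))"
  by (subst mctSUP) (use seq(1,3) in auto)
 finally show ?case by (simp add: image_comp)
qed

text \<open>Extends the strong Markov property from events and sets to weights known at time
  \<open>T\<close> and to non-negative functions. The weight that matters is the discount
  \<open>exp (- aa * T)\<close>.\<close>

lemma SM_fun: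
 assumes T: "stop T" and w: "w : bm (pre T)" and ph: "ph : bm cem_borel"
 shows "(NI (law X z) (%ww. w ww * ph (pos X (T ww + s) ww))) =
  (NI (law X z) (%ww. w ww * (NI (trans s (pos X (T ww) ww)) (%y. ph y))))"
 using w
proof induction
 case (cong f g)
 have "(NI (law X z) (%ww. f ww * h ww)) = (NI (law X z) (%ww. g ww * h ww))" for h
  by (rule nncong) (simp add: cong space_pre space_law)
 thus ?case using cong by simp
next
 case (set A) thus ?case using SM_fun1[OF T _ ph] by simp
next
 case (mult u c)
 note [measurable] = stopm[OF T] pre_measurable[OF T mult(2)] ph
 show ?case by (simp add: mult.assoc nncmult mult.IH)
next
 case (add u v)
 note [measurable] = stopm[OF T] pre_measurable[OF T add(1)] pre_measurable[OF T add(3)] ph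
 show ?case by (simp add: distrib_right nn_integral_add add.IH)
next
 case (seq U)
 note [measurable] = stopm[OF T] pre_measurable[OF T seq(1)] ph
 have *: "(NI (law X z) (%ww. (SUP i. U i ww) * h ww)) = (SUP i. NI (law X z) (%ww. U i ww * h ww))"
  if [measurable]: "h : bm (events X)" for h
  unfolding SUP_mult_right_ennreal
  by (rule mctSUP) (use seq(3) in "auto simp: incle intro!: mulR")
 show ?case by (simp add: image_comp * seq.IH)
qed

definition occ :: "real => ('w => ennreal) => ('a => ennreal) => 'a => ennreal" where
 "occ aa T g x = (PI x (%ww. (SI lborel (bf (T ww)) (%t. xp aa t * xt g (en t) ww))))"

text \<open>At \<open>T = iy\<close> the discount reads \<open>exp 0 = 1\<close>, because
  \<open>enn2real\<close> sends infinity to 0. This is harmless: the process is then in the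
  cemetery, where \<open>ext0\<close> vanishes.\<close>

definition fin :: "real => ('w => ennreal) => ('a => ennreal) => 'a => ennreal" where
 "fin aa T g x = (PI x (%ww. xp aa (enn2real (T ww)) * xt g (T ww) ww))"

abbreviation "R \<equiv> resolvent X"

lemma R_eq_occ: "R aa g x = occ aa (%_. iy) g x"
proof -
 have "{t::real. 0 <= t & en t < iy} = {0..}" by auto
 thus ?thesis unfolding resolvent_def occ_def by (simp only:)
qed

lemma R_eq_trans:
 assumes [measurable]: "g : BM"
 shows "R aa g y = (SI lborel {0..} (%s. xp aa s * (NI (trans (en s) (Some y)) (%z. ext0 g z))))"
proof -
 interpret PS: prob_space "P y" by (rule prob_law)
 interpret pair_sigma_finite "P y" lborel ..
 have "R aa g y = (LI (%s. PI y (%ww. xp aa s * xt g (en s) ww * ix {0..} s)))"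
  unfolding resolvent_def by (rule Fubini'[symmetric]) measurable
 also have "... = (LI (%s. (xp aa s * ix {0..} s) * (PI y (%ww. xt g (en s) ww))))"
  by (subst nncmult[symmetric], measurable, intro nncong, simp only: ac_simps)
 finally show ?thesis by (subst nn_integral_trans) (measurable, simp only: ac_simps)
qed

lemma R_measurable [measurable (raw)]:
 assumes [measurable]: "g : BM"
 shows "R aa g : BM"
proof -
 have [measurable]: "(%(y, s). NI (trans (en s) (Some y)) (%z. ext0 g z)) : bm (borel \<Otimes>\<^sub>M lborel)"
 proof -
  have "(%w. NI ((case (Some (fst w), snd w) of (z, s) => trans (en s) z)) (%z. ext0 g z)) : bm (borel \<Otimes>\<^sub>M lborel)"
   by (rule mcomp[OF mcomp[OF _ trans_joint] nn_integral_measurable_subprob_algebra])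
    (use Some_measurable[measurable] in measurable)
  thus ?thesis by (simp add: case_prod_beta')
 qed
 show ?thesis
  unfolding R_eq_trans[OF assms, abs_def] by measurable
qed

end

section \<open>Dynkin's formula and the resolvent equation\<close>

context hunt
begin

text \<open>The path integral is cut at \<open>T\<close>. The later part is an integral over
  \<open>s\<close> of the state at time \<open>T + s\<close>, to which the strong Markov property
  applies for each fixed \<open>s\<close>, with the discount up to \<open>T\<close> as
  weight.\<close>

theorem smarkov:
 assumes T: "stop T" and g [measurable]: "g : BM"
 shows "R aa g x = occ aa T g x + fin aa T (R aa g) x"
proof -
 let ?a = "%s w ww X T. xp aa s * (w ww * (NI (trans (en s) (pos X (T ww) ww)) (%z. ext0 g z))) * ix {0..} s"
 let ?b = "%w ww T. SI lborel {0..} (%s. xp aa s * (w ww * xt g (T ww + en s) ww))"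
 let ?d = "%s w ww T. xp aa s * (w ww * xt g (T ww + en s) ww) * ix {0..} s"
 note [measurable] = stopm[OF T]
 interpret PS: prob_space "P x" by (rule prob_law)
 interpret pair_sigma_finite "P x" lborel ..
 have [measurable]: "T : bm (P x)" by measurable
 define w where "w ww = xp aa (enn2real (T ww))" for ww
 have w: "w : bm (pre T)"
  unfolding w_def using filtration.measurable_stopping_time_pre_sigma[OF filtration_right T] by measurable
 note [measurable] = pre_measurable[OF T w]
 define F where "F t ww = xp aa t * xt g (en t) ww" for t ww
 have [measurable]: "(%(t, ww). F t ww) : bm (borel \<Otimes>\<^sub>M events X)"
  unfolding F_def by measurable
 have path: "(SI lborel {0..} (%t. F t ww)) = (SI lborel (bf (T ww)) (%t. F t ww)) +
   (?b w ww T)" if om [measurable]: "ww : Om" for ww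
 proof (cases "T ww")
  case top
  have "pos X (T ww + en s) ww = None" for s using pos_infty[OF om] top by simp
  moreover have "{t::real. 0 <= t & en t < T ww} = {0..}" using top by auto
  ultimately show ?thesis by simp
 next
  case (real r)
  have [measurable]: "(%t. F t ww) : BM" by measurable
  have "(SI lborel {0..} (%t. F t ww)) = (LI (%t. F t ww * ix (bf (T ww)) t + F t ww * ix {r..} t))"
   by (rule nncong) (use real in "auto split: splix simp: ennreal_less_iff")
  also have "... = (SI lborel (bf (T ww)) (%t. F t ww)) + (SI lborel {r..} (%t. F t ww))"
   by (rule nn_integral_add) measurable
  also have "(SI lborel {r..} (%t. F t ww)) = (LI (%s. F (r + s) ww * ix {r..} (r + s)))"
   by (subst nn_integral_real_affine[where c=1 and t=r]) auto
  also have "... = (?b w ww T)"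
  proof (rule nncong)
   fix s
   have "xp aa (r + s) = xp aa s * w ww"
    using real by (simp add: w_def ennreal_mult[symmetric] exp_add[symmetric] algebra_simps)
   moreover have "en (r + s) = T ww + en s" if "0 <= s" using real that by simp
   ultimately show "F (r + s) ww * ix {r..} (r + s) = ?d s w ww T"
    unfolding F_def by (auto split: splix simp: mult.assoc)
  qed
  finally show ?thesis .
 qed
 have "R aa g x = (PI x (%ww. (SI lborel (bf (T ww)) (%t. F t ww)) +
   (?b w ww T)))"
  unfolding resolvent_def F_def[symmetric] by (rule nncong) (simp add: path space_law)
 also have "... = occ aa T g x + (PI x (%ww. (?b w ww T)))"
  unfolding occ_def F_def[symmetric] by (rule nn_integral_add) measurable
 also have "(PI x (%ww. (?b w ww T))) =
   (LI (%s. PI x (%ww. ?d s w ww T)))"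
  by (rule Fubini'[symmetric]) measurable
 also have "... = (LI (%s. PI x (%ww. ?a s w ww X T)))"
 proof (rule nncong)
  fix s :: real
  have "(PI x (%ww. ?d s w ww T)) =
   xp aa s * ix {0..} s * (PI x (%ww. w ww * xt g (T ww + en s) ww))"
   by (subst nncmult[symmetric], measurable, intro nncong, simp only: ac_simps)
  also have "(PI x (%ww. w ww * xt g (T ww + en s) ww)) = (PI x (%ww. w ww * (NI (trans (en s) (pos X (T ww) ww)) (%z. ext0 g z))))"
   by (rule SM_fun[OF T w]) measurable
  also have "xp aa s * ix {0..} s * ... = (PI x (%ww. ?a s w ww X T))"
   by (subst nncmult[symmetric], measurable, intro nncong, simp only: ac_simps)
  finally show "(PI x (%ww. ?d s w ww T)) = ..." .
 qed
 also have "... = (PI x (%ww. LI (%s. ?a s w ww X T)))"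
 proof (rule Fubini')
  have [measurable]: "(%(ww, s). NI (trans (en s) (pos X (T ww) ww)) (%z. ext0 g z)) : bm (P x \<Otimes>\<^sub>M lborel)"
  proof -
   have "(%v. NI ((case (pos X (T (fst v)) (fst v), snd v) of (z, s) => trans (en s) z)) (%z. ext0 g z)) : bm (P x \<Otimes>\<^sub>M lborel)"
    by (rule mcomp[OF mcomp[OF _ trans_joint] nn_integral_measurable_subprob_algebra]) measurable
   thus ?thesis by (simp add: case_prod_beta')
  qed
  show "(%(ww, s). ?a s w ww X T)
   \<in> bm (P x \<Otimes>\<^sub>M lborel)" by measurable
 qed
 also have "... = fin aa T (R aa g) x"
  unfolding fin_def w_def[symmetric]
 proof (rule nn_integral_cong_AE)
  show "AE ww in P x. (LI (%s. ?a s w ww X T))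
   = w ww * xt (R aa g) (T ww) ww"
  proof (rule AE_I2)
   fix ww assume "ww : space (P x)"
   have m [measurable]: "(%s. NI (trans (en s) y) (%z. ext0 g z)) : BM" for y
   proof -
    have "(%v. NI ((case (y, v) of (z, s) => trans (en s) z)) (%z. ext0 g z)) : BM"
     by (rule mcomp[OF mcomp[OF _ trans_joint] nn_integral_measurable_subprob_algebra]) measurable
    thus ?thesis by simp
   qed
   show "(LI (%s. ?a s w ww X T))
    = w ww * xt (R aa g) (T ww) ww"
   proof (cases "pos X (T ww) ww")
    case None
    have "AE ww' in law X None. xt g (en s) ww' = 0" for s
     using pos_0[of None] AE_space
    proof eventually_elim
     case (elim ww')
     thus ?case using pos_absorb[of ww' 0 "en s"] by (simp add: space_law)
    qed
    hence "(NI (trans (en s) None) (%z. ext0 g z)) = 0" for s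
     by (simp add: nn_integral_trans nn_integral_0_iff_AE)
    thus ?thesis using None by simp
   next
    case (Some y)
    thus ?thesis
     by (simp only: ext0_simps R_eq_trans[OF g], subst nncmult[symmetric], measurable, intro nncong, simp only: ac_simps)
   qed
  qed
 qed
 finally show ?thesis .
qed

end

lemma None_sets: "{None} \<in> sets (cem_borel :: 'a::t2_space option measure)"
 by (simp add: sets_cem_borel vimage_def)

lemma Compl_None_sets: "- {None} \<in> sets (cem_borel :: 'a::t2_space option measure)"
 by (simp add: sets_cem_borel vimage_def)

lemma nn_integral_exp: "0 < aa ==> (SI lborel {0..} (%t. xp aa t)) = en (1 / aa)"
proof -
 assume a: "0 < aa"
 have "(SI lborel {0..} (%t. xp aa t)) = en (0 - (- exp (- aa * 0) / aa))"
 proof (rule nn_integral_FTC_atLeast)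
  show "((%t. - exp (- aa * t) / aa) \<longlongrightarrow> 0) at_top" using a by real_asymp
  show "((%t. - exp (- aa * t) / aa) has_real_derivative exp (- aa * x)) (at x)" for x
   using a by (auto intro!: derivative_eq_intros)
 qed auto
 thus ?thesis by simp
qed

text \<open>The convolution of two exponentials, written without subtraction. It is the scalar form
  of the resolvent equation and is inserted under path integrals.\<close>

lemma nn_integral_exp2:
 assumes "0 <= r" "aa < bb"
 shows "en (bb - aa) * (SI lborel {0..r} (%s. en (exp (- aa * s) * exp (- bb * (r - s))))) + xp bb r = xp aa r"
proof -
 let ?a = "SI lborel {0..r} (%s. en (exp (- aa * s) * exp (- bb * (r - s))))"
 have "?a =
   en (exp ((bb - aa) * r - bb * r) / (bb - aa) - exp ((bb - aa) * 0 - bb * r) / (bb - aa))"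
 proof (rule nn_integral_FTC_Icc)
  fix x
  have "((%s. exp ((bb - aa) * s - bb * r)) has_real_derivative exp ((bb - aa) * x - bb * r) * (bb - aa)) (at x)"
   by (auto intro!: derivative_eq_intros)
  from DERIV_cdivide[OF this, of "bb - aa"]
  have "((%s. exp ((bb - aa) * s - bb * r) / (bb - aa)) has_real_derivative exp ((bb - aa) * x - bb * r)) (at x)"
   using assms(2) by simp
  also have "exp ((bb - aa) * x - bb * r) = exp (- aa * x) * exp (- bb * (r - x))"
   unfolding exp_add[symmetric] by (simp add: algebra_simps)
  finally show "((%s. exp ((bb - aa) * s - bb * r) / (bb - aa)) has_real_derivative exp (- aa * x) * exp (- bb * (r - x))) (at x)" .
 qed (use assms in auto)
 also have "... = en ((exp (- aa * r) - exp (- bb * r)) / (bb - aa))"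
  by (simp add: diff_divide_distrib algebra_simps)
 finally have "en (bb - aa) * ?a = en (exp (- aa * r) - exp (- bb * r))"
  using assms(2) by (simp add: ennreal_mult'[symmetric])
 moreover have "exp (- bb * r) <= exp (- aa * r)" using assms by (simp add: mulR)
 ultimately show ?thesis by (simp add: ennreal_plus[symmetric] del: ennreal_plus)
qed

context hunt
begin

lemma mfun_occ:
 assumes [measurable]: "T : bm (events X)"
 shows "mfun (%g. occ aa T g x)"
proof -
 let ?a = "%W g. (NI (distr (density (P x \<Otimes>\<^sub>M lborel) W) borel (%(ww, t). the (px t ww))) (%y. g y))"
 interpret PS: prob_space "P x" by (rule prob_law)
 interpret pair_sigma_finite "P x" lborel ..
 note measurable_the_cem[measurable]
 note None_sets[measurable] Compl_None_sets[measurable]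
 define W where "W = (%(ww, t). xp aa t * ix (bf (T ww)) t * ix (- {None}) (px t ww))"
 have [measurable]: "W : bm (P x \<Otimes>\<^sub>M lborel)" unfolding W_def by measurable
 have [measurable]: "(%(ww, t). the (px t ww)) : P x \<Otimes>\<^sub>M lborel \<rightarrow>\<^sub>M borel" by measurable
 have "occ aa T g x = ?a W g"
  if [measurable]: "g : BM" for g
 proof -
  have "?a W g =
    (NI (P x \<Otimes>\<^sub>M lborel) (%z. W z * g (case z of (ww, t) => the (px t ww))))"
   by (subst nn_integral_distr, measurable, subst nn_integral_density) measurable
  also have "... = (PI x (%ww. LI (%t. W (ww, t) * g (the (px t ww)))))"
   by (subst lborel.nn_integral_fst[symmetric]) (simp_all)
  also have "... = occ aa T g x"
   unfolding occ_def W_def by (intro nncong) (auto split: splix option.splits simp: ext0_def)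
  finally show ?thesis ..
 qed
 thus ?thesis unfolding mfun_def by (intro exI[of _ "distr _ _ _"]) auto
qed

lemma mfun_fin:
 assumes [measurable]: "T : bm (events X)" "W : bm (events X)"
 shows "mfun (%g. PI x (%ww. W ww * xt g (T ww) ww))"
proof -
 note measurable_the_cem[measurable]
 note None_sets[measurable] Compl_None_sets[measurable]
 have "(PI x (%ww. W ww * xt g (T ww) ww)) =
   (NI (distr (density (P x) (%ww. W ww * ix (- {None}) (pos X (T ww) ww))) borel (%ww. the (pos X (T ww) ww))) (%y. g y))"
  if [measurable]: "g : BM" for g
  by (subst nn_integral_distr, measurable, subst nn_integral_density)
   (measurable, auto intro!: nncong split: splix option.splits simp: ext0_def)
 thus ?thesis unfolding mfun_def by (intro exI[of _ "distr _ _ _"]) auto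
qed

lemma mfun_fin': "T : bm (events X) ==> mfun (%g. fin aa T g x)"
 unfolding fin_def by (rule mfun_fin) simp_all

lemma kop_R: "kop (R aa)"
 unfolding kop_def
proof (intro conjI allI ballI)
 show "mfun (%g. R aa g x)" for x unfolding R_eq_occ by (rule mfun_occ) simp
qed measurable

text \<open>Conservativeness gives survival at every integer time almost surely, and the cemetery is
  absorbing.\<close>

lemma AE_alive: "AE ww in P x. \<forall>t<iy. pos X t ww ~= None"
proof -
 interpret PS: prob_space "P x" by (rule prob_law)
 note None_sets[measurable] Compl_None_sets[measurable]
 have "AE ww in P x. px (real n) ww ~= None" for n :: nat
 proof -
  have ext01: "ext0 (%_. 1::real) z <= 1" "0 <= ext0 (%_. 1::real) z" for z :: "'a option"
   by (cases z; simp)+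
  have int: "integrable (P x) (%ww. xt (%_. 1::real) (en (real n)) ww)"
   by (rule PS.integrable_const_bound[where B=1]) (auto intro!: AE_I2 simp: ext01)
  have "(\<integral>ww. xt (%_. 1::real) (en (real n)) ww \<partial>P x) = 1"
   using cons unfolding conservative_def semigroup_def by simp
  hence i: "(\<integral>ww. (1 - xt (%_. 1::real) (en (real n)) ww) \<partial>P x) = 0"
   by (subst Bochner_Integration.integral_diff) (simp_all add: PS.prob_space int)
  have "AE ww in P x. 1 - xt (%_. 1::real) (en (real n)) ww = 0"
   by (subst integral_nonneg_eq_0_iff_AE[symmetric])
    (auto intro!: AE_I2 i int simp: ext01)
  thus ?thesis
  proof eventually_elim
   case (elim ww) thus ?case by (cases "px (real n) ww") auto
  qed
 qed
 hence "AE ww in P x. \<forall>n::nat. px (real n) ww ~= None" by (simp add: AE_all_countable)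
 with AE_space show ?thesis
 proof eventually_elim
  case (elim ww)
  show ?case
  proof (intro allI impI notI)
   fix t assume t: "t < iy" "pos X t ww = None"
   then obtain n :: nat where "t <= of_nat n" using ennreal_Ex_less_of_nat[of t] by (auto intro: less_imp_le)
   thus False using pos_absorb[of ww t "en (real n)"] t elim by (auto simp: space_law ennreal_of_nat_eq_real_of_nat)
  qed
 qed
qed

lemma occ_mono_T: "(!!ww. ww : Om ==> S ww <= T ww) ==> occ aa S g x <= occ aa T g x"
 unfolding occ_def by (intro nnmono) (auto simp: space_law split: splix intro: order.strict_trans2)

lemma occ_le_R: "occ aa T g x <= R aa g x"
 unfolding R_eq_occ by (rule occ_mono_T) simp

lemma R_const_le: "0 < aa ==> R aa (%_. c) x <= c * en (1 / aa)"
proof -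
 assume a: "0 < aa"
 interpret PS: prob_space "P x" by (rule prob_law)
 have "R aa (%_. c) x <= (PI x (%ww. (SI lborel {0..} (%t. c * xp aa t))))"
  unfolding resolvent_def by (intro nnmono) (auto simp: ext0_def mult.commute split: option.splits splix)
 also have "... = c * en (1 / aa)"
  using a by (simp add: mult.assoc nncmult nn_integral_exp[simplified] PS.emeasure_space_1)
 finally show ?thesis .
qed

lemma R_const: "0 < aa ==> R aa (%_. c) x = c * en (1 / aa)"
proof -
 let ?b = "SI lborel {0..} (%t. c * xp aa t)"
 assume a: "0 < aa"
 interpret PS: prob_space "P x" by (rule prob_law)
 have "R aa (%_. c) x = (PI x (%ww. ?b))"
  unfolding resolvent_def
 proof (rule nn_integral_cong_AE)
  show "AE ww in P x. (SI lborel {0..} (%t. xp aa t * xt (%_. c) (en t) ww)) = ?b"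
   using AE_alive
  proof eventually_elim
   case (elim ww)
   have "xt (%_. c) (en t) ww = c" for t using elim[rule_format, of "en t"] by auto
   thus ?case by (simp add: mult.commute)
  qed
 qed
 also have "... = c * en (1 / aa)"
  using a by (simp add: mult.assoc nncmult nn_integral_exp[simplified] PS.emeasure_space_1)
 finally show ?thesis .
qed

lemma R_bound:
 assumes "0 < aa" "g : BM" "!!y. g y <= c" shows "R aa g x <= c * en (1 / aa)"
 using kop_mono[OF kop_R, of g "%_. c" aa x] R_const_le[of aa c x] assms by auto

lemma fin_bound:
 assumes "0 <= aa" "!!y. g y <= c" shows "fin aa T g x <= c"
proof -
 interpret PS: prob_space "P x" by (rule prob_law)
 have "fin aa T g x <= (PI x (%ww. c))"
  unfolding fin_def
 proof (rule nnmono)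
  fix ww
  have "xp aa (enn2real (T ww)) * xt g (T ww) ww <= 1 * c"
   using assms by (intro mult_mono) (auto simp: ext0_def split: option.splits)
  thus "xp aa (enn2real (T ww)) * xt g (T ww) ww <= c" by simp
 qed
 thus ?thesis by (simp add: PS.emeasure_space_1)
qed

text \<open>Dynkin's formula for a difference of potentials \<open>w = R aa b - R aa a\<close>, with
  \<open>R aa a\<close> moved to the other side. Boundedness of \<open>R aa a\<close> makes the
  common term at time \<open>T\<close> finite, so that it can be cancelled.\<close>

lemma SM_general:
 assumes T: "stop T" and [measurable]: "a : BM" "b : BM" "w : BM"
  and eq: "!!y. w y + R aa a y = R aa b y" and fin: "!!y. R aa a y <= c" "c < iy" "0 <= aa"
 shows "w x + occ aa T a x = occ aa T b x + fin aa T w x"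
proof -
 note m = mfun_fin'[OF stopm[OF T]]
 have F: "fin aa T (R aa a) x < iy" using fin_bound[of aa "R aa a" c T x] fin by (auto intro: le_less_trans)
 have "w x + (occ aa T a x + fin aa T (R aa a) x) = R aa b x" unfolding eq[symmetric] by (simp add: smarkov[OF T])
 also have "... = occ aa T b x + fin aa T (%y. w y + R aa a y) x"
  unfolding eq by (rule smarkov[OF T]) measurable
 also have "... = occ aa T b x + (fin aa T w x + fin aa T (R aa a) x)"
  by (subst mfun_add[OF m]) measurable
 finally have "fin aa T (R aa a) x + (w x + occ aa T a x) = fin aa T (R aa a) x + (occ aa T b x + fin aa T w x)"
  by (simp add: ac_simps)
 thus ?thesis using F by (auto simp: ennreal_add_left_cancel)
qed

lemma trans_trans:
 assumes [measurable]: "ph : bm cem_borel"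
 shows "(NI (trans t z) (%y. (NI (trans s y) (%u. ph u)))) = (NI (trans (t + s) z) (%u. ph u))"
proof -
 have "(NI (law X z) (%ww. 1 * ph (pos X (t + s) ww))) = (NI (law X z) (%ww. 1 * (NI (trans s (pos X t ww)) (%y. ph y))))"
  by (rule SM_fun[OF stopping_time_const[of _ t]]) measurable
 moreover have "(%y. NI (trans s y) (%u. ph u)) : bm cem_borel" by measurable
 ultimately show ?thesis by (simp add: nn_integral_trans)
qed

text \<open>By the Chapman-Kolmogorov equation an iterated resolvent is a double integral of
  \<open>u (s + t)\<close>. Exchanging \<open>s\<close> and \<open>t\<close> gives the commutation;
  the substitution \<open>r = s + t\<close> leaves the convolution of the two exponentials.\<close>

lemma resolvent_eq:
 assumes ab: "aa < bb" and [measurable]: "g : BM"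
 shows "R aa g x = R bb g x + en (bb - aa) * R aa (R bb g) x"
  and "R aa (R bb g) x = R bb (R aa g) x"
proof -
 let ?a = "%r. SI lborel {0..r} (%s. en (exp (- aa * s) * exp (- bb * (r - s))))"
 let ?d = "%s r u. (xp aa s * ix {0..} s) * (xp bb (r - s) * ix {0..} (r - s)) * u r"
 let ?f = "%s dd t. NI (trans (en s) (Some x)) (%y. (xp dd t * ix {0..} t) * (NI (trans (en t) y) (%z. ext0 g z)))"
 let ?h = "%r u. xp bb r * u r * ix {0..} r + en (bb - aa) * ((?a r) * u r * ix {0..} r)"
 let ?i = "%gg dd u. (LI (%s. LI (%t. (xp gg s * ix {0..} s) * (xp dd t * ix {0..} t) * u (s + t))))"
 let ?j = "%dd u s. LI (%t. (xp dd t * ix {0..} t) * u (s + t))"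
 define u where "u r = (NI (trans (en r) (Some x)) (%z. ext0 g z))" for r
 have m: "(%w. NI (trans (en (snd w)) (fst w)) (%z. ext0 g z)) : bm (cem_borel \<Otimes>\<^sub>M borel)"
  using mcomp[OF trans_joint nn_integral_measurable_subprob_algebra[of "ext0 g"]] by (simp add: case_prod_beta')
 have [measurable]: "u : BM"
  unfolding u_def using mcomp[OF _ m, of "%r. (Some x, r)" borel] by simp
 have zero: "(NI (trans (en s) None) (%z. ext0 g z)) = 0" for s
 proof -
  have "AE ww' in law X None. xt g (en s) ww' = 0"
   using pos_0[of None] AE_space
  proof eventually_elim
   case (elim ww')
   thus ?case using pos_absorb[of ww' 0 "en s"] by (simp add: space_law)
  qed
  thus ?thesis by (simp add: nn_integral_trans nn_integral_0_iff_AE)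
 qed
 have double: "R gg (R dd g) x = ?i gg dd u" for gg dd
 proof -
  have e: "ext0 (R dd g) y = (LI (%t. (xp dd t * ix {0..} t) * (NI (trans (en t) y) (%z. ext0 g z))))" for y
  proof (cases y)
   case (Some b)
   thus ?thesis by (simp only: ext0_simps R_eq_trans[OF assms(2)]) (intro nncong, simp only: ac_simps)
  qed (simp add: zero)
  have "(NI (trans (en s) (Some x)) (%y. ext0 (R dd g) y)) = (?j dd u s)" if s: "0 <= s" for s
  proof -
   interpret T: subprob_space "trans (en s) (Some x)" by (rule subprob_trans)
   interpret pair_sigma_finite "trans (en s) (Some x)" lborel ..
   have [measurable]: "(%(y, t). NI (trans (en t) y) (%z. ext0 g z)) : bm (trans (en s) (Some x) \<Otimes>\<^sub>M lborel)"
    using m by (simp add: case_prod_beta' cong: measurable_cong_sets sets_pair_measure_cong)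
   have "(NI (trans (en s) (Some x)) (%y. ext0 (R dd g) y)) =
    (LI (%t. ?f s dd t))"
    unfolding e by (rule Fubini'[symmetric]) measurable
   also have "... = (?j dd u s)"
   proof (rule nncong)
    fix t
    have "(?f s dd t) =
     (xp dd t * ix {0..} t) * (NI (trans (en s + en t) (Some x)) (%z. ext0 g z))"
     by (subst nncmult, measurable, subst trans_trans) measurable
    thus "(?f s dd t) =
     (xp dd t * ix {0..} t) * u (s + t)"
     using s by (auto simp: u_def split: splix)
   qed
   finally show ?thesis .
  qed
  hence "R gg (R dd g) x = (SI lborel {0..} (%s. xp gg s * (?j dd u s)))"
   by (subst R_eq_trans) (auto intro!: nncong split: splix)
  also have "... = ?i gg dd u"
   by (intro nncong) (simp add: nncmult[symmetric] mult.assoc, auto intro!: nncong split: splix)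
  finally show ?thesis .
 qed
 show "R aa (R bb g) x = R bb (R aa g) x"
  unfolding double
  by (subst lborel_pair.Fubini') (measurable, auto intro!: nncong simp: add.commute mult.commute split: splix)
 have "R aa (R bb g) x = (LI (%s. LI (%r. ?d s r u)))"
  unfolding double
 proof (rule nncong)
  fix s :: real
  show "(LI (%t. (xp aa s * ix {0..} s) * (xp bb t * ix {0..} t) * u (s + t)))
   = (LI (%r. ?d s r u))"
   by (subst (2) nn_integral_real_affine[where c=1 and t=s]) auto
 qed
 also have "... = (LI (%r. LI (%s. ?d s r u)))"
  by (rule lborel_pair.Fubini'[symmetric]) measurable
 also have "... = (SI lborel {0..} (%r. (?a r) * u r))"
 proof (rule nncong)
  fix r :: real
  have "(LI (%s. ?d s r u))
   = (LI (%s. (en (exp (- aa * s) * exp (- bb * (r - s))) * ix {0..r} s) * (u r * ix {0..} r)))"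
   by (intro nncong) (auto split: splix simp: ennreal_mult)
  thus "(LI (%s. ?d s r u))
   = (?a r) * u r * ix {0..} r"
   by (simp only: mult.assoc) (subst nn_integral_multc[symmetric], measurable, simp only: mult.assoc)
 qed
 finally have RR: "R aa (R bb g) x = (SI lborel {0..} (%r. (?a r) * u r))" .
 have [measurable]: "(%r. ?a r) : BM"
 proof -
  have "ix {0..r} s = (ix {0..} s * ix {0..} (r - s) :: ennreal)" for r s :: real
   by (auto split: splix)
  thus ?thesis by simp
 qed
 have "R aa g x = (SI lborel {0..} (%r. xp aa r * u r))"
  unfolding u_def by (rule R_eq_trans) measurable
 also have "... = (LI (%r. ?h r u))"
 proof (rule nncong)
  fix r :: real
  show "xp aa r * u r * ix {0..} r = ?h r u"
  proof (cases "0 <= r")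
   case True
   show ?thesis
    unfolding nn_integral_exp2[OF True ab, symmetric] using True
    by (simp only: distrib_right mult.assoc add.commute indicator_simps atLeast_iff mult_1_right)
  qed simp
 qed
 also have "... = (SI lborel {0..} (%r. xp bb r * u r)) + en (bb - aa) * R aa (R bb g) x"
  unfolding RR by (subst nn_integral_add, measurable, subst nncmult) measurable
 also have "(SI lborel {0..} (%r. xp bb r * u r)) = R bb g x"
  unfolding u_def by (rule R_eq_trans[symmetric]) measurable
 finally show "R aa g x = R bb g x + en (bb - aa) * R aa (R bb g) x" .
qed

end

text \<open>Neumann series: \<open>neu R q g j\<close> is the partial sum \<open>(\<Sum>i<j. (R q)\<^sup>i R g)\<close>. With \<open>R\<close> the
  \<open>aa\<close>-resolvent and \<open>q = aa - ps\<close> its limit is the potential of the process killed at rate \<open>ps\<close>.\<close>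

primrec neu :: "(('a => ennreal) => 'a => ennreal) => ('a => ennreal) => ('a => ennreal) => nat => 'a => ennreal" where
 "neu R q g 0 = (%_. 0)"
| "neu R q g (Suc j) = R (%y. g y + q y * neu R q g j y)"

definition nlim :: "(('a => ennreal) => 'a => ennreal) => ('a => ennreal) => ('a => ennreal) => 'a => ennreal" where
 "nlim R q g y = (SUP j. neu R q g j y)"

lemma neu_measurable:
 assumes R: "kop R" and [measurable]: "q : BM" "g : BM"
 shows "neu R q g j : BM"
proof (induction j)
 case (Suc j)
 note [measurable] = Suc.IH
 show ?case unfolding neu.simps by (rule kopm[OF R]) measurable
qed simp

lemma nlim_measurable:
 assumes R: "kop R" and "q : BM" "g : BM"
 shows "nlim R q g : BM"
 unfolding nlim_def[abs_def] by (intro borel_measurable_SUP countableI_type neu_measurable[OF assms])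

lemma neu_Suc_le:
 assumes R: "kop R" and [measurable]: "q : BM" "g : BM"
 shows "neu R q g j x <= neu R q g (Suc j) x"
proof (induction j arbitrary: x)
 case (Suc j)
 note [measurable] = neu_measurable[OF R assms(2,3)]
 have "neu R q g (Suc j) x = R (%y. g y + q y * neu R q g j y) x" by simp
 also have "... <= R (%y. g y + q y * neu R q g (Suc j) y) x"
  by (rule kop_mono[OF R]) (simp_all only: add_left_mono mulL[OF Suc.IH zero_le] borel_measurable_add borel_measurable_times_ennreal assms(2,3) neu_measurable[OF R assms(2,3)])
 also have "... = neu R q g (Suc (Suc j)) x" by simp
 finally show ?case .
qed simp

lemma neu_incseq:
 assumes R: "kop R" and "q : BM" "g : BM"
 shows "incseq (neu R q g)"
 by (rule incseq_SucI) (use neu_Suc_le[OF assms] in "auto simp: le_fun_def")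

lemma nlim_fix:
 assumes R: "kop R" and [measurable]: "q : BM" "g : BM"
 shows "nlim R q g x = R (%y. g y + q y * nlim R q g y) x"
proof -
 let ?a = "(SUP j. neu R q g (Suc j) x)"
 note [measurable] = neu_measurable[OF R assms(2,3)]
 note inc = neu_incseq[OF R assms(2,3)]
 have "R (%y. g y + q y * nlim R q g y) x = R (%y. SUP j. g y + q y * neu R q g j y) x"
  unfolding nlim_def by (intro arg_cong[where f="%h. R h x"] ext) (simp add: SUP_mult_left_ennreal ennreal_SUP_add_right)
 also have "... = (SUP j. R (%y. g y + q y * neu R q g j y) x)"
  by (rule kop_SUP[OF R]) (measurable, use inc in "auto simp: incle intro!: add_left_mono mulL")
 also have "... = ?a" by simp
 also have "... = nlim R q g x"
  unfolding nlim_def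
 proof (rule antisym)
  show "?a <= (SUP j. neu R q g j x)" by (rule SUP_least, rule SUP_upper) simp
  show "(SUP j. neu R q g j x) <= ?a"
   by (rule SUP_least, rule SUP_upper2, rule UNIV_I, rule neu_Suc_le[OF assms])
 qed
 finally show ?thesis ..
qed

lemma neu_least:
 assumes R: "kop R" and [measurable]: "q : BM" "g : BM" "c : BM"
  and c: "!!x. R (%y. g y + q y * c y) x <= c x"
 shows "neu R q g j x <= c x"
proof (induction j arbitrary: x)
 case (Suc j)
 note [measurable] = neu_measurable[OF R assms(2,3)]
 have "R (%y. g y + q y * neu R q g j y) x <= R (%y. g y + q y * c y) x"
  by (rule kop_mono[OF R]) (measurable, intro add_left_mono mulL Suc.IH, simp)
 thus ?case using c[of x] by auto
qed simp

text \<open>The limit lies below every supersolution of its fixed-point equation; upper bounds for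
  killed potentials are obtained by exhibiting one.\<close>

lemma nlim_least:
 assumes "kop R" "q : BM" "g : BM" "c : BM"
  and "!!x. R (%y. g y + q y * c y) x <= c x"
 shows "nlim R q g x <= c x"
 unfolding nlim_def by (rule SUP_least) (rule neu_least[OF assms])

lemma ennreal_cancel: "a + x = a + y ==> a ~= iy ==> x = (y :: ennreal)"
 by (simp add: ennreal_add_left_cancel)

lemma add_rearrange:
 fixes a b r w n g :: ennreal
 assumes "r = w + n" "r = g + a" "n = b + a" shows "a + (w + b) = a + g"
proof -
 have "a + (w + b) = w + (b + a)" by (simp only: ac_simps)
 also have "... = g + a" unfolding assms(3)[symmetric] assms(1)[symmetric] by (rule assms(2))
 finally show ?thesis by (simp only: add.commute)
qed

text \<open>The error \<open>e i n\<close> vanishes in \<open>n\<close> only for fixed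
  \<open>i\<close>. The upper limit in \<open>n\<close> is therefore taken first, and
  \<open>i\<close> is sent to infinity afterwards.\<close>

lemma squeeze_two_index:
 fixes G :: "nat => ennreal"
 assumes lo: "!!n. L <= G n" and up: "!!n i. G n <= A i + e i n" and e: "!!i::nat. (%n. e i n) ----> 0" and A: "A ----> L"
 shows "G ----> L"
proof -
 have "Limsup sequentially G <= A i" for i
 proof -
  have "(%n. A i + e i n) ----> A i + 0" by (intro tendsto_intros e)
  hence "Limsup sequentially (%n. A i + e i n) = A i" by (intro lim_imp_Limsup) auto
  moreover have "Limsup sequentially G <= Limsup sequentially (%n. A i + e i n)"
   by (rule Limsup_mono) (simp add: up)
  ultimately show ?thesis by simp
 qed
 hence "Limsup sequentially G <= L" by (intro LIMSEQ_le_const[OF A]) auto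
 moreover have "L <= Liminf sequentially G" by (rule Liminf_bounded) (simp add: lo)
 moreover have "Liminf sequentially G <= Limsup sequentially G" by (rule Liminf_le_Limsup) simp
 ultimately show ?thesis by (simp add: tendsto_iff_Liminf_eq_Limsup antisym)
qed

section \<open>Killing at a finite rate on an open set\<close>

context hunt
begin

text \<open>The \<open>aa\<close>-potential of the process killed at rate \<open>N\<close> on
  \<open>U\<close>, written as uniform killing at rate \<open>aa + N\<close> compensated by creation
  at rate \<open>N\<close> off \<open>U\<close>. All terms of the series are then
  non-negative.\<close>

definition kill :: "real => 'a set => real => ('a => ennreal) => 'a => ennreal" where
 "kill aa U N g = nlim (R (aa + N)) (%y. en N * ix (- U) y) g"

context
 fixes aa c N :: real and U :: "'a set" and g :: "'a => ennreal"
 assumes aa: "0 < aa" and N: "0 < N" and U: "open U" and g [measurable]: "g : BM" and gc: "!!y. g y <= en c" and c0: "0 <= c"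
begin

lemma U_sets [measurable]: "U : sets borel" using U by simp

lemma kill_measurable [measurable]: "kill aa U N g : BM"
 unfolding kill_def by (rule nlim_measurable[OF kop_R]) measurable

lemma kill_fix: "kill aa U N g x = R (aa + N) (%y. g y + en N * ix (- U) y * kill aa U N g y) x"
 unfolding kill_def by (rule nlim_fix[OF kop_R]) measurable

text \<open>The constant \<open>c / aa\<close> solves \<open>(c + N * z) / (aa + N) = z\<close>,
  hence is a supersolution for a source bounded by \<open>c\<close>.\<close>

lemma kill_bound: "kill aa U N g x <= en (c / aa)"
 unfolding kill_def
proof (rule nlim_least[OF kop_R])
 let ?a = "%y. g y + en N * ix (- U) y * en (c / aa)"
 fix x
 have "R (aa + N) (%y. ?a y) x
   <= (en c + en N * en (c / aa)) * en (1 / (aa + N))"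
 proof (rule R_bound)
  show "?a y <= en c + en N * en (c / aa)" for y
   by (rule add_mono[OF gc]) (auto split: splix)
 qed (use aa N in simp_all)
 also have "... = en ((c + N * (c / aa)) / (aa + N))"
  using aa c0 N by (simp add: ennreal_mult[symmetric] ennreal_plus[symmetric] del: ennreal_plus)
 also have "(c + N * (c / aa)) / (aa + N) = c / aa"
  using aa N by (simp add: divide_simps) (simp add: algebra_simps)
 finally show "R (aa + N) (%y. ?a y) x <= en (c / aa)" .
qed measurable

lemma kill_rate_bound: "R aa (%y. en N * ix A y * kill aa U N g y) x <= en (N * (c / aa) * (1 / aa))"
 if [measurable]: "A : sets borel"
proof -
 have "R aa (%y. en N * ix A y * kill aa U N g y) x <= en N * en (c / aa) * en (1 / aa)"
  by (rule R_bound) (use aa N kill_bound in "auto intro!: mulL split: splix")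
 thus ?thesis using aa c0 N by (simp add: ennreal_mult'[symmetric] mult.assoc)
qed

text \<open>Trades the rate \<open>aa + N\<close> for \<open>aa\<close> by the resolvent equation.
  In this form the killed potential is a difference of two \<open>aa\<close>-potentials, so that
  \<open>SM_general\<close> applies to it.\<close>

lemma kill_eq: "kill aa U N g x + R aa (%y. en N * ix U y * kill aa U N g y) x = R aa g x"
proof -
 let ?a = "%y. en N * ix (- U) y * kill aa U N g y"
 let ?b = "%y. en N * ix U y * kill aa U N g y"
 define h where "h y = g y + en N * ix (- U) y * kill aa U N g y" for y
 have [measurable]: "h : BM" unfolding h_def by measurable
 have w: "R (aa + N) h = kill aa U N g" unfolding h_def by (rule ext) (rule kill_fix[symmetric])
 have 1: "R aa h x = kill aa U N g x + en N * R aa (kill aa U N g) x"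
  using resolvent_eq(1)[of aa "aa + N" h x] N unfolding w by simp
 have 2: "R aa h x = R aa g x + R aa ?a x"
  unfolding h_def by (rule kop_add[OF kop_R]) measurable
 have "en N * R aa (kill aa U N g) x = R aa (%y. en N * kill aa U N g y) x"
  by (rule kop_cmult[OF kop_R, symmetric]) measurable
 also have "... = R aa (%y. en N * ix U y * kill aa U N g y + en N * ix (- U) y * kill aa U N g y) x"
  by (rule arg_cong[where f="%h. R aa h x"]) (auto split: splix)
 also have "... = R aa ?b x + R aa ?a x"
  by (rule kop_add[OF kop_R]) measurable
 finally have "R aa ?a x + (kill aa U N g x + R aa ?b x)
  = R aa ?a x + R aa g x"
  by (rule add_rearrange[OF 1 2])
 moreover have "R aa ?a x ~= iy"
  using kill_rate_bound[of "- U" x] by (auto simp: top_unique)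
 ultimately show ?thesis by (rule ennreal_cancel)
qed

end

declare U_sets [measurable del]

text \<open>The normalised resolvent averages over an exponential time of order \<open>1/n\<close>.
  After the scaling \<open>t = s / n\<close>, right continuity of the path at time 0 and dominated
  convergence give the limit.\<close>

lemma resolvent_cont_lim:
 assumes [measurable]: "g : BM" and g1: "!!z. g z <= 1" and cont: "isCont g y" and aa: "0 < aa"
 shows "(%n. en (rs n) * R (aa + rs n) g y) ----> (g y :: ennreal)"
proof -
 let ?b = "%n F ww. en (rs n) * (LI (%t. xp (aa + rs n) t * F t ww * ix {0..} t))"
 let ?d = "%n s F ww. xp (aa + rs n) (s / rs n) * F (s / rs n) ww * ix {0..} (s / rs n)"
 let ?f = "%s. en (exp (- s)) * ix {0..} s"
 let ?h = "%real. NI (lborel :: real measure) (%s. en (exp (- s)) * ix {0..} s * g y)"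
 interpret PS: prob_space "P y" by (rule prob_law)
 define F where "F t ww = xt g (en t) ww" for t ww
 have F1: "F t ww <= 1" for t ww unfolding F_def ext0_def by (auto split: option.splits intro: g1)
 have [measurable]: "(%(ww, t). F t ww) : bm (events X \<Otimes>\<^sub>M borel)" unfolding F_def by measurable
 define E where "E n s = xp (aa / rs n + 1) s * ix {0..} s" for n :: nat and s :: real
 define ph where "ph n ww = (LI (%s. E n s * F (s / rs n) ww))" for n ww
 have [measurable]: "E n : BM" for n unfolding E_def by measurable
 have int1: "(LI (%s. ?f s)) = 1"
  using nn_integral_exp[of 1] by simp
 have E_le: "E n s <= ?f s" for n s
 proof (cases "0 <= s")
  case True
  have e: "- (a + 1) * s = - (a * s) - s" for a :: real by (simp add: algebra_simps)
  have "- (aa / rs n + 1) * s = - (aa / rs n * s) - s" by (rule e)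
  moreover have "0 <= aa / rs n * s" using True aa by simp
  ultimately have "exp (- (aa / rs n + 1) * s) <= exp (- s)" unfolding exp_le_cancel_iff by linarith
  thus ?thesis using True unfolding E_def by (auto intro!: mulR ennreal_leI)
 qed (simp add: E_def)
 have eq: "en (rs n) * R (aa + rs n) g y = (PI y (%ww. ph n ww))" for n
 proof -
  have "en (rs n) * R (aa + rs n) g y =
   (PI y (%ww. ?b n F ww))"
   unfolding resolvent_def F_def by (rule nncmult[symmetric]) measurable
  also have "... = (PI y (%ww. ph n ww))"
  proof (rule nncong)
   fix ww assume "ww : space (P y)"
   hence [measurable]: "ww : Om" by (simp add: space_law)
   have "?b n F ww
    = en (rs n) * (en (1 / rs n) * (LI (%s. ?d n s F ww)))"
    by (subst nn_integral_real_affine[where c="1 / rs n" and t=0]) auto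
   also have "... = (LI (%s. ?d n s F ww))"
    unfolding mult.assoc[symmetric] by (subst ennreal_mult[symmetric]) auto
   also have "... = ph n ww"
    unfolding ph_def
   proof (rule nncong)
    fix s :: real
    have e: "(aa + N) * (s / N) = (aa / N + 1) * s" if "0 < N" for N
     using that by (simp add: distrib_right add_divide_distrib)
    have "(aa + rs n) * (s / rs n) = (aa / rs n + 1) * s" by (rule e) simp
    moreover have "ix {0..} (s / rs n) = (ix {0..} s :: ennreal)"
     by (auto split: splix simp: zero_le_divide_iff)
    ultimately show "?d n s F ww = E n s * F (s / rs n) ww"
     unfolding E_def mult_minus_left by (simp only: ac_simps)
   qed
   finally show "?b n F ww = ph n ww" .
  qed
  finally show ?thesis .
 qed
 have "(%n. PI y (%ww. ph n ww)) ----> (PI y (%ww. g y))"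
 proof (rule nn_integral_dominated_convergence[where w="%_. 1"])
  show "ph n : bm (P y)" for n unfolding ph_def by measurable
  show "AE ww in P y. ph n ww <= 1" for n
  proof (rule AE_I2)
   fix ww
   have "ph n ww <= (LI (%s. en (exp (- s)) * ix {0..} s * 1))"
    unfolding ph_def by (intro nnmono mult_mono F1 E_le) simp_all
   thus "ph n ww <= 1" using int1 by simp
  qed
  show "AE ww in P y. (%n. ph n ww) ----> g y"
   using pos_0[of "Some y"] AE_space
  proof eventually_elim
   case (elim ww)
   hence om [measurable]: "ww : Om" by (simp add: space_law)
   have ev: "((%s. xt g s ww) \<longlongrightarrow> g y) (at_right 0)"
   proof (rule topological_tendstoI)
    fix V assume V: "open V" "g y : V"
    obtain A where A: "open A" "y : A" "!!z. z : A ==> g z : V"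
     using continuous_at_open[THEN iffD1, OF cont, rule_format, of V] V by auto
    have "limitin cem_top (%s. pos X s ww) (Some y) (at_right 0)"
     using pos_rc[OF om, of 0] unfolding elim(1) by simp
    hence "\<forall>\<^sub>F s in at_right 0. pos X s ww : Some ` A"
     unfolding limitin_def using openin_cem_Some[OF A(1)] imageI[OF A(2), of Some] by blast
    thus "\<forall>\<^sub>F s in at_right 0. xt g s ww : V"
     by eventually_elim (auto simp: A(3))
   qed
   have "(%n. ph n ww) ----> (?h real)"
    unfolding ph_def
   proof (rule nn_integral_dominated_convergence[where w="%s. ?f s"])
    show "AE s in lborel. E n s * F (s / rs n) ww <= en (exp (- s)) * ix {0..} s" for n
     using mult_mono[OF E_le F1] by (intro AE_I2) fastforce
    show "(LI (%s. ?f s)) < iy" using int1 by simp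
    show "AE s in lborel. (%n. E n s * F (s / rs n) ww) ----> en (exp (- s)) * ix {0..} s * g y"
    proof (rule AE_I2)
     fix s :: real
     show "(%n. E n s * F (s / rs n) ww) ----> en (exp (- s)) * ix {0..} s * g y"
     proof (cases "0 <= s")
      case True
      have Fl: "(%n. F (s / rs n) ww) ----> g y"
      proof (cases "s = 0")
       case True
       hence "F (s / rs n) ww = g y" for n using elim(1) by (simp add: F_def)
       thus ?thesis by simp
      next
       case False
       hence s: "0 < s" using `0 <= s` by simp
       have "(%n. s / rs n) ----> 0" by real_asymp
       hence "filterlim (%n. en (s / rs n)) (at_right 0) sequentially"
        unfolding at_within_def filterlim_inf filterlim_principal using s
        by (auto intro!: always_eventually tendsto_ennrealI[of _ 0, simplified])
       from filterlim_compose[OF ev this] show ?thesis unfolding F_def .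
      qed
      have "(%n. - (aa / rs n + 1) * s) ----> - s" by real_asymp
      hence El: "(%n. E n s) ----> en (exp (- s)) * ix {0..} s"
       unfolding E_def using True by (simp only: indicator_simps atLeast_iff mult_1_right) (intro tendsto_ennrealI tendsto_exp)
      show ?thesis
      proof (rule tendsto_mult_ennreal[OF El Fl])
       show "\<not> (en (exp (- s)) * ix {0..} s = 0 & g y = iy \<or> en (exp (- s)) * ix {0..} s = iy & g y = 0)"
        using g1[of y] by (auto simp: ennreal_mult_eq_top_iff top_unique split: splix)
      qed
     next
      case False
      thus ?thesis by (simp add: E_def)
     qed
    qed
   qed measurable
   also have "(?h real) = g y"
    by (subst nn_integral_multc) (measurable, simp only: int1 mult_1_left)
   finally show ?case .
  qed
 qed (auto simp: PS.emeasure_space_1)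
 thus ?thesis by (simp add: eq PS.emeasure_space_1 del: of_nat_Suc)
qed

lemma resolvent_leave_lim:
 assumes U: "open U" and y: "y : U" and aa: "0 < aa"
 shows "(%n. en (rs n) * R (aa + rs n) (ix (- U)) y) ----> 0"
proof -
 have [measurable]: "U : sets borel" using U by simp
 have "isCont (ix (- U) :: 'a => ennreal) y"
  unfolding continuous_at_open using U y by (auto intro!: exI[of _ U])
 moreover have "ix (- U) z <= (1 :: ennreal)" for z by (auto split: splix)
 moreover have "ix (- U) y = (0 :: ennreal)" using y by simp
 ultimately show ?thesis using resolvent_cont_lim[of "ix (- U)" y aa] aa by (simp del: of_nat_Suc)
qed

text \<open>Up to a time of order \<open>1/n\<close> the path stays in the open set
  \<open>U\<close>, where it is killed at rate \<open>n\<close>. What remains is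
  \<open>c / (aa + n)\<close> plus the uniform bound \<open>c / aa\<close> times the chance of
  having left \<open>U\<close>.\<close>

lemma kill_lim_0:
 assumes aa: "0 < aa" and U: "open U" and [measurable]: "g : BM" and gc: "!!y. g y <= en c" "0 <= c" and y: "y : U"
 shows "(%n. kill aa U (rs n) g y) ----> 0"
proof -
 let ?a = "%n. en (c / (aa + rs n)) + en (c / aa) * (en (rs n) * R (aa + rs n) (ix (- U)) y)"
 have [measurable]: "U : sets borel" using U by simp
 have N: "0 < rs n" for n by simp
 note [measurable] = kill_measurable[OF aa N U assms(3) gc]
 have "kill aa U (rs n) g y <= ?a n" for n
 proof -
  have "kill aa U (rs n) g y <= R (aa + rs n) (%y. en c + en (c / aa) * en (rs n) * ix (- U) y) y"
   unfolding kill_fix[OF aa N U assms(3) gc, of n y]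
   by (rule kop_mono[OF kop_R]) (measurable, intro add_mono gc, use kill_bound[OF aa N U assms(3) gc] in "auto simp: mult.commute mulL simp del: of_nat_Suc split: splix")
  also have "... = R (aa + rs n) (%y. en c) y + en (c / aa) * en (rs n) * R (aa + rs n) (ix (- U)) y"
   by (subst kop_add[OF kop_R], measurable, subst kop_cmult[OF kop_R]) measurable
  also have "R (aa + rs n) (%y. en c) y <= en c * en (1 / (aa + rs n))"
   by (rule R_const_le) (use aa in simp)
  also have "... = en (c / (aa + rs n))" using aa gc by (simp add: ennreal_mult[symmetric])
  finally show ?thesis by (simp add: mult.assoc)
 qed
 note H = this
 have "(%n. ?a n) ----> en 0 + en (c / aa) * 0"
 proof (intro tendsto_intros ennreal_tendsto_cmult resolvent_leave_lim[OF U y aa])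
  show "(%n. c / (aa + rs n)) ----> 0" by real_asymp
 qed auto
 hence L: "(%n. ?a n) ----> 0" by simp
 show ?thesis
  by (rule tendsto_sandwich[OF _ _ tendsto_const L]) (use H in "simp_all only: eventually_True zero_le")
qed

end

section \<open>Hitting times of open sets and exit times\<close>

context hunt
begin

text \<open>The parameter \<open>ee\<close> excludes early times. The value 0 serves exit times;
  positive values serve the study of regular boundary points, where only visits after time
  \<open>ee\<close> may be counted.\<close>

definition Qs :: "real => ennreal set" where
 "Qs ee = {s. en ee < s & (\<exists>q::rat. s = en (real_of_rat q))}"

lemma countable_Qs: "countable (Qs ee)"
proof -
 have "Qs ee <= range (%q::rat. en (real_of_rat q))" unfolding Qs_def by auto
 thus ?thesis by (rule countable_subset) simp
qed

lemma Qs_between: "en ee <= s ==> s < b ==> \<exists>q\<in>Qs ee. s < q & q < b"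
 using ennreal_rat_dense[of s b] unfolding Qs_def by (auto intro: le_less_trans)

abbreviation "hitA ee \<equiv> hit (Qs ee)"

lemma hitA_ge: "en ee <= hitA ee U ww"
 unfolding hit_def by (rule Inf_greatest) (auto simp: Qs_def)

lemma rc_interval:
 assumes om: "ww : Om" and s: "s < iy" and V: "openin cem_top V" "pos X s ww : V"
 shows "\<exists>b>s. \<forall>r. s < r & r < b --> pos X r ww : V"
proof -
 have "\<forall>\<^sub>F r in at_right s. pos X r ww : V" using pos_rc[OF om s] V unfolding limitin_def by blast
 thus ?thesis using eventually_at_right[OF s, of "%r. pos X r ww : V"] by auto
qed

text \<open>By right continuity the path remains in the open set for a while after \<open>s\<close>,
  so arbitrarily close rational times detect the visit.\<close>

lemma hitA_le:
 assumes om: "ww : Om" and s: "en ee <= s" "s < iy" and U: "open U" "pos X s ww : Some ` U"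
 shows "hitA ee U ww <= s"
proof (rule ccontr)
 assume "\<not> hitA ee U ww <= s"
 hence lt: "s < hitA ee U ww" by simp
 obtain b where b: "s < b" "!!r. s < r ==> r < b ==> pos X r ww : Some ` U"
  using rc_interval[OF om s(2) openin_cem_Some[OF U(1)] U(2)] by auto
 obtain q where q: "q : Qs ee" "s < q" "q < min b (hitA ee U ww)"
  using Qs_between[OF s(1), of "min b (hitA ee U ww)"] b lt by auto
 hence "hitA ee U ww <= q" unfolding hit_def by (intro Inf_lower) (use b in auto)
 thus False using q by auto
qed

lemma hitA_closure:
 assumes om: "ww : Om" and T: "hitA ee U ww < iy" and V: "openin cem_top V" "pos X (hitA ee U ww) ww : V"
 shows "\<exists>u\<in>U. Some u : V"
proof -
 obtain b where b: "hitA ee U ww < b" "!!r. hitA ee U ww < r ==> r < b ==> pos X r ww : V"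
  using rc_interval[OF om T V] by auto
 obtain q where q: "q : Qs ee" "pos X q ww : Some ` U" "q < b"
  using b(1) unfolding hit_def Inf_less_iff by auto
 hence "hitA ee U ww <= q" unfolding hit_def by (intro Inf_lower) auto
 hence "pos X q ww : V" using b(2)[of q] q(3) V(2) by (cases "hitA ee U ww = q") auto
 thus ?thesis using q(2) by auto
qed

lemma stop_hitA: "open U ==> stop (hitA ee U)"
 by (rule stop_hit[OF countable_Qs]) simp

definition hitF :: "real => 'a set => nat => 'w => ennreal" where
 "hitF ee U i = hit (from_nat_into (Qs ee) ` {..i}) U"

lemma range_Qs: "range (from_nat_into (Qs ee)) = Qs ee"
proof -
 have "Qs ee ~= {}" using Qs_between[of ee "en ee" iy] by auto
 thus ?thesis using countable_Qs by (rule range_from_nat_into)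
qed

lemma stop_hitF: "open U ==> stop (hitF ee U i)"
 unfolding hitF_def by (rule stop_hit) auto

lemma hitF_ge: "hitA ee U ww <= hitF ee U i ww"
 unfolding hitF_def hit_def by (rule Inf_superset_mono) (use range_Qs in auto)

lemma hitF_pos: "hitF ee U i ww < iy ==> pos X (hitF ee U i ww) ww : Some ` U"
proof -
 assume lt: "hitF ee U i ww < iy"
 define A where "A = {t : from_nat_into (Qs ee) ` {..i}. pos X t ww : Some ` U}"
 have "A ~= {}" using lt unfolding hitF_def hit_def A_def[symmetric] by auto
 moreover have "finite A" unfolding A_def by simp
 ultimately have "Inf A : A" by (metis Min_in cInf_eq_Min)
 thus ?thesis unfolding hitF_def hit_def A_def[symmetric] by (simp add: A_def)
qed

lemma hitF_lim: "(%i. hitF ee U i ww) ----> hitA ee U ww"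
proof -
 have dec: "decseq (%i. hitF ee U i ww)"
  unfolding decseq_def hitF_def hit_def by (intro allI impI Inf_superset_mono) auto
 have "(INF i. hitF ee U i ww) = hitA ee U ww"
 proof (rule antisym)
  show "hitA ee U ww <= (INF i. hitF ee U i ww)" by (rule INF_greatest) (rule hitF_ge)
  show "(INF i. hitF ee U i ww) <= hitA ee U ww"
   unfolding hit_def[of "Qs ee"]
  proof (rule Inf_greatest)
   fix t assume t: "t : {t : Qs ee. pos X t ww : Some ` U}"
   then obtain i where "t = from_nat_into (Qs ee) i" using range_Qs[of ee] by auto
   hence "hitF ee U i ww <= t" using t unfolding hitF_def hit_def by (intro Inf_lower) auto
   thus "(INF i. hitF ee U i ww) <= t" by (rule INF_lower2[OF UNIV_I])
  qed
 qed
 thus ?thesis using LIMSEQ_INF[OF dec] by simp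
qed

lemma occ_tendsto:
 assumes aa: "0 < aa" and [measurable]: "g : BM" and gc: "!!y. g y <= en c"
  and [measurable]: "!!i::nat. T i : bm (events X)" "S : bm (events X)"
  and lim: "!!ww. ww : Om ==> (%i. T i ww) ----> S ww"
 shows "(%i. occ aa (T i) g x) ----> occ aa S g x"
proof -
 let ?a = "%i ww F. SI lborel (bf (T i ww)) (%t. F t ww)"
 let ?b = "%ww F. SI lborel (bf (S ww)) (%t. F t ww)"
 let ?d = "(LI (%t. en c * xp aa t * ix {0..} t))"
 interpret PS: prob_space "P x" by (rule prob_law)
 define F where "F t ww = xp aa t * xt g (en t) ww" for t ww
 have [measurable]: "(%(ww, t). F t ww) : bm (events X \<Otimes>\<^sub>M borel)" unfolding F_def by measurable
 have Fc: "F t ww <= en c * xp aa t" for t ww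
  using gc unfolding F_def ext0_def by (auto simp: mult.commute intro!: mulR split: option.splits)
 have tot: "?d = en c * en (1 / aa)"
  unfolding mult.assoc by (subst nncmult) (measurable, simp only: nn_integral_exp[OF aa])
 have fin: "en c * en (1 / aa) < iy" by (simp add: ennreal_mult_less_top)
 show ?thesis
  unfolding occ_def F_def[symmetric]
 proof (rule nn_integral_dominated_convergence[where w="%_. en c * en (1 / aa)"])
  show "(%ww. ?a i ww F) : bm (P x)" for i by measurable
  show "(%ww. ?b ww F) : bm (P x)" by measurable
  show "AE ww in P x. (?a i ww F) <= en c * en (1 / aa)" for i
   unfolding tot[symmetric] by (intro AE_I2 nnmono) (use Fc in "auto split: splix")
  show "(PI x (%ww. en c * en (1 / aa))) < iy" using fin by (simp add: PS.emeasure_space_1)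
  show "AE ww in P x. (%i. ?a i ww F) ----> (?b ww F)"
  proof (rule AE_I2)
   fix ww assume "ww : space (P x)"
   hence om [measurable]: "ww : Om" by (simp add: space_law)
   show "(%i. ?a i ww F) ----> (?b ww F)"
   proof (rule nn_integral_dominated_convergence[where w="%t. en c * xp aa t * ix {0..} t"])
    show "AE t in lborel. F t ww * ix (bf (T i ww)) t <= en c * xp aa t * ix {0..} t" for i
     by (intro AE_I2) (use Fc in "auto split: splix")
    show "?d < iy" unfolding tot by (rule fin)
    \<comment> \<open>The indicators can fail to converge at the limiting time itself only, a
      Lebesgue null set.\<close>
    have "AE t in lborel. t ~= enn2real (S ww)" by (rule AE_lborel_singleton)
    thus "AE t in lborel. (%i. F t ww * ix (bf (T i ww)) t) ----> F t ww * ix (bf (S ww)) t"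
    proof eventually_elim
     case (elim t)
     have "\<forall>\<^sub>F i in sequentially. ix (bf (T i ww)) t = (ix (bf (S ww)) t :: ennreal)"
     proof (cases "0 <= t & en t < S ww")
      case True
      hence "\<forall>\<^sub>F i in sequentially. en t < T i ww" using order_tendstoD(1)[OF lim[OF om]] by blast
      thus ?thesis by eventually_elim (use True in auto)
     next
      case False
      show ?thesis
      proof (cases "0 <= t")
       case True
       hence "S ww < en t" using False elim by (cases "S ww") (auto simp: not_less ennreal_less_iff le_less)
       hence "\<forall>\<^sub>F i in sequentially. T i ww < en t" using order_tendstoD(2)[OF lim[OF om]] by blast
       thus ?thesis by eventually_elim (use False in "auto split: splix")
      qed simp
     qed
     hence "\<forall>\<^sub>F i in sequentially. F t ww * ix (bf (T i ww)) t = F t ww * ix (bf (S ww)) t"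
      by eventually_elim simp
     thus ?case by (rule tendsto_eventually)
    qed
   qed measurable
  qed
 qed (rule borel_measurable_const)
qed

lemma occ_const_0: "occ aa (%_. 0) g x = 0"
 unfolding occ_def by simp

lemma fin_const_0: "g : BM ==> fin aa (%_. 0) g x = g x"
proof -
 assume [measurable]: "g : BM"
 interpret PS: prob_space "P x" by (rule prob_law)
 have "fin aa (%_. 0) g x = (PI x (%ww. g x))"
  unfolding fin_def by (rule nn_integral_cong_AE) (use pos_0[of "Some x"] in "eventually_elim, simp")
 thus ?thesis by (simp add: PS.emeasure_space_1)
qed

lemma fin_tendsto_0:
 assumes "0 <= aa" and [measurable]: "!!n::nat. h n : BM" and hc: "!!n y. h n y <= en c"
  and [measurable]: "T : bm (events X)"
  and U: "!!ww. ww : Om ==> T ww < iy ==> pos X (T ww) ww : Some ` U" and lim: "!!y. y : U ==> (%n. h n y) ----> 0"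
 shows "(%n. fin aa T (h n) x) ----> 0"
proof -
 let ?a = "%ww n. xp aa (enn2real (T ww)) * xt (h n) (T ww) ww"
 interpret PS: prob_space "P x" by (rule prob_law)
 have "(%n. fin aa T (h n) x) ----> (PI x (%ww. 0))"
  unfolding fin_def
 proof (rule nn_integral_dominated_convergence[where w="%_. en c"])
  show "AE ww in P x. xp aa (enn2real (T ww)) * xt (h n) (T ww) ww <= en c" for n
  proof (rule AE_I2)
   fix ww
   have "?a ww n <= 1 * en c"
    using assms(1) hc by (intro mult_mono) (auto simp: ext0_def split: option.splits)
   thus "?a ww n <= en c" by simp
  qed
  show "AE ww in P x. (%n. ?a ww n) ----> 0"
  proof (rule AE_I2)
   fix ww assume "ww : space (P x)"
   hence om: "ww : Om" by (simp add: space_law)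
   have "(%n. xt (h n) (T ww) ww) ----> 0"
   proof (cases "T ww < iy")
    case True
    then obtain y where y: "y : U" "pos X (T ww) ww = Some y" using U[OF om] by auto
    thus ?thesis using lim[OF y(1)] by simp
   next
    case False
    hence "T ww = iy" by (cases "T ww") auto
    hence "pos X (T ww) ww = None" using pos_infty[OF om] by simp
    thus ?thesis by simp
   qed
   hence "(%n. ?a ww n) ----> xp aa (enn2real (T ww)) * 0"
    by (intro ennreal_tendsto_cmult) auto
   thus "(%n. ?a ww n) ----> 0" by simp
  qed
 qed (auto simp: PS.emeasure_space_1)
 thus ?thesis by simp
qed

lemma occ_mono_before:
 assumes "!!ww t. ww : Om ==> 0 <= t ==> en t < S ww ==> \<not> en t < T ww ==> xt g (en t) ww = 0"
 shows "occ aa S g x <= occ aa T g x"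
 unfolding occ_def
proof (intro nnmono)
 fix ww t assume "ww : space (P x)"
 thus "xp aa t * xt g (en t) ww * ix (bf (S ww)) t
  <= xp aa t * xt g (en t) ww * ix (bf (T ww)) t"
  using assms[of ww t] by (auto simp: space_law split: splix)
qed

text \<open>Killing on an open set at a rate tending to infinity amounts to killing at its hitting time. The upper
  bound uses the hitting times along finite time sets, at which the process is inside the open set.\<close>

lemma kill_tendsto_from:
 assumes aa: "0 < aa" and U: "open U" and g [measurable]: "g : BM" and gc: "!!y. g y <= en c" "0 <= c"
 shows "(%n. occ aa (%_. en ee) g x + fin aa (%_. en ee) (kill aa U (rs n) g) x) ----> occ aa (hitA ee U) g x"
proof -
 let ?b = "%i n. occ aa (hitF ee U i) g x + fin aa (hitF ee U i) (kill aa U (rs n) g) x"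
 have N: "0 < rs n" for n by simp
 have [measurable]: "U : sets borel" using U by simp
 note [measurable] = kill_measurable[OF aa N U g gc]
 define a where "a n y = en (rs n) * ix U y * kill aa U (rs n) g y" for n y
 have [measurable]: "a n : BM" for n unfolding a_def by measurable
 have SM: "kill aa U (rs n) g x + occ aa T (a n) x = occ aa T g x + fin aa T (kill aa U (rs n) g) x" if "stop T" for T n
 proof (rule SM_general[OF that])
  show "kill aa U (rs n) g y + R aa (a n) y = R aa g y" for y
   unfolding a_def by (rule kill_eq[OF aa N U g gc])
  show "R aa (a n) y <= en (rs n * (c / aa) * (1 / aa))" for y
   unfolding a_def by (rule kill_rate_bound[OF aa N U g gc]) simp
 qed (use aa in "simp_all del: of_nat_Suc")
 show ?thesis
 proof (rule squeeze_two_index)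
  fix n i
  let ?G = "occ aa (%_. en ee) g x + fin aa (%_. en ee) (kill aa U (rs n) g) x"
  have G: "?G = kill aa U (rs n) g x + occ aa (%_. en ee) (a n) x"
   by (rule SM[OF stopping_time_const, symmetric])
  have "occ aa (hitA ee U) g x <= occ aa (hitA ee U) g x + fin aa (hitA ee U) (kill aa U (rs n) g) x" by simp
  also have "... = kill aa U (rs n) g x + occ aa (hitA ee U) (a n) x" by (rule SM[OF stop_hitA[OF U], symmetric])
  also have "... <= ?G"
   unfolding G
  proof (intro add_left_mono occ_mono_before)
   \<comment> \<open>Between time \<open>ee\<close> and the hitting time the path is off
     \<open>U\<close>, where the killing term \<open>a n\<close> vanishes.\<close>
   fix ww t assume *: "ww : Om" "0 <= t" "en t < hitA ee U ww" "\<not> en t < en ee"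
   show "xt (a n) (en t) ww = 0"
   proof (cases "px t ww")
    case (Some y)
    have "en ee <= en t" using *(4) by (simp only: not_less)
    hence "y ~: U" using hitA_le[OF *(1) _ _ U, of ee "en t"] *(3) Some by (auto simp: not_less[symmetric])
    thus ?thesis using Some by (simp add: a_def)
   qed simp
  qed
  finally show "occ aa (hitA ee U) g x <= ?G" .
  have "?G <= kill aa U (rs n) g x + occ aa (hitF ee U i) (a n) x"
   unfolding G by (intro add_left_mono occ_mono_T order_trans[OF hitA_ge hitF_ge])
  also have "... = ?b i n" by (rule SM[OF stop_hitF[OF U]])
  finally show "?G <= ?b i n" .
 next
  fix i
  show "(%n. fin aa (hitF ee U i) (kill aa U (rs n) g) x) ----> 0"
  proof (rule fin_tendsto_0[where U=U and c="c / aa"])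
   show "kill aa U (rs n) g y <= en (c / aa)" for n y by (rule kill_bound[OF aa N U g gc])
   show "(%n. kill aa U (rs n) g y) ----> 0" if "y : U" for y by (rule kill_lim_0[OF aa U g gc that])
   show "hitF ee U i : bm (events X)" by (rule stopm[OF stop_hitF[OF U]])
  qed (use aa hitF_pos in "auto simp del: of_nat_Suc")
 next
  show "(%i. occ aa (hitF ee U i) g x) ----> occ aa (hitA ee U) g x"
   by (rule occ_tendsto[OF aa g gc(1) stopm[OF stop_hitF[OF U]] stopm[OF stop_hitA[OF U]] hitF_lim])
 qed
qed

lemma kill_tendsto:
 assumes aa: "0 < aa" and U: "open U" and g [measurable]: "g : BM" and gc: "!!y. g y <= en c" "0 <= c"
 shows "(%n. kill aa U (rs n) g x) ----> occ aa (hitA 0 U) g x"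
proof -
 have N: "0 < rs n" for n by simp
 show ?thesis
  using kill_tendsto_from[OF assms, of 0 x] by (simp only: ennreal_0 occ_const_0 add_0 fin_const_0[OF kill_measurable[OF aa N U g gc]])
qed

lemma occ_hitA_measurable:
 assumes aa: "0 < aa" and U: "open U" and g [measurable]: "g : BM" and gc: "!!y. g y <= en c" "0 <= c"
 shows "occ aa (hitA 0 U) g : BM"
proof (rule borel_measurable_LIMSEQ_order)
 show "kill aa U (rs n) g : BM" for n by (rule kill_measurable[OF aa _ U g gc]) simp
 show "(%n. kill aa U (rs n) g x) ----> occ aa (hitA 0 U) g x" for x by (rule kill_tendsto[OF assms])
qed

text \<open>At each finite killing rate, Dynkin's formula up to the smaller of \<open>S\<close> and
  the hitting time has no killing term, since the path is off \<open>U\<close> before that time. The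
  identity then survives the limit of infinite rate.\<close>

lemma occ_hitA_SM:
 assumes aa: "0 < aa" and U: "open U" and g [measurable]: "g : BM" and gc: "!!y. g y <= en c" "0 <= c" and S: "stop S"
 shows "occ aa (hitA 0 U) g x = occ aa (%ww. min (S ww) (hitA 0 U ww)) g x + fin aa (%ww. min (S ww) (hitA 0 U ww)) (occ aa (hitA 0 U) g) x"
proof -
 let ?T = "%ww. min (S ww) (hitA 0 U ww)"
 have N: "0 < rs n" for n by simp
 have [measurable]: "U : sets borel" using U by simp
 note [measurable] = kill_measurable[OF aa N U g gc] occ_hitA_measurable[OF aa U g gc]
 have T: "stop ?T" by (rule stopping_time_min[OF S stop_hitA[OF U]])
 define a where "a n y = en (rs n) * ix U y * kill aa U (rs n) g y" for n y
 have [measurable]: "a n : BM" for n unfolding a_def by measurable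
 have SM: "kill aa U (rs n) g x + occ aa ?T (a n) x = occ aa ?T g x + fin aa ?T (kill aa U (rs n) g) x" for n
 proof (rule SM_general[OF T])
  show "kill aa U (rs n) g y + R aa (a n) y = R aa g y" for y
   unfolding a_def by (rule kill_eq[OF aa N U g gc])
  show "R aa (a n) y <= en (rs n * (c / aa) * (1 / aa))" for y
   unfolding a_def by (rule kill_rate_bound[OF aa N U g gc]) simp
 qed (use aa in "simp_all del: of_nat_Suc")
 have "occ aa ?T (a n) x <= occ aa (%_. 0) (a n) x" for n
 proof (rule occ_mono_before)
  fix ww t assume *: "ww : Om" "0 <= t" "en t < min (S ww) (hitA 0 U ww)"
  show "xt (a n) (en t) ww = 0"
  proof (cases "px t ww")
   case (Some y)
   have "y ~: U" using hitA_le[OF *(1) _ _ U, of 0 "en t"] * Some by auto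
   thus ?thesis using Some by (simp add: a_def)
  qed simp
 qed
 hence "occ aa ?T (a n) x = 0" for n by (simp add: occ_const_0)
 hence eq: "kill aa U (rs n) g x = occ aa ?T g x + fin aa ?T (kill aa U (rs n) g) x" for n using SM[of n] by simp
 have "(%n. fin aa ?T (kill aa U (rs n) g) x) ----> fin aa ?T (occ aa (hitA 0 U) g) x"
 proof (rule mfun_lim[OF mfun_fin'[OF stopm[OF T]], where k="%_. en (c / aa)"])
  show "kill aa U (rs n) g y <= en (c / aa)" for n y by (rule kill_bound[OF aa N U g gc])
  show "fin aa ?T (%_. en (c / aa)) x < iy" using fin_bound[of aa "%_. en (c / aa)" "en (c / aa)" ?T x] aa by (simp add: le_less_trans)
  show "(%n. kill aa U (rs n) g y) ----> occ aa (hitA 0 U) g y" for y by (rule kill_tendsto[OF aa U g gc])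
 qed measurable
 hence "(%n. kill aa U (rs n) g x) ----> occ aa ?T g x + fin aa ?T (occ aa (hitA 0 U) g) x"
  unfolding eq by (intro tendsto_add tendsto_const)
 thus ?thesis using kill_tendsto[OF aa U g gc, of x] LIMSEQ_unique by blast
qed

text \<open>With \<open>S = iy\<close> the preceding identity says that a finite potential equals
  itself plus its expected value at the hitting time, which is therefore 0.\<close>

lemma fin_hitA_zero:
 assumes aa: "0 < aa" and U: "open U" and g [measurable]: "g : BM" and gc: "!!y. g y <= en c" "0 <= c"
 shows "fin aa (hitA 0 U) (occ aa (hitA 0 U) g) x = 0"
proof -
 have "occ aa (hitA 0 U) g x + fin aa (hitA 0 U) (occ aa (hitA 0 U) g) x = occ aa (hitA 0 U) g x + 0"
  using occ_hitA_SM[OF assms stopping_time_const[of _ iy], of x] by (simp add: min_absorb2)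
 moreover have "occ aa (hitA 0 U) g x ~= iy"
 proof -
  have "occ aa (hitA 0 U) g x <= en c * en (1 / aa)" by (rule order_trans[OF occ_le_R R_bound[OF aa g gc(1)]])
  also have "... < iy" by (simp add: ennreal_mult_less_top)
  finally show ?thesis by simp
 qed
 ultimately show ?thesis by (rule ennreal_cancel)
qed

definition Uk :: "'a set => nat => 'a set" where
 "Uk D k = (\<Union>z\<in>-D. ball z (1 / real (Suc k)))"

definition Tk :: "'a set => nat => 'w => ennreal" where
 "Tk D k = hitA 0 (Uk D k)"

text \<open>The supremum of the hitting times of shrinking neighbourhoods of the complement. It is a
  genuine stopping time, and from points of an open \<open>D\<close> it agrees almost surely with
  the exit time.\<close>

definition TD :: "'a set => 'w => ennreal" where
 "TD D ww = (SUP k. Tk D k ww)"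

lemma open_Uk: "open (Uk D k)" unfolding Uk_def by auto

lemma Uk_mono: "i <= k ==> Uk D k <= Uk D i"
proof -
 assume "i <= k"
 hence "1 / real (Suc k) <= 1 / real (Suc i)" by (intro divide_left_mono) auto
 thus ?thesis unfolding Uk_def by fastforce
qed

lemma Compl_subset_Uk: "- D <= Uk D k" unfolding Uk_def by force

lemma stop_Tk: "stop (Tk D k)" unfolding Tk_def by (rule stop_hitA[OF open_Uk])

lemma stop_TD: "stop (TD D)" unfolding TD_def by (rule stop_SUP[OF stop_Tk])

lemma hit_anti: "U <= V ==> hit Q V ww <= hit Q U ww"
 unfolding hit_def by (rule Inf_superset_mono) auto

lemma Tk_incseq: "incseq (%k. Tk D k ww)"
 unfolding Tk_def by (rule incseq_SucI) (rule hit_anti[OF Uk_mono], simp)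

text \<open>By quasi-left continuity the positions at the increasing hitting times converge to the
  position at their supremum. These positions lie in the closures of \<open>Uk D k\<close>, so the
  limit cannot lie in the open set \<open>D\<close>.\<close>

lemma hitA_sup_limit:
 "AE ww in P x. (SUP k. hitA ee (Uk D k) ww) < iy --> pos X (SUP k. hitA ee (Uk D k) ww) ww : Some ` (- D)" if D: "open D"
proof -
 let ?T = "%k. hitA ee (Uk D k)"
 have "AE ww in P x. (SUP n. ?T n ww) < iy --> limitin cem_top (%n. pos X (?T n ww) ww) (pos X (SUP n. ?T n ww) ww) sequentially"
  by (rule qlc[unfolded quasi_left_continuous_def, rule_format])
   (simp add: stop_hitA open_Uk incseq_SucI hit_anti Uk_mono)
 thus ?thesis using AE_alive AE_space
 proof eventually_elim
  case (elim ww)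
  show ?case
  proof
   assume fin: "(SUP k. hitA ee (Uk D k) ww) < iy"
   have om: "ww : Om" using elim(3) by (simp add: space_law)
   obtain y where y: "pos X (SUP k. hitA ee (Uk D k) ww) ww = Some y" using elim(2) fin by auto
   have lim: "limitin cem_top (%n. pos X (?T n ww) ww) (Some y) sequentially" using elim(1) fin y by auto
   have "y \<in> - D"
   proof (rule ccontr)
    assume "y ~: - D"
    then obtain e where e: "0 < e" "ball y e <= D" using D open_contains_ball by blast
    have op: "openin cem_top (Some ` ball y (e / 2))" by simp
    have "\<forall>\<^sub>F n in sequentially. pos X (?T n ww) ww : Some ` ball y (e / 2)"
     using lim op e unfolding limitin_def by auto
    moreover have "\<forall>\<^sub>F n in sequentially. 1 / rs n < e / 2"
     using order_tendstoD(2)[OF LIMSEQ_Suc[OF lim_1_over_n], of "e / 2"] e by simp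
    ultimately have "\<forall>\<^sub>F n in sequentially. False"
    proof eventually_elim
     case (elim n)
     have "?T n ww <= (SUP k. hitA ee (Uk D k) ww)" by (rule SUP_upper) simp
     hence "?T n ww < iy" using fin by (rule le_less_trans)
     then obtain u where u: "u : Uk D n" "Some u : Some ` ball y (e / 2)" using hitA_closure[OF om _ op, of ee] elim by blast
     then obtain z where z: "z ~: D" "dist z u < 1 / rs n" unfolding Uk_def by auto
     have "dist y z < e" using dist_triangle_half_r[of u y e z] u z elim(2) by (auto simp: dist_commute)
     thus False using e z by auto
    qed
    thus False by simp
   qed
   thus "pos X (SUP k. hitA ee (Uk D k) ww) ww : Some ` (- D)" using y by auto
  qed
 qed
qed

lemma TD_le:
 assumes "ww : Om" "t < iy" "pos X t ww : Some ` (- D)" shows "TD D ww <= t"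
 unfolding TD_def Tk_def
proof (rule SUP_least)
 fix k
 show "hitA 0 (Uk D k) ww <= t"
  by (rule hitA_le[OF assms(1) _ assms(2) open_Uk]) (use assms(3) Compl_subset_Uk in auto)
qed

text \<open>Positivity comes from right continuity at time 0 in the interior of \<open>D\<close>. At
  time \<open>TD\<close> the path is off \<open>D\<close> by \<open>hitA_sup_limit\<close>, so the
  exit time is not later; conversely every visit to the complement is preceded by visits to its
  neighbourhoods.\<close>

lemma exit_eq:
 assumes D: "open D" and x: "x : D"
 shows "AE ww in P x. exit_time X D ww = TD D ww & 0 < TD D ww & (TD D ww < iy --> pos X (TD D ww) ww : Some ` (- D))"
 using hitA_sup_limit[OF D, of 0 x] AE_alive pos_0[of "Some x"] AE_space
proof eventually_elim
 let ?a = "\<lambda>ww. Inf {t. 0 < t & pos X t ww \<in> - (Some ` D)}"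
 case (elim ww)
 have om: "ww : Om" using elim(4) by (simp add: space_law)
 have XT: "TD D ww < iy --> pos X (TD D ww) ww : Some ` (- D)" using elim(1) unfolding TD_def Tk_def by simp
 have pos: "0 < TD D ww"
 proof -
  obtain e where e: "0 < e" "ball x e <= D" using D x open_contains_ball by blast
  obtain b where b: "0 < b" "!!r. 0 < r ==> r < b ==> pos X r ww : Some ` ball x (e / 2)"
   using rc_interval[OF om _ openin_cem_Some[of "ball x (e / 2)"], of 0] elim(3) e by auto
  obtain k where k: "1 / real (Suc k) < e / 2" using nat_approx_posE[of "e / 2"] e by auto
  have "b <= Tk D k ww"
   unfolding Tk_def hit_def
  proof (rule Inf_greatest, rule ccontr)
   fix t assume t: "t : {t : Qs 0. pos X t ww : Some ` Uk D k}" and "\<not> b <= t"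
   hence "pos X t ww : Some ` ball x (e / 2)" using b(2)[of t] by (auto simp: Qs_def)
   then obtain u where u: "u : Uk D k" "dist x u < e / 2" using t by auto
   then obtain z where z: "z ~: D" "dist z u < 1 / real (Suc k)" unfolding Uk_def by auto
   have "dist x z < e" using dist_triangle_half_r[of u x e z] u z k by (auto simp: dist_commute)
   thus False using e z by auto
  qed
  also have "... <= TD D ww" unfolding TD_def by (rule SUP_upper) simp
  finally show ?thesis using b(1) by (rule order.strict_trans2[rotated])
 qed
 have "exit_time X D ww = TD D ww"
  unfolding exit_time_def hitting_time_def
 proof (rule antisym)
  show "TD D ww <= ?a ww"
  proof (rule Inf_greatest)
   fix t assume t: "t : {t. 0 < t & pos X t ww \<in> - (Some ` D)}"
   show "TD D ww <= t"
   proof (cases "t < iy")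
    case True
    then obtain z where "pos X t ww = Some z" using elim(2) by auto
    thus ?thesis using TD_le[OF om True, of D] t by auto
   next
    case False hence "t = top" by (simp add: less_top[symmetric])
    thus ?thesis by simp
   qed
  qed
  show "?a ww <= TD D ww"
  proof (cases "TD D ww < iy")
   case True
   thus ?thesis using XT pos by (intro Inf_lower) auto
  next
   case False hence "TD D ww = top" by (simp add: less_top[symmetric])
   thus ?thesis by simp
  qed
 qed
 thus ?case using pos XT by simp
qed

end

section \<open>Potential and exit operators of an open set\<close>

lemma SUP_mult_incseq:
 fixes a b :: "nat => ennreal"
 assumes a: "incseq a" and b: "incseq b"
 shows "(SUP n. a n * b n) = (SUP n. a n) * (SUP n. b n)"
proof (rule antisym)
 show "(SUP n. a n * b n) <= (SUP n. a n) * (SUP n. b n)"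
  by (rule SUP_least) (intro mult_mono SUP_upper; simp)
 have "(SUP n. a n) * (SUP n. b n) = (SUP i. SUP j. a i * b j)"
  by (subst SUP_mult_right_ennreal) (simp only: SUP_mult_left_ennreal)
 also have "... <= (SUP n. a n * b n)"
 proof (intro SUP_least)
  fix i j
  have "a i * b j <= a (max i j) * b (max i j)" using a b by (intro mult_mono) (auto simp: incseq_def)
  thus "a i * b j <= (SUP n. a n * b n)" by (rule SUP_upper2[OF UNIV_I])
 qed
 finally show "(SUP n. a n) * (SUP n. b n) <= (SUP n. a n * b n)" .
qed

lemma incseq_mult: "incseq a ==> incseq b ==> incseq (%n. a n * b n)" for a b :: "nat => ennreal"
 unfolding incseq_def by (auto intro: mult_mono)

lemma exp_approx:
 assumes "0 <= t"
 shows incseq_exp_approx: "incseq (%n. xp (aa + 1 / rs n) t)"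
  and SUP_exp_approx: "(SUP n. xp (aa + 1 / rs n) t) = xp aa t"
proof -
 show inc: "incseq (%n. xp (aa + 1 / rs n) t)"
 proof (rule incseq_SucI)
  fix n
  have "1 / real (Suc (Suc n)) <= 1 / rs n" by (intro divide_left_mono) auto
  hence "(aa + 1 / real (Suc (Suc n))) * t <= (aa + 1 / rs n) * t" using assms by (intro mulR) auto
  thus "xp (aa + 1 / rs n) t <= xp (aa + 1 / real (Suc (Suc n))) t"
   by (intro ennreal_leI) (simp only: mult_minus_left exp_le_cancel_iff neg_le_iff_le)
 qed
 have "(%n. exp (- (aa + 1 / rs n) * t)) ----> exp (- (aa + 0) * t)"
  by (intro tendsto_intros LIMSEQ_Suc[OF lim_1_over_n])
 hence "(%n. xp (aa + 1 / rs n) t) ----> xp aa t"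
  by (intro tendsto_ennrealI) simp
 thus "(SUP n. xp (aa + 1 / rs n) t) = xp aa t"
  using LIMSEQ_SUP[OF inc] LIMSEQ_unique by blast
qed

lemma SUP_min_of_nat: "(SUP n. min x (en (real n))) = (x :: ennreal)"
proof (rule antisym)
 show "x <= (SUP n. min x (en (real n)))"
 proof (cases x)
  case (real r)
  obtain n :: nat where "r <= real n" using real_arch_simple by blast
  hence "min x (en (real n)) = x" using real by (simp add: min_def ennreal_leI)
  thus ?thesis by (metis SUP_upper UNIV_I)
 next
  case top
  thus ?thesis by (simp add: ennreal_SUP_of_nat_eq_top ennreal_of_nat_eq_real_of_nat[symmetric])
 qed
qed (auto intro: SUP_least)

lemma incseq_min_of_nat: "incseq (%n. min x (en (real n)))" for x :: ennreal
 by (auto simp: incseq_def min_def intro: order_trans[OF _ ennreal_leI])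

context hunt
begin

text \<open>Discount rates decreasing to \<open>aa\<close> and functions increasing to
  \<open>g\<close> can be taken together. This carries identities obtained for bounded functions at
  positive rates over to arbitrary functions and to rate 0.\<close>

lemma occ_SUP_params:
 assumes [measurable]: "T : bm (events X)" "!!n. h n : BM" and inc: "incseq h" and h: "!!y. (SUP n. h n y) = g y"
 shows "occ aa T g x = (SUP n. occ (aa + 1 / rs n) T (h n) x)"
proof -
 let ?a = "%n t ww. xp (aa + 1 / rs n) t * xt (h n) (en t) ww * ix (bf (T ww)) t"
 let ?b = "%t ww. (SUP n. xp (aa + 1 / rs n) t * xt (h n) (en t) ww * ix (bf (T ww)) t)"
 have inch: "incseq (%n. ext0 (h n) z)" for z
  using inc unfolding incle by (cases z) auto
 have SUPh: "(SUP n. ext0 (h n) z) = ext0 g z" for z by (cases z) (auto simp: h)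
 have "occ aa T g x = (PI x (%ww. (LI (%t. ?b t ww))))"
  unfolding occ_def
 proof (intro nncong)
  fix ww t
  show "xp aa t * xt g (en t) ww * ix (bf (T ww)) t =
    ?b t ww"
  proof (cases "0 <= t & en t < T ww")
   case True
   thus ?thesis
    using SUP_mult_incseq[OF incseq_exp_approx inch, of t aa "px t ww"] SUP_exp_approx[of t aa] SUPh by simp
  qed simp
 qed
 also have "... = (PI x (%ww. (SUP n. LI (%t. ?a n t ww))))"
 proof (rule nncong)
  fix ww assume "ww : space (P x)"
  hence [measurable]: "ww : Om" by (simp add: space_law)
  show "(LI (%t. ?b t ww))
   = (SUP n. LI (%t. ?a n t ww))"
  proof (rule mctSUP)
   show "incseq (%n t. ?a n t ww)"
    using incseq_mult[OF incseq_exp_approx inch] unfolding incle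
    by (auto split: splix simp del: of_nat_Suc)
  qed measurable
 qed
 also have "... = (SUP n. occ (aa + 1 / rs n) T (h n) x)"
  unfolding occ_def
 proof (rule mctSUP)
  show "incseq (%n ww. LI (%t. ?a n t ww))"
   using incseq_mult[OF incseq_exp_approx inch] unfolding incle
   by (intro allI impI nnmono) (auto split: splix simp del: of_nat_Suc)
 qed measurable
 finally show ?thesis .
qed

lemma fin_SUP_params:
 assumes [measurable]: "T : bm (events X)" "W : bm (events X)" "!!n. h n : BM" and inc: "incseq h" and h: "!!y. (SUP n. h n y) = g y"
 shows "(PI x (%ww. xp aa (enn2real (T ww)) * W ww * xt g (T ww) ww))
  = (SUP n. PI x (%ww. xp (aa + 1 / rs n) (enn2real (T ww)) * W ww * xt (h n) (T ww) ww))"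
proof -
 let ?a = "%ww. (SUP n. xp (aa + 1 / rs n) (enn2real (T ww)) * W ww * xt (h n) (T ww) ww)"
 let ?b = "%n ww. xp (aa + 1 / rs n) (enn2real (T ww)) * W ww * xt (h n) (T ww) ww"
 let ?c = "%ww. xp aa (enn2real (T ww)) * W ww * xt g (T ww) ww"
 have inch: "incseq (%n. ext0 (h n) z)" for z
  using inc unfolding incle by (cases z) auto
 have SUPh: "(SUP n. ext0 (h n) z) = ext0 g z" for z by (cases z) (auto simp: h)
 have incW: "incseq (%n. xp (aa + 1 / rs n) (enn2real (T ww)) * W ww)" for ww
  by (rule incseq_mult[OF incseq_exp_approx]) (auto simp: incseq_def)
 have "(PI x (%ww. ?c ww))
   = (PI x (%ww. ?a ww))"
 proof (rule nncong)
  fix ww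
  show "?c ww
   = ?a ww"
   unfolding SUP_mult_incseq[OF incW inch] SUPh
   by (subst SUP_mult_right_ennreal[symmetric]) (simp only: SUP_exp_approx[OF enn2real_nonneg])
 qed
 also have "... = (SUP n. PI x (%ww. ?b n ww))"
 proof (rule mctSUP)
  show "incseq (%n ww. ?b n ww)"
   using incseq_mult[OF incW inch] unfolding incle by auto
 qed measurable
 finally show ?thesis .
qed

lemma occ_SUP_T:
 assumes [measurable]: "!!k. T k : bm (events X)" "g : BM" and inc: "!!ww. incseq (%k. T k ww)"
 shows "occ aa (%ww. SUP k. T k ww) g x = (SUP k::nat. occ aa (T k) g x)"
proof -
 let ?a = "%ww. (LI (%t. (SUP k. xp aa t * xt g (en t) ww * ix (bf (T k ww)) t)))"
 let ?b = "%ww. (SUP k. LI (%t. xp aa t * xt g (en t) ww * ix (bf (T k ww)) t))"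
 have ind: "ix (bf ((SUP k. T k ww))) t = (SUP k. ix (bf (T k ww)) t :: ennreal)" for ww t
 proof (cases "0 <= t & en t < (SUP k. T k ww)")
  case True
  then obtain k where "en t < T k ww" by (auto simp: less_SUP_iff)
  hence "(1::ennreal) <= (SUP k. ix (bf (T k ww)) t)"
   using True by (intro SUP_upper2[of k]) auto
  moreover have "(SUP k. ix (bf (T k ww)) t) <= (1::ennreal)" by (rule SUP_least) (auto split: splix)
  ultimately show ?thesis using True by auto
 next
  case False
  hence "ix (bf (T k ww)) t = (0::ennreal)" for k by (auto simp: less_SUP_iff)
  thus ?thesis using False by simp
 qed
 have incI: "incseq (%k. ix (bf (T k ww)) t :: ennreal)" for ww t
  using inc[of ww] unfolding incseq_def by (auto split: splix intro: order.strict_trans2)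
 have "occ aa (%ww. SUP k. T k ww) g x = (PI x (%ww. ?a ww))"
  unfolding occ_def by (simp only: ind SUP_mult_left_ennreal)
 also have "... = (PI x (%ww. ?b ww))"
 proof (rule nncong)
  fix ww assume "ww : space (P x)"
  hence [measurable]: "ww : Om" by (simp add: space_law)
  show "?a ww
   = ?b ww"
   by (rule mctSUP)
    (use incI in "auto simp: incle intro!: mulL")
 qed
 also have "... = (SUP k. occ aa (T k) g x)"
  unfolding occ_def
  by (rule mctSUP)
   (use incI in "auto simp: incle intro!: nnmono mulL")
 finally show ?thesis .
qed

text \<open>The value off \<open>D\<close> is 0, also at irregular boundary points. This is the
  value that killing near the complement produces in the limit, as \<open>occ_Tk_outside\<close>
  shows, and it makes \<open>RD_SUP\<close> hold everywhere.\<close>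

definition RD :: "real => 'a set => ('a => ennreal) => 'a => ennreal" where
 "RD aa D g x = (if x : D then occ aa (exit_time X D) g x else 0)"

definition HD :: "real => 'a set => ('a => ennreal) => 'a => ennreal" where
 "HD aa D g x = (if x : D then fin aa (exit_time X D) g x else 0)"

lemma RD_outside: "x ~: D ==> RD aa D g x = 0" and HD_outside: "x ~: D ==> HD aa D g x = 0"
 by (auto simp: RD_def HD_def)

lemma RD_TD: "open D ==> x : D ==> RD aa D g x = occ aa (TD D) g x"
proof -
 assume "open D" and x: "x : D"
 from exit_eq[OF this] have "AE ww in P x. exit_time X D ww = TD D ww" by eventually_elim simp
 hence "occ aa (exit_time X D) g x = occ aa (TD D) g x"
  unfolding occ_def by (rule nn_integral_cong_AE[OF AE_mp]) (rule AE_I2, simp)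
 thus ?thesis using x by (simp add: RD_def)
qed

lemma HD_TD: "open D ==> x : D ==> HD aa D g x = fin aa (TD D) g x"
proof -
 assume "open D" and x: "x : D"
 from exit_eq[OF this] have "AE ww in P x. exit_time X D ww = TD D ww" by eventually_elim simp
 hence "fin aa (exit_time X D) g x = fin aa (TD D) g x"
  unfolding fin_def by (rule nn_integral_cong_AE[OF AE_mp]) (rule AE_I2, simp)
 thus ?thesis using x by (simp add: HD_def)
qed

lemma TD_measurable [measurable]: "TD D : bm (events X)" and Tk_measurable [measurable]: "Tk D k : bm (events X)"
 by (rule stopm[OF stop_TD] stopm[OF stop_Tk])+

lemma occ_zero_T: "(AE ww in P x. T ww = 0) ==> occ aa T g x = 0"
proof -
 assume "AE ww in P x. T ww = 0"
 hence "occ aa T g x = (PI x (%ww. 0))"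
  unfolding occ_def by (rule nn_integral_cong_AE[OF AE_mp]) (rule AE_I2, simp)
 thus ?thesis by simp
qed

lemma occ_Tk_outside: assumes "x ~: D" shows "occ aa (Tk D k) g x = 0"
proof (rule occ_zero_T)
 show "AE ww in P x. Tk D k ww = 0"
  using pos_0[of "Some x"] AE_space
 proof eventually_elim
  case (elim ww)
  thus ?case using hitA_le[of ww 0 0 "Uk D k"] open_Uk[of D k] assms Compl_subset_Uk[of D k]
   by (auto simp: Tk_def space_law)
 qed
qed

lemma RD_SUP:
 assumes "open D" and [measurable]: "g : BM"
 shows "RD aa D g x = (SUP k. occ aa (Tk D k) g x)"
proof (cases "x : D")
 case True
 thus ?thesis
  unfolding RD_TD[OF assms(1) True] TD_def[abs_def] by (intro occ_SUP_T Tk_incseq) measurable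
qed (simp add: RD_outside occ_Tk_outside)

lemma mfun_RD: "open D ==> mfun (%g. RD aa D g x)"
proof (cases "x : D")
 case False
 thus ?thesis unfolding RD_def mfun_def by (intro exI[of _ "null_measure borel"]) auto
next
 case True
 assume "open D"
 thus ?thesis using mfun_occ[of "TD D" aa x] True by (simp add: RD_TD)
qed

lemma mfun_HD: "open D ==> mfun (%g. HD aa D g x)"
proof (cases "x : D")
 case False
 thus ?thesis unfolding HD_def mfun_def by (intro exI[of _ "null_measure borel"]) auto
next
 case True
 assume "open D"
 thus ?thesis using mfun_fin'[of "TD D" aa x] True by (simp add: HD_TD)
qed

lemma RD_SUP_params:
 assumes D: "open D" and [measurable]: "!!n. h n : BM" and "incseq h" and "!!y. (SUP n. h n y) = g y"
 shows "RD aa D g x = (SUP n. RD (aa + 1 / rs n) D (h n) x)"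
 using occ_SUP_params[of "TD D" h g aa x] assms by (cases "x : D") (simp_all add: RD_TD RD_outside del: of_nat_Suc)

lemma truncate:
 assumes [measurable]: "g : BM"
 shows "(%y. min (g y) (en (real n))) : BM" "incseq (%n y. min (g y) (en (real n)))"
  "(SUP n. min (g y) (en (real n))) = g y"
 using incseq_min_of_nat by (auto simp: SUP_min_of_nat incle)

lemma RD_measurable [measurable (raw)]:
 assumes D: "open D" and aa: "0 <= aa" and g [measurable]: "g : BM"
 shows "RD aa D g : BM"
proof -
 have bounded: "RD bb D h : BM" if "0 < bb" and [measurable]: "h : BM" and "!!y. h y <= en c" "0 <= c" for bb c h
  unfolding RD_SUP[OF D that(2), abs_def] Tk_def
  by (intro borel_measurable_SUP countableI_type occ_hitA_measurable[OF that(1) open_Uk that(2-4)])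
 have "RD aa D g = (%x. SUP n. RD (aa + 1 / rs n) D (%y. min (g y) (en (real n))) x)"
  by (rule ext) (rule RD_SUP_params[OF D truncate[OF g]])
 also have "... \<in> BM"
 proof (intro borel_measurable_SUP countableI_type)
  fix n :: nat
  have "0 < aa + 1 / rs n" using aa by (intro add_nonneg_pos) auto
  thus "RD (aa + 1 / rs n) D (%y. min (g y) (en (real n))) : BM"
   by (rule bounded[of _ _ "real n"]) auto
 qed
 finally show ?thesis .
qed

lemma kop_RD: "open D ==> 0 <= aa ==> kop (RD aa D)"
 unfolding kop_def by (auto simp: mfun_RD RD_measurable)

lemma occ_mono_params:
 assumes "bb <= aa" "!!y. g y <= h y" shows "occ aa T g x <= occ bb T h x"
 unfolding occ_def
proof (intro nnmono)
 fix ww and t :: real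
 show "xp aa t * xt g (en t) ww * ix (bf (T ww)) t
  <= xp bb t * xt h (en t) ww * ix (bf (T ww)) t"
 proof (cases "0 <= t")
  case True
  have "exp (- aa * t) <= exp (- bb * t)" using True assms(1) by (simp add: mulR)
  moreover have "ext0 g z <= ext0 h z" for z using assms(2) by (cases z) auto
  ultimately show ?thesis by (intro mulR mult_mono ennreal_leI) auto
 qed simp
qed

lemma RD_mono_params: "bb <= aa ==> (!!y. g y <= h y) ==> RD aa D g x <= RD bb D h x"
 unfolding RD_def using occ_mono_params[of bb aa g h] by simp

text \<open>The strong Markov property of the process killed on leaving \<open>D\<close>. For
  bounded functions and positive rates it is \<open>occ_hitA_SM\<close> for the neighbourhoods
  \<open>Uk D k\<close>, the contribution of the event that the hitting time comes first being
  removed by \<open>fin_hitA_zero\<close>. The rest is monotone limits in \<open>k\<close> and in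
  the rate.\<close>

lemma RD_SM:
 assumes D: "open D" and x: "x : D" and S: "stop S" and aa: "0 <= aa" and g [measurable]: "g : BM"
 shows "RD aa D g x = occ aa (%ww. min (S ww) (TD D ww)) g x +
  (PI x (%ww. xp aa (enn2real (S ww)) * ix {ww. S ww < TD D ww} ww * xt (RD aa D g) (S ww) ww))"
proof -
 let ?a = "%an n gn. %ww. en (exp (- an n * enn2real (S ww))) * ix {ww. S ww < TD D ww} ww * xt (RD (an n) D (gn n)) (S ww) ww"
 let ?b = "%bb k W. PI x (%ww. xp bb (enn2real (S ww)) * ix {ww. S ww < Tk D k ww} ww * xt (W k) (S ww) ww)"
 let ?d = "%bb k W. fin bb (%ww. min (S ww) (Tk D k ww)) (W k) x"
 let ?e = "%bb k W. PI x (%ww. xp bb (enn2real (Tk D k ww)) * ix {ww. \<not> S ww < Tk D k ww} ww * xt (W k) (Tk D k ww) ww)"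
 let ?f = "%bb ww h. xp bb (enn2real (S ww)) * ix {ww. S ww < TD D ww} ww * xt (RD bb D h) (S ww) ww"
 let ?l = "%an gn. SUP n. occ (an n) (%ww. min (S ww) (TD D ww)) (gn n) x"
 note [measurable] = stopm[OF S]
 have bounded: "RD bb D h x = occ bb (%ww. min (S ww) (TD D ww)) h x +
  (PI x (%ww. ?f bb ww h))"
  if bb: "0 < bb" and h [measurable]: "h : BM" and hc: "!!y. h y <= en c" "0 <= c" for bb c h
 proof -
  define W where "W k = occ bb (Tk D k) h" for k
  have Wm [measurable]: "W k : BM" for k
   unfolding W_def Tk_def by (rule occ_hitA_measurable[OF bb open_Uk h hc])
  have incW: "incseq (%k. W k y)" for y
   unfolding W_def incseq_def using Tk_incseq by (auto intro!: occ_mono_T simp: incseq_def)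
  have SUPW: "(SUP k. W k y) = RD bb D h y" for y unfolding W_def by (rule RD_SUP[OF D h, symmetric])
  have step: "W k x = occ bb (%ww. min (S ww) (Tk D k ww)) h x +
    (?b bb k W)" for k
  proof -
   have z: "fin bb (Tk D k) (W k) x = 0" unfolding W_def Tk_def by (rule fin_hitA_zero[OF bb open_Uk h hc])
   have "?d bb k W =
    (PI x (%ww. xp bb (enn2real (S ww)) * ix {ww. S ww < Tk D k ww} ww * xt (W k) (S ww) ww +
      xp bb (enn2real (Tk D k ww)) * ix {ww. \<not> S ww < Tk D k ww} ww * xt (W k) (Tk D k ww) ww))"
    unfolding fin_def by (rule nncong) (auto split: splix simp: min_def not_less le_less)
   also have "... = (?b bb k W) +
     (?e bb k W)"
    by (rule nn_integral_add) measurable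
   also have "(?e bb k W) <= fin bb (Tk D k) (W k) x"
    unfolding fin_def by (rule nnmono) (auto split: splix)
   finally have "?d bb k W <= (?b bb k W)"
    unfolding z by (simp add: add_left_mono)
   moreover have "(?b bb k W) <= ?d bb k W"
    unfolding fin_def by (rule nnmono) (auto split: splix simp: min_def)
   ultimately have "?d bb k W = (?b bb k W)"
    by (rule antisym)
   thus ?thesis
    using occ_hitA_SM[OF bb open_Uk h hc S, of D k x] unfolding W_def Tk_def[symmetric] by simp
  qed
  have incI: "incseq (%k. ix {ww. S ww < Tk D k ww} ww :: ennreal)" for ww
   using Tk_incseq[of D ww] unfolding incseq_def by (auto split: splix intro: order.strict_trans2)
  have SUPI: "(SUP k. ix {ww. S ww < Tk D k ww} ww :: ennreal) = ix {ww. S ww < TD D ww} ww" for ww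
  proof (cases "S ww < TD D ww")
   case True
   then obtain k where "S ww < Tk D k ww" by (auto simp: TD_def less_SUP_iff)
   hence "(1::ennreal) <= (SUP k. ix {ww. S ww < Tk D k ww} ww)" by (intro SUP_upper2[of k]) auto
   moreover have "(SUP k. ix {ww. S ww < Tk D k ww} ww) <= (1::ennreal)" by (rule SUP_least) (auto split: splix)
   ultimately show ?thesis using True by auto
  next
   case False
   hence "ix {ww. S ww < Tk D k ww} ww = (0::ennreal)" for k by (auto simp: TD_def less_SUP_iff)
   thus ?thesis using False by simp
  qed
  have incX: "incseq (%k. ext0 (W k) z)" and SUPX: "(SUP k. ext0 (W k) z) = ext0 (RD bb D h) z" for z
   using incW SUPW by (cases z; auto simp: incseq_def)+
  define Z where "Z k ww = xp bb (enn2real (S ww)) * ix {ww. S ww < Tk D k ww} ww * xt (W k) (S ww) ww" for k ww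
  have incIe: "incseq (%k. xp bb (enn2real (S ww)) * ix {ww. S ww < Tk D k ww} ww)" for ww
   by (rule incseq_mult[OF _ incI]) (simp add: incseq_def)
  have incZ: "incseq (%k. Z k ww)" for ww unfolding Z_def by (rule incseq_mult[OF incIe incX])
  have [measurable]: "Z k : bm (P x)" for k unfolding Z_def by measurable
  have SUPZ: "(SUP k. Z k ww) = ?f bb ww h" for ww
   unfolding Z_def SUP_mult_incseq[OF incIe incX] SUPX by (simp only: SUP_mult_left_ennreal[symmetric] SUPI)
  have "RD bb D h x = (SUP k. occ bb (%ww. min (S ww) (Tk D k ww)) h x + (PI x (%ww. Z k ww)))"
   unfolding SUPW[symmetric] Z_def step[symmetric] ..
  also have "... = (SUP k. occ bb (%ww. min (S ww) (Tk D k ww)) h x) + (SUP k. PI x (%ww. Z k ww))"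
  proof (rule ennreal_SUP_add)
   show "incseq (%k. occ bb (%ww. min (S ww) (Tk D k ww)) h x)"
    using Tk_incseq unfolding incseq_def by (auto intro!: occ_mono_T min.mono)
   show "incseq (%k. PI x (%ww. Z k ww))"
    using incZ unfolding incseq_def by (auto intro!: nnmono)
  qed
  also have "(SUP k. occ bb (%ww. min (S ww) (Tk D k ww)) h x) = occ bb (%ww. SUP k. min (S ww) (Tk D k ww)) h x"
   by (rule occ_SUP_T[symmetric]) (simp_all add: incseq_def min.coboundedI2 Tk_incseq[unfolded incseq_def])
  also have "(%ww. SUP k. min (S ww) (Tk D k ww)) = (%ww. min (S ww) (TD D ww))"
   unfolding TD_def by (simp add: inf_SUP flip: inf_min)
  also have "(SUP k. PI x (%ww. Z k ww)) = (PI x (%ww. (SUP k. Z k ww)))"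
   by (rule mctSUP[symmetric]) (use incZ in "auto simp: incle")
  finally show ?thesis unfolding SUPZ .
 qed
 define gn where "gn n y = min (g y) (en (real n))" for n y
 have [measurable]: "gn n : BM" for n unfolding gn_def by measurable
 have gn: "incseq gn" "(SUP n. gn n y) = g y" for y using truncate[OF g] by (auto simp: gn_def[abs_def])
 define an where "an n = aa + 1 / rs n" for n
 have an: "0 < an n" for n unfolding an_def using aa by (intro add_nonneg_pos) auto
 have RDinc: "incseq (%n. RD (an n) D (gn n))" and RDsup: "(SUP n. RD (an n) D (gn n) y) = RD aa D g y" for y
 proof -
  show "(SUP n. RD (an n) D (gn n) y) = RD aa D g y" unfolding an_def by (rule RD_SUP_params[OF D _ gn, symmetric]) measurable
  show "incseq (%n. RD (an n) D (gn n))"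
  proof (unfold incle, intro allI impI)
   fix i j :: nat and y assume "i <= j"
   have "an j <= an i" unfolding an_def using `i <= j` by (simp add: frac_le)
   moreover have "gn i z <= gn j z" for z using gn(1) `i <= j` by (auto simp: incle)
   ultimately show "RD (an i) D (gn i) y <= RD (an j) D (gn j) y"
    by (rule RD_mono_params)
  qed
 qed
 have RDm [measurable]: "RD (an n) D (gn n) : BM" for n by (rule RD_measurable[OF D]) (use an[of n] in auto)
 have "RD aa D g x = (SUP n. RD (an n) D (gn n) x)" by (rule RDsup[symmetric])
 also have "... = (SUP n. occ (an n) (%ww. min (S ww) (TD D ww)) (gn n) x +
  (PI x (?a an n gn)))"
 proof (rule SUP_cong[OF refl])
  fix n
  show "RD (an n) D (gn n) x = occ (an n) (%ww. min (S ww) (TD D ww)) (gn n) x +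
   (PI x (?a an n gn))"
   by (rule bounded[of _ _ "real n", OF an]) (auto simp: gn_def)
 qed
 also have "... = (?l an gn) +
  (SUP n. PI x (?a an n gn))"
 proof (rule ennreal_SUP_add)
  have dec: "an j <= an i" if "i <= j" for i j unfolding an_def using that by (simp add: frac_le)
  show "incseq (%n. occ (an n) (%ww. min (S ww) (TD D ww)) (gn n) x)"
   unfolding incseq_def using gn(1)
   by (intro allI impI occ_mono_params dec) (simp_all add: incle)
  show "incseq (%n. PI x (?a an n gn))"
   unfolding incseq_def using RDinc
   by (auto intro!: nnmono mult_mono ennreal_leI mulR dec simp: incle ext0_def split: option.splits splix)
 qed
 also have "(?l an gn) = occ aa (%ww. min (S ww) (TD D ww)) g x"
  unfolding an_def by (rule occ_SUP_params[symmetric, OF _ _ gn]) measurable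
 also have "(SUP n. PI x (?a an n gn))
  = (PI x (%ww. xp aa (enn2real (S ww)) * ix {ww. S ww < TD D ww} ww * xt (RD aa D g) (S ww) ww))"
  unfolding an_def by (rule fin_SUP_params[symmetric, OF _ _ RDm[unfolded an_def] RDinc[unfolded an_def] RDsup[unfolded an_def]]) measurable
 finally show ?thesis .
qed

lemma RD_nest:
 assumes D: "open D" and D': "open D'" "D' <= D" and x: "x : D'" and aa: "0 <= aa" and g [measurable]: "g : BM"
 shows "RD aa D g x = RD aa D' g x + HD aa D' (RD aa D g) x"
proof -
 let ?a = "PI x (%ww. xp aa (enn2real (TD D' ww)) * ix {ww. TD D' ww < TD D ww} ww * xt (RD aa D g) (TD D' ww) ww)"
 have le: "exit_time X D' ww <= exit_time X D ww" for ww
  unfolding exit_time_def hitting_time_def by (rule Inf_superset_mono) (use D'(2) in auto)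
 have xD: "x : D" using x D' by auto
 have ae: "AE ww in P x. min (TD D' ww) (TD D ww) = TD D' ww &
  ix {ww. TD D' ww < TD D ww} ww * xt (RD aa D g) (TD D' ww) ww = xt (RD aa D g) (TD D' ww) ww"
  using exit_eq[OF D xD] exit_eq[OF D'(1) x] AE_space
 proof eventually_elim
  case (elim ww)
  have lt: "TD D' ww <= TD D ww" using le[of ww] elim by simp
  moreover have "TD D' ww < TD D ww \<or> xt (RD aa D g) (TD D' ww) ww = 0"
  proof (cases "TD D' ww = TD D ww")
   case True
   thus ?thesis
    using elim pos_infty[of ww] by (cases "TD D ww < iy") (auto simp: RD_outside space_law less_top[symmetric])
  qed (use lt in auto)
  ultimately show ?case by (auto simp: min_def)
 qed
 have "RD aa D g x = occ aa (%ww. min (TD D' ww) (TD D ww)) g x +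
  ?a"
  by (rule RD_SM[OF D xD stop_TD aa g])
 also have "occ aa (%ww. min (TD D' ww) (TD D ww)) g x = occ aa (TD D') g x"
  unfolding occ_def by (rule nn_integral_cong_AE) (use ae in "eventually_elim, simp")
 also have "?a
  = fin aa (TD D') (RD aa D g) x"
  unfolding fin_def by (rule nn_integral_cong_AE) (use ae in "eventually_elim, simp add: mult.assoc")
 finally show ?thesis by (simp add: RD_TD[OF D'(1) x] HD_TD[OF D'(1) x])
qed

lemma dynkin_D:
 assumes D: "open D" and x: "x : D" and m: "a : BM" "b : BM" "w : BM"
  and eq: "!!y. w y + R aa a y = R aa b y" and fin: "!!y. R aa a y <= c" "c < iy" "0 <= aa"
 shows "w x + RD aa D a x = RD aa D b x + HD aa D w x"
 unfolding RD_TD[OF D x] HD_TD[OF D x] by (rule SM_general[OF stop_TD m eq fin])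

end

text \<open>The measure is read off from indicators; additivity and monotone continuity give
  countable additivity. Sums and compositions of functionals are recognised as integrals by this
  criterion.\<close>

lemma mfunI:
 fixes L :: "('a::topological_space => ennreal) => ennreal"
 assumes add: "!!f g. f : BM ==> g : BM ==> L (%y. f y + g y) = L f + L g"
  and cmult: "!!c g. g : BM ==> L (%y. c * g y) = c * L g"
  and SUP: "!!h. (!!i::nat. h i : BM) ==> incseq h ==> L (%y. SUP i. h i y) = (SUP i. L (h i))"
 shows "mfun L"
proof -
 have zero: "L (%_. 0) = 0" using cmult[of "%_. 0" 0] by simp
 define mm where "mm = measure_of UNIV (sets borel) (%A. L (ix A))"
 have sm: "sets mm = sets borel" unfolding mm_def by (metis sets.sets_measure_of_eq space_borel)
 have em: "emeasure mm A = L (ix A)" if "A : sets borel" for A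
 proof (rule emeasure_measure_of[OF mm_def])
  show "positive (sets mm) (%A. L (ix A))" using zero by (simp add: positive_def indicator_def[abs_def])
  show "countably_additive (sets mm) (%A. L (ix A))"
  proof (rule countably_additiveI)
   fix A :: "nat => 'a set" assume A: "range A <= sets mm" "disjoint_family A"
   have [measurable]: "A i : sets borel" for i using A(1) sm by auto
   have fs: "L (%y. \<Sum>i<n. ix (A i) y) = (\<Sum>i<n. L (ix (A i)))" for n
   proof (induction n)
    case (Suc n)
    have "L (%y. (\<Sum>i<n. ix (A i) y) + ix (A n) y) = L (%y. \<Sum>i<n. ix (A i) y) + L (ix (A n))"
     by (rule add) measurable
    thus ?case using Suc by (simp add: add.commute)
   qed (simp add: zero)
   have "L (ix (\<Union>i. A i)) = L (%y. SUP n. \<Sum>i<n. ix (A i) y)"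
   proof (rule arg_cong[where f=L], rule ext)
    fix y
    show "ix (\<Union>i. A i) y = (SUP n. \<Sum>i<n. ix (A i) y :: ennreal)"
     unfolding suminf_eq_SUP[symmetric] by (rule suminf_indicator[OF A(2), symmetric])
   qed
   also have "... = (SUP n. L (%y. \<Sum>i<n. ix (A i) y))"
   proof (rule SUP)
    show "incseq (%n y. \<Sum>i<n. ix (A i) y :: ennreal)"
     by (auto simp: incle intro!: sum_mono2)
   qed measurable
   also have "... = (\<Sum>i. L (ix (A i)))" unfolding fs suminf_eq_SUP ..
   finally show "(\<Sum>i. L (ix (A i))) = L (ix (\<Union>i. A i))" ..
  qed
 qed (use that sm in auto)
 have "L g = (NI mm (%y. g y))" if "g : BM" for g
  using that
 proof induction
  case (cong f g)
  hence "f = g" by auto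
  thus ?case using cong by simp
 next
  case (set A) thus ?case using sm by (simp add: em)
 next
  case (mult u c)
  have [measurable]: "u : bm mm" using mult sm by (simp cong: measurable_cong_sets)
  show ?case by (simp add: cmult[OF mult(2)] mult.IH nncmult)
 next
  case (add u v)
  have [measurable]: "u : bm mm" "v : bm mm" using add sm by (simp_all cong: measurable_cong_sets)
  show ?case using assms(1)[OF add(3,1)] by (simp add: add.IH nn_integral_add)
 next
  case (seq U)
  have [measurable]: "U i : bm mm" for i using seq sm by (simp cong: measurable_cong_sets)
  have "(\<Squnion> range U) = (%y. SUP i. U i y)" by (rule ext) (simp add: image_comp)
  thus ?case using seq(3) by (simp add: SUP[OF seq(1,3)] seq.IH mctSUP)
 qed
 thus ?thesis unfolding mfun_def using sm by blast
qed

lemma mfun_comp: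
 assumes L: "mfun L" and K: "kop K" shows "mfun (%g. L (K g))"
proof (rule mfunI)
 fix f g :: "'a => ennreal" and c
 assume fg: "f : BM" "g : BM"
 have "K (%y. f y + g y) = (%y. K f y + K g y)" by (rule ext) (rule kop_add[OF K fg])
 thus "L (K (%y. f y + g y)) = L (K f) + L (K g)" using mfun_add[OF L kopm[OF K fg(1)] kopm[OF K fg(2)]] by simp
next
 fix g :: "'a => ennreal" and c assume g: "g : BM"
 have "K (%y. c * g y) = (%y. c * K g y)" by (rule ext) (rule kop_cmult[OF K g])
 thus "L (K (%y. c * g y)) = c * L (K g)" using mfun_cmult[OF L kopm[OF K g]] by simp
next
 fix h :: "nat => 'a => ennreal" assume h: "!!i. h i : BM" "incseq h"
 have "K (%y. SUP i. h i y) = (%y. SUP i. K (h i) y)" by (rule ext) (rule kop_SUP[OF K h])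
 moreover have "incseq (%i. K (h i))"
  using h unfolding incle by (intro allI impI kop_mono[OF K]) auto
 ultimately show "L (K (%y. SUP i. h i y)) = (SUP i. L (K (h i)))"
  using mfun_SUP[OF L kopm[OF K h(1)]] by simp
qed

lemma mfun_incseq: "mfun L ==> (!!i::nat. h i : BM) ==> incseq h ==> incseq (%i. L (h i))"
 unfolding incle by (auto intro: mfun_mono)

lemma mfun_plus:
 assumes L: "mfun L" "mfun M" shows "mfun (%g. L g + c * M g)"
proof (rule mfunI)
 fix f g :: "'a => ennreal"
 assume fg: "f : BM" "g : BM"
 show "L (%y. f y + g y) + c * M (%y. f y + g y) = L f + c * M f + (L g + c * M g)"
  unfolding mfun_add[OF L(1) fg] mfun_add[OF L(2) fg] by (simp only: distrib_left ac_simps)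
next
 fix g :: "'a => ennreal" and d assume g: "g : BM"
 show "L (%y. d * g y) + c * M (%y. d * g y) = d * (L g + c * M g)"
  unfolding mfun_cmult[OF L(1) g] mfun_cmult[OF L(2) g] by (simp only: distrib_left ac_simps)
next
 fix h :: "nat => 'a => ennreal" assume h: "!!i. h i : BM" "incseq h"
 show "L (%y. SUP i. h i y) + c * M (%y. SUP i. h i y) = (SUP i. L (h i) + c * M (h i))"
  unfolding mfun_SUP[OF L(1) h] mfun_SUP[OF L(2) h] SUP_mult_left_ennreal
  by (rule ennreal_SUP_add[symmetric])
   (use mfun_incseq[OF L(1) h] mfun_incseq[OF L(2) h] in "auto simp: incseq_def intro: mulL")
qed

lemma kop_if:
 fixes D :: "'a::topological_space set"
 assumes K: "kop K" and D [measurable]: "D : sets borel"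
 shows "kop (%g y. if y : D then K g y else g y)"
 unfolding kop_def
proof (intro conjI allI ballI)
 fix x
 show "mfun (%g. if x : D then K g x else g x)"
 proof (cases "x : D")
  case True thus ?thesis using kop_mfun[OF K, of x] by simp
 next
  case False
  have "mfun (%g :: 'a => ennreal. g x)" by (rule mfunI) auto
  thus ?thesis using False by simp
 qed
next
 fix g :: "'a => ennreal" assume [measurable]: "g : BM"
 have [measurable]: "K g : BM" by (rule kopm[OF K]) measurable
 show "(%y. if y : D then K g y else g y) : BM" by measurable
qed

section \<open>Resolvent equations for the killed process\<close>

context hunt
begin

text \<open>The Markov property at each fixed time \<open>s\<close> replaces the inner potential by
  a path integral over the times after \<open>s\<close>. Fubini's theorem then leaves the
  convolution of two exponentials along one path.\<close>

lemma RD_RD: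
 assumes D: "open D" and x: "x : D" and aa: "0 <= aa" and bb: "0 < bb" and g [measurable]: "g : BM" and gc: "!!y. g y <= en c"
 shows "RD aa D (RD bb D g) x = (PI x (%ww. (SI lborel (bf (TD D ww)) (%t.       (SI lborel {0..t} (%s. en (exp (- aa * s) * exp (- bb * (t - s))))) * xt g (en t) ww))))"
proof -
 let ?a = "%s t G ww I. en (exp ((bb - aa) * s)) * ix {0..} s * (xp bb t * G t ww * I t ww * ix {0..} (t - s))"
 let ?b = "%s G ww I. LI (%t. en (exp ((bb - aa) * s)) * ix {0..} s * (xp bb t * G t ww * I t ww * ix {s..} t))"
 let ?d = "%G ww I s. LI (%t. xp bb t * G t ww * I t ww * ix {s..} t)"
 let ?e = "%s I ww. xp bb s * I s ww * xt (RD bb D g) (en s) ww"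
 let ?f = "%t. SI lborel {0..t} (%s. en (exp (- aa * s) * exp (- bb * (t - s))))"
 let ?h = "%s. PI x (%ww. xp bb (enn2real (en s)) * ix {ww. en s < TD D ww} ww * xt (RD bb D g) (en s) ww)"
 let ?i = "%G ww s I. (LI (%t. xp bb t * G t ww * ix (bf (min (en s) (TD D ww))) t + xp bb t * G t ww * I t ww * ix {s..} t))"
 let ?j = "%s I. PI x (%ww. en (exp ((bb - aa) * s)) * (?e s I ww))"
 let ?k = "%G ww s I. (LI (%t. xp bb t * G t ww * ix (bf (min (en s) (TD D ww))) t)) + (?d G ww I s)"
 let ?l = "%s t. en (exp (- aa * s) * exp (- bb * (t - s))) * ix {0..t} s"
 interpret PS: prob_space "P x" by (rule prob_law)
 interpret Q: pair_sigma_finite "P x" lborel ..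
 note [measurable] = RD_measurable[OF D less_imp_le[OF bb] g]
 define I where "I t ww = (ix (bf (TD D ww)) t :: ennreal)" for t ww
 define G where "G t ww = xt g (en t) ww" for t ww
 have [measurable]: "(%(ww, t). I t ww) : bm (events X \<Otimes>\<^sub>M borel)" unfolding I_def by measurable
 have [measurable]: "(%(ww, t). G t ww) : bm (events X \<Otimes>\<^sub>M borel)" unfolding G_def by measurable
 \<comment> \<open>The potential at rate \<open>bb\<close> is cut at time \<open>s\<close> in two
   ways, once by \<open>RD_SM\<close> and once along the path. The common part before
   \<open>s\<close> is finite, and cancelling it identifies the parts after
   \<open>s\<close>.\<close>
 have key: "(PI x (%ww. ?e s I ww))
   = (PI x (%ww. ?d G ww I s))" if s: "0 <= s" for s
 proof -
  let ?A = "occ bb (%ww. min (en s) (TD D ww)) g x"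
  have "RD bb D g x = ?A + (?h s)"
   by (rule RD_SM[OF D x stopping_time_const less_imp_le[OF bb] g])
  also have "(?h s)
    = (PI x (%ww. ?e s I ww))"
   using s by (intro nncong) (auto simp: I_def split: splix)
  finally have 1: "RD bb D g x = ?A + (PI x (%ww. ?e s I ww))" .
  have "RD bb D g x = (PI x (%ww. ?i G ww s I))"
   unfolding RD_TD[OF D x] occ_def G_def I_def using s
   by (intro nncong) (auto split: splix simp: ennreal_less_iff)
  also have "... = (PI x (%ww. ?k G ww s I))"
  proof (rule nncong)
   fix ww assume "ww : space (P x)"
   hence [measurable]: "ww : Om" by (simp add: space_law)
   show "?i G ww s I =
    ?k G ww s I"
    by (rule nn_integral_add) measurable
  qed
  also have "... = ?A + (PI x (%ww. ?d G ww I s))"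
   unfolding occ_def G_def[symmetric] by (rule nn_integral_add) measurable
  finally have 2: "RD bb D g x = ?A + (PI x (%ww. ?d G ww I s))" .
  have "?A <= en c * en (1 / bb)" by (rule order_trans[OF occ_le_R R_bound[OF bb g gc]])
  also have "... < iy" by (simp add: ennreal_mult_less_top)
  finally have "?A ~= iy" by simp
  from ennreal_cancel[OF trans[OF 1[symmetric] 2] this] show ?thesis .
 qed
 have "RD aa D (RD bb D g) x = (PI x (%ww. LI (%s. en (exp ((bb - aa) * s)) * (?e s I ww))))"
  unfolding RD_TD[OF D x, of aa] occ_def I_def
 proof (intro nncong)
  fix ww and s :: real
  have "xp aa s = en (exp ((bb - aa) * s)) * xp bb s"
   unfolding ennreal_mult[OF exp_ge_zero exp_ge_zero, symmetric] exp_add[symmetric] by (simp add: algebra_simps)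
  thus "xp aa s * xt (RD bb D g) (en s) ww * ix (bf (TD D ww)) s =
   en (exp ((bb - aa) * s)) * (xp bb s * ix (bf (TD D ww)) s * xt (RD bb D g) (en s) ww)"
   by (simp only: ac_simps)
 qed
 also have "... = (LI (%s. ?j s I))"
  by (rule Q.Fubini'[symmetric]) measurable
 also have "... = (LI (%s. PI x (%ww. ?b s G ww I)))"
 proof (rule nncong)
  fix s :: real
  show "(?j s I) =
   (PI x (%ww. ?b s G ww I))"
  proof (cases "0 <= s")
   case True
   have "(?j s I) =
     en (exp ((bb - aa) * s)) * (PI x (%ww. ?e s I ww))"
    by (rule nncmult) measurable
   also have "... = en (exp ((bb - aa) * s)) * (PI x (%ww. ?d G ww I s))"
    unfolding key[OF True] ..
   also have "... = (PI x (%ww. en (exp ((bb - aa) * s)) * (?d G ww I s)))"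
    by (rule nncmult[symmetric]) measurable
   also have "... = (PI x (%ww. ?b s G ww I))"
   proof (rule nncong)
    fix ww assume "ww : space (P x)"
    hence [measurable]: "ww : Om" by (simp add: space_law)
    show "en (exp ((bb - aa) * s)) * (?d G ww I s)
     = (?b s G ww I)"
    proof -
     have [measurable]: "{s..} \<in> sets borel" by simp
     have "(%t. xp bb t * G t ww * I t ww * ix {s..} t) : bm lborel" by measurable
     thus ?thesis using True by (simp add: nncmult)
    qed
   qed
   finally show ?thesis .
  qed (simp add: I_def)
 qed
 also have "... = (PI x (%ww. LI (%s. LI (%t. ?a s t G ww I))))"
 proof -
  have "(LI (%s. PI x (%ww. ?b s G ww I)))
   = (LI (%s. PI x (%ww. LI (%t. ?a s t G ww I))))"
   by (rule nncong, rule nncong, rule nncong) (auto split: splix)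
  also have "... = (PI x (%ww. LI (%s. LI (%t. ?a s t G ww I))))"
   by (rule Q.Fubini') measurable
  finally show ?thesis .
 qed
 also have "... = (PI x (%ww. LI (%t. LI (%s. ?a s t G ww I))))"
 proof (rule nncong)
  fix ww assume "ww : space (P x)"
  hence [measurable]: "ww : Om" by (simp add: space_law)
  show "(LI (%s. LI (%t. ?a s t G ww I)))
    = (LI (%t. LI (%s. ?a s t G ww I)))"
   by (rule lborel_pair.Fubini'[symmetric]) measurable
 qed
 also have "... = (PI x (%ww. (SI lborel (bf (TD D ww)) (%t.       (?f t) * xt g (en t) ww))))"
 proof (intro nncong)
  fix ww and t :: real
  have "(LI (%s. ?a s t G ww I))
   = (LI (%s. (?l s t) * (G t ww * I t ww)))"
  proof (rule nncong)
   fix s :: real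
   have "en (exp ((bb - aa) * s)) * xp bb t = en (exp (- aa * s) * exp (- bb * (t - s)))"
    unfolding ennreal_mult[OF exp_ge_zero exp_ge_zero, symmetric] exp_add[symmetric] by (simp add: algebra_simps)
   moreover have "ix {0..} s * ix {0..} (t - s) = (ix {0..t} s :: ennreal)" by (auto split: splix)
   moreover have "?a s t G ww I
    = (en (exp ((bb - aa) * s)) * xp bb t) * (ix {0..} s * ix {0..} (t - s)) * (G t ww * I t ww)"
    by (simp only: ac_simps)
   ultimately show "?a s t G ww I
    = (?l s t) * (G t ww * I t ww)" by (simp only:)
  qed
  also have "... = (?f t) * (G t ww * I t ww)"
   by (rule nn_integral_multc) measurable
  finally show "(LI (%s. ?a s t G ww I))
   = (?f t) * xt g (en t) ww * ix (bf (TD D ww)) t"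
   unfolding G_def I_def by (simp only: mult.assoc)
 qed
 finally show ?thesis .
qed

lemma RD_resolvent:
 assumes D: "open D" and aa: "0 <= aa" "aa < bb" and g [measurable]: "g : BM"
 shows RD_resolvent_eq: "RD aa D g x = RD bb D g x + en (bb - aa) * RD aa D (RD bb D g) x"
  and RD_commute: "RD aa D (RD bb D g) x = RD bb D (RD aa D g) x"
proof -
 let ?d = "%r a b. SI lborel {0..r} (%s. en (exp (- a * s) * exp (- b * (r - s))))"
 let ?f = "%ww b h a. (SI lborel (bf (TD D ww)) (%t. xp b t * xt h (en t) ww)) + en (b - a) * (SI lborel (bf (TD D ww)) (%t. (?d t a b) * xt h (en t) ww))"
 let ?i = "%b t h ww a. xp b t * xt h (en t) ww * ix (bf (TD D ww)) t + en (b - a) * ((?d t a b) * xt h (en t) ww * ix (bf (TD D ww)) t)"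
 let ?k = "RD bb D g x + en (bb - aa) * RD aa D (RD bb D g) x"
 have bounded: "RD a D h x = RD b D h x + en (b - a) * RD a D (RD b D h) x & RD a D (RD b D h) x = RD b D (RD a D h) x"
  if a: "0 < a" "a < b" and h [measurable]: "h : BM" and hc: "!!y. h y <= en c" for a b c h
 proof (cases "x : D")
  case True
  have [measurable]: "(%r. ?d r a b) : BM" for a b :: real
  proof -
   have "ix {0..r} s = (ix {0..} s * ix {0..} (r - s) :: ennreal)" for r s :: real
    by (auto split: splix)
   thus ?thesis by simp
  qed
  have swap: "(?d t a b) = (?d t b a)" for t
  proof -
   have "(?d t a b) =
    (LI (%s. en (exp (- a * (t - s)) * exp (- b * (t - (t - s)))) * ix {0..t} (t - s)))"
    by (subst nn_integral_real_affine[where c="-1" and t=t]) auto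
   also have "... = (?d t b a)"
    by (rule nncong) (auto split: splix simp: mult.commute)
   finally show ?thesis .
  qed
  have "RD a D (RD b D h) x = RD b D (RD a D h) x"
   using a by (subst (1 2) RD_RD[OF D True _ _ h hc]) (auto simp only: swap less_imp_le)
  moreover have "RD a D h x = RD b D h x + en (b - a) * RD a D (RD b D h) x"
  proof -
   have "RD b D h x + en (b - a) * RD a D (RD b D h) x =
    (PI x (%ww. ?f ww b h a))"
    using a by (subst RD_RD[OF D True _ _ h hc], simp, simp, unfold RD_TD[OF D True] occ_def, subst nn_integral_add, measurable, subst nncmult, measurable)
   also have "... = RD a D h x"
    unfolding RD_TD[OF D True] occ_def
   proof (rule nncong)
    fix ww assume "ww : space (P x)"
    hence [measurable]: "ww : Om" by (simp add: space_law)
    have "(SI lborel (bf (TD D ww)) (%t. xp a t * xt h (en t) ww))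
     = (LI (%t. ?i b t h ww a))"
    proof (rule nncong)
     fix t :: real
     show "xp a t * xt h (en t) ww * ix (bf (TD D ww)) t
      = ?i b t h ww a"
     proof (cases "0 <= t")
      case True
      show ?thesis
       unfolding nn_integral_exp2[OF True a(2), symmetric]
       by (simp only: distrib_right mult.assoc add.commute)
     qed simp
    qed
    also have "... = ?f ww b h a"
     by (subst nn_integral_add, measurable, subst nncmult, measurable)
    finally show "?f ww b h a
     = (SI lborel (bf (TD D ww)) (%t. xp a t * xt h (en t) ww))" ..
   qed
   finally show ?thesis ..
  qed
  ultimately show ?thesis by blast
 qed (simp add: RD_outside)
 define gn where "gn n y = min (g y) (en (real n))" for n y
 have [measurable]: "gn n : BM" for n unfolding gn_def by measurable
 have gn: "incseq gn" "(SUP n. gn n y) = g y" for y using truncate[OF g] by (auto simp: gn_def[abs_def])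
 define e where "e n = 1 / rs n" for n
 have e: "0 < e n" "j <= n ==> e n <= e j" for n j unfolding e_def by (auto simp: frac_le)
 have inc: "incseq (%n. RD (a + e n) D (gn n))" for a
  unfolding incle using gn(1) e by (intro allI impI RD_mono_params) (auto simp: incle)
 have sup: "(SUP n. RD (a + e n) D (gn n) y) = RD a D g y" for a y
  unfolding e_def by (rule RD_SUP_params[OF D _ gn, symmetric]) measurable
 have m: "RD (a + e n) D (gn n) : BM" if "0 <= a" for a n
  by (rule RD_measurable[OF D]) (use e(1)[of n] that in auto)
 have two: "RD a D (RD b D g) x = (SUP n. RD (a + e n) D (RD (b + e n) D (gn n)) x)" if "0 <= b" for a b
  unfolding e_def by (rule RD_SUP_params[OF D m[OF that, unfolded e_def] inc[of b, unfolded e_def] sup[of b, unfolded e_def]])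
 have B: "RD (aa + e n) D (gn n) x = RD (bb + e n) D (gn n) x + en (bb - aa) * RD (aa + e n) D (RD (bb + e n) D (gn n)) x &
   RD (aa + e n) D (RD (bb + e n) D (gn n)) x = RD (bb + e n) D (RD (aa + e n) D (gn n)) x" for n
  using bounded[of "aa + e n" "bb + e n" "gn n" "real n"] aa e(1)[of n] by (simp add: gn_def)
 show "RD aa D (RD bb D g) x = RD bb D (RD aa D g) x"
  using aa by (subst (1 2) two) (auto simp: B)
 have "RD aa D g x = (SUP n. RD (bb + e n) D (gn n) x + en (bb - aa) * RD (aa + e n) D (RD (bb + e n) D (gn n)) x)"
  unfolding sup[symmetric] using B by simp
 also have "... = (SUP n. RD (bb + e n) D (gn n) x) + (SUP n. en (bb - aa) * RD (aa + e n) D (RD (bb + e n) D (gn n)) x)"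
 proof (rule ennreal_SUP_add)
  show "incseq (%n. RD (bb + e n) D (gn n) x)" using inc[of bb] by (simp add: incle)
  show "incseq (%n. en (bb - aa) * RD (aa + e n) D (RD (bb + e n) D (gn n)) x)"
   unfolding incseq_def using e gn(1)
   by (intro allI impI mulL RD_mono_params) (auto simp: incle)
 qed
 also have "... = ?k"
  using aa by (simp add: sup two SUP_mult_left_ennreal)
 finally show "RD aa D g x = ?k" .
qed

end

section \<open>Resolvents as test functions, and identities for the exit operator\<close>

lemma closed_indicator_approx:
 fixes C :: "'a::metric_space set"
 assumes C: "closed C" "C ~= {}"
 shows "continuous_on UNIV (%y. max 0 (1 - real i * infdist y C))"
  and "(%i. en (max 0 (1 - real i * infdist y C))) ----> ix C y"
  and "max 0 (1 - real i * infdist y C) <= 1"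
proof -
 show "continuous_on UNIV (%y. max 0 (1 - real i * infdist y C))" by (intro continuous_intros)
 show "max 0 (1 - real i * infdist y C) <= 1" using infdist_nonneg[of y C] by simp
 show "(%i. en (max 0 (1 - real i * infdist y C))) ----> ix C y"
 proof (cases "y : C")
  case True
  hence "infdist y C = 0" by simp
  thus ?thesis using True by simp
 next
  case False
  hence p: "0 < infdist y C" using C in_closed_iff_infdist_zero[of C y] infdist_nonneg[of y C] by auto
  obtain N :: nat where N: "1 / infdist y C < real N" using reals_Archimedean2 by blast
  have "\<forall>\<^sub>F i in sequentially. en (max 0 (1 - real i * infdist y C)) = ix C y"
  proof (rule eventually_sequentiallyI)
   fix i assume "N <= i"
   hence "real N * infdist y C <= real i * infdist y C" using p by (intro mulR) auto
   moreover have "1 < real N * infdist y C" using N p by (simp add: field_simps)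
   ultimately show "en (max 0 (1 - real i * infdist y C)) = ix C y" using False by simp
  qed
  thus ?thesis by (rule tendsto_eventually)
 qed
qed

lemma sets_borel_closed: "sets borel = sigma_sets UNIV {C::'a::topological_space set. closed C}"
proof -
 have "(borel :: 'a measure) = sigma UNIV (Collect closed)" by (rule borel_eq_closed) 
 hence "sets (borel :: 'a measure) = sets (sigma UNIV (Collect closed))" by (rule arg_cong)
 thus ?thesis by simp
qed

lemma mfun_eq_closed:
 fixes L :: "('a::topological_space => ennreal) => ennreal"
 assumes L: "mfun L" "mfun M" and fin: "L (%_. 1) < iy" and cl: "!!C. closed C ==> L (ix C) = M (ix C)"
  and g: "g : BM"
 shows "L g = M g"
proof -
 obtain mm where mm: "sets mm = sets borel" "!!g. g : BM ==> L g = (NI mm (%y. g y))" using L(1) unfolding mfun_def by blast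
 obtain nu where nu: "sets nu = sets borel" "!!g. g : BM ==> M g = (NI nu (%y. g y))" using L(2) unfolding mfun_def by blast
 have "mm = nu"
 proof (rule measure_eqI_generator_eq[where E="{C. closed C}" and \<Omega>=UNIV and A="%_. UNIV"])
  show "Int_stable {C::'a set. closed C}" by (auto intro!: Int_stableI)
  show "sets mm = sigma_sets UNIV {C. closed C}" "sets nu = sigma_sets UNIV {C. closed C}" using mm nu sets_borel_closed by auto
  show "emeasure mm C = emeasure nu C" if "C : {C. closed C}" for C
  proof -
   have s: "C : sets borel" using that by simp
   hence "C : sets mm" "C : sets nu" using mm nu by auto
   thus ?thesis using cl[of C] that mm(2)[of "ix C"] nu(2)[of "ix C"] s by simp
  qed
  show "emeasure mm UNIV ~= iy" for i :: nat
   using fin mm(2)[of "%_. 1"] sets_eq_imp_space_eq[OF mm(1)] by auto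
 qed auto
 thus ?thesis using mm(2)[OF g] nu(2)[OF g] by simp
qed

context hunt
begin

lemma R_norm_le: "ph : BM ==> (!!y. ph y <= 1) ==> en (rs n) * R (1 + rs n) ph y <= 1"
proof -
 assume ph: "ph : BM" "!!y. ph y <= 1"
 have "R (1 + rs n) ph y <= 1 * en (1 / (1 + rs n))" by (rule R_bound[OF _ ph]) simp
 hence "en (rs n) * R (1 + rs n) ph y <= en (rs n) * en (1 / (1 + rs n))"
  by (intro mulL) (simp_all del: of_nat_Suc)
 also have "... = en (rs n * (1 / (1 + rs n)))" by (rule ennreal_mult[symmetric]) simp_all
 also have "... <= en 1" by (rule ennreal_leI) (simp add: field_simps)
 finally show ?thesis by simp
qed

lemma isCont_ennreal: "continuous_on UNIV f ==> isCont (%y. en (f y)) y" for f :: "'a => real"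
 unfolding continuous_at by (intro tendsto_ennrealI) (simp add: continuous_on_eq_continuous_at continuous_at)

text \<open>Resolvents of bounded functions approximate continuous functions, so they determine a measure.\<close>

lemma mfun_eq_R:
 assumes L: "mfun L" "mfun M" and fin: "L (%_. 1) < iy" "M (%_. 1) < iy"
  and eq: "!!ph n. ph : BM ==> (!!y. ph y <= 1) ==> L (R (1 + rs n) ph) = M (R (1 + rs n) ph)"
  and g: "g : BM"
 shows "L g = M g"
proof -
 let ?b = "%i y C. en (max 0 (1 - real i * infdist y C))"
 have cont: "L (%y. en (f y)) = M (%y. en (f y))" if f: "continuous_on UNIV f" "!!y. f y <= 1" for f :: "'a => real"
 proof -
  have [measurable]: "f : BM" using f(1) by (rule borel_measurable_continuous_onI)
  let ?h = "%n y. en (rs n) * R (1 + rs n) (%y. en (f y)) y"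
  have m: "?h n : BM" for n by measurable
  have f1: "en (f y) <= 1" for y using f(2)[of y] by (simp add: ennreal_le_1)
  have lim: "(%n. ?h n y) ----> en (f y)" for y
   by (rule resolvent_cont_lim) (use isCont_ennreal[OF f(1)] f1 in auto)
  have le: "?h n y <= 1" for n y by (rule R_norm_le[OF _ f1]) measurable
  have "(%n. L (?h n)) ----> L (%y. en (f y))"
   by (rule mfun_lim[OF L(1) m _ _ le fin(1) lim]) measurable
  moreover have "(%n. M (?h n)) ----> M (%y. en (f y))"
   by (rule mfun_lim[OF L(2) m _ _ le fin(2) lim]) measurable
  moreover have "L (?h n) = M (?h n)" for n
   using mfun_cmult[OF L(1), of "R (1 + rs n) (%y. en (f y))" "en (rs n)"]
    mfun_cmult[OF L(2), of "R (1 + rs n) (%y. en (f y))" "en (rs n)"]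
    eq[of "%y. en (f y)" n] f1 by (simp del: of_nat_Suc)
  ultimately show ?thesis using LIMSEQ_unique by fastforce
 qed
 have cl: "L (ix C) = M (ix C)" if C: "closed C" for C
 proof (cases "C = {}")
  case True
  hence "ix C = (%_::'a. 0::ennreal)" by auto
  thus ?thesis using mfun_zero[OF L(1)] mfun_zero[OF L(2)] by simp
 next
  case False
  note A = closed_indicator_approx[OF C False]
  have [measurable]: "(%y. max 0 (1 - real i * infdist y C)) : BM" for i
   by (rule borel_measurable_continuous_onI[OF A(1)])
  have [measurable]: "C : sets borel" using C by simp
  have le: "?b i y C <= 1" for i y using A(3) by (simp add: ennreal_le_1)
  have "(%i. L (%y. ?b i y C)) ----> L (ix C)"
   by (rule mfun_lim[OF L(1) _ _ _ le fin(1) A(2)]) measurable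
  moreover have "(%i. M (%y. ?b i y C)) ----> M (ix C)"
   by (rule mfun_lim[OF L(2) _ _ _ le fin(2) A(2)]) measurable
  ultimately show ?thesis using cont[OF A(1,3)] LIMSEQ_unique by fastforce
 qed
 show ?thesis by (rule mfun_eq_closed[OF L fin(1) cl g])
qed

text \<open>Measurability in the starting point need only be known on resolvents of bounded
  functions. It passes to continuous functions, to indicators of closed sets, by complements and
  disjoint unions to all Borel sets, and finally to all non-negative functions.\<close>

lemma kop_class:
 assumes mf: "!!x. mfun (%g. K g x)" and fin: "!!x. K (%_. 1) x < iy"
  and R: "!!ph n. ph : BM ==> (!!y. ph y <= 1) ==> K (R (1 + rs n) ph) : BM"
 shows "kop K"
proof -
 have cont: "K (%y. en (f y)) : BM" if f: "continuous_on UNIV f" "!!y. f y <= 1" for f :: "'a => real"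
 proof -
  have [measurable]: "f : BM" using f(1) by (rule borel_measurable_continuous_onI)
  have f1: "en (f y) <= 1" for y using f(2)[of y] by (simp add: ennreal_le_1)
  let ?h = "%n y. en (rs n) * R (1 + rs n) (%y. en (f y)) y"
  have m: "?h n : BM" for n by measurable
  have le: "?h n y <= 1" for n y by (rule R_norm_le[OF _ f1]) measurable
  show ?thesis
  proof (rule borel_measurable_LIMSEQ_order)
   fix x
   show "(%n. K (?h n) x) ----> K (%y. en (f y)) x"
    by (rule mfun_lim[OF mf m _ _ le fin]) (measurable, rule resolvent_cont_lim, use isCont_ennreal[OF f(1)] f1 in auto)
  next
   fix n
   have "K (?h n) = (%x. en (rs n) * K (R (1 + rs n) (%y. en (f y))) x)"
    by (rule ext, rule mfun_cmult[OF mf]) measurable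
   moreover have [measurable]: "K (R (1 + rs n) (%y. en (f y))) : BM" by (rule R[OF _ f1]) measurable
   ultimately show "K (?h n) : BM" by simp
  qed
 qed
 have cl: "K (ix C) : BM" if C: "closed C" for C
 proof (cases "C = {}")
  case True
  hence "ix C = (%_::'a. 0::ennreal)" by auto
  hence "K (ix C) = (%_. 0)" using mfun_zero[OF mf] by auto
  thus ?thesis by simp
 next
  case False
  note A = closed_indicator_approx[OF C False]
  have [measurable]: "(%y. max 0 (1 - real i * infdist y C)) : BM" for i
   by (rule borel_measurable_continuous_onI[OF A(1)])
  have [measurable]: "C : sets borel" using C by simp
  have le: "en (max 0 (1 - real i * infdist y C)) <= 1" for i y using A(3) by (simp add: ennreal_le_1)
  show ?thesis
  proof (rule borel_measurable_LIMSEQ_order)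
   show "(%i. K (%y. en (max 0 (1 - real i * infdist y C))) x) ----> K (ix C) x" for x
    by (rule mfun_lim[OF mf _ _ _ le fin A(2)]) measurable
  qed (rule cont[OF A(1,3)])
 qed
 have setm: "K (ix A) : BM" if "A : sets borel" for A
 proof -
  have "Int_stable {C::'a set. closed C}" "{C::'a set. closed C} <= Pow UNIV" "A : sigma_sets UNIV {C. closed C}"
   using that sets_borel_closed by (auto intro!: Int_stableI)
  thus ?thesis
  proof (induction rule: sigma_sets_induct_disjoint)
   case (basic A) thus ?case using cl by simp
  next
   case empty thus ?case using cl[of "{}"] by (simp only: closed_empty)
  next
   case (compl A)
   have s: "A : sets borel" using compl(1) sets_borel_closed by auto
   have "K (ix (UNIV - A)) = (%x. K (%_. 1) x - K (ix A) x)"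
   proof
    fix x
    have "K (%_. 1) x = K (%y. ix A y + ix (UNIV - A) y) x"
     by (rule arg_cong[where f="%h. K h x"]) (auto split: splix)
    also have "... = K (ix A) x + K (ix (UNIV - A)) x" by (rule mfun_add[OF mf]) (use s in auto)
    finally have e: "K (%_. 1) x = K (ix A) x + K (ix (UNIV - A)) x" .
    hence "K (ix A) x ~= iy" using fin[of x] by auto
    thus "K (ix (UNIV - A)) x = K (%_. 1) x - K (ix A) x" unfolding e by simp
   qed
   moreover have "K (%_. 1) : BM" using cl[of UNIV] by simp
   ultimately show ?case using compl.IH by simp
  next
   case (union A)
   have s: "A i : sets borel" for i using union(2) sets_borel_closed by auto
   have "K (ix (\<Union>i. A i)) = (%x. \<Sum>i. K (ix (A i)) x)"
   proof
    fix x
    obtain mm where mm: "sets mm = sets borel" "!!g. g : BM ==> K g x = (NI mm (%y. g y))" using mf[of x] unfolding mfun_def by blast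
    have "A i : sets mm" for i using s mm(1) by auto
    hence "(\<Sum>i. emeasure mm (A i)) = emeasure mm (\<Union>i. A i)" by (intro suminf_emeasure union(1)) auto
    thus "K (ix (\<Union>i. A i)) x = (\<Sum>i. K (ix (A i)) x)"
     using s mm by (simp add: sets.countable_UN)
   qed
   thus ?case using union.IH by simp
  qed
 qed
 have "K g : BM" if "g : BM" for g
  using that
 proof induction
  case (cong f g)
  hence "f = g" by auto
  thus ?case using cong by simp
 next
  case (set A) thus ?case by (rule setm)
 next
  case (mult u c)
  have "K (%y. c * u y) = (%x. c * K u x)" by (rule ext) (rule mfun_cmult[OF mf mult(2)])
  thus ?case using mult.IH by simp
 next
  case (add u v)
  have "K (%y. v y + u y) = (%x. K v x + K u x)" by (rule ext) (rule mfun_add[OF mf add(3,1)])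
  thus ?case using add.IH by simp
 next
  case (seq U)
  have "K (\<Squnion> range U) = (%x. SUP i. K (U i) x)"
  proof
   fix x
   have "(\<Squnion> range U) = (%y. SUP i. U i y)" by (rule ext) (simp add: image_comp)
   thus "K (\<Squnion> range U) x = (SUP i. K (U i) x)" using mfun_SUP[OF mf seq(1,3)] by simp
  qed
  moreover have "(%x. SUP i. K (U i) x) : BM" using seq.IH by measurable
  ultimately show ?case by (simp only:)
 qed
 thus ?thesis unfolding kop_def using mf by blast
qed

text \<open>The resolvent equation \<open>R gg ph = R aa (ph + (aa - gg) R gg ph)\<close>, with the
  difference split over both sides. It thus holds for either order of the rates and presents
  \<open>R gg ph\<close> in the form required by Dynkin's formula.\<close>

lemma R_repr:
 assumes aa: "0 < aa" and gg: "0 < gg" and [measurable]: "ph : BM" and ph1: "!!y. ph y <= 1"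
 shows "R gg ph y + R aa (%z. en gg * R gg ph z) y = R aa (%z. ph z + en aa * R gg ph z) y"
proof -
 note c = kop_cmult[OF kop_R R_measurable[OF assms(3)]]
 have b: "R aa (%z. ph z + en aa * R gg ph z) y = R aa ph y + en aa * R aa (R gg ph) y"
  by (subst kop_add[OF kop_R]) (measurable, simp add: c)
 consider "aa < gg" | "aa = gg" | "gg < aa" by linarith
 thus ?thesis
 proof cases
  case 1
  have "en gg * z = en (gg - aa) * z + en aa * z" for z
   using 1 aa by (simp add: distrib_right[symmetric] ennreal_plus[symmetric] del: ennreal_plus)
  thus ?thesis unfolding b c using resolvent_eq(1)[OF 1 assms(3), of y] by (simp add: add.assoc)
 next
  case 2
  thus ?thesis unfolding b c by simp
 next
  case 3
  have e: "en aa * z = en (aa - gg) * z + en gg * z" for z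
   using 3 gg by (simp add: distrib_right[symmetric] ennreal_plus[symmetric] del: ennreal_plus)
  show ?thesis unfolding b c resolvent_eq(2)[OF 3 assms(3), of y, symmetric] e[of "R gg (R aa ph) y"]
   using resolvent_eq(1)[OF 3 assms(3), of y] by (simp add: add.assoc)
 qed
qed

lemma dynkin_R:
 assumes D: "open D" and x: "x : D" and aa: "0 < aa" and gg: "0 < gg" and [measurable]: "ph : BM" and ph1: "!!y. ph y <= 1"
 shows "R gg ph x + RD aa D (%z. en gg * R gg ph z) x = RD aa D (%z. ph z + en aa * R gg ph z) x + HD aa D (R gg ph) x"
proof (rule dynkin_D[OF D x])
 show "R gg ph y + R aa (%z. en gg * R gg ph z) y = R aa (%z. ph z + en aa * R gg ph z) y" for y
  by (rule R_repr[OF aa gg assms(5) ph1])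
 have "R gg ph z <= 1 * en (1 / gg)" for z by (rule R_bound[OF gg _ ph1]) simp
 hence "en gg * R gg ph z <= en gg * en (1 / gg)" for z by (intro mulL) simp_all
 hence "en gg * R gg ph z <= 1" for z using gg by (simp add: ennreal_mult'[symmetric])
 thus "R aa (%z. en gg * R gg ph z) y <= 1 * en (1 / aa)" for y by (intro R_bound[OF aa]) measurable
qed (use aa in auto)

lemma RD_bound:
 assumes "0 < aa" "open D" "g : BM" "!!y. g y <= c" shows "RD aa D g x <= c * en (1 / aa)"
 using order_trans[OF occ_le_R R_bound[OF assms(1,3,4)]] by (simp add: RD_def)

lemma RD_finite:
 assumes "0 < aa" "open D" "g : BM" "!!y. g y <= c" "c < iy" shows "RD aa D g x ~= iy"
proof -
 have "RD aa D g x <= c * en (1 / aa)" by (rule RD_bound[OF assms(1-4)])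
 also have "... < iy" using assms(5) by (simp add: ennreal_mult_less_top)
 finally show ?thesis by simp
qed

lemma HD_bound: "0 <= aa ==> (!!y. g y <= c) ==> HD aa D g x <= c"
 unfolding HD_def using fin_bound[of aa g c] by simp

lemma R_gen_bounds:
 assumes gg: "0 < gg" and ph: "ph : BM" "!!y. ph y <= 1"
 shows "en gg * R gg ph z <= 1" and "R gg ph z <= en (1 / gg)"
proof -
 show 1: "R gg ph z <= en (1 / gg)" using R_bound[OF gg ph] by simp
 have "en gg * R gg ph z <= en gg * en (1 / gg)" by (rule mulL[OF 1]) simp
 thus "en gg * R gg ph z <= 1" using gg by (simp add: ennreal_mult'[symmetric])
qed

lemma HD_SUP_params:
 assumes D: "open D" and [measurable]: "!!n. h n : BM" and "incseq h" and "!!y. (SUP n. h n y) = g y"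
 shows "HD aa D g x = (SUP n. HD (aa + 1 / rs n) D (h n) x)"
 using fin_SUP_params[of "TD D" "%_. 1" h, where x=x and g=g and aa=aa] assms by (cases "x : D") (simp_all add: HD_TD fin_def HD_outside del: of_nat_Suc)

lemma HD_mono_params: "bb <= aa ==> (!!y. g y <= h y) ==> HD aa D g x <= HD bb D h x"
 unfolding HD_def fin_def
 by (auto intro!: nnmono mult_mono ennreal_leI mulR simp: ext0_def split: option.splits)

text \<open>For a resolvent, Dynkin's formula in \<open>D\<close> writes the exit term as a
  difference of terms already known to be measurable, with finite subtrahend;
  \<open>kop_class\<close> extends this to all functions.\<close>

lemma kop_HD:
 assumes D: "open D" and aa: "0 <= aa" shows "kop (HD aa D)"
proof -
 have pos: "kop (HD a D)" if a: "0 < a" for a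
 proof (rule kop_class)
  show "mfun (%g. HD a D g x)" for x by (rule mfun_HD[OF D])
  show "HD a D (%_. 1) x < iy" for x using HD_bound[of a "%_. 1" 1 D x] a by (auto intro: le_less_trans)
  fix ph :: "'a => ennreal" and n :: nat
  assume ph [measurable]: "ph : BM" and ph1: "!!y. ph y <= 1"
  let ?gg = "1 + rs n"
  have gg: "0 < ?gg" by simp
  let ?a = "%z. en ?gg * R ?gg ph z" and ?b = "%z. ph z + en a * R ?gg ph z"
  have [measurable]: "D : sets borel" using D by simp
  have mb: "?a : BM" "?b : BM" by measurable
  note [measurable] = RD_measurable[OF D less_imp_le[OF a] mb(1)] RD_measurable[OF D less_imp_le[OF a] mb(2)]
  have fin: "RD a D ?b x ~= iy" for x
  proof (rule RD_finite[OF a D])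
   show "?b y <= 1 + en a * en (1 / ?gg)" for y
    by (intro add_mono ph1 mulL R_gen_bounds[OF gg ph ph1]) simp
   show "1 + en a * en (1 / ?gg) < iy" by (simp add: ennreal_mult_less_top del: of_nat_Suc)
  qed measurable
  have "HD a D (R ?gg ph) = (%x. if x : D then R ?gg ph x + RD a D ?a x - RD a D ?b x else 0)"
  proof
   fix x
   show "HD a D (R ?gg ph) x = (if x : D then R ?gg ph x + RD a D ?a x - RD a D ?b x else 0)"
    using dynkin_R[OF D _ a gg ph ph1, of x] fin[of x] by (simp add: HD_outside del: of_nat_Suc)
  qed
  also have "... \<in> BM" by measurable
  finally show "HD a D (R ?gg ph) : BM" .
 qed
 have "HD aa D g : BM" if [measurable]: "g : BM" for g
 proof -
  have "HD aa D g = (%x. SUP n::nat. HD (aa + 1 / rs n) D g x)"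
   by (rule ext) (rule HD_SUP_params[OF D], auto)
  moreover have "HD (aa + 1 / rs n) D g : BM" for n
  proof -
   have "0 < aa + 1 / rs n" using aa by (intro add_nonneg_pos) auto
   thus ?thesis by (rule kopm[OF pos]) simp
  qed
  ultimately show ?thesis by simp
 qed
 thus ?thesis unfolding kop_def using mfun_HD[OF D] by blast
qed

lemma HD_RD_const:
 assumes D: "open D" and x: "x : D" and aa: "0 < aa"
 shows "RD aa D (%_. en aa) x + HD aa D (%_. 1) x = 1"
proof -
 have "1 + RD aa D (%_. 0) x = RD aa D (%_. en aa) x + HD aa D (%_. 1) x"
 proof (rule dynkin_D[OF D x])
  show "1 + R aa (%_. 0) y = R aa (%_. en aa) y" for y
   using aa by (simp add: R_const kop_zero[OF kop_R] ennreal_mult'[symmetric])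
  show "R aa (%_. 0) y <= 0" for y by (simp add: kop_zero[OF kop_R])
 qed (use aa in auto)
 thus ?thesis by (simp add: kop_zero[OF kop_RD[OF D less_imp_le[OF aa]]])
qed

lemma RD_cong:
 assumes D: "open D" and eq: "!!y. y : D ==> h y = k y" shows "RD a D h x = RD a D k x"
proof (cases "x : D")
 case True
 have "xt h (en t) ww * ix (bf (TD D ww)) t = xt k (en t) ww * ix (bf (TD D ww)) t"
  if "ww : Om" for t ww
 proof (cases "px t ww")
  case (Some y)
  show ?thesis
  proof (cases "y : D")
   case True
   thus ?thesis using Some eq by simp
  next
   case False
   hence "TD D ww <= en t" using Some by (intro TD_le[OF that]) auto
   thus ?thesis by (simp add: not_less)
  qed
 qed simp
 thus ?thesis unfolding RD_TD[OF D True] occ_def by (intro nncong) (simp add: mult.assoc space_law)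
qed (simp add: RD_outside)

text \<open>At positive rates both sides are finite measures, so it suffices to test them on
  resolvents of bounded functions. There Dynkin's formula at the two rates, together with the
  resolvent equation of \<open>RD\<close>, gives the identity after cancellation of finite
  terms.\<close>

lemma HD_resolvent:
 assumes D: "open D" and ab: "0 <= bb" "bb < aa" and g: "g : BM"
 shows "HD bb D g x = HD aa D g x + en (aa - bb) * RD aa D (HD bb D g) x"
proof (cases "x : D")
 let ?f = "%e g. SUP n. en (aa - bb) * RD (aa + e n) D (HD (bb + e n) D g) x"
 case x: True
 have pos: "HD b D g x = HD a D g x + en (a - b) * RD a D (HD b D g) x" if b: "0 < b" "b < a" and g: "g : BM" for a b g
 proof (rule mfun_eq_R[OF _ _ _ _ _ g])
  have a: "0 < a" using b by simp
  show "mfun (%g. HD b D g x)" by (rule mfun_HD[OF D])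
  show "mfun (%g. HD a D g x + en (a - b) * RD a D (HD b D g) x)"
   by (rule mfun_plus[OF mfun_HD[OF D] mfun_comp[OF mfun_RD[OF D] kop_HD[OF D less_imp_le[OF b(1)]]]])
  show "HD b D (%_. 1) x < iy" using HD_bound[of b "%_. 1" 1 D x] b by (auto intro: le_less_trans)
  have H1: "HD b D (%_. 1) y <= 1" for y using HD_bound[of b "%_. 1" 1 D y] b by simp
  have Hm: "HD b D h : BM" if "h : BM" for h
   by (rule kopm[OF kop_HD[OF D less_imp_le[OF b(1)]] that])
  show "HD a D (%_. 1) x + en (a - b) * RD a D (HD b D (%_. 1)) x < iy"
   using le_less_trans[OF HD_bound[of a "%_. 1" 1 D x], of iy] a RD_finite[OF a D Hm H1, where x=x] by (simp add: ennreal_mult_less_top less_top)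
  fix ph :: "'a => ennreal" and n :: nat
  assume ph [measurable]: "ph : BM" and ph1: "!!y. ph y <= 1"
  define gg where "gg = 1 + rs n"
  have gg: "0 < gg" unfolding gg_def by simp
  define w where "w = R gg ph"
  define l where "l = (%z. en gg * w z)"
  define p where "p c = (%z. ph z + en c * w z)" for c
  have [measurable]: "w : BM" "l : BM" "p c : BM" for c
   unfolding l_def p_def w_def by measurable
  note [measurable] = Hm
  have w1: "w z <= en (1 / gg)" and l1: "l z <= 1" for z
   unfolding w_def l_def using R_gen_bounds[OF gg ph ph1] by auto
  have p1: "p c z <= 1 + en c * en (1 / gg)" for c z
   unfolding p_def by (intro add_mono ph1 mulL w1) simp
  have fl: "RD c D l y ~= iy" and fp: "RD c D (p d) y ~= iy" and fw: "RD c D w y ~= iy" if "0 < c" for c d y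
   by (rule RD_finite[OF that D _ l1] RD_finite[OF that D _ p1] RD_finite[OF that D _ w1]; simp add: ennreal_mult_less_top)+
  have Db: "w y + RD b D l y = RD b D (p b) y + HD b D w y" if "y : D" for y
   unfolding w_def l_def p_def by (rule dynkin_R[OF D that b(1) gg ph ph1])
  have Da: "w x + RD a D l x = RD a D (p a) x + HD a D w x"
   unfolding w_def l_def p_def by (rule dynkin_R[OF D x a gg ph ph1])
  have ka: "kop (RD a D)" by (rule kop_RD[OF D less_imp_le[OF a]])
  have mRb: "RD b D h : BM" if "h : BM" for h by (rule RD_measurable[OF D less_imp_le[OF b(1)] that])
  note cong = RD_cong[OF D, of _ _ a x]
  \<comment> \<open>Dynkin's formula at rate \<open>b\<close> holds at every point of
    \<open>D\<close>, so \<open>RD a D\<close> can be applied to it.\<close>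
  have E1: "RD a D w x + RD a D (RD b D l) x = RD a D (RD b D (p b)) x + RD a D (HD b D w) x"
   using cong[of "%y. w y + RD b D l y" "%y. RD b D (p b) y + HD b D w y"] Db
   by (simp add: kop_add[OF ka] mRb Hm)
  let ?d = "en (a - b)"
  have comm: "RD a D (RD b D h) x = RD b D (RD a D h) x" and res: "RD b D h x = RD a D h x + ?d * RD a D (RD b D h) x" if "h : BM" for h
   using RD_resolvent[OF D less_imp_le[OF b(1)] b(2) that, of x] by auto
  have pa: "RD a D (p a) x = RD a D (p b) x + ?d * RD a D w x"
  proof -
   have "p a = (%z. p b z + ?d * w z)"
    unfolding p_def using b by (auto simp: add.assoc distrib_right[symmetric] ennreal_plus[symmetric] simp del: ennreal_plus)
   thus ?thesis by (simp add: kop_add[OF ka] kop_cmult[OF ka])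
  qed
  define Y where "Y = ?d * RD a D (HD b D w) x"
  have E2: "?d * RD a D w x + ?d * RD a D (RD b D l) x = ?d * RD a D (RD b D (p b)) x + Y"
   unfolding Y_def using arg_cong[OF E1, of "%z. ?d * z"] by (simp add: distrib_left)
  have "RD a D l x + RD b D (p b) x + (Y + HD a D w x) = RD a D l x + (RD a D (p b) x + ?d * RD a D (RD b D (p b)) x) + (Y + HD a D w x)"
   using res[of "p b"] by simp
  also have "... = RD a D l x + RD a D (p b) x + HD a D w x + (?d * RD a D (RD b D (p b)) x + Y)" by (simp only: ac_simps)
  also have "... = RD a D l x + RD a D (p b) x + HD a D w x + (?d * RD a D w x + ?d * RD a D (RD b D l) x)" unfolding E2 ..
  also have "... = (RD a D l x + ?d * RD a D (RD b D l) x) + ((RD a D (p b) x + ?d * RD a D w x) + HD a D w x)" by (simp only: ac_simps)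
  also have "... = RD b D l x + (w x + RD a D l x)" using res[of l] pa Da by simp
  also have "... = RD a D l x + (w x + RD b D l x)" by (simp only: ac_simps)
  also have "... = RD a D l x + RD b D (p b) x + HD b D w x" unfolding Db[OF x] by (simp only: ac_simps)
  finally have "RD a D l x + RD b D (p b) x + (Y + HD a D w x) = RD a D l x + RD b D (p b) x + HD b D w x" .
  moreover have "RD a D l x + RD b D (p b) x ~= iy" using fl[OF a] fp[OF b(1)] by simp
  ultimately have "Y + HD a D w x = HD b D w x" by (rule ennreal_cancel)
  thus "HD b D (R (1 + rs n) ph) x = HD a D (R (1 + rs n) ph) x + en (a - b) * RD a D (HD b D (R (1 + rs n) ph)) x"
   unfolding Y_def w_def gg_def by (simp only: add.commute)
 qed
 define e where "e n = 1 / rs n" for n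
 have e: "0 < e n" "j <= n ==> e n <= e j" for n j unfolding e_def by (auto simp: frac_le)
 have sup: "HD b D g y = (SUP n. HD (b + e n) D g y)" for b y
  unfolding e_def by (rule HD_SUP_params[OF D]) (use g in auto)
 have inc: "incseq (%n. HD (b + e n) D g)" for b
  unfolding incle using e by (intro allI impI HD_mono_params) auto
 have "HD bb D g x = (SUP n. HD (aa + e n) D g x + en (aa - bb) * RD (aa + e n) D (HD (bb + e n) D g) x)"
  unfolding sup[of bb x]
 proof (rule SUP_cong[OF refl])
  fix n
  have "0 < bb + e n" "bb + e n < aa + e n" using ab e(1)[of n] by auto
  thus "HD (bb + e n) D g x = HD (aa + e n) D g x + en (aa - bb) * RD (aa + e n) D (HD (bb + e n) D g) x"
   using pos[of "bb + e n" "aa + e n" g] g by simp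
 qed
 also have "... = (SUP n. HD (aa + e n) D g x) + (?f e g)"
 proof (rule ennreal_SUP_add)
  show "incseq (%n. HD (aa + e n) D g x)" using inc[of aa] by (simp add: incle)
  show "incseq (%n. en (aa - bb) * RD (aa + e n) D (HD (bb + e n) D g) x)"
   unfolding incseq_def using e by (intro allI impI mulL RD_mono_params HD_mono_params) auto
 qed
 also have "(?f e g) = en (aa - bb) * RD aa D (HD bb D g) x"
  unfolding SUP_mult_left_ennreal[symmetric] e_def
  by (subst RD_SUP_params[OF D, of "%n. HD (bb + 1 / rs n) D g" "HD bb D g"])
   (use inc[of bb] sup[of bb] ab in "auto simp: e_def simp del: of_nat_Suc intro!: kopm[OF kop_HD[OF D]] g")
 finally show ?thesis unfolding sup[of aa x] .
qed (simp add: HD_outside RD_outside)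

text \<open>The tower property for nested domains. On resolvents the exit term is expressed through
  \<open>RD\<close> by Dynkin's formula in either domain, and \<open>RD_nest\<close> compares the
  two; the function under the outer exit operator equals \<open>g\<close> off
  \<open>D\<close>.\<close>

lemma HD_nest:
 assumes D: "open D" and D': "open D'" "D' <= D" and x: "x : D'" and aa: "0 <= aa" and g: "g : BM"
 shows "HD aa D g x = HD aa D' (%y. if y : D then HD aa D g y else g y) x"
proof -
 have [measurable]: "D : sets borel" using D by simp
 have xD: "x : D" using x D' by auto
 have pos: "HD a D g x = HD a D' (%y. if y : D then HD a D g y else g y) x" if a: "0 < a" and g: "g : BM" for a g
 proof (rule mfun_eq_R[OF _ _ _ _ _ g])
  note kD = kop_HD[OF D less_imp_le[OF a]] and kD' = kop_HD[OF D'(1) less_imp_le[OF a]]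
  note ki = kop_if[OF kD]
  show "mfun (%g. HD a D g x)" by (rule kop_mfun[OF kD])
  show "mfun (%g. HD a D' (%y. if y : D then HD a D g y else g y) x)"
   by (rule mfun_comp[OF kop_mfun[OF kD'] ki]) simp
  show "HD a D (%_. 1) x < iy" using HD_bound[of a "%_. 1" 1 D x] a by (auto intro: le_less_trans)
  have "HD a D' (%y. if y : D then HD a D (%_. 1) y else 1) x <= 1"
   by (rule HD_bound) (use a HD_bound[of a "%_. 1" 1 D] in auto)
  thus "HD a D' (%y. if y : D then HD a D (%_. 1) y else 1) x < iy" by (auto intro: le_less_trans)
  fix ph :: "'a => ennreal" and n :: nat
  assume ph [measurable]: "ph : BM" and ph1: "!!y. ph y <= 1"
  define gg where "gg = 1 + rs n"
  have gg: "0 < gg" unfolding gg_def by simp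
  define w where "w = R gg ph"
  define l where "l = (%z. en gg * w z)"
  define p where "p = (%z. ph z + en a * w z)"
  have [measurable]: "w : BM" "l : BM" "p : BM"
   unfolding l_def p_def w_def by measurable
  have p1: "p z <= 1 + en a * en (1 / gg)" for z
   unfolding p_def w_def by (intro add_mono ph1 mulL R_gen_bounds[OF gg ph ph1]) simp
  have l1: "l z <= 1" for z unfolding l_def w_def by (rule R_gen_bounds[OF gg ph ph1])
  have fin: "1 + en a * en (1 / gg) < iy" by (simp add: ennreal_mult_less_top)
  have mR: "RD a D h : BM" if "h : BM" for h by (rule RD_measurable[OF D less_imp_le[OF a] that])
  have Dy: "w y + RD a D l y = RD a D p y + HD a D w y" if "y : D" for y
   unfolding w_def l_def p_def by (rule dynkin_R[OF D that a gg ph ph1])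
  have D'x: "w x + RD a D' l x = RD a D' p x + HD a D' w x"
   unfolding w_def l_def p_def by (rule dynkin_R[OF D'(1) x a gg ph ph1])
  define G where "G y = (if y : D then HD a D w y else w y)" for y
  have mG: "G : BM" unfolding G_def by (rule kopm[OF ki]) simp_all
  have eqG: "(%y. w y + RD a D l y) = (%y. RD a D p y + G y)"
   by (rule ext) (use Dy in "auto simp: G_def RD_outside")
  have nest: "RD a D h x = RD a D' h x + HD a D' (RD a D h) x" if "h : BM" for h
   by (rule RD_nest[OF D D' x less_imp_le[OF a] that])
  have H1: "HD a D' w x + HD a D' (RD a D l) x = HD a D' (RD a D p) x + HD a D' G x"
   using arg_cong[OF eqG, of "%h. HD a D' h x"] by (simp add: kop_add[OF kD'] mR mG)
  have "RD a D' p x + HD a D' (RD a D p) x + HD a D w x = w x + RD a D l x" using Dy[OF xD] nest[of p] by simp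
  also have "... = (w x + RD a D' l x) + HD a D' (RD a D l) x" using nest[of l] by (simp add: add.assoc)
  also have "... = RD a D' p x + (HD a D' w x + HD a D' (RD a D l) x)" unfolding D'x by (simp only: add.assoc)
  also have "... = RD a D' p x + HD a D' (RD a D p) x + HD a D' G x" unfolding H1 by (simp only: add.assoc)
  finally have e: "RD a D' p x + HD a D' (RD a D p) x + HD a D w x = RD a D' p x + HD a D' (RD a D p) x + HD a D' G x" .
  have "RD a D' p x + HD a D' (RD a D p) x = RD a D p x" using nest[of p] by simp
  hence "RD a D' p x + HD a D' (RD a D p) x ~= iy" using RD_finite[OF a D _ p1 fin, where x=x] by simp
  from ennreal_cancel[OF e this]
  show "HD a D (R (1 + rs n) ph) x = HD a D' (%y. if y : D then HD a D (R (1 + rs n) ph) y else R (1 + rs n) ph y) x"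
   unfolding G_def[abs_def] w_def gg_def .
 qed
 define e where "e n = 1 / rs n" for n
 have e: "0 < e n" "j <= n ==> e n <= e j" for n j unfolding e_def by (auto simp: frac_le)
 have sup: "HD aa D g y = (SUP n. HD (aa + e n) D g y)" for y
  unfolding e_def by (rule HD_SUP_params[OF D]) (use g in auto)
 have inc: "incseq (%n y. if y : D then HD (aa + e n) D g y else g y)"
  unfolding incle using e by (auto intro!: HD_mono_params)
 have "HD aa D g x = (SUP n. HD (aa + e n) D' (%y. if y : D then HD (aa + e n) D g y else g y) x)"
  unfolding sup[of x] using aa e by (intro SUP_cong[OF refl] pos[OF _ g]) (auto intro: add_nonneg_pos)
 also have "... = HD aa D' (%y. if y : D then HD aa D g y else g y) x"
  unfolding e_def
 proof (rule HD_SUP_params[OF D'(1), symmetric])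
  show "(%y. if y : D then HD (aa + 1 / rs n) D g y else g y) : BM" for n
   by (rule kopm[OF kop_if[OF kop_HD[OF D]]]) (use aa g in auto)
  show "incseq (%n y. if y : D then HD (aa + 1 / rs n) D g y else g y)" using inc unfolding e_def .
  show "(SUP n. if y : D then HD (aa + 1 / rs n) D g y else g y) = (if y : D then HD aa D g y else g y)" for y
   using sup[of y] unfolding e_def by simp
 qed
 finally show ?thesis .
qed

end

section \<open>Generators, jumps and the Ikeda-Watanabe formula\<close>

lemma ext0_ennreal: "ext0 (%y. en (f y)) z = en (ext0 f z)"
 by (cases z) auto

lemma C0_bounded: "g : C0 ==> \<exists>M>0. \<forall>y. \<bar>g y\<bar> <= M"
 unfolding C0_def bounded_pos by (auto simp: real_norm_def)

lemma C0_measurable: "g : C0 ==> g : BM"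
 unfolding C0_def by (auto intro: borel_measurable_continuous_onI)

lemma generates_unique: "generates S X f g ==> gen S X f = g"
 unfolding gen_def
proof (rule the_equality)
 fix h assume a: "generates S X f g" "generates S X f h"
 show "h = g"
 proof
  fix x
  show "h x = g x"
   using a unfolding generates_def
   by (intro tendsto_unique[OF trivial_limit_at_right_real tendsto_uniform_limitI tendsto_uniform_limitI]) auto
 qed
qed

context hunt
begin

lemma semigroup_nn:
 assumes [measurable]: "f : BM" and f: "!!y. 0 <= f y" "!!y. f y <= (1::real)"
 shows "en (semigroup X t f x) = (PI x (%ww. xt (%y. en (f y)) (en t) ww))"
  and "0 <= semigroup X t f x" "semigroup X t f x <= 1"
proof -
 interpret prob_space "P x" by (rule prob_law)
 have e: "0 <= ext0 f z" "ext0 f z <= 1" for z using f by (cases z; simp)+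
 have i: "integrable (P x) (%ww. xt f (en t) ww)"
  by (rule integrable_const_bound[where B=1]) (use e in auto)
 show "en (semigroup X t f x) = (PI x (%ww. xt (%y. en (f y)) (en t) ww))"
  unfolding semigroup_def ext0_ennreal using i e by (subst nn_integral_eq_integral) auto
 show "0 <= semigroup X t f x" "semigroup X t f x <= 1"
  unfolding semigroup_def using e i integral_mono[OF i, of "%_. 1"] by (auto simp: prob_space)
qed

lemma semigroup_measurable:
 assumes [measurable]: "f : BM" and f: "!!y. 0 <= f y" "!!y. f y <= (1::real)"
 shows "semigroup X t f : BM"
proof -
 have "(%x. NI (trans (en t) (Some x)) (%z. ext0 (%y. en (f y)) z)) : BM"
  using Some_measurable by measurable
 hence "(%x. en (semigroup X t f x)) : BM"
  by (simp add: semigroup_nn[OF assms] nn_integral_trans)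
 hence "(%x. enn2real (en (semigroup X t f x))) : BM" by measurable
 thus ?thesis by (simp add: semigroup_nn(2)[OF assms])
qed

lemma genD: "f : gen_dom S X ==> generates S X f (gen S X f)"
 unfolding gen_dom_def using generates_unique by fastforce

lemma gen_lim: "f : gen_dom S X ==> ((%t. (semigroup X t f x - f x) / t) \<longlongrightarrow> gen S X f x) (at_right 0)"
 by (rule tendsto_uniform_limitI[where S=UNIV]) (use genD[of f S] in "simp_all add: generates_def")

lemma R_shift:
 assumes [measurable]: "f : BM" and f: "!!y. 0 <= f y" "!!y. f y <= (1::real)" and h: "0 < h"
 shows "R aa (%y. en (f y)) x = (SI lborel {0..<h} (%s. xp aa s * en (semigroup X s f x)))
  + xp aa h * R aa (%y. en (semigroup X h f y)) x"
proof -
 let ?b = "%s x. xp aa s * en (semigroup X (h + s) f x) * ix {0..} s"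
 let ?d = "%y. en (semigroup X h f y)"
 let ?g = "%x. SI lborel {0..} (%s. xp aa s * en (semigroup X (h + s) f x))"
 let ?j = "%z. (NI (trans (en h) z) (%u. ext0 (%y. en (f y)) u))"
 let ?k = "%s x. NI (trans (en s) (Some x)) (%z. ext0 (%y. en (f y)) z)"
 note [measurable] = semigroup_measurable[OF assms(1) f]
 let ?F = "%s. xp aa s * en (semigroup X s f x)"
 have tr: "(?k s x) = en (semigroup X s f x)" for s x
  by (simp add: nn_integral_trans semigroup_nn[OF assms(1) f])
 have mt: "(%s. ?k s x) : BM"
  using trans_joint Some_measurable by measurable
 have mF [measurable]: "(%s. en (semigroup X s f x)) : BM" using mt unfolding tr .
 have "R aa (%y. en (f y)) x = (SI lborel {0..} (%s. ?F s))"
  by (subst R_eq_trans) (simp_all add: tr)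
 also have "... = (LI (%s. ?F s * ix {0..<h} s + ?F s * ix {h..} s))"
  using h by (intro nncong) (auto split: splix)
 also have "... = (SI lborel {0..<h} (%s. ?F s)) + (SI lborel {h..} (%s. ?F s))"
  by (rule nn_integral_add) measurable
 also have "(SI lborel {h..} (%s. ?F s)) = (LI (%s. ?F (h + 1 * s) * ix {h..} (h + 1 * s)))"
  by (subst nn_integral_real_affine[where c=1 and t=h]) auto
 also have "... = (LI (%s. xp aa h * (?b s x)))"
 proof (rule nncong)
  fix s :: real
  have "exp (- aa * (h + 1 * s)) = exp (- aa * h) * exp (- aa * s)" by (simp add: exp_add[symmetric] algebra_simps)
  hence e: "xp aa (h + 1 * s) = xp aa h * xp aa s" by (simp only: ennreal_mult' exp_ge_zero)
  have i: "(ix {h..} (h + 1 * s) :: ennreal) = ix {0..} s" by (simp add: indicator_def)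
  show "?F (h + 1 * s) * ix {h..} (h + 1 * s) = xp aa h * (?b s x)"
   unfolding e i by (simp only: mult.assoc mult_1)
 qed
 also have "... = xp aa h * (?g x)"
  by (rule nncmult) measurable
 also have "(?g x) = R aa ?d x"
 proof (subst R_eq_trans; (intro nncong)?)
  fix s :: real
  show "?b s x =
   xp aa s * (NI (trans (en s) (Some x)) (%z. ext0 ?d z)) * ix {0..} s"
  proof (cases "0 <= s")
   case True
   have "en (semigroup X (h + s) f x) = (NI (trans (en s) (Some x)) (%z. ?j z))"
    using True h by (subst trans_trans) (auto simp: tr[symmetric] ennreal_plus[symmetric] add.commute simp del: ennreal_plus)
   also have "... = (NI (trans (en s) (Some x)) (%z. ext0 ?d z))"
   proof (rule nncong)
    fix z :: "'a option"
    have "AE ww in law X None. px h ww = None"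
     using pos_0[of None] AE_space by eventually_elim (auto simp: space_law intro: pos_absorb[of _ 0])
    hence "(NI (trans (en h) None) (%u. ext0 (%y. en (f y)) u)) = 0"
     by (subst nn_integral_trans) (auto simp: nn_integral_0_iff_AE)
    thus "?j z = ext0 ?d z"
     by (cases z) (simp_all add: tr)
   qed
   finally show ?thesis by simp
  qed simp
 qed measurable
 finally show ?thesis .
qed

text \<open>\<open>f = R\<^sup>aa (aa f - A f)\<close>, by differentiating \<open>R_shift\<close> at \<open>h = 0\<close>.\<close>

lemma gen_resolvent:
 assumes dom: "f : gen_dom C0 X" and f: "!!y. 0 <= f y" "!!y. f y <= (1::real)" and aa: "0 < aa"
 shows "en (f x) + R aa (%y. en (gen C0 X f y)) x = R aa (%y. en aa * en (f y) + en (- gen C0 X f y)) x"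
proof -
 let ?i = "%s. exp (- aa * s) * semigroup X s f x"
 define A where "A = gen C0 X f"
 have gen: "f : C0" "A : C0" "uniform_limit UNIV (%t x. (semigroup X t f x - f x) / t) A (at_right 0)"
  using genD[OF dom] unfolding generates_def A_def by auto
 have mf [measurable]: "f : BM" and mA [measurable]: "A : BM"
  using gen by (auto intro: C0_measurable)
 obtain M where M: "0 < M" "!!y. \<bar>A y\<bar> <= M" using C0_bounded[OF gen(2)] by auto
 note sm [measurable] = semigroup_measurable[OF mf f] and sb = semigroup_nn(2,3)[OF mf f]
 have fin: "R aa (%y. en (g y)) x = en (enn2real (R aa (%y. en (g y)) x))" if [measurable]: "g : BM" and "!!y. g y <= c" for g c
 proof -
  have "R aa (%y. en (g y)) x <= en c * en (1 / aa)" by (rule R_bound[OF aa]) (auto intro: ennreal_leI that)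
  also have "... < \<top>" by (simp add: ennreal_mult_less_top)
  finally show ?thesis by simp
 qed
 define a where "a = enn2real (R aa (%y. en (f y)) x)"
 define g where "g = enn2real (R aa (%y. en (A y)) x)"
 define k where "k = enn2real (R aa (%y. en (- A y)) x)"
 define p where "p h = enn2real (R aa (%y. en (semigroup X h f y)) x)" for h
 define on where "on h = (SI lborel {0..<h} (%s. xp aa s * en (semigroup X s f x)))" for h
 define ob where "ob h = enn2real (on h)" for h
 have nn: "0 <= a" "0 <= g" "0 <= k" "0 <= p h" "0 <= ob h" for h unfolding a_def g_def k_def p_def ob_def by auto
 have ea: "R aa (%y. en (f y)) x = en a" unfolding a_def by (rule fin[OF mf f(2)])
 have eg: "R aa (%y. en (A y)) x = en g" unfolding g_def by (rule fin[OF mA]) (use M(2) abs_le_D1 in blast)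
 have ek: "R aa (%y. en (- A y)) x = en k" unfolding k_def by (rule fin) (measurable, use M(2) abs_le_D2 in blast)
 have ep: "R aa (%y. en (semigroup X h f y)) x = en (p h)" for h unfolding p_def by (rule fin[OF sm sb(2)])
 have shift: "a = ob h + exp (- aa * h) * p h" and eo: "on h = en (ob h)" if "0 < h" for h
 proof -
  have e: "en a = on h + xp aa h * en (p h)"
   unfolding on_def ea[symmetric] ep[symmetric] by (rule R_shift[OF mf f that])
  hence "on h ~= \<top>" by auto
  thus eo: "on h = en (ob h)" unfolding ob_def by (simp add: top.not_eq_extremum)
  have "en a = en (ob h) + en (exp (- aa * h) * p h)" using e nn(4)[of h] unfolding eo by (simp add: ennreal_mult)
  also have "... = en (ob h + exp (- aa * h) * p h)" by (rule ennreal_plus[symmetric]) (use nn in auto)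
  finally have "en a = en (ob h + exp (- aa * h) * p h)" .
  thus "a = ob h + exp (- aa * h) * p h" by (subst (asm) ennreal_inj) (use nn in auto)
 qed
 have unif: "\<forall>\<^sub>F h in at_right 0. 0 < h & (\<forall>y. \<bar>(semigroup X h f y - f y) / h - A y\<bar> < e)" if "0 < e" for e
  using uniform_limitD[OF gen(3) that] eventually_at_right_less[of "0::real"]
  by eventually_elim (auto simp: dist_real_def)
 have lim1: "((%h. (p h - a) / h) \<longlongrightarrow> g - k) (at_right 0)"
 proof (rule tendstoI)
  fix e :: real assume e: "0 < e"
  have "0 < e * aa / 2" using e aa by simp
  from unif[OF this] show "\<forall>\<^sub>F h in at_right 0. dist ((p h - a) / h) (g - k) < e"
  proof eventually_elim
   case (elim h)
   define d where "d = e * aa / 2"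
   have d: "0 < d" using e aa by (simp add: d_def)
   have b: "semigroup X h f y <= f y + h * A y + h * d" "f y + h * A y <= semigroup X h f y + h * d" for y
   proof -
    have "\<bar>semigroup X h f y - f y - h * A y\<bar> = h * \<bar>(semigroup X h f y - f y) / h - A y\<bar>"
     using elim by (simp add: abs_mult[symmetric] field_simps)
    also have "... <= h * d" using elim unfolding d_def by (intro mulL) (auto intro: less_imp_le)
    finally show "semigroup X h f y <= f y + h * A y + h * d" "f y + h * A y <= semigroup X h f y + h * d" by auto
   qed
   \<comment> \<open>The positive and negative parts of the derivative are put on opposite sides, so
     that a signed pointwise inequality becomes one between non-negative integrands.\<close>
   have pw: "en (u y) + en h * en (- b y) <= en (v y) + en h * en (b y) + en (h * d)"
    if "u y <= v y + h * b y + h * d" "0 <= u y" "0 <= v y" for u v b and y :: 'a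
   proof (cases "0 <= b y")
    case True
    thus ?thesis using that elim d by (auto simp: ennreal_neg ennreal_mult'[symmetric] simp flip: ennreal_plus intro!: ennreal_leI)
   next
    case False
    hence n: "0 <= h * - b y" using elim by (intro mult_nonneg_nonneg) auto
    have "en (u y) + en (h * - b y) <= en (v y) + en (h * d)"
     using that n elim d by (simp flip: ennreal_plus)
    moreover have "en (h * - b y) = en h * en (- b y)" by (rule ennreal_mult') (use elim in simp)
    ultimately show ?thesis using False by (simp add: ennreal_neg)
   qed
   have Rle: "en u' + en (h * bn) <= en v' + en (h * bp) + en (h * d / aa)"
    if [measurable]: "u : BM" "v : BM" "b : BM"
     and le: "!!y. u y <= v y + h * b y + h * d" and nn: "!!y. 0 <= u y" "!!y. 0 <= v y"
     and r: "R aa (%y. en (u y)) x = en u'" "R aa (%y. en (v y)) x = en v'" "R aa (%y. en (b y)) x = en bp" "R aa (%y. en (- b y)) x = en bn"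
    for u v b u' v' bp bn
   proof -
    have "R aa (%y. en (u y) + en h * en (- b y)) x <= R aa (%y. en (v y) + en h * en (b y) + en (h * d)) x"
     by (rule kop_mono[OF kop_R _ _ pw]) (use le nn in auto)
    moreover have "R aa (%y. en (u y) + en h * en (- b y)) x = en u' + en h * en bn"
     "R aa (%y. en (v y) + en h * en (b y) + en (h * d)) x = en v' + en h * en bp + en (h * d) * en (1 / aa)"
     by (simp_all add: kop_add[OF kop_R] kop_cmult[OF kop_R] R_const[OF aa] r)
    moreover have "en (h * z) = en h * en z" for z by (rule ennreal_mult') (use elim in simp)
    moreover have "en (h * d / aa) = en (h * d) * en (1 / aa)"
     using aa elim d by (simp add: ennreal_mult'[symmetric])
    ultimately show ?thesis by simp
   qed
   have "p h + h * k <= a + h * g + h * d / aa"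
    using Rle[OF sm mf mA b(1) sb(1) f(1) ep ea eg ek] elim nn d aa by (simp flip: ennreal_plus)
   moreover have "a + h * g <= p h + h * k + h * d / aa"
   proof -
    have "en a + en (h * g) <= en (p h) + en (h * k) + en (h * d / aa)"
    proof (rule Rle[OF mf sm _ _ f(1) sb(1) ea ep])
     show "f y <= semigroup X h f y + h * (- A y) + h * d" for y using b(2)[of y] by simp
     show "R aa (%y. en (- A y)) x = en k" "R aa (%y. en (- (- A y))) x = en g" using ek eg by simp_all
    qed measurable
    thus ?thesis using elim nn d aa by (simp flip: ennreal_plus)
   qed
   ultimately have "\<bar>p h - a - h * (g - k)\<bar> <= h * (d / aa)" by (simp add: algebra_simps abs_le_iff)
   hence "\<bar>(p h - a) / h - (g - k)\<bar> <= d / aa"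
    using elim by (simp add: field_simps abs_le_iff)
   also have "d / aa < e" using e aa by (simp add: d_def)
   finally show ?case by (simp add: dist_real_def)
  qed
 qed
 have p: "(p \<longlongrightarrow> a) (at_right 0)"
 proof -
  have "((%h. a + h * ((p h - a) / h)) \<longlongrightarrow> a + 0 * (g - k)) (at_right 0)" by (intro tendsto_intros lim1)
  moreover have "\<forall>\<^sub>F h in at_right 0. a + h * ((p h - a) / h) = p h"
   using eventually_at_right_less[of "0::real"] by eventually_elim simp
  ultimately have "(p \<longlongrightarrow> a + 0 * (g - k)) (at_right 0)" by (rule Lim_transform_eventually)
  thus ?thesis by simp
 qed
 have lim2: "((%h. ob h / h) \<longlongrightarrow> f x) (at_right 0)"
 proof (rule tendsto_sandwich)
  have sx: "\<forall>\<^sub>F h in at_right 0. \<forall>s. 0 < s --> s <= h --> \<bar>semigroup X s f x - f x\<bar> <= h * (M + 1)"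
  proof -
   obtain b where b: "0 < b" "!!s. 0 < s ==> s < b ==> \<bar>(semigroup X s f x - f x) / s - A x\<bar> < 1"
    using unif[of 1] unfolding eventually_at_right_field by auto
   have "\<bar>semigroup X s f x - f x\<bar> <= h * (M + 1)" if "0 < s" "s <= h" "h < b" for s h
   proof -
    have "\<bar>(semigroup X s f x - f x) / s\<bar> <= M + 1" using b(2)[of s] that M(2)[of x] by linarith
    hence "\<bar>semigroup X s f x - f x\<bar> <= s * (M + 1)" using that by (simp add: abs_le_iff field_simps)
    also have "... <= h * (M + 1)" using that M by (intro mulR) auto
    finally show ?thesis .
   qed
   thus ?thesis unfolding eventually_at_right_field using b(1) by (intro exI[of _ b]) auto
  qed
  have cst: "(SI lborel {0<..<h} (%s. en c)) = en (c * h)" if "0 < h" "0 <= c" for c h :: real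
   using that by (simp add: nn_integral_cmult_indicator ennreal_mult')
  have on': "on h = (SI lborel {0<..<h} (%s. en (?i s)))" for h
   unfolding on_def
  proof (rule nn_integral_cong_AE)
   show "AE s in lborel. xp aa s * en (semigroup X s f x) * ix {0..<h} s = en (?i s) * ix {0<..<h} s"
    using AE_lborel_singleton[of 0] by eventually_elim (auto simp: ennreal_mult' split: splix)
  qed
  show "\<forall>\<^sub>F h in at_right 0. ob h / h <= f x + h * (M + 1)"
   using sx eventually_at_right_less[of "0::real"]
  proof eventually_elim
   case (elim h)
   let ?c = "f x + h * (M + 1)"
   have c: "0 <= ?c" using f(1)[of x] elim M by simp
   have "on h <= (SI lborel {0<..<h} (%s. en ?c))"
    unfolding on'
   proof (rule nnmono)
    fix s
    have "?i s <= 1 * ?c" if "s : {0<..<h}"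
     using that elim sb(1)[of s x] aa by (intro mult_mono) (force simp: abs_le_iff)+
    thus "en (?i s) * ix {0<..<h} s <= en ?c * ix {0<..<h} s"
     by (auto split: splix intro!: ennreal_leI)
   qed
   hence "ob h <= ?c * h" using elim c by (simp add: eo cst)
   thus ?case using elim by (simp add: field_simps)
  qed
  show "\<forall>\<^sub>F h in at_right 0. f x - h * (M + 1) - aa * h <= ob h / h"
   using sx eventually_at_right_less[of "0::real"]
  proof eventually_elim
   case (elim h)
   let ?c = "f x - h * (M + 1) - aa * h"
   have "(SI lborel {0<..<h} (%s. en (max 0 ?c))) <= on h"
    unfolding on'
   proof (rule nnmono)
    fix s
    have "?c <= ?i s" if "s : {0<..<h}"
    proof -
     have "f x - h * (M + 1) <= semigroup X s f x" using that elim by (force simp: abs_le_iff)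
     moreover have "(1 - aa * s) * semigroup X s f x <= ?i s"
      using exp_ge_add_one_self[of "- aa * s"] sb(1) by (intro mulR) auto
     moreover have "aa * s * semigroup X s f x <= aa * h * 1"
      using that aa sb[of s x] by (intro mult_mono) auto
     ultimately show ?thesis by (simp add: algebra_simps)
    qed
    moreover have "0 <= ?i s" using sb(1) by simp
    ultimately show "en (max 0 ?c) * ix {0<..<h} s <= en (?i s) * ix {0<..<h} s"
     by (auto split: splix intro!: ennreal_leI)
   qed
   hence "en (max 0 ?c * h) <= en (ob h)" using elim by (subst (asm) cst) (simp_all add: eo)
   hence "max 0 ?c * h <= ob h" using nn by (subst (asm) ennreal_le_iff) auto
   moreover have "?c * h <= max 0 ?c * h" using elim by (intro mulR) auto
   ultimately show ?case using elim by (simp add: field_simps)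
  qed
  show "((%h. f x + h * (M + 1)) \<longlongrightarrow> f x) (at_right 0)" by (auto intro!: tendsto_eq_intros)
  show "((%h. f x - h * (M + 1) - aa * h) \<longlongrightarrow> f x) (at_right 0)" by (auto intro!: tendsto_eq_intros)
 qed
 \<comment> \<open>After division by \<open>h\<close>, the shift identity says that a sum of three
   difference quotients is 0 for every small \<open>h\<close>; its limit is the resolvent
   identity.\<close>
 have "((%h. (exp (- aa * h) - 1) / h) \<longlongrightarrow> - aa) (at_right 0)" using aa by real_asymp
 hence "((%h. ob h / h + (exp (- aa * h) - 1) / h * p h + (p h - a) / h) \<longlongrightarrow> f x + - aa * a + (g - k)) (at_right 0)"
  by (intro tendsto_intros lim1 lim2 p)
 moreover have "\<forall>\<^sub>F h in at_right 0. ob h / h + (exp (- aa * h) - 1) / h * p h + (p h - a) / h = 0"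
  using eventually_at_right_less[of "0::real"]
 proof eventually_elim
  case (elim h)
  have "ob h / h + (exp (- aa * h) - 1) / h * p h + (p h - a) / h = (ob h + exp (- aa * h) * p h - a) / h"
   using elim by (simp add: field_simps)
  thus ?case using shift[OF elim] by simp
 qed
 ultimately have "f x + - aa * a + (g - k) = 0"
  using tendsto_unique[OF trivial_limit_at_right_real _ tendsto_eventually] by blast
 hence "f x + g = aa * a + k" by simp
 hence "en (f x) + en g = en aa * en a + en k"
  using f nn aa by (simp add: ennreal_mult'[symmetric] flip: ennreal_plus)
 thus ?thesis unfolding A_def[symmetric] ea[symmetric] eg ek[symmetric]
  by (simp add: kop_add[OF kop_R] kop_cmult[OF kop_R])
qed

end

lemma mfun_mult:
 fixes L :: "('a::topological_space => ennreal) => ennreal"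
 assumes L: "mfun L" and q [measurable]: "q : BM"
 shows "mfun (%g. L (%y. q y * g y))"
proof (rule mfunI)
 show "L (%y. q y * (f y + g y)) = L (%y. q y * f y) + L (%y. q y * g y)" if [measurable]: "f : BM" "g : BM" for f g
  unfolding distrib_left by (rule mfun_add[OF L]) auto
 show "L (%y. q y * (c * g y)) = c * L (%y. q y * g y)" if [measurable]: "g : BM" for c g
  unfolding mult.left_commute[of _ c] by (rule mfun_cmult[OF L]) auto
 show "L (%y. q y * (SUP i. h i y)) = (SUP i. L (%y. q y * h i y))" if [measurable]: "!!i::nat. h i : BM" and "incseq h" for h
  unfolding SUP_mult_left_ennreal
  by (rule mfun_SUP[OF L]) (use that in "auto simp: incle intro!: mulL")
qed

lemma bumpD:
 assumes "f : bump m \<D> K D"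
 shows "f : \<D>" "!!x. x : K ==> f x = 1" "!!x. x ~: D ==> f x = 0" "!!x. 0 <= f x" "!!x. f x <= 1"
 using assms unfolding bump_def by auto

lemma compact_exhaust:
 fixes D :: "'a::heine_borel set" and z0 :: 'a
 assumes "closed D"
 defines "K \<equiv> (%n::nat. {y. dist z0 y <= real n & 1 / rs n <= infdist y D})"
 assumes "D ~= {}"
 shows "compact (K n)" "K n <= - D" "incseq K" "y ~: D ==> \<exists>n. y : K n"
proof -
 have e: "K n = cball z0 (real n) Int {y. 1 / rs n <= infdist y D}" for n unfolding K_def by auto
 have "closed {y. 1 / rs n <= infdist y D}" for n by (intro closed_Collect_le continuous_intros)
 thus "compact (K n)" unfolding e by (intro compact_Int_closed) simp_all
 have "infdist y D = 0" if "y : D" for y using that by simp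
 thus "K n <= - D" unfolding K_def by (auto simp del: of_nat_Suc)
 show "incseq K"
 proof (rule incseq_SucI)
  fix n
  have "1 / real (Suc (Suc n)) <= 1 / rs n" by (intro divide_left_mono) auto
  thus "K n <= K (Suc n)" unfolding K_def by (auto simp del: of_nat_Suc intro: order_trans)
 qed
 assume "y ~: D"
 hence p: "0 < infdist y D" using in_closed_iff_infdist_zero[OF assms(1,3), of y] infdist_nonneg[of y D] by auto
 obtain N :: nat where N: "max (dist z0 y) (1 / infdist y D) < real N" using reals_Archimedean2 by blast
 hence "1 < real N * infdist y D" using p by (simp add: field_simps)
 also have "... <= real (Suc N) * infdist y D" using p by (intro mulR) auto
 finally have "1 / real (Suc N) <= infdist y D" using p by (simp add: field_simps del: of_nat_Suc)
 thus "\<exists>n. y : K n" using N unfolding K_def by (intro exI[of _ N]) auto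
qed

locale levy = hunt X for X :: "('w, 'a::heine_borel) process" +
 fixes m :: "'a measure" and j :: "'a => 'a => real" and \<D> :: "('a => real) set"
 assumes sets_m [measurable_cong, simp]: "sets m = sets borel" and sigma_m: "sigma_finite_measure m"
  and j_joint: "(%(x, y). j x y) : bm (borel \<Otimes>\<^sub>M borel)"
  and lev: "levy_kernel X (%x. density m (%y. en (j x y)))"
  and j_pos: "!!x y. x ~= y ==> 0 < j x y"
  and dom: "\<D> <= gen_dom C0 X"
  and bump_ex: "!!K D. compact K ==> open D ==> K <= D ==> bump m \<D> K D ~= {}"
begin

lemma j_measurable [measurable]: "(%y. j x y) : BM"
 using mcomp[OF measurable_Pair1' j_joint, of x] by simp

lemma j_measurable2 [measurable (raw)]: "f : bm M ==> g : bm M ==> (%w. j (f w) (g w)) : bm M"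
 using mcomp[OF measurable_Pair j_joint, of f M g] by simp

lemma bump_gen: "f : bump m \<D> K D ==> f : gen_dom C0 X" using dom bumpD(1) by blast

lemma bump_C0: "f : bump m \<D> K D ==> f : C0" "f : bump m \<D> K D ==> gen C0 X f : C0"
 using genD[OF bump_gen] unfolding generates_def by auto

lemma bump_measurable: "f : bump m \<D> K D ==> f : BM" "f : bump m \<D> K D ==> gen C0 X f : BM"
 by (auto intro: C0_measurable bump_C0)

definition jop :: "('a => ennreal) => 'a => ennreal" where
 "jop g x = (NI m (%y. en (j x y) * g y))"

lemma kop_jop: "kop jop"
proof -
 interpret sigma_finite_measure m by (rule sigma_m)
 have "mfun (%g. jop g x)" for x
  unfolding mfun_def jop_def by (rule exI[of _ "density m (%y. en (j x y))"]) (auto simp: nn_integral_density)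
 moreover have "jop g : BM" if [measurable]: "g : BM" for g
  unfolding jop_def by measurable
 ultimately show ?thesis unfolding kop_def by auto
qed

lemma levy_lim:
 assumes "continuous_on UNIV f" "bounded (range f)" "x ~: closure {y. f y ~= 0}" and f: "!!y. 0 <= f y"
 shows "((%t. semigroup X t f x / t) \<longlongrightarrow> enn2real (jop (%y. en (f y)) x)) (at_right 0)"
  and "jop (%y. en (f y)) x < iy"
proof -
 have [measurable]: "f : BM" using assms(1) by (rule borel_measurable_continuous_onI)
 let ?J = "density m (%y. en (j x y))"
 have L: "integrable ?J f" "((%t. semigroup X t f x / t) \<longlongrightarrow> (\<integral>y. f y \<partial>?J)) (at_right 0)"
  using lev assms unfolding levy_kernel_def by auto
 have e: "jop (%y. en (f y)) x = en (\<integral>y. f y \<partial>?J)"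
  unfolding jop_def using nn_integral_eq_integral[OF L(1)] f by (simp add: nn_integral_density)
 show "jop (%y. en (f y)) x < iy" unfolding e by simp
 show "((%t. semigroup X t f x / t) \<longlongrightarrow> enn2real (jop (%y. en (f y)) x)) (at_right 0)"
  using L(2) f unfolding e by (simp add: integral_nonneg)
qed

text \<open>At a point off the closed support \<open>f x = 0\<close>, so the difference quotient of
  the generator is the semigroup divided by time, whose limit is the integral against the Levy
  kernel.\<close>

lemma gen_far:
 assumes f: "f : bump m \<D> K D" and x: "x ~: closure D"
 shows "en (gen C0 X f x) = jop (%y. en (f y)) x" "0 <= gen C0 X f x"
proof -
 have s: "{y. f y ~= 0} <= D" using bumpD(3)[OF f] by auto
 hence x': "x ~: closure {y. f y ~= 0}" using x closure_mono by blast
 hence "f x = 0" using closure_subset[of "{y. f y ~= 0}"] by blast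
 have C: "continuous_on UNIV f" "bounded (range f)" using bump_C0[OF f] unfolding C0_def by auto
 note L = levy_lim[OF C x' bumpD(4)[OF f]]
 have "gen C0 X f x = enn2real (jop (%y. en (f y)) x)"
  using tendsto_unique[OF trivial_limit_at_right_real gen_lim[OF bump_gen[OF f], of x]] L(1) `f x = 0` by simp
 thus "en (gen C0 X f x) = jop (%y. en (f y)) x" "0 <= gen C0 X f x" using L(2) by simp_all
qed

lemma dynkin_bump:
 assumes f: "f : bump m \<D> K U" and D: "open D" "x : D" and aa: "0 < aa"
 shows "en (f x) + RD aa D (%y. en (gen C0 X f y)) x
  = RD aa D (%y. en aa * en (f y) + en (- gen C0 X f y)) x + HD aa D (%y. en (f y)) x"
proof -
 note [measurable] = bump_measurable[OF f]
 obtain M where M: "!!y. \<bar>gen C0 X f y\<bar> <= M" using C0_bounded[OF bump_C0(2)[OF f]] by auto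
 show ?thesis
 proof (rule dynkin_D[OF D])
  show "en (f y) + R aa (%y. en (gen C0 X f y)) y = R aa (%y. en aa * en (f y) + en (- gen C0 X f y)) y" for y
   by (rule gen_resolvent[OF bump_gen[OF f] bumpD(4,5)[OF f] aa])
  show "R aa (%y. en (gen C0 X f y)) y <= en M * en (1 / aa)" for y
   by (rule R_bound[OF aa]) (use M in "auto intro!: ennreal_leI intro: abs_le_D1")
 qed (use aa in "auto simp: ennreal_mult_less_top")
qed

text \<open>For a bump function supported away from the closure of \<open>D\<close>, Dynkin's
  formula reduces to the claim: the function vanishes on \<open>D\<close>, and its generator there
  is \<open>jop\<close> of it. Bumps shrinking to a compact set give indicators, and an exhaustion
  of the complement of the closure gives all \<open>g\<close>.\<close>

theorem ikeda_watanabe: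
 assumes D: "open D" and aa: "0 <= aa" and g: "g : BM" and g0: "!!y. y : closure D ==> g y = 0"
 shows "HD aa D g x = RD aa D (jop g) x"
proof (cases "x : D")
 case x: True
 have pos: "HD a D g x = RD a D (jop g) x" if a: "0 < a" for a
 proof -
  let ?L = "%g. HD a D g x" and ?M = "%g. RD a D (jop g) x"
  have L: "mfun ?L" by (rule mfun_HD[OF D])
  have M: "mfun ?M" by (rule mfun_comp[OF mfun_RD[OF D] kop_jop])
  have bump: "?L (%y. en (f y)) = ?M (%y. en (f y))" if f: "f : bump m \<D> K U" and U: "closure U <= - closure D" for f K U
  proof -
   have U': "y ~: closure U" "y ~: U" if "y : D" for y using that U closure_subset[of D] closure_subset[of U] by auto
   have "RD a D (%y. en a * en (f y) + en (- gen C0 X f y)) x = RD a D (%_. 0) x"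
    by (rule RD_cong[OF D]) (use U' gen_far[OF f] bumpD(3)[OF f] in "simp add: ennreal_neg")
   also have "... = 0" by (rule kop_zero[OF kop_RD[OF D]]) (use a in simp)
   finally have z: "RD a D (%y. en a * en (f y) + en (- gen C0 X f y)) x = 0" .
   have "RD a D (%y. en (gen C0 X f y)) x = ?M (%y. en (f y))"
    by (rule RD_cong[OF D]) (rule gen_far(1)[OF f U'(1)])
   thus ?thesis using dynkin_bump[OF f D x a] bumpD(3)[OF f U'(2)[OF x]] by (simp add: z)
  qed
  have cpt: "?L (ix K) = ?M (ix K)" if K: "compact K" "K <= - closure D" for K
  proof (cases "K = {}")
   case True
   hence "ix K = (%_::'a. 0::ennreal)" by auto
   thus ?thesis using mfun_zero[OF L] mfun_zero[OF M] by simp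
  next
   case K0: False
   obtain e where e: "0 < e" "{y. infdist y K <= e} <= - closure D"
    using compact_in_open_separated[OF K0 K(1) _ K(2)] by auto
   define U where "U d = {y. infdist y K < d}" for d
   have oU: "open (U d)" for d unfolding U_def by (intro open_Collect_less continuous_intros)
   have cU: "closure (U d) <= {y. infdist y K <= d}" for d
    by (rule closure_minimal) (auto simp: U_def intro!: closed_Collect_le continuous_intros)
   define K1 where "K1 = {y. infdist y K <= e / 2}"
   have K1: "compact K1" unfolding K1_def by (rule compact_infdist_le[OF K0 K(1)]) (use e in auto)
   have "K1 <= U e" unfolding K1_def U_def using e by auto
   \<comment> \<open>One fixed bump, equal to 1 on a neighbourhood of \<open>K\<close> that carries
     all later bumps; it dominates them, with the same finite integral on both sides.\<close>
   then obtain f0 where f0: "f0 : bump m \<D> K1 (U e)" using bump_ex[OF K1 oU] by blast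
   define d where "d n = e / (2 * rs n)" for n
   have d: "0 < d n" "d n <= e / 2" for n unfolding d_def using e by (auto simp: field_simps)
   have "K <= U (d n)" for n unfolding U_def using d by auto
   hence "\<exists>f. f : bump m \<D> K (U (d n))" for n using bump_ex[OF K(1) oU] by blast
   then obtain f where f: "f n : bump m \<D> K (U (d n))" for n by metis
   have eqf: "?L (%y. en (f n y)) = ?M (%y. en (f n y))" for n
    by (rule bump[OF f]) (use cU[of "d n"] d(2)[of n] e in force)
   have eq0: "?L (%y. en (f0 y)) = ?M (%y. en (f0 y))"
    by (rule bump[OF f0]) (use cU[of e] e in force)
   have L0: "?L (%y. en (f0 y)) <= 1" by (rule HD_bound) (use a bumpD(5)[OF f0] in "auto simp: ennreal_le_1")
   hence fL: "?L (%y. en (f0 y)) < iy" by (rule le_less_trans) simp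
   note [measurable] = bump_measurable(1)[OF f] bump_measurable(1)[OF f0]
   have [measurable]: "K : sets borel" using K by (simp add: compact_imp_closed)
   have le: "en (f n y) <= en (f0 y)" for n y
   proof (cases "y : U (d n)")
    case True
    hence "y : K1" using d(2)[of n] unfolding U_def K1_def by auto
    thus ?thesis using bumpD(2)[OF f0] bumpD(5)[OF f] by (simp add: ennreal_le_1)
   next
    case False
    thus ?thesis using bumpD(3)[OF f] by simp
   qed
   have lim: "(%n. en (f n y)) ----> ix K y" for y
   proof (cases "y : K")
    case True
    thus ?thesis using bumpD(2)[OF f] by simp
   next
    case False
    hence p: "0 < infdist y K" using in_closed_iff_infdist_zero[OF compact_imp_closed[OF K(1)] K0, of y] infdist_nonneg[of y K] by auto
    have "d ----> 0" unfolding d_def by real_asymp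
    hence "\<forall>\<^sub>F n in sequentially. d n < infdist y K" using p by (rule order_tendstoD)
    hence "\<forall>\<^sub>F n in sequentially. en (f n y) = ix K y"
     by eventually_elim (use False bumpD(3)[OF f, of y] in "auto simp: U_def")
    thus ?thesis by (rule tendsto_eventually)
   qed
   have "(%n. ?L (%y. en (f n y))) ----> ?L (ix K)"
    by (rule mfun_lim[OF L _ _ _ le fL lim]) measurable
   moreover have "(%n. ?M (%y. en (f n y))) ----> ?M (ix K)"
    by (rule mfun_lim[OF M _ _ _ le fL[unfolded eq0] lim]) measurable
   ultimately show ?thesis unfolding eqf using LIMSEQ_unique by blast
  qed
  have ne: "closure D ~= {}" using x by auto
  note ex = compact_exhaust[OF closed_closure[of D] ne, where ?z0.0=x]
  define K where "K n = {y. dist x y <= real n & 1 / rs n <= infdist y (closure D)}" for n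
  note ex = ex[folded K_def]
  have [measurable]: "K n : sets borel" for n using ex(1) by (simp add: compact_imp_closed)
  note [measurable] = g
  have n: "?L (%y. ix (K n) y * g y) = ?M (%y. ix (K n) y * g y)" for n
  proof (rule mfun_eq_closed[OF mfun_mult[OF L] mfun_mult[OF M] _ _ g])
   have "?L (%y. ix (K n) y * 1) <= 1" by (rule HD_bound) (use a in "auto split: splix")
   thus "?L (%y. ix (K n) y * 1) < iy" by (rule le_less_trans) simp
   fix C :: "'a set" assume "closed C"
   hence "compact (K n Int C)" "K n Int C <= - closure D" using ex(1,2)[of n] by (auto intro: compact_Int_closed)
   thus "?L (%y. ix (K n) y * ix C y) = ?M (%y. ix (K n) y * ix C y)"
    using cpt[of "K n Int C"] by (simp only: indicator_inter_arith[symmetric] eta_contract_eq)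
  qed simp_all
  have inc: "incseq (%n y. ix (K n) y * g y)"
   using ex(3) by (auto simp: incle split: splix)
  have sup: "(SUP n. ix (K n) y * g y) = g y" for y
  proof (cases "y : closure D")
   case False
   then obtain n where "y : K n" using ex(4) by blast
   hence "g y <= (SUP n. ix (K n) y * g y)" by (intro SUP_upper2[of n]) auto
   moreover have "(SUP n. ix (K n) y * g y) <= g y" by (intro SUP_least) (auto split: splix)
   ultimately show ?thesis by simp
  qed (simp add: g0)
  have "?L g = (SUP n. ?L (%y. ix (K n) y * g y))"
   using mfun_SUP[OF L _ inc] by (simp add: sup)
  moreover have "?M g = (SUP n. ?M (%y. ix (K n) y * g y))"
   using mfun_SUP[OF M _ inc] by (simp add: sup)
  ultimately show ?thesis unfolding n by simp
 qed
 have ps: "0 < aa + 1 / rs n" for n using aa by (intro add_nonneg_pos) auto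
 have "HD aa D g x = (SUP n. HD (aa + 1 / rs n) D g x)" by (rule HD_SUP_params[OF D]) (use g in auto)
 also have "... = (SUP n. RD (aa + 1 / rs n) D (jop g) x)" unfolding pos[OF ps] ..
 also have "... = RD aa D (jop g) x"
  by (rule RD_SUP_params[OF D, symmetric]) (use kopm[OF kop_jop g] in auto)
 finally show ?thesis .
qed (simp add: HD_outside RD_outside)

text \<open>By conservativeness the semigroup fixes the constant 1, so the generator of
  \<open>1 - f\<close> is minus that of \<open>f\<close>. This connects (B2-a) and (B2-b),
  formulated in \<open>C_inf\<close>, with \<open>C0\<close>, in which \<open>gen_resolvent\<close>
  and Dynkin's formula are available.\<close>

lemma generates_C_inf:
 assumes "f : gen_dom C0 X"
 shows "gen C_inf X f = gen C0 X f" and "gen C_inf X (%y. 1 - f y) = (%y. - gen C0 X f y)"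
  and "(%y. 1 - f y) : gen_dom C_inf X"
proof -
 have C: "g : C_inf" if "g : C0" for g :: "'a => real" using that unfolding C0_def C_inf_def by auto
 note g = genD[OF assms, unfolded generates_def]
 have "generates C_inf X f (gen C0 X f)" using g C unfolding generates_def by auto
 thus "gen C_inf X f = gen C0 X f" by (rule generates_unique)
 have c: "continuous_on UNIV f" "continuous_on UNIV (gen C0 X f)" "(f \<longlongrightarrow> 0) cocompact" "(gen C0 X f \<longlongrightarrow> 0) cocompact"
  using g unfolding C0_def by auto
 have "generates C_inf X (%y. 1 - f y) (%y. - gen C0 X f y)"
  unfolding generates_def
 proof (intro conjI)
  show "(%y. 1 - f y) : C_inf" unfolding C_inf_def using c
   by (auto intro!: continuous_intros exI[of _ "1 - 0"] tendsto_intros)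
  show "(%y. - gen C0 X f y) : C_inf" unfolding C_inf_def using c
   by (auto intro!: continuous_intros exI[of _ "- 0"] tendsto_intros)
  have sg: "semigroup X t (%y. 1 - f y) x = 1 - semigroup X t f x" if "0 < t" for t x
  proof -
   interpret PS: prob_space "P x" by (rule prob_law)
   have [measurable]: "f : BM" using g by (auto intro: C0_measurable)
   obtain M where M: "0 < M" "!!y. \<bar>f y\<bar> <= M" using C0_bounded g by blast
   have i: "integrable (P x) (%ww. xt f (en t) ww)"
   proof (rule PS.integrable_const_bound[where B=M])
    have "norm (ext0 f z) <= M" for z using M by (cases z) (auto intro: less_imp_le)
    thus "AE ww in P x. norm (xt f (en t) ww) <= M" by simp
   qed measurable
   have "semigroup X t (%y. 1 - f y) x = (\<integral>ww. 1 - xt f (en t) ww \<partial>P x)"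
    unfolding semigroup_def
   proof (rule integral_cong_AE)
    show "AE ww in P x. xt (%y. 1 - f y) (en t) ww = 1 - xt f (en t) ww"
     using AE_alive
    proof eventually_elim
     case (elim ww)
     thus ?case using spec[OF elim, of "en t"] by (cases "px t ww") (auto simp: less_top)
    qed
   qed measurable
   also have "... = 1 - semigroup X t f x" unfolding semigroup_def using i by (simp add: PS.prob_space)
   finally show ?thesis .
  qed
  have ul: "uniform_limit UNIV (%t x. - ((semigroup X t f x - f x) / t)) (%y. - gen C0 X f y) (at_right 0)"
   using g by (intro uniform_limit_intros) auto
  show "uniform_limit UNIV (%t x. (semigroup X t (%y. 1 - f y) x - (1 - f x)) / t) (%y. - gen C0 X f y) (at_right 0)"
  proof (rule uniform_limit_cong[THEN iffD1, OF _ _ ul])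
   show "\<forall>\<^sub>F t in at_right 0. \<forall>x\<in>UNIV. - ((semigroup X t f x - f x) / t) = (semigroup X t (%y. 1 - f y) x - (1 - f x)) / t"
    using eventually_at_right_less[of "0::real"] by eventually_elim (simp add: sg field_simps)
  qed simp
 qed
 thus "gen C_inf X (%y. 1 - f y) = (%y. - gen C0 X f y)" "(%y. 1 - f y) : gen_dom C_inf X"
  by (auto intro: generates_unique simp: gen_dom_def)
qed

text \<open>Maximum principle: the semigroup of \<open>f\<close> is at most 1, the value of
  \<open>f\<close> at \<open>x\<close>.\<close>

lemma gen_max:
 assumes f: "f : bump m \<D> K U" and x: "f x = 1" shows "gen C0 X f x <= 0"
proof (rule tendsto_upperbound[OF gen_lim[OF bump_gen[OF f]]])
 show "\<forall>\<^sub>F t in at_right 0. (semigroup X t f x - f x) / t <= 0"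
  using eventually_at_right_less[of "0::real"]
  by eventually_elim (use semigroup_nn(3)[OF bump_measurable(1)[OF f] bumpD(4,5)[OF f]] x in "auto simp: divide_le_0_iff")
qed simp

end

section \<open>Duality of killed potentials\<close>

lemma neu_shift:
 assumes R: "kop R" and [measurable]: "q : BM" "g : BM"
 shows "neu R q g (Suc j) x = R g x + neu R q (%y. q y * R g y) j x"
proof -
 have [measurable]: "R g : BM" by (rule kopm[OF R]) simp
 have [measurable]: "neu R q (%y. q y * R g y) j : BM" for j by (rule neu_measurable[OF R]) measurable
 show ?thesis
 proof (induction j arbitrary: x)
  case 0
  show ?case by simp
 next
  case (Suc j)
  have "neu R q g (Suc (Suc j)) x = R (%y. g y + (q y * R g y + q y * neu R q (%y. q y * R g y) j y)) x"
   unfolding neu.simps(2)[of R q g "Suc j"] Suc.IH by (simp only: distrib_left)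
  also have "... = R g x + R (%y. q y * R g y + q y * neu R q (%y. q y * R g y) j y) x"
   by (rule kop_add[OF R]) measurable
  finally show ?case by simp
 qed
qed

text \<open>The series for \<open>R\<close> is opened from the inside by \<open>neu_shift\<close>,
  that for \<open>S\<close> from the outside by its recursion; at each step one factor
  \<open>q\<close> changes sides.\<close>

lemma neu_dual:
 assumes R: "kop R" and S: "kop S" and m [measurable_cong]: "sets m = sets borel"
  and dual: "!!f g. f : BM ==> g : BM ==> (NI m (%x. f x * R g x)) = (NI m (%x. S f x * g x))"
  and q [measurable]: "q : BM" and f: "f : BM" and g: "g : BM"
 shows "(NI m (%x. f x * neu R q g j x)) = (NI m (%x. neu S q f j x * g x))"
 using g
proof (induction j arbitrary: g)
 case 0
 thus ?case by simp
next
 case (Suc j)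
 note [measurable] = Suc.prems f kopm[OF R] kopm[OF S] neu_measurable[OF R] neu_measurable[OF S]
 have "(NI m (%x. f x * neu R q g (Suc j) x)) = (NI m (%x. f x * R g x + f x * neu R q (%y. q y * R g y) j x))"
  unfolding neu_shift[OF R q Suc.prems] distrib_left ..
 also have "... = (NI m (%x. f x * R g x)) + (NI m (%x. f x * neu R q (%y. q y * R g y) j x))"
  by (rule nn_integral_add) measurable
 also have "(NI m (%x. f x * neu R q (%y. q y * R g y) j x)) = (NI m (%x. (q x * neu S q f j x) * R g x))"
  by (subst Suc.IH) (simp_all add: mult.assoc mult.left_commute)
 also have "... = (NI m (%x. S (%x. q x * neu S q f j x) x * g x))" by (rule dual) measurable
 also have "(NI m (%x. f x * R g x)) = (NI m (%x. S f x * g x))" by (rule dual) measurable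
 also have "(NI m (%x. S f x * g x)) + (NI m (%x. S (%x. q x * neu S q f j x) x * g x)) = (NI m (%x. S f x * g x + S (%x. q x * neu S q f j x) x * g x))"
  by (rule nn_integral_add[symmetric]) measurable
 also have "... = (NI m (%x. neu S q f (Suc j) x * g x))"
  by (simp add: kop_add[OF S] distrib_right)
 finally show ?case .
qed

lemma nlim_dual:
 assumes R: "kop R" and S: "kop S" and m [measurable_cong]: "sets m = sets borel"
  and dual: "!!f g. f : BM ==> g : BM ==> (NI m (%x. f x * R g x)) = (NI m (%x. S f x * g x))"
  and q [measurable]: "q : BM" and f [measurable]: "f : BM" and g [measurable]: "g : BM"
 shows "(NI m (%x. f x * nlim R q g x)) = (NI m (%x. nlim S q f x * g x))"
proof -
 note [measurable] = neu_measurable[OF R] neu_measurable[OF S]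
 have "(NI m (%x. f x * nlim R q g x)) = (SUP j. NI m (%x. f x * neu R q g j x))"
  unfolding nlim_def SUP_mult_left_ennreal
  using neu_incseq[OF R q g] by (intro mctSUP) (auto simp: incle intro!: mulL)
 also have "... = (SUP j. NI m (%x. neu S q f j x * g x))" by (simp add: neu_dual[OF assms])
 also have "... = (NI m (%x. nlim S q f x * g x))"
  unfolding nlim_def SUP_mult_right_ennreal
  using neu_incseq[OF S q f] by (intro mctSUP[symmetric]) (auto simp: incle intro!: mulR)
 finally show ?thesis .
qed

locale dualp = hunt X + Y: hunt Y for X :: "('w, 'a::heine_borel) process" and Y :: "('v, 'a) process" +
 fixes m :: "'a measure"
 assumes sets_m [measurable_cong, simp]: "sets m = sets borel" and sigma_m: "sigma_finite_measure m"
  and dual: "strong_dual m X Y"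
begin

lemma space_m [simp]: "space m = UNIV" using sets_eq_imp_space_eq[OF sets_m] by simp

lemma res_dual: "0 < aa ==> f : BM ==> g : BM ==> (NI m (%x. f x * R aa g x)) = (NI m (%x. Y.R aa f x * g x))"
 using dual unfolding strong_dual_def by auto

lemma sym: "dualp Y X m"
proof unfold_locales
 have "(NI m (%x. f x * Y.R aa g x)) = (NI m (%x. R aa f x * g x))"
  if "0 < aa" "f : BM" "g : BM" for aa f g
 proof -
  have "(NI m (%x. f x * Y.R aa g x)) = (NI m (%x. Y.R aa g x * f x))" by (simp only: mult.commute)
  also have "... = (NI m (%x. g x * R aa f x))" by (rule res_dual[symmetric, OF that(1,3,2)])
  finally show ?thesis by (simp only: mult.commute)
 qed
 thus "strong_dual m Y X" using dual unfolding strong_dual_def by blast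
next
 show "sets m = sets borel" by (rule sets_m)
 show "\<exists>A. countable A & A <= sets m & \<Union> A = space m & (\<forall>a\<in>A. emeasure m a ~= iy)"
  by (rule sigma_finite_measure.sigma_finite_countable[OF sigma_m])
qed

lemma kill_dual:
 assumes aa: "0 < aa" "0 < N" "open U" and fg: "f : BM" "g : BM"
 shows "(NI m (%x. f x * kill aa U N g x)) = (NI m (%x. Y.kill aa U N f x * g x))"
 unfolding kill_def Y.kill_def
proof (rule nlim_dual[OF kop_R Y.kop_R sets_m _ _ fg])
 have [measurable]: "U : sets borel" using aa by simp
 show "(%y. en N * ix (- U) y) : BM" by measurable
 show "(NI m (%x. f x * R (aa + N) g x)) = (NI m (%x. Y.R (aa + N) f x * g x))" if "f : BM" "g : BM" for f g
  by (rule res_dual[OF _ that]) (use aa in simp)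
qed

lemma R_ac:
 assumes g: "g : BM" and a: "AE y in m. g y = 0" and aa: "0 < aa"
 shows "R aa g x = 0"
proof -
 let ?N = "{y. g y ~= 0}"
 have s [measurable]: "?N : sets borel" using g by measurable
 have N: "?N : null_sets m" using a AE_iff_null_sets[of ?N m] s by simp
 hence "R aa (ix ?N) x = 0" using dual aa unfolding strong_dual_def by blast
 hence "R aa (%y. iy * ix ?N y) x = 0" by (subst kop_cmult[OF kop_R]) simp_all
 moreover have "R aa g x <= R aa (%y. iy * ix ?N y) x"
  by (rule kop_mono[OF kop_R g]) (auto split: splix)
 ultimately show ?thesis by simp
qed

lemma RD_ac:
 assumes D: "open D" and aa: "0 <= aa" and g: "g : BM" and a: "AE y in m. y : D --> g y = 0"
 shows "RD aa D g x = 0"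
proof -
 have [measurable]: "D : sets borel" using D by simp
 note [measurable] = g
 define h where "h y = g y * ix D y" for y
 have h [measurable]: "h : BM" unfolding h_def by measurable
 have "RD b D h x = 0" if "0 < b" for b
 proof -
  have "RD b D h x <= R b h x" unfolding RD_def using occ_le_R by simp
  also have "... = 0" by (rule R_ac[OF h _ that]) (use a in "auto simp: h_def split: splix")
  finally show ?thesis by simp
 qed
 moreover have "0 < aa + 1 / rs n" for n using aa by (intro add_nonneg_pos) auto
 moreover have "RD aa D h x = (SUP n. RD (aa + 1 / rs n) D h x)" by (rule RD_SUP_params[OF D]) (auto simp: h)
 ultimately have "RD aa D h x = 0" by simp
 moreover have "RD aa D g x = RD aa D h x" by (rule RD_cong[OF D]) (simp add: h_def)
 ultimately show ?thesis by simp
qed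

lemma RD_mono_AE:
 assumes D: "open D" and aa: "0 <= aa" and g [measurable]: "g : BM" and h [measurable]: "h : BM"
  and a: "AE y in m. y : D --> g y <= h y"
 shows "RD aa D g x <= RD aa D h x"
proof -
 let ?n = "%y. if g y <= h y then 0 else g y"
 have "RD aa D g x <= RD aa D (%y. h y + ?n y) x" by (intro kop_mono[OF kop_RD[OF D aa]]) auto
 also have "... = RD aa D h x + RD aa D ?n x" by (rule kop_add[OF kop_RD[OF D aa]]) measurable
 also have "RD aa D ?n x = 0" by (rule RD_ac[OF D aa]) (use a in auto)
 finally show ?thesis by simp
qed

text \<open>Hunt's switching identity for an open set. At each finite killing rate it is the duality
  of the Neumann series; boundedness and integrability of \<open>f\<close> and \<open>g\<close>
  permit dominated convergence as the rate tends to infinity.\<close>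

lemma hitA_dual:
 assumes aa: "0 < aa" and U: "open U" and f [measurable]: "f : BM" and g [measurable]: "g : BM"
  and b: "!!y. f y <= en c" "!!y. g y <= en c" "0 <= c" and i: "(NI m (%y. f y)) < iy" "(NI m (%y. g y)) < iy"
 shows "(NI m (%x. f x * occ aa (hitA 0 U) g x)) = (NI m (%x. Y.occ aa (Y.hitA 0 U) f x * g x))"
proof -
 have lim: "(%n. NI m (%x. f x * k n x)) ----> (NI m (%x. f x * l x))"
  if [measurable]: "f : BM" "!!n. k n : BM" "l : BM"
   and "(NI m (%y. f y)) < iy" and k: "!!n x. k n x <= en (c / aa)" and kl: "!!x. (%n. k n x) ----> l x" and fc: "!!x. f x <= en c" for f l and k :: "nat => 'a => ennreal"
 proof (rule nn_integral_dominated_convergence[where w="%x. en (c / aa) * f x"])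
  show "(NI m (%x. en (c / aa) * f x)) < iy" using that(4) by (simp add: nncmult ennreal_mult_less_top)
  show "AE x in m. f x * k n x <= en (c / aa) * f x" for n
  proof (rule AE_I2)
   fix x show "f x * k n x <= en (c / aa) * f x" using mulL[OF k[of n x], of "f x"] by (simp add: mult.commute)
  qed
  show "AE x in m. (%n. f x * k n x) ----> f x * l x"
  proof (intro AE_I2 ennreal_tendsto_cmult kl)
   fix x show "f x < \<top>" using fc[of x] by (auto intro: le_less_trans)
  qed
 qed measurable
 have "(%n. NI m (%x. f x * kill aa U (rs n) g x)) ----> (NI m (%x. f x * occ aa (hitA 0 U) g x))"
  by (rule lim[OF f kill_measurable[OF aa _ U g b(2,3)] occ_hitA_measurable[OF aa U g b(2,3)] i(1) kill_bound[OF aa _ U g b(2,3)] kill_tendsto[OF aa U g b(2,3)] b(1)]) simp_all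
 moreover have "(%n. NI m (%x. g x * Y.kill aa U (rs n) f x)) ----> (NI m (%x. g x * Y.occ aa (Y.hitA 0 U) f x))"
  by (rule lim[OF g Y.kill_measurable[OF aa _ U f b(1,3)] Y.occ_hitA_measurable[OF aa U f b(1,3)] i(2) Y.kill_bound[OF aa _ U f b(1,3)] Y.kill_tendsto[OF aa U f b(1,3)] b(2)]) simp_all
 moreover have "(NI m (%x. f x * kill aa U (rs n) g x)) = (NI m (%x. g x * Y.kill aa U (rs n) f x))" for n
  using kill_dual[OF aa _ U f g, of "rs n"] by (simp add: mult.commute)
 ultimately show ?thesis using LIMSEQ_unique by (fastforce simp: mult.commute)
qed

lemma sigma_trunc:
 obtains A :: "nat => 'a set" where "!!n. A n : sets borel" "incseq A" "(\<Union>n. A n) = UNIV" "!!n. emeasure m (A n) < iy"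
proof -
 interpret sigma_finite_measure m by (rule sigma_m)
 obtain A :: "nat => 'a set" where "range A <= sets m" "(\<Union>i. A i) = space m" "!!i. emeasure m (A i) ~= iy" "incseq A"
  by (rule sigma_finite_incseq) blast
 thus ?thesis by (intro that[of A]) (auto simp: less_top)
qed

text \<open>The same neighbourhoods of the complement serve both processes, so
  \<open>hitA_dual\<close> passes to the limit in \<open>k\<close>. Truncation on sets of finite
  measure and positive rates provide its integrability assumptions and are removed by monotone
  limits.\<close>

theorem RD_dual:
 assumes D: "open D" and aa: "0 <= aa" and f [measurable]: "f : BM" and g [measurable]: "g : BM"
 shows "(NI m (%x. f x * RD aa D g x)) = (NI m (%x. Y.RD aa D f x * g x))"
proof -
 have RDm: "RD a D k : BM" "Y.RD a D k : BM" if "k : BM" "0 <= a" for a k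
  using RD_measurable[OF D that(2,1)] Y.RD_measurable[OF D that(2,1)] by auto
 have step1: "(NI m (%x. f x * RD a D g x)) = (NI m (%x. Y.RD a D f x * g x))"
  if a: "0 < a" and f [measurable]: "f : BM" and g [measurable]: "g : BM"
   and b: "!!y. f y <= en c" "!!y. g y <= en c" "0 <= c" and i: "(NI m (%y. f y)) < iy" "(NI m (%y. g y)) < iy" for a c f g
 proof -
  have mono: "incseq (%k. occ a (Tk D k) h x)" "incseq (%k. Y.occ a (Y.Tk D k) h x)" for h x
   using Tk_incseq[of D] Y.Tk_incseq[of D] by (auto simp: incseq_def intro!: occ_mono_T Y.occ_mono_T)
  have [measurable]: "occ a (Tk D k) g : BM" "Y.occ a (Y.Tk D k) f : BM" for k
   unfolding Tk_def[abs_def] Y.Tk_def[abs_def]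
   by (rule occ_hitA_measurable[OF a open_Uk g b(2,3)] Y.occ_hitA_measurable[OF a Y.open_Uk f b(1,3)])+
  have "(NI m (%x. f x * RD a D g x)) = (SUP k. NI m (%x. f x * occ a (Tk D k) g x))"
   unfolding RD_SUP[OF D g] SUP_mult_left_ennreal
   using mono by (intro mctSUP) (auto simp: incle intro!: mulL)
  also have "... = (SUP k. NI m (%x. Y.occ a (Y.Tk D k) f x * g x))"
   unfolding Tk_def[abs_def] Y.Tk_def[abs_def] Uk_def Y.Uk_def
   by (intro SUP_cong[OF refl] hitA_dual[OF a _ f g b i]) auto
  also have "... = (NI m (%x. Y.RD a D f x * g x))"
   unfolding Y.RD_SUP[OF D f] SUP_mult_right_ennreal
   using mono by (intro mctSUP[symmetric]) (auto simp: incle intro!: mulR)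
  finally show ?thesis .
 qed
 obtain A where A: "!!n. A n : sets borel" "incseq A" "(\<Union>n. A n) = UNIV" "!!n. emeasure m (A n) < iy" by (rule sigma_trunc) blast
 note [measurable] = A(1)
 define tr where "tr h n y = min (h y) (en (real n)) * ix (A n) y" for h :: "'a => ennreal" and n y
 have tr [measurable]: "tr h n : BM" if [measurable]: "h : BM" for h n unfolding tr_def by measurable
 have inc: "incseq (tr h)" if "h : BM" for h
  unfolding tr_def[abs_def] incle
 proof (intro allI impI mult_mono)
  fix i n x assume "i <= (n::nat)"
  thus "min (h x) (en (real i)) <= min (h x) (en (real n))" by (intro min.mono ennreal_leI) auto
  show "(ix (A i) x :: ennreal) <= ix (A n) x" using A(2) `i <= n` by (auto simp: incseq_def split: splix)
 qed simp_all
 have sup: "(SUP n. tr h n y) = h y" if "h : BM" for h y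
 proof -
  have "incseq (%n. ix (A n) y :: ennreal)" using A(2) by (auto simp: incseq_def split: splix)
  moreover have "(SUP n. ix (A n) y :: ennreal) = 1"
  proof (rule antisym)
   obtain n where "y : A n" using A(3) by blast
   thus "1 <= (SUP n. ix (A n) y :: ennreal)" by (intro SUP_upper2[of n]) auto
  qed (auto intro!: SUP_least split: splix)
  ultimately show ?thesis
   unfolding tr_def using SUP_mult_incseq[OF incseq_min_of_nat, of "%n. ix (A n) y" "h y"] by (simp add: SUP_min_of_nat)
 qed
 have b: "tr h n y <= en (real n)" for h n y unfolding tr_def by (auto split: splix)
 have i: "(NI m (%y. tr h n y)) < iy" for h n
 proof -
  have "(NI m (%y. tr h n y)) <= (NI m (%y. en (real n) * ix (A n) y))"
   unfolding tr_def by (intro nnmono mulR) auto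
  also have "... < iy" using A(4)[of n] by (simp add: nn_integral_cmult_indicator ennreal_mult_less_top)
  finally show ?thesis .
 qed
 let ?a = "%n. aa + 1 / rs n"
 have a: "0 < ?a n" for n using aa by (intro add_nonneg_pos) auto
 have ai: "?a k <= ?a n" if "n <= k" for n k using that by (simp add: frac_le del: of_nat_Suc)
 have incR: "incseq (%n. RD (?a n) D (tr h n) x)" "incseq (%n. Y.RD (?a n) D (tr h n) x)" if "h : BM" for h x
  using inc[OF that] ai by (auto simp: incle simp del: of_nat_Suc intro!: RD_mono_params Y.RD_mono_params)
 have incp: "incseq (%n. tr h n x)" if "h : BM" for h x using inc[OF that] by (auto simp: incle)
 have m1: "RD (?a n) D (tr g n) : BM" "Y.RD (?a n) D (tr f n) : BM" for n
  using RDm[OF tr[OF g] less_imp_le[OF a]] RDm[OF tr[OF f] less_imp_le[OF a]] by auto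
 note [measurable] = m1
 have "(NI m (%x. f x * RD aa D g x)) = (NI m (%x. (SUP n. tr f n x * RD (?a n) D (tr g n) x)))"
  by (subst SUP_mult_incseq[OF incp[OF f] incR(1)[OF g]], simp only: sup[OF f] RD_SUP_params[OF D tr[OF g] inc[OF g] sup[OF g]])
 also have "... = (SUP n. NI m (%x. tr f n x * RD (?a n) D (tr g n) x))"
  using incseq_mult[OF incp[OF f] incR(1)[OF g]] by (intro mctSUP) (auto simp: incle simp del: of_nat_Suc)
 also have "... = (SUP n. NI m (%x. Y.RD (?a n) D (tr f n) x * tr g n x))"
  by (intro SUP_cong[OF refl] step1[OF a tr[OF f] tr[OF g] b b _ i i]) simp
 also have "... = (NI m (%x. (SUP n. Y.RD (?a n) D (tr f n) x * tr g n x)))"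
  using incseq_mult[OF incR(2)[OF f] incp[OF g]] by (intro mctSUP[symmetric]) (auto simp: incle simp del: of_nat_Suc)
 also have "... = (NI m (%x. Y.RD aa D f x * g x))"
  by (subst SUP_mult_incseq[OF incR(2)[OF f] incp[OF g]], simp only: sup[OF g] Y.RD_SUP_params[OF D tr[OF f] inc[OF f] sup[OF f]])
 finally show ?thesis .
qed

end

section \<open>Excessive functions of the killed process\<close>

lemma antimono_tendsto_at_right:
 fixes ph :: "real => ennreal"
 assumes anti: "!!s t. 0 < s ==> s <= t ==> ph t <= ph s" and sup: "(SUP k. ph (1 / real (Suc k))) = L"
 shows "(ph \<longlongrightarrow> L) (at_right 0)"
proof (rule order_tendstoI)
 fix a assume "a < L"
 then obtain k where k: "a < ph (1 / real (Suc k))" unfolding sup[symmetric] less_SUP_iff by auto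
 have "\<forall>\<^sub>F t in at_right 0. 0 < t & t < 1 / real (Suc k)"
  unfolding eventually_at_right_field by (intro exI[of _ "1 / real (Suc k)"]) auto
 thus "\<forall>\<^sub>F t in at_right 0. a < ph t" by eventually_elim (use k anti less_le_trans in "blast intro: less_imp_le")
next
 fix a assume a: "L < a"
 have "ph t <= L" if t: "0 < t" for t
 proof -
  obtain k where "1 / real (Suc k) < t" using nat_approx_posE[OF t] by auto
  hence "ph t <= ph (1 / real (Suc k))" by (intro anti) auto
  also have "... <= L" unfolding sup[symmetric] by (rule SUP_upper) simp
  finally show ?thesis .
 qed
 thus "\<forall>\<^sub>F t in at_right 0. ph t < a"
  using eventually_at_right_less[of "0::real"] by (auto elim!: eventually_mono intro: le_less_trans a)
qed

context hunt
begin

abbreviation "ks \<equiv> killed_semigroup X"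

lemma ks_eq:
 assumes D: "open D" and x: "x : D"
 shows "ks D t f x = (PI x (%ww. ix {ww. en t < TD D ww} ww * xt f (en t) ww))"
 unfolding killed_semigroup_def using exit_eq[OF D x]
 by (intro nn_integral_cong_AE) (auto elim!: eventually_mono simp: indicator_def)

lemma mfun_ks:
 assumes D: "open D" and x: "x : D" shows "mfun (%f. ks D t f x)"
 unfolding ks_eq[OF assms] by (rule mfun_fin) measurable

lemma ks_1: "ks D t (%_. 1) x <= 1"
proof -
 interpret PS: prob_space "P x" by (rule prob_law)
 have "ks D t (%_. 1) x <= (PI x (%ww. 1))"
  unfolding killed_semigroup_def by (intro nnmono) (auto simp: ext0_def split: option.splits splix)
 thus ?thesis by (simp add: PS.emeasure_space_1)
qed

lemma ks_joint:
 assumes D: "open D" and x: "x : D" and [measurable]: "f : BM"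
 shows "(%t. ks D t f x) : BM"
proof -
 interpret PS: prob_space "P x" by (rule prob_law)
 have "(%t. PI x (%ww. (if en t < TD D ww then 1 else 0) * xt f (en t) ww)) : BM"
  by measurable
 moreover have "ix {ww. en t < TD D ww} ww = (if en t < TD D ww then 1 else 0 :: ennreal)" for t ww by (simp add: indicator_def)
 ultimately show ?thesis unfolding ks_eq[OF D x] by simp
qed

lemma RD_ks:
 assumes D: "open D" and x: "x : D" and aa: "0 <= aa" and f [measurable]: "f : BM"
 shows "RD aa D f x = (SI lborel {0..} (%t. xp aa t * ks D t f x))"
proof -
 let ?a = "%t ww. xp aa t * xt f (en t) ww * (if 0 <= t & en t < TD D ww then 1 else 0)"
 interpret PS: prob_space "P x" by (rule prob_law)
 interpret PP: pair_sigma_finite "P x" lborel ..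
 have "RD aa D f x = (PI x (%ww. (LI (%t. ?a t ww))))"
  unfolding RD_TD[OF D x] occ_def by (intro nncong) (simp add: indicator_def)
 also have "... = (LI (%t. (PI x (%ww. ?a t ww))))"
  by (rule PP.Fubini'[symmetric]) measurable
 also have "... = (LI (%t. (PI x (%ww. (xp aa t * ix {0..} t) * (ix {ww. en t < TD D ww} ww * xt f (en t) ww)))))"
  by (intro nncong) (auto simp: indicator_def)
 also have "... = (SI lborel {0..} (%t. xp aa t * ks D t f x))"
  unfolding ks_eq[OF D x] by (subst nncmult) (measurable, simp add: mult.assoc mult.commute[of "ix _ _"])
 finally show ?thesis .
qed

text \<open>The potential at rate 0 may be infinite, so it is approximated by the finite potentials
  \<open>u n\<close>. By \<open>RD_SM\<close> at the constant time \<open>t\<close>,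
  \<open>u n\<close> splits into the occupation \<open>oc n t\<close> before \<open>t\<close> and
  the rest \<open>A n t\<close>. The first part grows with \<open>t\<close>, so the second
  decreases; the first is at most \<open>n * t\<close>, so nothing is lost as \<open>t\<close> tends
  to 0.\<close>

lemma ks_RD:
 assumes D: "open D" and x: "x : D" and h [measurable]: "h : BM"
 shows ks_RD_anti: "0 < s ==> s <= t ==> ks D t (RD 0 D h) x <= ks D s (RD 0 D h) x"
  and ks_RD_sup: "(SUP k. ks D (1 / real (Suc k)) (RD 0 D h) x) = RD 0 D h x"
proof -
 let ?b = "%a. SUP k. ks D (a k) (RD 0 D h) x"
 let ?c = "%a n t u. PI x (%ww. en (exp (- a n * enn2real (en t))) * ix {ww. en t < TD D ww} ww * xt (u n) (en t) ww)"
 define a where "a n = 1 / rs n" for n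
 define hn where "hn n = (%y. min (h y) (en (real n)))" for n
 define u where "u n = RD (a n) D (hn n)" for n
 have a: "0 < a n" for n unfolding a_def by simp
 have T: "hn n : BM" "incseq hn" "(SUP n. hn n y) = h y" for n y
  using truncate[OF h] unfolding hn_def by auto
 have um [measurable]: "u n : BM" for n unfolding u_def by (rule RD_measurable[OF D less_imp_le[OF a] T(1)])
 have uinc: "incseq u" unfolding u_def incle
 proof (intro allI impI RD_mono_params)
  fix i n y assume "i <= (n::nat)"
  thus "a n <= a i" "hn i y <= hn n y" using T(2) by (auto simp: a_def frac_le incle simp del: of_nat_Suc)
 qed
 have usup: "RD 0 D h y = (SUP n. u n y)" for y
  unfolding u_def a_def using RD_SUP_params[OF D T(1,2) T(3), of 0] by simp
 define A where "A n t = en (exp (- a n * t)) * ks D t (u n) x" for n t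
 define oc where "oc n t = occ (a n) (%ww. min (en t) (TD D ww)) (hn n) x" for n t
 have un: "u n x = oc n t + A n t" if "0 < t" for n t
 proof -
  interpret filtration Om "right_filtration X" by (rule filtration_right)
  have "u n x = oc n t + (?c a n t u)"
   unfolding u_def oc_def by (rule RD_SM[OF D x stopping_time_const less_imp_le[OF a] T(1)])
  also have "(?c a n t u) = A n t"
   unfolding A_def ks_eq[OF D x] using that by (subst nncmult[symmetric]) (auto simp: mult.assoc)
  finally show ?thesis .
 qed
 have fin: "u n x ~= iy" for n unfolding u_def by (rule RD_finite[OF a D T(1), of n "en (real n)"]) (auto simp: hn_def)
 have ks_sup: "ks D t (RD 0 D h) x = (SUP n. A n t)" if t: "0 < t" for t
 proof -
  have i: "incseq (%n. ks D t (u n) x)" by (rule mfun_incseq[OF mfun_ks[OF D x] um uinc])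
  have "ks D t (RD 0 D h) x = (SUP n. ks D t (u n) x)"
   unfolding ext[of "RD 0 D h" "%y. SUP n. u n y", OF usup] by (rule mfun_SUP[OF mfun_ks[OF D x] um uinc])
  also have "... = (SUP n. en (exp (- a n * t))) * (SUP n. ks D t (u n) x)"
   using SUP_exp_approx[of t 0] t unfolding a_def by simp
  also have "... = (SUP n. A n t)"
   unfolding A_def by (rule SUP_mult_incseq[symmetric, OF _ i]) (use incseq_exp_approx[of t 0] t in "simp add: a_def")
  finally show ?thesis .
 qed
 have anti: "A n t <= A n s" if "0 < s" "s <= t" for n s t
 proof -
  have "oc n s <= oc n t" unfolding oc_def by (intro occ_mono_T min.mono ennreal_leI that order_refl)
  moreover have "oc n t + A n t = oc n s + A n s" using un[of s n] un[of t n] that by simp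
  moreover have "oc n t ~= iy" using fin[of n] un[of t n] that by auto
  moreover have "oc n s ~= iy" using fin[of n] un[of s n] that by auto
  ultimately show ?thesis by (metis add_left_mono ennreal_add_left_cancel_le add_right_mono infinity_ennreal_def)
 qed
 show *: "ks D t (RD 0 D h) x <= ks D s (RD 0 D h) x" if "0 < s" "s <= t" for s t
 proof -
  have "(SUP n. A n t) <= (SUP n. A n s)" by (rule SUP_mono) (use anti[OF that] in blast)
  thus ?thesis using that by (simp add: ks_sup)
 qed
 have le: "ks D t (RD 0 D h) x <= RD 0 D h x" if "0 < t" for t
 proof -
  have "A n t <= u n x" for n unfolding un[OF that] by (rule add_increasing) simp_all
  hence "(SUP n. A n t) <= (SUP n. u n x)" by (intro SUP_mono) blast
  thus ?thesis by (simp only: ks_sup[OF that] usup)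
 qed
 have oc_le: "oc n t <= en (real n * t)" if "0 < t" for n t
 proof -
  interpret PS: prob_space "P x" by (rule prob_law)
  have "oc n t <= (PI x (%ww. (LI (%s. en (real n) * ix {0..t} s))))"
   unfolding oc_def occ_def
  proof (intro nnmono)
   fix ww s
   have "en (exp (- a n * s)) * xt (hn n) (en s) ww <= 1 * en (real n)" if "0 <= s"
    by (rule mult_mono) (use a[of n] that in "auto simp: hn_def ext0_def ennreal_le_1 split: option.splits")
   thus "en (exp (- a n * s)) * xt (hn n) (en s) ww * ix {s. 0 <= s & en s < min (en t) (TD D ww)} s <= en (real n) * ix {0..t} s"
    using that by (auto split: splix simp: ennreal_less_iff)
  qed
  also have "... = en (real n * t)" using that by (simp add: nn_integral_cmult_indicator PS.emeasure_space_1 ennreal_mult')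
  finally show ?thesis .
 qed
 have "u n x <= (?b a)" for n
 proof (rule LIMSEQ_le_const2)
  show "(%k. u n x - en (real n * a k)) ----> u n x"
  proof -
   have "(%k. real n * a k) ----> 0" unfolding a_def by real_asymp
   hence "(%k. en (real n * a k)) ----> en 0" by (rule tendsto_ennrealI)
   hence "(%k. u n x - en (real n * a k)) ----> u n x - en 0"
    by (intro tendsto_diff_ennreal) (use fin in auto)
   thus ?thesis by simp
  qed
  have "u n x - en (real n * a k) <= (?b a)" for k
  proof -
   have "u n x <= en (real n * a k) + A n (a k)" using un[OF a, of n k] oc_le[OF a, of n k] by (simp add: add_right_mono)
   hence "u n x - en (real n * a k) <= A n (a k)" by (simp add: ennreal_minus_le_iff)
   also have "... <= ks D (a k) (RD 0 D h) x" unfolding ks_sup[OF a] by (rule SUP_upper) simp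
   also have "... <= (?b a)" by (rule SUP_upper) simp
   finally show ?thesis .
  qed
  thus "\<exists>N. \<forall>k\<ge>N. u n x - en (real n * a k) <= (?b a)" by blast
 qed
 hence "RD 0 D h x <= (?b a)" unfolding usup[of x] by (rule SUP_least)
 thus "(SUP k. ks D (1 / real (Suc k)) (RD 0 D h) x) = RD 0 D h x"
  using le[OF a] unfolding a_def by (intro antisym SUP_least) auto
qed

lemma ks_RD_le: "open D ==> x : D ==> h : BM ==> 0 < t ==> ks D t (RD 0 D h) x <= RD 0 D h x"
proof -
 assume a: "open D" "x : D" "h : BM" and t: "0 < t"
 obtain k where "1 / real (Suc k) < t" using nat_approx_posE[OF t] by auto
 hence "ks D t (RD 0 D h) x <= ks D (1 / real (Suc k)) (RD 0 D h) x" by (intro ks_RD_anti[OF a]) auto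
 also have "... <= RD 0 D h x" unfolding ks_RD_sup[OF a, symmetric] by (rule SUP_upper) simp
 finally show ?thesis .
qed

lemma excessive_RD: "open D ==> h : BM ==> excessive X D (RD 0 D h)"
 unfolding excessive_def using ks_RD_le ks_RD_anti ks_RD_sup
 by (auto intro!: antimono_tendsto_at_right)

lemma excessive_SUP:
 assumes D: "open D" and F: "!!n::nat. excessive X D (F n)" and [measurable]: "!!n. F n : BM" and inc: "incseq F"
 shows "excessive X D (%x. SUP n. F n x)"
 unfolding excessive_def
proof (intro conjI allI ballI impI)
 have S: "ks D t (%x. SUP n. F n x) x = (SUP n. ks D t (F n) x)" if "x : D" for x t
  by (rule mfun_SUP[OF mfun_ks[OF D that] _ inc]) simp
 fix x assume x: "x : D"
 show le: "ks D t (%x. SUP n. F n x) x <= (SUP n. F n x)" if "0 < t" for t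
  unfolding S[OF x] using F x that unfolding excessive_def by (intro SUP_mono) auto
 show "((%t. ks D t (%x. SUP n. F n x) x) \<longlongrightarrow> (SUP n. F n x)) (at_right 0)"
 proof (rule order_tendstoI)
  fix a assume "a < (SUP n. F n x)"
  then obtain n where n: "a < F n x" unfolding less_SUP_iff by auto
  have "((%t. ks D t (F n) x) \<longlongrightarrow> F n x) (at_right 0)" using F x unfolding excessive_def by blast
  hence "\<forall>\<^sub>F t in at_right 0. a < ks D t (F n) x" using n by (rule order_tendstoD)
  thus "\<forall>\<^sub>F t in at_right 0. a < ks D t (%x. SUP n. F n x) x"
   unfolding S[OF x] less_SUP_iff by eventually_elim auto
 next
  fix a assume "(SUP n. F n x) < a"
  thus "\<forall>\<^sub>F t in at_right 0. ks D t (%x. SUP n. F n x) x < a"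
   using eventually_at_right_less[of "0::real"] le by (auto elim!: eventually_mono intro: le_less_trans)
 qed
qed

lemma excessive_RD_le:
 assumes D: "open D" and F: "excessive X D F" and [measurable]: "F : BM" and aa: "0 < aa"
 shows "en aa * RD aa D F x <= F x"
proof (cases "x : D")
 case x: True
 have "RD aa D F x <= (SI lborel {0..} (%t. xp aa t * F x))"
  unfolding RD_ks[OF D x less_imp_le[OF aa] assms(3)]
 proof (rule nn_integral_mono_AE)
  show "AE t in lborel. xp aa t * ks D t F x * ix {0..} t <= xp aa t * F x * ix {0..} t"
   using AE_lborel_singleton[of 0]
  proof eventually_elim
   case (elim t)
   thus ?case using F x unfolding excessive_def by (auto split: splix intro!: mulL)
  qed
 qed
 also have "... = F x * (SI lborel {0..} (%t. xp aa t))"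
  by (subst nncmult[symmetric]) (auto simp: mult.assoc mult.left_commute intro!: nncong)
 also have "... = F x * en (1 / aa)" by (subst nn_integral_exp[OF aa]) simp
 finally have "en aa * RD aa D F x <= en aa * (F x * en (1 / aa))" by (rule mulL) simp
 also have "en aa * en (1 / aa) = 1" using aa by (simp add: ennreal_mult'[symmetric])
 hence "en aa * (F x * en (1 / aa)) = F x" unfolding mult.left_commute[of "en aa"] by simp
 finally show ?thesis .
qed (simp add: RD_outside)

text \<open>Normalised resolvents of the killed process. They serve as smoothing operators: they do
  not see null sets, and they increase to any excessive function on \<open>D\<close>.\<close>

definition Kn :: "'a set => nat => ('a => ennreal) => 'a => ennreal" where
 "Kn D n g x = en (rs n) * RD (rs n) D g x"

lemma kop_Kn:
 assumes "open D" shows "kop (Kn D n)"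
proof -
 have k: "kop (RD (rs n) D)" by (rule kop_RD[OF assms]) simp
 have "mfun (%g. Kn D n g x)" for x unfolding Kn_def
 proof (rule mfunI)
  show "en (rs n) * RD (rs n) D (%y. SUP i. h i y) x = (SUP i. en (rs n) * RD (rs n) D (h i) x)"
   if "!!i::nat. h i : BM" "incseq h" for h
   by (subst kop_SUP[OF k that]) (rule SUP_mult_left_ennreal)
 qed (simp_all add: kop_add[OF k] kop_cmult[OF k] distrib_left mult.left_commute del: of_nat_Suc)
 moreover have "Kn D n g : BM" if "g : BM" for g
  unfolding Kn_def[abs_def] using kopm[OF k that] by measurable
 ultimately show ?thesis unfolding kop_def by blast
qed

lemma Kn_1: "open D ==> Kn D n (%_. 1) x <= 1"
proof -
 assume D: "open D"
 have "RD (rs n) D (%_. 1) x <= 1 * en (1 / rs n)" by (rule RD_bound[OF _ D]) simp_all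
 hence "Kn D n (%_. 1) x <= en (rs n) * en (1 / rs n)" unfolding Kn_def by (intro mulL) simp_all
 also have "... = 1" by (simp add: ennreal_mult'[symmetric] del: of_nat_Suc)
 finally show ?thesis .
qed

lemma Kn_outside: "x ~: D ==> Kn D n g x = 0"
 by (simp add: Kn_def RD_outside)

text \<open>Monotonicity in \<open>n\<close> combines the resolvent equation with
  \<open>Kn D n F <= F\<close>. Convergence holds because the normalised resolvent is an average of
  the killed semigroup over an exponential time concentrating at 0.\<close>

lemma excessive_Kn:
 assumes D: "open D" and F: "excessive X D F" and m [measurable]: "F : BM"
 shows "incseq (%n. Kn D n F)" and "Kn D n F x <= F x" and "x : D ==> (SUP n. Kn D n F x) = F x"
proof -
 let ?e = "%K0 t d. en (K0 * exp (- K0 * t)) * ix {0..d / 2} t"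
 let ?f = "%b n d. b * en (1 - exp (- rs n * (d / 2)))"
 show le: "Kn D n F x <= F x" for n x unfolding Kn_def by (rule excessive_RD_le[OF D F m]) simp
 show inc: "incseq (%n. Kn D n F)"
 proof (intro incseq_SucI le_funI)
  fix n x
  let ?a = "rs n" and ?b = "real (Suc (Suc n))"
  have ab: "0 <= ?a" "?a < ?b" by auto
  have m2: "RD c D F : BM" if "0 <= c" for c by (rule RD_measurable[OF D that m])
  have k: "kop (RD ?b D)" by (rule kop_RD[OF D]) simp
  have "Kn D n F x = en ?a * (RD ?b D F x + en (?b - ?a) * RD ?b D (RD ?a D F) x)"
   unfolding Kn_def RD_commute[OF D ab m, symmetric] RD_resolvent_eq[OF D ab m, symmetric] ..
  also have "... = en ?a * RD ?b D F x + en (?b - ?a) * RD ?b D (Kn D n F) x"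
   unfolding Kn_def by (subst kop_cmult[OF k m2[OF ab(1)]]) (simp only: distrib_left mult.left_commute)
  also have "RD ?b D (Kn D n F) x <= RD ?b D F x"
   by (rule kop_mono[OF k kopm[OF kop_Kn[OF D] m] m le])
  also have "en ?a * RD ?b D F x + en (?b - ?a) * RD ?b D F x = Kn D (Suc n) F x"
   unfolding Kn_def distrib_right[symmetric] by (subst ennreal_plus[symmetric]) simp_all
  finally show "Kn D n F x <= Kn D (Suc n) F x" by (simp add: mulL add_left_mono)
 qed
 show "(SUP n. Kn D n F x) = F x" if x: "x : D"
 proof (rule antisym)
  show "(SUP n. Kn D n F x) <= F x" using le by (intro SUP_least)
  show "F x <= (SUP n. Kn D n F x)"
  proof (rule dense_le)
   fix b assume b: "b < F x"
   have "((%t. ks D t F x) \<longlongrightarrow> F x) (at_right 0)" using F x unfolding excessive_def by blast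
   hence "\<forall>\<^sub>F t in at_right 0. b < ks D t F x" using b by (rule order_tendstoD)
   then obtain d where d: "0 < d" "!!t. 0 < t ==> t < d ==> b < ks D t F x" unfolding eventually_at_right_field by blast
   \<comment> \<open>Only the times in \<open>[0, d / 2]\<close> are kept, on which the killed
     semigroup exceeds \<open>b\<close>; the exponential law gives them mass tending to 1.\<close>
   have "?f b n d <= Kn D n F x" for n
   proof -
    let ?a = "rs n"
    have i: "(LI (%t. ?e ?a t d)) = en (- exp (- ?a * (d / 2)) - - exp (- ?a * 0))"
     by (rule nn_integral_FTC_Icc) (use d in "auto intro!: derivative_eq_intros simp del: of_nat_Suc")
    have "b * en (1 - exp (- ?a * (d / 2))) = (LI (%t. b * (?e ?a t d)))"
     by (subst nncmult, measurable) (use i in simp)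
    also have "... <= (LI (%t. en ?a * (xp ?a t * ks D t F x * ix {0..} t)))"
    proof (rule nn_integral_mono_AE)
     show "AE t in lborel. b * (?e ?a t d) <= en ?a * (xp ?a t * ks D t F x * ix {0..} t)"
      using AE_lborel_singleton[of 0]
     proof eventually_elim
      case (elim t)
      show ?case
      proof (cases "t : {0..d / 2}")
       case True
       hence "b <= ks D t F x" using d elim by (intro less_imp_le d(2)) auto
       hence "b * (en ?a * xp ?a t) <= ks D t F x * (en ?a * xp ?a t)" by (rule mulR) simp
       moreover have "en (?a * exp (- ?a * t)) = en ?a * xp ?a t" by (rule ennreal_mult') simp
       moreover have "ks D t F x * (en ?a * xp ?a t) = en ?a * (xp ?a t * ks D t F x)"
        by (simp only: mult.commute mult.left_commute)
       ultimately show ?thesis using True by (simp del: of_nat_Suc)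
      qed simp
     qed
    qed
    also have "... = Kn D n F x"
     unfolding Kn_def RD_ks[OF D x of_nat_0_le_iff m] by (rule nncmult) (use ks_joint[OF D x m] in measurable)
    finally show ?thesis .
   qed
   hence le2: "?f b n d <= (SUP n. Kn D n F x)" for n by (rule order_trans) (rule SUP_upper, simp)
   have "(%n. 1 - exp (- rs n * (d / 2))) ----> 1" using d(1) by real_asymp
   hence "(%n. en (1 - exp (- rs n * (d / 2)))) ----> en 1" by (rule tendsto_ennrealI)
   hence "(%n. ?f b n d) ----> b * en 1"
    by (intro ennreal_tendsto_cmult) (use b in "auto simp: less_top[symmetric]")
   thus "b <= (SUP n. Kn D n F x)" by (intro LIMSEQ_le_const2[of _ b]) (use le2 in auto)
  qed
 qed
qed

end

lemma kop_kernel: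
 fixes K :: "('a::topological_space => ennreal) => 'a => ennreal"
 assumes K: "kop K" and K1: "!!x. K (%_. 1) x <= 1"
 obtains kk where "kk : borel \<rightarrow>\<^sub>M subprob_algebra borel" "!!g x. g : BM ==> K g x = (NI (kk x) (%y. g y))"
proof -
 have "\<forall>x. \<exists>mm. sets mm = sets borel & (\<forall>g\<in>BM. K g x = (NI mm (%y. g y)))"
  using kop_mfun[OF K] unfolding mfun_def by blast
 then obtain kk where s: "!!x. sets (kk x) = sets borel" and i: "!!g x. g : BM ==> K g x = (NI (kk x) (%y. g y))"
  by metis
 have e: "emeasure (kk x) A = K (ix A) x" if "A : sets borel" for A x
  using i[of "ix A" x] that s[of x] by simp
 have "kk : borel \<rightarrow>\<^sub>M subprob_algebra borel"
 proof (rule measurable_subprob_algebra)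
  show "subprob_space (kk x)" for x
  proof
   have "emeasure (kk x) UNIV = K (%_. 1) x" using e[of UNIV] by simp
   thus "emeasure (kk x) (space (kk x)) <= 1" using K1[of x] sets_eq_imp_space_eq[OF s[of x]] by simp
  qed (use sets_eq_imp_space_eq[OF s[of x]] in simp)
  show "(%x. emeasure (kk x) A) : BM" if "A : sets borel" for A
   unfolding e[OF that] by (rule kopm[OF K]) (use that in simp)
 qed (rule s)
 thus ?thesis using that i by blast
qed

lemma kop_scale:
 assumes k: "kop K" shows "kop (%g x. c * K g x)"
proof -
 have "mfun (%g. c * K g x)" for x
 proof (rule mfunI)
  show "c * K (%y. SUP i. h i y) x = (SUP i. c * K (h i) x)" if "!!i::nat. h i : BM" "incseq h" for h
   by (subst kop_SUP[OF k that]) (rule SUP_mult_left_ennreal)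
 qed (simp_all add: kop_add[OF k] kop_cmult[OF k] distrib_left mult.left_commute)
 moreover have "(%x. c * K g x) : BM" if "g : BM" for g
  using kopm[OF k that] by measurable
 ultimately show ?thesis unfolding kop_def by blast
qed

context hunt
begin

text \<open>At positive rates the operator is a bounded measurable kernel, for which parameters can
  be integrated by Fubini's theorem; rate 0 is the monotone limit. This is needed to average the
  approximate Green functions over their first variable.\<close>

lemma RD_param:
 fixes M :: "'c measure"
 assumes D: "open D" and h [measurable]: "(%(w, z). h w z) : bm (M \<Otimes>\<^sub>M borel)"
 shows RD_param_measurable: "(%(w, y). RD 0 D (h w) y) : bm (M \<Otimes>\<^sub>M borel)"
  and RD_fubini: "sigma_finite_measure M ==> (NI M (%w. RD 0 D (h w) y)) = RD 0 D (%z. NI M (%w. h w z)) y"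
proof -
 define a where "a n = 1 / rs n" for n
 have a: "0 < a n" for n unfolding a_def by simp
 have hw [measurable]: "h w : BM" if "w : space M" for w
  using mcomp[OF measurable_Pair1'[OF that] h] by simp
 have "\<exists>kk. kk : borel \<rightarrow>\<^sub>M subprob_algebra borel & (\<forall>g x. g : BM --> en (a n) * RD (a n) D g x = (NI (kk x) (%y. g y)))" for n
 proof (rule kop_kernel[OF kop_scale[OF kop_RD[OF D less_imp_le[OF a]]]])
  show "en (a n) * RD (a n) D (%_. 1) x <= 1" for x
  proof -
   have "RD (a n) D (%_. 1) x <= 1 * en (1 / a n)" by (rule RD_bound[OF a D]) simp_all
   hence "en (a n) * RD (a n) D (%_. 1) x <= en (a n) * en (1 / a n)" by (intro mulL) simp_all
   also have "... = 1" using a[of n] by (simp add: ennreal_mult'[symmetric])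
   finally show ?thesis .
  qed
 qed blast
 then obtain kk where kk [measurable]: "!!n. kk n : borel \<rightarrow>\<^sub>M subprob_algebra borel"
  and kki: "!!n g x. g : BM ==> en (a n) * RD (a n) D g x = (NI (kk n x) (%y. g y))" by metis
 have RDa: "RD (a n) D g x = en (1 / a n) * (NI (kk n x) (%y. g y))" if "g : BM" for n g x
 proof -
  have "RD (a n) D g x = (en (1 / a n) * en (a n)) * RD (a n) D g x" using a[of n] by (simp add: ennreal_mult'[symmetric])
  thus ?thesis unfolding kki[OF that, symmetric] by (simp only: mult.assoc)
 qed
 have R0: "RD 0 D g x = (SUP n. RD (a n) D g x)" if "g : BM" for g x
  using RD_SUP_params[OF D, of "%_. g" g 0 x] that unfolding a_def by simp
 have inc: "incseq (%n. RD (a n) D g x)" for g x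
  unfolding incseq_def by (intro allI impI RD_mono_params) (auto simp: a_def frac_le simp del: of_nat_Suc)
 have m1: "(%(w, y). RD (a n) D (h w) y) : bm (M \<Otimes>\<^sub>M borel)" for n
 proof -
  have "(%p. NI (kk n (snd p)) (%z. h (fst p) z)) : bm (M \<Otimes>\<^sub>M borel)"
   by (rule nn_integral_measurable_subprob_algebra2[where N=borel]) measurable
  hence "(%p. en (1 / a n) * (NI (kk n (snd p)) (%z. h (fst p) z))) : bm (M \<Otimes>\<^sub>M borel)" by measurable
  thus ?thesis
   by (rule measurable_cong[THEN iffD1, rotated]) (auto simp: space_pair_measure RDa hw)
 qed
 have "(%p. SUP n. (case p of (w, y) => RD (a n) D (h w) y)) : bm (M \<Otimes>\<^sub>M borel)"
  using m1 by measurable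
 thus "(%(w, y). RD 0 D (h w) y) : bm (M \<Otimes>\<^sub>M borel)"
  by (rule measurable_cong[THEN iffD1, rotated]) (auto simp: space_pair_measure R0 hw)
 assume M: "sigma_finite_measure M"
 interpret M: sigma_finite_measure M by (rule M)
 have [measurable]: "(%w. RD (a n) D (h w) y) : bm M" for n
  using mcomp[OF measurable_Pair2'[of y borel M] m1[of n]] by simp
 have H [measurable]: "(%z. NI M (%w. h w z)) : BM" by measurable
 have "(NI M (%w. RD 0 D (h w) y)) = (NI M (%w. (SUP n. RD (a n) D (h w) y)))"
  by (intro nncong R0 hw)
 also have "... = (SUP n. NI M (%w. RD (a n) D (h w) y))"
  using inc by (intro mctSUP) (auto simp: incle)
 also have "... = (SUP n. RD (a n) D (%z. NI M (%w. h w z)) y)"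
 proof (rule SUP_cong[OF refl])
  fix n
  have sk: "sets (kk n y) = sets borel" by (rule sets_kernel[OF kk]) simp
  note [measurable_cong] = sk
  interpret k: subprob_space "kk n y" by (rule subprob_space_kernel[OF kk]) simp
  interpret P: pair_sigma_finite M "kk n y" ..
  have "(NI M (%w. RD (a n) D (h w) y)) = (NI M (%w. en (1 / a n) * (NI (kk n y) (%z. h w z))))"
   by (intro nncong RDa hw)
  also have "... = en (1 / a n) * (NI M (%w. (NI (kk n y) (%z. h w z))))" by (rule nncmult) measurable
  also have "(NI M (%w. (NI (kk n y) (%z. h w z)))) = (NI (kk n y) (%z. (NI M (%w. h w z))))"
   by (rule P.Fubini'[symmetric]) measurable
  finally show "(NI M (%w. RD (a n) D (h w) y)) = RD (a n) D (%z. NI M (%w. h w z)) y" unfolding RDa[OF H] .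
 qed
 also have "... = RD 0 D (%z. NI M (%w. h w z)) y" by (rule R0[OF H, symmetric])
 finally show "(NI M (%w. RD 0 D (h w) y)) = RD 0 D (%z. NI M (%w. h w z)) y" .
qed

end

section \<open>Existence and uniqueness of the Green function\<close>

context dualp
begin

text \<open>The integrals may be infinite, so the difference of the functions cannot be used.
  Instead \<open>max (F1 y) (F2 y)\<close> and \<open>F2 y\<close> are shown to be densities of the
  same measure.\<close>

lemma AE_le_of_integral:
 assumes [measurable]: "F1 : BM" "F2 : BM"
  and le: "!!f. f : BM ==> (NI m (%y. f y * F1 y)) <= (NI m (%y. f y * F2 y))"
 shows "AE y in m. F1 y <= F2 y"
proof -
 let ?a = "%A. (NI m (%y. ix A y * max (F1 y) (F2 y)))"
 let ?b = "%A. (NI m (%y. ix A y * F2 y))"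
 interpret sigma_finite_measure m by (rule sigma_m)
 have "density m (%y. max (F1 y) (F2 y)) = density m F2"
 proof (rule measure_eqI)
  fix A assume "A : sets (density m (%y. max (F1 y) (F2 y)))"
  hence A [measurable]: "A : sets borel" by simp
  let ?B = "{y. F2 y < F1 y}"
  have [measurable]: "?B : sets borel" by measurable
  have "?a A = (NI m (%y. ix (A Int ?B) y * F1 y + ix (A - ?B) y * F2 y))"
   by (intro nncong) (auto simp: max_def split: splix)
  also have "... = (NI m (%y. ix (A Int ?B) y * F1 y)) + (NI m (%y. ix (A - ?B) y * F2 y))"
   by (rule nn_integral_add) measurable
  also have "... <= (NI m (%y. ix (A Int ?B) y * F2 y)) + (NI m (%y. ix (A - ?B) y * F2 y))"
   by (intro add_right_mono le) measurable
  also have "... = (NI m (%y. ix (A Int ?B) y * F2 y + ix (A - ?B) y * F2 y))"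
   by (rule nn_integral_add[symmetric]) measurable
  also have "... = ?b A" by (intro nncong) (auto split: splix)
  finally have 1: "?a A <= ?b A" .
  have 2: "?b A <= ?a A"
   by (intro nnmono mulL) auto
  show "emeasure (density m (%y. max (F1 y) (F2 y))) A = emeasure (density m F2) A"
   using antisym[OF 1 2] A by (simp add: emeasure_density mult.commute[of "ix A _"])
 qed simp
 hence "AE y in m. max (F1 y) (F2 y) = F2 y" by (intro density_unique) auto
 thus ?thesis by eventually_elim (simp add: max_def split: if_splits)
qed

text \<open>Integrated inequalities give one almost everywhere; applying \<open>Kn\<close> makes it
  hold at every point by absolute continuity, and \<open>Kn\<close> of an excessive function
  increases to the function itself.\<close>

lemma exc_le:
 assumes D: "open D" and F: "excessive X D F1" "excessive X D F2" and m: "F1 : BM" "F2 : BM"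
  and le: "!!f. f : BM ==> (NI m (%y. f y * F1 y)) <= (NI m (%y. f y * F2 y))" and x: "x : D"
 shows "F1 x <= F2 x"
proof -
 have "Kn D n F1 x <= Kn D n F2 x" for n
  unfolding Kn_def using AE_le_of_integral[OF m le] by (intro mulL RD_mono_AE[OF D _ m]) auto
 hence "(SUP n. Kn D n F1 x) <= (SUP n. Kn D n F2 x)" by (intro SUP_mono) blast
 thus ?thesis using excessive_Kn(3)[OF D F(1) m(1) x] excessive_Kn(3)[OF D F(2) m(2) x] by simp
qed

lemma exc_eq:
 assumes "open D" "excessive X D F1" "excessive X D F2" "F1 : BM" "F2 : BM"
  and "!!f. f : BM ==> (NI m (%y. f y * F1 y)) = (NI m (%y. f y * F2 y))" and "x : D"
 shows "F1 x = F2 x"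
 using exc_le[OF assms(1-5) _ assms(7)] exc_le[OF assms(1,3,2,5,4) _ assms(7)] assms(6) by (metis antisym order_refl)

text \<open>Radon-Nikodym on the product space yields a jointly measurable density
  \<open>th0\<close> of \<open>K\<close>, but only for almost every starting point. One more
  application of \<open>K\<close> does not see the exceptional null set, so its square has a jointly
  measurable density for every starting point.\<close>

lemma kernel_density:
 assumes K: "kop K" and K1: "!!x. K (%_. 1) x <= 1"
  and ac: "!!g x. g : BM ==> AE y in m. g y = 0 ==> K g x = 0"
 obtains th where "(%(x, y). th x y) : bm (borel \<Otimes>\<^sub>M borel)"
  "!!g x. g : BM ==> K (K g) x = (NI m (%y. th x y * g y))" "!!x y. K (%_. 1) x = 0 ==> th x y = 0"
proof -
 let ?b = "%th0 x g. NI m (%y. th0 (x, y) * g y)"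
 interpret sigma_finite_measure m by (rule sigma_m)
 interpret PM: pair_sigma_finite m m ..
 obtain kk where kk [measurable]: "kk : borel \<rightarrow>\<^sub>M subprob_algebra borel" and kki: "!!g x. g : BM ==> K g x = (NI (kk x) (%y. g y))"
  by (rule kop_kernel[OF K K1]) blast
 have sk [measurable_cong]: "sets (kk x) = sets borel" for x by (rule sets_kernel[OF kk]) simp
 let ?B = "borel \<Otimes>\<^sub>M borel :: ('a \<times> 'a) measure"
 have sB [measurable_cong]: "sets (m \<Otimes>\<^sub>M m) = sets ?B" by (intro sets_pair_measure_cong) simp_all
 define N where "N x = distr (kk x) ?B (Pair x)" for x
 have N: "N : m \<rightarrow>\<^sub>M subprob_algebra ?B" unfolding N_def by (rule measurable_distr2[where M=borel]) measurable
 define Th where "Th = m \<bind> N"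
 have sTh: "sets Th = sets ?B" unfolding Th_def by (rule sets_bind[where N="?B"]) (use sets_kernel[OF N] in auto)
 have iTh: "(NI Th (%p. f p)) = (NI m (%x. (NI (kk x) (%y. f (x, y)))))" if [measurable]: "f : bm ?B" for f
  unfolding Th_def by (subst nn_integral_bind[OF that N]) (simp add: N_def nn_integral_distr)
 have "absolutely_continuous (m \<Otimes>\<^sub>M m) Th"
  unfolding absolutely_continuous_def
 proof
  fix A assume A: "A : null_sets (m \<Otimes>\<^sub>M m)"
  hence As [measurable]: "A : sets ?B" using sB by auto
  have "AE p in m \<Otimes>\<^sub>M m. p ~: A" by (rule AE_not_in[OF A])
  hence "AE x in m. AE y in m. (x, y) ~: A" by (rule PM.AE_pair)
  hence "AE x in m. (NI (kk x) (%y. ix A (x, y))) = 0"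
  proof eventually_elim
   case (elim x)
   have "K (%y. ix A (x, y)) x = 0" by (rule ac) (measurable, use elim in auto)
   thus ?case by (subst (asm) kki) measurable
  qed
  hence "(NI m (%x. (NI (kk x) (%y. ix A (x, y))))) = (NI m (%x. 0))" by (rule nn_integral_cong_AE)
  hence "(NI Th (%p. ix A p)) = 0" by (subst iTh) simp_all
  thus "A : null_sets Th" using As sTh by (intro null_setsI) auto
 qed
 then obtain th0 where th0: "th0 : bm (m \<Otimes>\<^sub>M m)" "density (m \<Otimes>\<^sub>M m) th0 = Th"
  using PM.Radon_Nikodym sTh sB by metis
 have [measurable]: "th0 : bm ?B" using th0(1) sB by (simp cong: measurable_cong_sets)
 have dens: "AE x in m. K g x = (?b th0 x g)" if [measurable]: "g : BM" for g
 proof -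
  have [measurable]: "K g : BM" by (rule kopm[OF K that])
  have eq: "(NI m (%x. f x * K g x)) = (NI m (%x. f x * (?b th0 x g)))" if [measurable]: "f : BM" for f
  proof -
   have "(NI m (%x. f x * K g x)) = (NI m (%x. (NI (kk x) (%y. f x * g y))))"
    by (intro nncong) (simp add: kki nncmult)
   also have "... = (NI Th (%p. f (fst p) * g (snd p)))" by (subst iTh) simp_all
   also have "... = (NI (m \<Otimes>\<^sub>M m) (%p. th0 p * (f (fst p) * g (snd p))))"
    unfolding th0(2)[symmetric] by (rule nn_integral_density) measurable
   also have "... = (NI m (%x. (NI m (%y. th0 (x, y) * (f x * g y)))))" by (subst nn_integral_fst[symmetric]) simp_all
   also have "... = (NI m (%x. f x * (?b th0 x g)))"
    by (intro nncong) (subst nncmult[symmetric], measurable, simp add: mult.left_commute)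
   finally show ?thesis .
  qed
  have mI: "(%x. ?b th0 x g) : BM" by measurable
  note mK = kopm[OF K that]
  have "AE x in m. K g x <= (?b th0 x g)" by (rule AE_le_of_integral[OF mK mI eq_refl[OF eq]])
  moreover have "AE x in m. (?b th0 x g) <= K g x" by (rule AE_le_of_integral[OF mI mK eq_refl[OF eq[symmetric]]])
  ultimately show ?thesis by eventually_elim (rule antisym)
 qed
 have Kle: "K h x <= K h' x" if [measurable]: "h : BM" "h' : BM" and a: "AE y in m. h y = h' y" for h h' x
 proof -
  have "K h x <= K (%y. h' y + (if h y = h' y then 0 else h y)) x" by (rule kop_mono[OF K]) auto
  also have "... = K h' x + K (%y. if h y = h' y then 0 else h y) x" by (rule kop_add[OF K]) measurable
  also have "K (%y. if h y = h' y then 0 else h y) x = 0" by (rule ac) (use a in auto)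
  finally show ?thesis by simp
 qed
 define th where "th x y = (NI (kk x) (%z. th0 (z, y)))" for x y
 show ?thesis
 proof (rule that[of th])
  have "(%p. NI (kk (fst p)) (%z. th0 (z, snd p))) : bm ?B"
   by (rule nn_integral_measurable_subprob_algebra2[where N=borel]) measurable
  thus "(%(x, y). th x y) : bm ?B" unfolding th_def by (simp add: split_beta')
  fix g :: "'a => ennreal" and x assume [measurable]: "g : BM"
  interpret k: subprob_space "kk x" by (rule subprob_space_kernel[OF kk]) simp
  interpret P: pair_sigma_finite "kk x" m ..
  have [measurable]: "K g : BM" by (rule kopm[OF K]) simp
  have "K (K g) x = K (%z. ?b th0 z g) x"
   using dens[of g] by (intro antisym Kle) (auto elim!: eventually_mono)
  also have "... = (NI (kk x) (%z. (?b th0 z g)))" by (rule kki) measurable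
  also have "... = (NI m (%y. (NI (kk x) (%z. th0 (z, y) * g y))))" by (rule P.Fubini'[symmetric]) measurable
  also have "... = (NI m (%y. th x y * g y))" unfolding th_def by (intro nncong nn_integral_multc) measurable
  finally show "K (K g) x = (NI m (%y. th x y * g y))" .
 next
  fix x y assume z: "K (%_. 1) x = 0"
  have "K (%z. th0 (z, y)) x <= K (%z. iy * 1) x" by (rule kop_mono[OF K]) simp_all
  also have "... = iy * K (%_. 1) x" by (rule kop_cmult[OF K]) simp
  also have "... = 0" by (simp add: z)
  finally show "th x y = 0" unfolding th_def by (subst (asm) kki) simp_all
 qed
qed

end

context dualp
begin

text \<open>With \<open>th\<^sub>n(x, -)\<close> the density of \<open>K\<^sub>n K\<^sub>n(x, -)\<close>, where \<open>K\<^sub>n = n R\<^sub>D\<^sup>n\<close>, the Green function is the limit of the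
co-potentials of \<open>th\<^sub>n(x, -)\<close>. Identities that hold almost everywhere extend to all points of \<open>D\<close>, since both sides are excessive.\<close>

theorem is_green_ex:
 assumes D: "open D" shows "\<exists>G. is_green m X Y D G"
proof -
 let ?b = "%f x. (SUP n. Kn D n (Kn D n (RD 0 D f)) x)"
 let ?c = "%n f x. Kn D n (Kn D n (RD 0 D f)) x"
 let ?d = "%f G x. (NI m (%y. f y * G x y))"
 interpret S: dualp Y X m by (rule sym)
 interpret sigma_finite_measure m by (rule sigma_m)
 interpret PM: pair_sigma_finite m m ..
 let ?B = "borel \<Otimes>\<^sub>M borel :: ('a \<times> 'a) measure"
 have sB [measurable_cong]: "sets (m \<Otimes>\<^sub>M m) = sets ?B" by (intro sets_pair_measure_cong) simp_all
 have "\<exists>th. (%(x, y). th x y) : bm ?B &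
  (\<forall>g x. g : BM --> Kn D n (Kn D n g) x = (NI m (%y. th x y * g y))) & (\<forall>x y. x ~: D --> th x y = 0)" for n
 proof (rule kernel_density[OF kop_Kn[OF D] Kn_1[OF D]])
  show "Kn D n g x = 0" if "g : BM" "AE y in m. g y = 0" for g x
  proof -
   have "RD (rs n) D g x = 0" by (rule RD_ac[OF D of_nat_0_le_iff that(1)]) (use that(2) in auto)
   thus ?thesis by (simp only: Kn_def mult_zero_right)
  qed
 qed (use Kn_outside in blast)
 then obtain th where th [measurable]: "!!n. (%(x, y). th n x y) : bm ?B"
  and thK: "!!n g x. g : BM ==> Kn D n (Kn D n g) x = (NI m (%y. th n x y * g y))"
  and th0: "!!n x y. x ~: D ==> th n x y = 0" by metis
 have ths [measurable]: "th n x : BM" "(%x. th n x y) : BM" for n x y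
  using mcomp[OF measurable_Pair1' th, of x n] mcomp[OF measurable_Pair2' th, of y n] by simp_all
 define Gn where "Gn n x y = Y.RD 0 D (th n x) y" for n x y
 have Gnm [measurable]: "(%(x, y). Gn n x y) : bm ?B" for n
  unfolding Gn_def by (rule Y.RD_param_measurable[OF D th])
 have Gns [measurable]: "Gn n x : BM" for n x
  using mcomp[OF measurable_Pair1' Gnm, of x n] by simp
 have Gexc: "excessive Y D (Gn n x)" for n x unfolding Gn_def[abs_def] by (rule Y.excessive_RD[OF D ths(1)])
 have Rm [measurable]: "RD 0 D f : BM" if "f : BM" for f by (rule RD_measurable[OF D order_refl that])
 \<comment> \<open>By \<open>RD_dual\<close> the co-potential is moved onto \<open>f\<close>, and
   the density of the squared kernel is integrated against the result.\<close>
 have Gint: "(NI m (%y. f y * Gn n x y)) = ?c n f x" if [measurable]: "f : BM" for f n x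
 proof -
  have "(NI m (%y. f y * Gn n x y)) = (NI m (%y. RD 0 D f y * th n x y))"
   unfolding Gn_def by (rule S.RD_dual[OF D order_refl that ths(1)])
  thus ?thesis unfolding thK[OF Rm[OF that]] by (simp only: mult.commute)
 qed
 have KKm: "Kn D n f : BM" if "f : BM" for n f by (rule kopm[OF kop_Kn[OF D] that])
 have Kexc: "excessive X D (Kn D n (RD 0 D f))" if f: "f : BM" for n f
 proof -
  let ?a = "rs n"
  have "Kn D n (RD 0 D f) y = RD 0 D (%y. en ?a * RD ?a D f y) y" for y
   unfolding Kn_def by (subst kop_cmult[OF kop_RD[OF D order_refl] RD_measurable[OF D _ f]]) (simp_all add: RD_commute[OF D order_refl _ f, of ?a] del: of_nat_Suc)
  moreover have "(%y. en ?a * RD ?a D f y) : BM"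
   using RD_measurable[OF D _ f, of ?a] by measurable
  ultimately show ?thesis using excessive_RD[OF D, of "%y. en ?a * RD ?a D f y"] by presburger
 qed
 note Ki = excessive_Kn[OF D]
 have Kinc: "Kn D i F x <= Kn D n F x" if "i <= n" "excessive X D F" "F : BM" for i n F x
  using Ki(1)[OF that(2,3)] that(1) by (auto simp: incle)
 have KK: "incseq (%n. ?c n f x)" "?b f x = RD 0 D f x"
  if f: "f : BM" for f x
 proof -
  note e = excessive_RD[OF D f] and r = Rm[OF f]
  have le: "?c i f x <= ?c n f x" if "i <= n" for i n
   by (rule order_trans[OF kop_mono[OF kop_Kn[OF D] KKm[OF r] KKm[OF r] Kinc[OF that e r]] Kinc[OF that Kexc[OF f] KKm[OF r]]])
  thus "incseq (%n. ?c n f x)" by (simp add: incseq_def)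
  show "?b f x = RD 0 D f x"
  proof (cases "x : D")
   case x: True
   show ?thesis
   proof (rule antisym)
    show "?b f x <= RD 0 D f x"
     by (intro SUP_least order_trans[OF Ki(2)[OF Kexc[OF f] KKm[OF r]] Ki(2)[OF e r]])
    have "Kn D i (RD 0 D f) x <= ?b f x" for i
    proof -
     have "Kn D i (RD 0 D f) x = Kn D i (%y. SUP n. Kn D n (RD 0 D f) y) x"
     proof (rule arg_cong[where f="%h. Kn D i h x"], rule ext)
      show "RD 0 D f y = (SUP n. Kn D n (RD 0 D f) y)" for y
       using Ki(3)[OF e r, of y] by (cases "y : D") (simp_all add: RD_outside Kn_outside)
     qed
     also have "... = (SUP n. Kn D i (Kn D n (RD 0 D f)) x)"
      by (rule kop_SUP[OF kop_Kn[OF D] KKm[OF r] Ki(1)[OF e r]])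
     also have "... <= ?b f x"
     proof (rule SUP_least)
      fix n
      have "Kn D i (Kn D n (RD 0 D f)) x <= Kn D (max i n) (Kn D n (RD 0 D f)) x" by (rule Kinc[OF _ Kexc[OF f] KKm[OF r]]) simp
      also have "... <= Kn D (max i n) (Kn D (max i n) (RD 0 D f)) x"
       by (rule kop_mono[OF kop_Kn[OF D] KKm[OF r] KKm[OF r] Kinc[OF _ e r]]) simp
      finally show "Kn D i (Kn D n (RD 0 D f)) x <= ?b f x" by (rule order_trans) (rule SUP_upper, simp)
     qed
     finally show ?thesis .
    qed
    thus "RD 0 D f x <= ?b f x"
     unfolding Ki(3)[OF e r x, symmetric] by (rule SUP_least)
   qed
  qed (simp add: RD_outside Kn_outside)
 qed
 have Ginc: "incseq (%n. Gn n x)" for x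
 proof (intro incseq_SucI le_funI)
  fix n y
  show "Gn n x y <= Gn (Suc n) x y"
  proof (cases "y : D")
   case True
   show ?thesis
    by (rule S.exc_le[OF D Gexc Gexc Gns Gns _ True]) (use KK(1)[of _ x] in "simp add: Gint incseq_Suc_iff")
  qed (simp add: Gn_def Y.RD_outside)
 qed
 define G where "G x y = (SUP n. Gn n x y)" for x y
 have Gm [measurable]: "(%(x, y). G x y) : bm ?B"
 proof -
  have "(%p. SUP n. (case p of (x, y) => Gn n x y)) : bm ?B" by measurable
  thus ?thesis by (simp add: G_def split_beta')
 qed
 have Gs [measurable]: "G x : BM" for x
  using mcomp[OF measurable_Pair1' Gm, of x] by simp
 have Gi: "?d f G x = RD 0 D f x" if [measurable]: "f : BM" for f x
 proof -
  have "?d f G x = (SUP n. NI m (%y. f y * Gn n x y))"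
   unfolding G_def SUP_mult_left_ennreal using Ginc[of x]
   by (intro mctSUP) (auto simp: incle intro!: mulL)
  thus ?thesis by (simp add: Gint KK(2))
 qed
 have GY: "excessive Y D (G x)" for x
  unfolding G_def[abs_def] by (rule Y.excessive_SUP[OF D Gexc Gns Ginc])
 \<comment> \<open>An average of \<open>G x\<close> over the first variable is again co-excessive.
   It is used with the law of the killed process at time \<open>t\<close> and with measures having a
   density with respect to \<open>m\<close>, so that \<open>exc_le\<close> and \<open>exc_eq\<close>
   apply in the second variable.\<close>
 have mix: "(%y. NI mm (%x. G x y)) : BM" "excessive Y D (%y. NI mm (%x. G x y))"
  if s [measurable_cong]: "sets mm = sets borel" and sf: "sigma_finite_measure mm" for mm
 proof -
  interpret M: sigma_finite_measure mm by (rule sf)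
  have thmm: "(%(x, y). th n x y) : bm (mm \<Otimes>\<^sub>M borel)" for n by measurable
  have I [measurable]: "(%y. NI mm (%x. th n x y)) : BM" for n by measurable
  have f: "(NI mm (%x. Gn n x y)) = Y.RD 0 D (%y. NI mm (%x. th n x y)) y" for n y
   unfolding Gn_def by (rule Y.RD_fubini[OF D thmm sf])
  have e: "(%y. NI mm (%x. G x y)) = (%y. SUP n. NI mm (%x. Gn n x y))"
   unfolding G_def using Ginc by (intro ext mctSUP) (auto simp: incle)
  show "excessive Y D (%y. NI mm (%x. G x y))" unfolding e
  proof (rule Y.excessive_SUP[OF D])
   show "excessive Y D (%y. NI mm (%x. Gn n x y))" for n unfolding f by (rule Y.excessive_RD[OF D I])
   show "(%y. NI mm (%x. Gn n x y)) : BM" for n by measurable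
   show "incseq (%n y. NI mm (%x. Gn n x y))" using Ginc by (auto simp: incle intro!: nnmono)
  qed
  show "(%y. NI mm (%x. G x y)) : BM" by measurable
 qed
 have mixi: "(NI m (%y. f y * (NI mm (%x. G x y)))) = (NI mm (%x. RD 0 D f x))"
  if s [measurable_cong]: "sets mm = sets borel" and sf: "sigma_finite_measure mm" and [measurable]: "f : BM" for mm f
 proof -
  interpret M: sigma_finite_measure mm by (rule sf)
  interpret P: pair_sigma_finite mm m ..
  have "(NI m (%y. f y * (NI mm (%x. G x y)))) = (NI m (%y. (NI mm (%x. f y * G x y))))"
   by (intro nncong nncmult[symmetric]) measurable
  also have "... = (NI mm (%x. ?d f G x))" by (rule P.Fubini') measurable
  finally show ?thesis by (simp add: Gi)
 qed
 have occ: "occupation X D f x = RD 0 D f x" if "x : D" for f x using that unfolding RD_def occupation_def occ_def by simp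
 have occY: "occupation Y D f x = Y.RD 0 D f x" if "x : D" for f x using that unfolding Y.RD_def occupation_def Y.occ_def by simp
 have G0: "G x y = 0" if "x ~: D \<or> y ~: D" for x y
 proof -
  have "Gn n x y = 0" for n
  proof (cases "y : D")
   case False
   thus ?thesis by (simp add: Gn_def Y.RD_outside)
  next
   case True
   hence "th n x = (%_. 0)" using that th0 by auto
   thus ?thesis unfolding Gn_def using kop_zero[OF Y.kop_RD[OF D order_refl]] by simp
  qed
  thus ?thesis by (simp add: G_def)
 qed
 have GD: "f y * G x y * ix D y = f y * G x y" "f x * G x y * ix D x = f x * G x y" for f :: "'a => ennreal" and x y
  using G0 by (auto split: splix)
 have "is_green m X Y D G"
  unfolding is_green_def GD
 proof (intro conjI ballI allI impI)
  show "occupation X D f x = ?d f G x" if "f : BM" "x : D" for f x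
   using that by (simp add: occ Gi)
  show "occupation Y D f y = (NI m (%x. f x * G x y))" if f [measurable]: "f : BM" and y: "y : D" for f y
  proof -
   have s: "sets (density m f) = sets borel" by simp
   obtain A where A [measurable]: "!!n. A n : sets borel" and Ai: "incseq A" "(\<Union>n. A n) = UNIV" "!!n. emeasure m (A n) < iy" by (rule sigma_trunc) blast
   \<comment> \<open>A finite-valued density makes the measure sigma-finite, as \<open>mix\<close>
     requires.\<close>
   define tr where "tr n x = min (f x) (en (real n)) * ix (A n) x" for n x
   have trm [measurable]: "tr n : BM" for n unfolding tr_def by measurable
   have sf: "sigma_finite_measure (density m (tr n))" for n
    by (subst sigma_finite_iff_density_finite[OF trm[unfolded measurable_cong_sets[OF sets_m refl, symmetric]]])
     (auto simp: tr_def min_def top_unique intro!: AE_I2 split: splix)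
   have mono: "incseq (%n. tr n x)" for x
    unfolding tr_def[abs_def]
    by (intro incseq_mult incseq_min_of_nat) (use Ai(1) in "auto simp: incseq_def split: splix")
   have sup: "(SUP n. tr n x) = f x" for x
   proof -
    have "incseq (%n. ix (A n) x :: ennreal)" using Ai(1) by (auto simp: incseq_def split: splix)
    moreover have "(SUP n. ix (A n) x :: ennreal) = 1"
    proof (rule antisym)
     obtain n where "x : A n" using Ai(2) by blast
     thus "1 <= (SUP n. ix (A n) x :: ennreal)" by (intro SUP_upper2[of n]) auto
    qed (auto intro!: SUP_least split: splix)
    ultimately show ?thesis
     unfolding tr_def using SUP_mult_incseq[OF incseq_min_of_nat, of "%n. ix (A n) x" "f x"] by (simp add: SUP_min_of_nat)
   qed
   have dI: "(NI (density m (tr n)) (%x. h x)) = (NI m (%x. tr n x * h x))" if [measurable]: "h : BM" for n h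
    by (rule nn_integral_density) measurable
   have Gy [measurable]: "(%x. G x y) : BM" for y using mcomp[OF measurable_Pair2' Gm, of y] by simp
   have tn: "Y.RD 0 D (tr n) y = (NI m (%x. tr n x * G x y))" for n
   proof -
    have "Y.RD 0 D (tr n) y = (NI (density m (tr n)) (%x. G x y))"
    proof (rule S.exc_eq[OF D Y.excessive_RD[OF D trm] mix(2)[OF _ sf] Y.RD_measurable[OF D order_refl trm] mix(1)[OF _ sf] _ y])
     fix g :: "'a => ennreal" assume g: "g : BM"
     show "(NI m (%y. g y * Y.RD 0 D (tr n) y)) = (NI m (%y. g y * (NI (density m (tr n)) (%x. G x y))))"
      using RD_dual[OF D order_refl trm g, of n] by (subst mixi[OF _ sf g]) (simp_all add: dI[OF Rm[OF g]] mult.commute)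
    qed simp_all
    thus ?thesis by (simp add: dI)
   qed
   have "Y.RD 0 D f y = (SUP n. Y.RD 0 D (tr n) y)"
    using kop_SUP[OF Y.kop_RD[OF D order_refl], where h=tr and x=y] mono by (simp add: sup incle)
   also have "... = (NI m (%x. (SUP n. tr n x * G x y)))"
    unfolding tn using mono by (intro mctSUP[symmetric]) (auto simp: incle intro!: mulR)
   also have "... = (NI m (%x. f x * G x y))" unfolding SUP_mult_right_ennreal[symmetric] sup ..
   finally show ?thesis using occY[OF y] by simp
  qed
  show "excessive X D (%x. G x y)" if y: "y : D" for y
  proof -
   \<comment> \<open>Excessiveness in \<open>x\<close> is proved for fixed \<open>x\<close> by
     varying \<open>y\<close>: as a function of \<open>y\<close> the semigroup term is co-excessive,
     so inequalities may be checked after integration in \<open>y\<close>, where they become those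
     of \<open>ks_RD\<close>.\<close>
   define F where "F t x = (%y. killed_semigroup X D t (%x. G x y) x)" for t x
   have Fx: "excessive Y D (F t x)" "F t x : BM"
    "!!f. f : BM ==> (NI m (%y. f y * F t x y)) = ks D t (RD 0 D f) x" if x: "x : D" for t x
   proof -
    obtain mm where mm: "sets mm = sets borel" "!!g. g : BM ==> ks D t g x = (NI mm (%y. g y))"
     using mfun_ks[OF D x, of t] unfolding mfun_def by blast
    have "emeasure mm UNIV <= 1" using ks_1[of D t x] mm(2)[of "%_. 1"] sets_eq_imp_space_eq[OF mm(1)] by simp
    hence "finite_measure mm" using sets_eq_imp_space_eq[OF mm(1)] by (intro finite_measureI) (auto simp: top_unique)
    hence sf: "sigma_finite_measure mm" by (rule finite_measure.axioms)
    have Gy: "(%x. G x y) : BM" for y using mcomp[OF measurable_Pair2' Gm, of y] by simp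
    have e: "F t x = (%y. NI mm (%x. G x y))" unfolding F_def using mm(2)[OF Gy] by simp
    show "excessive Y D (F t x)" "F t x : BM" unfolding e by (rule mix[OF mm(1) sf])+
    show "(NI m (%y. f y * F t x y)) = ks D t (RD 0 D f) x" if "f : BM" for f
     unfolding e mixi[OF mm(1) sf that] using mm(2)[OF Rm[OF that]] by simp
   qed
   have le: "F t x y <= G x y" if "0 < t" "x : D" for t x
    by (rule S.exc_le[OF D Fx(1)[OF that(2)] GY Fx(2)[OF that(2)] Gs _ y]) (simp add: Fx(3)[OF that(2)] Gi ks_RD_le[OF D that(2) _ that(1)])
   have anti: "F t x y' <= F s x y'" if "0 < s" "s <= t" "x : D" for s t x y'
   proof (cases "y' : D")
    case True
    show ?thesis
     by (rule S.exc_le[OF D Fx(1)[OF that(3)] Fx(1)[OF that(3)] Fx(2)[OF that(3)] Fx(2)[OF that(3)] _ True])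
      (simp add: Fx(3)[OF that(3)] ks_RD_anti[OF D that(3) _ that(1,2)])
   next
    case False
    hence "(%x. G x y') = (%_. 0)" using G0 by auto
    thus ?thesis unfolding F_def using mfun_zero[OF mfun_ks[OF D that(3)]] by simp
   qed
   have sup: "(SUP k. F (1 / real (Suc k)) x y) = G x y" if x: "x : D" for x
   proof -
    let ?F = "%k. F (1 / real (Suc k)) x"
    have inc: "incseq ?F" unfolding incle by (intro allI impI anti x) (auto simp: frac_le simp del: of_nat_Suc)
    have m: "(%y. SUP k. ?F k y) : BM" using Fx(2)[OF x] by measurable
    show ?thesis
    proof (rule S.exc_eq[OF D Y.excessive_SUP[OF D Fx(1)[OF x] Fx(2)[OF x] inc] GY m Gs _ y])
     fix f :: "'a => ennreal" assume f [measurable]: "f : BM"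
     note [measurable] = Fx(2)[OF x]
     have "(NI m (%y. f y * (SUP k. ?F k y))) = (SUP k. NI m (%y. f y * ?F k y))"
      unfolding SUP_mult_left_ennreal using inc
      by (intro mctSUP) (auto simp: incle simp del: of_nat_Suc intro!: mulL)
     also have "... = RD 0 D f x" unfolding Fx(3)[OF x f] by (rule ks_RD_sup[OF D x f])
     finally show "(NI m (%y. f y * (SUP k. ?F k y))) = ?d f G x" by (simp only: Gi[OF f])
    qed
   qed
   show ?thesis unfolding excessive_def
    using le anti sup unfolding F_def by (auto intro!: antimono_tendsto_at_right)
  qed
 qed (use Gm G0 GY in auto)
 thus ?thesis by blast
qed

lemma is_green_unique:
 assumes D: "open D" and G: "is_green m X Y D G" "is_green m X Y D G'" shows "G = G'"
proof (intro ext)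
 interpret S: dualp Y X m by (rule sym)
 fix x y
 show "G x y = G' x y"
 proof (cases "x : D & y : D")
  case True
  have [measurable]: "D : sets borel" using D by simp
  have m: "(%y. H x y) : BM" if "is_green m X Y D H" for H
  proof -
   have "(%(x, y). H x y) : bm (borel \<Otimes>\<^sub>M borel)" using that unfolding is_green_def by blast
   from mcomp[OF measurable_Pair1' this, of x] show ?thesis by simp
  qed
  have i: "(NI m (%y. f y * H x y)) = occupation X D f x" if H: "is_green m X Y D H" and f: "f : BM" for H f
  proof -
   have "(NI m (%y. f y * H x y)) = (SI m D (%y. f y * H x y))"
    by (intro nncong) (use H in "auto simp: is_green_def split: splix")
   thus ?thesis using H f True unfolding is_green_def by auto
  qed
  show ?thesis
   by (rule S.exc_eq[OF D _ _ m[OF G(1)] m[OF G(2)]]) (use G True i in "auto simp: is_green_def")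
 qed (use G in "auto simp: is_green_def")
qed

lemma RD_green:
 assumes D: "open D" and f: "f : BM" and x: "x : D"
 shows "RD 0 D f x = (NI m (%y. f y * green m X Y D x y))" and "(%y. green m X Y D x y) : BM"
proof -
 let ?a = "(NI m (%y. f y * green m X Y D x y))"
 have G: "is_green m X Y D (green m X Y D)"
 proof -
  have "\<exists>!G. is_green m X Y D G" using is_green_ex[OF D] is_green_unique[OF D] by blast
  thus ?thesis unfolding green_def by (rule theI')
 qed
 hence "(%(x, y). green m X Y D x y) : bm (borel \<Otimes>\<^sub>M borel)" unfolding is_green_def by blast
 from mcomp[OF measurable_Pair1' this, of x] show "(%y. green m X Y D x y) : BM" by simp
 have "RD 0 D f x = (SI m D (%y. f y * green m X Y D x y))"
  using G f x unfolding is_green_def RD_def occupation_def occ_def by simp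
 also have "... = ?a"
  by (intro nncong) (use G in "auto simp: is_green_def split: splix")
 finally show "RD 0 D f x = ?a" .
qed

end

section \<open>Irregular boundary points form a polar set\<close>

context hunt
begin

text \<open>Visits to the neighbourhoods of the complement are counted only after time
  \<open>ee\<close>. As \<open>ee\<close> decreases to 0, the limit is almost surely 0 exactly when
  the exit time is, which detects regularity.\<close>

definition sg :: "real => 'a set => 'w => ennreal" where
 "sg ee D ww = (SUP k. hitA ee (Uk D k) ww)"

lemma sg_measurable [measurable]: "sg ee D : bm (events X)"
 unfolding sg_def[abs_def] by (intro borel_measurable_SUP stopm stop_hitA open_Uk) simp

lemma sg_le: "ww : Om ==> en ee <= t ==> t < iy ==> pos X t ww : Some ` (- D) ==> sg ee D ww <= t"
 unfolding sg_def using Compl_subset_Uk[of D] by (intro SUP_least hitA_le) (auto simp: open_Uk)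

lemma exit_le_sg:
 assumes "open D" "0 < ee"
 shows "AE ww in P x. exit_time X D ww <= sg ee D ww"
 using hitA_sup_limit[OF assms(1), of ee x]
proof eventually_elim
 case (elim ww)
 have "en ee <= sg ee D ww" unfolding sg_def by (rule SUP_upper2[of 0]) (auto simp: hitA_ge)
 hence "0 < sg ee D ww" using assms(2) less_le_trans[of 0 "en ee" "sg ee D ww"] by simp
 thus ?case
  using elim unfolding exit_time_def hitting_time_def sg_def[symmetric]
  by (cases "sg ee D ww < iy") (auto intro!: Inf_lower simp: less_top[symmetric])
qed

text \<open>By the Markov property at time \<open>ee\<close> the starting point enters only through
  \<open>semigroup X ee F\<close> with bounded \<open>F\<close>. The strong Feller property then
  makes the discounted mean of \<open>sg\<close> continuous in \<open>x\<close>.\<close>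

lemma occ_sg:
 assumes D: "open D" and ee: "0 < ee"
 obtains F where "F : BM" "!!y. 0 <= F y" "!!y. F y <= (1::real)"
  "!!x. occ 1 (sg ee D) (%_. 1) x = en (1 - exp (- ee) + exp (- ee) * semigroup X ee F x)"
proof -
 interpret filtration Om "right_filtration X" by (rule filtration_right)
 let ?c = "%_::'w. en ee"
 define L where "L k = occ 1 (hitA 0 (Uk D k)) (%_. 1)" for k
 note h = zero_less_one open_Uk[of D] borel_measurable_const[of "1::ennreal"]
 have Lm [measurable]: "L k : BM" for k
  unfolding L_def by (rule occ_hitA_measurable[OF h, where c=1]) simp_all
 have L1: "L k y <= 1" for k y
  unfolding L_def using order_trans[OF occ_le_R R_const_le[of 1 1 y]] by simp
 have Linc: "incseq L"
  unfolding L_def incle by (intro allI impI occ_mono_T hit_anti Uk_mono)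
 have fc: "fin 1 ?c g x = en (exp (- ee)) * (PI x (%ww. xt g (en ee) ww))" if [measurable]: "g : BM" for g x
  unfolding fin_def using ee by (simp add: nncmult)
 have step: "occ 1 (hitA ee (Uk D k)) (%_. 1) x = occ 1 ?c (%_. 1) x + fin 1 ?c (L k) x" for k x
 proof (rule LIMSEQ_unique[OF kill_tendsto_from[OF h, where c=1]])
  have mf: "mfun (%g. fin 1 ?c g x)" by (rule mfun_fin') simp
  have "(%n. fin 1 ?c (kill 1 (Uk D k) (rs n) (%_. 1)) x) ----> fin 1 ?c (L k) x"
  proof (rule mfun_lim[OF mf _ _ Lm])
   show "kill 1 (Uk D k) (rs n) (%_. 1) : BM" for n
    by (rule kill_measurable[OF zero_less_one _ open_Uk, of _ _ 1]) simp_all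
   show "kill 1 (Uk D k) (rs n) (%_. 1) y <= 1" for n y
    using kill_bound[OF zero_less_one _ open_Uk, of "rs n" "%_. 1" 1] by simp
   show "fin 1 ?c (%_. 1) x < iy" using fin_bound[of 1 "%_. 1" 1 ?c x] by (auto intro: le_less_trans)
   show "(%n. kill 1 (Uk D k) (rs n) (%_. 1) y) ----> L k y" for y
    unfolding L_def by (rule kill_tendsto[OF h, where c=1]) simp_all
  qed simp
  thus "(%n. occ 1 ?c (%_. 1) x + fin 1 ?c (kill 1 (Uk D k) (rs n) (%_. 1)) x) ----> occ 1 ?c (%_. 1) x + fin 1 ?c (L k) x"
   by (intro tendsto_add tendsto_const)
 qed simp_all
 have oc: "occ 1 ?c (%_. 1) x = en (1 - exp (- ee))" for x
 proof -
  interpret PS: prob_space "P x" by (rule prob_law)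
  have "1 = occ 1 ?c (%_. 1) x + fin 1 ?c (%_. 1) x"
   using smarkov[OF stopping_time_const, of "%_. 1" 1 x "en ee"] ext[of "R 1 (%_. 1)" "%_. 1"] by (simp add: R_const fin_def)
  moreover have "(PI x (%ww. xt (%_. 1) (en ee) ww)) = (PI x (%ww. 1))"
  proof (rule nn_integral_cong_AE)
   show "AE ww in P x. xt (%_. 1) (en ee) ww = (1::ennreal)"
    using AE_alive[of x]
   proof eventually_elim
    case (elim ww)
    thus ?case using spec[OF elim, of "en ee"] by (cases "px ee ww") (auto simp: less_top)
   qed
  qed
  ultimately have "en (exp (- ee)) + occ 1 ?c (%_. 1) x = en (exp (- ee)) + en (1 - exp (- ee))"
   using ee by (simp add: fc PS.emeasure_space_1 add.commute flip: ennreal_plus)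
  thus ?thesis by (rule ennreal_cancel) simp
 qed
 define F where "F y = enn2real (SUP k. L k y)" for y
 have F1: "(SUP k. L k y) <= 1" for y using L1 by (intro SUP_least)
 have Fe: "(SUP k. L k y) = en (F y)" for y
  unfolding F_def using F1[of y] by (subst ennreal_enn2real) (auto intro: le_less_trans)
 show ?thesis
 proof (rule that[of F])
  show Fm: "F : BM" unfolding F_def by measurable
  show F0: "0 <= F y" for y unfolding F_def by simp
  show F1': "F y <= 1" for y using F1[of y] unfolding Fe by simp
  fix x
  have "occ 1 (sg ee D) (%_. 1) x = (SUP k. occ 1 (hitA ee (Uk D k)) (%_. 1) x)"
   unfolding sg_def[abs_def] by (rule occ_SUP_T) (auto simp: incseq_def intro!: hit_anti Uk_mono stopm stop_hitA open_Uk)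
  also have "... = en (1 - exp (- ee)) + (SUP k. fin 1 ?c (L k) x)"
   unfolding step oc by (rule ennreal_SUP_add_right[symmetric]) simp
  also have "(SUP k. fin 1 ?c (L k) x) = fin 1 ?c (%y. SUP k. L k y) x"
   by (rule mfun_SUP[OF mfun_fin' Lm Linc, symmetric]) simp
  also have "... = en (exp (- ee)) * en (semigroup X ee F x)"
   unfolding Fe semigroup_nn(1)[OF Fm F0 F1'] using Fm by (intro fc) measurable
  finally show "occ 1 (sg ee D) (%_. 1) x = en (1 - exp (- ee) + exp (- ee) * semigroup X ee F x)"
   using ee semigroup_nn(2)[OF Fm F0 F1'] by (simp add: ennreal_mult' ennreal_plus)
 qed
qed

lemma occ_1_zero:
 assumes [measurable]: "T : bm (events X)" and z: "occ 1 T (%_. 1) x = 0"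
 shows "AE ww in P x. T ww = 0"
proof -
 have "AE ww in P x. (SI lborel (bf (T ww)) (%t. xp 1 t * xt (%_. 1) (en t) ww)) = 0"
 proof -
  have "(%ww. LI (%t. xp 1 t * xt (%_. 1) (en t) ww * (if 0 <= t & en t < T ww then 1 else 0))) : bm (P x)"
   by measurable
  thus ?thesis using z unfolding occ_def
   by (subst (asm) nn_integral_0_iff_AE) (simp_all add: indicator_def)
 qed
 thus ?thesis using AE_alive[of x]
 proof eventually_elim
  case (elim ww)
  show ?case
  proof (rule ccontr)
   assume "T ww ~= 0"
   hence "0 < T ww" by (simp add: zero_less_iff_neq_zero)
   then obtain c where c: "0 < c" "c < T ww" using dense by blast
   then obtain r where r0: "0 < r" and r: "c = en r" "en r < T ww" by (cases c) auto
   have "0 < en (exp (- r) * r)" using r0 by simp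
   also have "... = (LI (%t. en (exp (- r)) * ix {0..r} t))"
    using r0 by (simp add: nn_integral_cmult_indicator ennreal_mult')
   also have "... <= (SI lborel (bf (T ww)) (%t. xp 1 t * xt (%_. 1) (en t) ww))"
   proof (rule nnmono)
    fix t
    show "en (exp (- r)) * ix {0..r} t <= xp 1 t * xt (%_. 1) (en t) ww * ix (bf (T ww)) t"
    proof (cases "t : {0..r}")
     case True
     hence "en t < T ww" using r(2) r0 by (auto intro: le_less_trans ennreal_leI)
     moreover have "px t ww ~= None" using spec[OF elim(2), of "en t"] by (auto simp: less_top)
     ultimately show ?thesis using True by (auto intro: ennreal_leI)
    qed simp
   qed
   finally show False using elim(1) by simp
  qed
 qed
qed

text \<open>A point outside \<open>D\<close> that does not exit at once has discounted means
  \<open>?rh i\<close> bounded below by some \<open>1 / (n + 1)\<close>. The set \<open>B n\<close>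
  of such points is closed by continuity, and thin: from a point regular for it the process exits at
  once, and the means tend to 0. The irregular points are thus semi-polar, hence polar.\<close>

lemma irregular_polar:
 assumes D: "open D" and sf: "strongly_feller X" and pol: "!!B. semi_polar X B ==> polar X B"
 obtains E where "E : sets borel" "frontier D - regular_points X D <= E" "!!x. AE ww in P x. hitting_time X (Some ` E) ww = iy"
proof -
 define e where "e i = 1 / real (Suc i)" for i
 have e: "0 < e i" for i unfolding e_def by simp
 have "\<forall>i. \<exists>F. F : BM & (\<forall>y. 0 <= F y & F y <= (1::real)) &
  (\<forall>x. occ 1 (sg (e i) D) (%_. 1) x = en (1 - exp (- e i) + exp (- e i) * semigroup X (e i) F x))"
  using occ_sg[OF D e] by metis
 then obtain F where F: "!!i. F i : BM" "!!i y. 0 <= F i y" "!!i y. F i y <= 1"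
  and occF: "!!i x. occ 1 (sg (e i) D) (%_. 1) x = en (1 - exp (- e i) + exp (- e i) * semigroup X (e i) (F i) x)" by metis
 let ?rh = "%i x. 1 - exp (- e i) + exp (- e i) * semigroup X (e i) (F i) x"
 have cont: "continuous_on UNIV (?rh i)" for i
 proof -
  have "bounded (range (F i))" unfolding bounded_iff using F(2,3)[of i] by (intro exI[of _ 1]) auto
  thus ?thesis using sf e F(1) unfolding strongly_feller_def by (intro continuous_intros) auto
 qed
 have rh0: "0 <= ?rh i x" for i x using semigroup_nn(2)[OF F(1-3)] e[of i] by (intro add_nonneg_nonneg) auto
 have sg_anti: "sg (e i) D ww <= sg (e k) D ww" if "k <= i" for i k ww
 proof -
  have "e i <= e k" using that unfolding e_def by (simp add: frac_le)
  hence "Qs (e k) <= Qs (e i)" unfolding Qs_def by (auto intro: le_less_trans ennreal_leI)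
  hence "hitA (e i) U ww <= hitA (e k) U ww" for U unfolding hit_def by (intro Inf_superset_mono) auto
  thus ?thesis unfolding sg_def by (intro SUP_mono) blast
 qed
 have lim: "(%i. sg (e i) D ww) ----> (INF i. sg (e i) D ww)" for ww
  by (rule LIMSEQ_INF) (use sg_anti in "simp add: decseq_def")
 have olim: "(%i. occ 1 (sg (e i) D) (%_. 1) x) ----> occ 1 (%ww. INF i. sg (e i) D ww) (%_. 1) x" for x
  by (rule occ_tendsto[of _ _ 1]) (use lim in auto)
 define B where "B n = - D Int (\<Inter>i. {x. 1 / rs n <= ?rh i x})" for n
 have clB: "closed (B n)" for n
  unfolding B_def using D by (intro closed_Int closed_INT ballI closed_Collect_le[OF continuous_on_const cont]) auto
 have reach: "AE ww in P x. (INF i. sg (e i) D ww) = 0" if "AE ww in P x. exit_time X D ww = 0" for x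
  using that AE_alive[of x] AE_space
 proof eventually_elim
  case (elim ww)
  have om: "ww : Om" using elim(3) by (simp add: space_law)
  have "(INF i. sg (e i) D ww) <= d" if d: "0 < d" for d
  proof -
   have "Inf {t. 0 < t & pos X t ww \<in> - Some ` D} < d" using elim(1) d unfolding exit_time_def hitting_time_def by simp
   then obtain t where t: "0 < t" "pos X t ww \<in> - Some ` D" "t < d" unfolding Inf_less_iff by auto
   have tf: "t < iy" using t(3) by (auto simp: less_top[symmetric])
   then obtain y where "pos X t ww = Some y" using elim(2) by auto
   hence p: "pos X t ww : Some ` (- D)" using t(2) by auto
   obtain r where r: "t = en r" "0 < r" using t(1) tf by (cases t) auto
   obtain i where i: "e i < r" unfolding e_def using nat_approx_posE[OF r(2)] by auto
   hence "sg (e i) D ww <= t" using r by (intro sg_le[OF om _ tf p]) (auto intro: ennreal_leI)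
   thus ?thesis using t(3) by (intro INF_lower2[of i]) auto
  qed
  thus ?case using dense_ge[of 0 "INF i. sg (e i) D ww"] by simp
 qed
 have "thin X (B n)" for n
  unfolding thin_def
 proof (intro bexI[of _ "B n"] conjI allI notI subset_refl)
  show "B n : sets borel" using clB by simp
  fix x assume h: "AE ww in P x. hitting_time X (Some ` B n) ww = 0"
  interpret PS: prob_space "P x" by (rule prob_law)
  \<comment> \<open>A point regular for a closed set belongs to it, by right continuity at time
    0.\<close>
  have "AE ww in P x. x : B n"
   using h pos_0[of "Some x"] AE_space
  proof eventually_elim
   case (elim ww)
   have om: "ww : Om" using elim(3) by (simp add: space_law)
   show ?case
   proof (rule ccontr)
    assume "x ~: B n"
    hence "pos X 0 ww : Some ` (- B n)" using elim(2) by simp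
    then obtain b where b: "0 < b" "!!r. 0 < r ==> r < b ==> pos X r ww : Some ` (- B n)"
     using rc_interval[OF om _ openin_cem_Some[OF open_Compl[OF clB[of n]]], of 0] by auto
    have "Inf {t. 0 < t & pos X t ww : Some ` B n} < b" using elim(1) b(1) unfolding hitting_time_def by simp
    then obtain t where "0 < t" "pos X t ww : Some ` B n" "t < b" unfolding Inf_less_iff by auto
    thus False using b(2)[of t] by auto
   qed
  qed
  hence x: "x : B n" using PS.AE_const by simp
  have "AE ww in P x. exit_time X D ww = 0"
   using h
  proof eventually_elim
   case (elim ww)
   have "exit_time X D ww <= hitting_time X (Some ` B n) ww"
    unfolding exit_time_def hitting_time_def by (rule Inf_superset_mono) (auto simp: B_def)
   thus ?case using elim by simp
  qed
  hence "occ 1 (%ww. INF i. sg (e i) D ww) (%_. 1) x = 0" by (intro occ_zero_T reach)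
  hence "(%i. en (?rh i x)) ----> 0" using olim[of x] unfolding occF by simp
  moreover have "en (1 / rs n) <= en (?rh i x)" for i using x unfolding B_def by (intro ennreal_leI) auto
  ultimately have "en (1 / rs n) <= 0" by (intro LIMSEQ_le_const[of _ 0]) auto
  thus False by simp
 qed
 hence "semi_polar X (\<Union>n. B n)" unfolding semi_polar_def by blast
 hence "polar X (\<Union>n. B n)" by (rule pol)
 then obtain E where E: "E : sets borel" "(\<Union>n. B n) <= E" "!!x. AE ww in P x. hitting_time X (Some ` E) ww = iy"
  unfolding polar_def by blast
 have "x : (\<Union>n. B n)" if x: "x : frontier D" "x ~: regular_points X D" for x
 proof (rule ccontr)
  assume n: "x ~: (\<Union>n. B n)"
  have "x ~: D" using x D by (simp add: frontier_def interior_open)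
  hence "\<exists>i. ?rh i x < 1 / rs n" for n using n unfolding B_def by (auto simp: not_le)
  hence le: "(INF i. en (?rh i x)) <= en (1 / rs n)" for n
   by (meson INF_lower2 UNIV_I ennreal_leI less_imp_le)
  have "(INF i. en (?rh i x)) <= 0"
  proof (rule LIMSEQ_le_const)
   have "(%n. 1 / rs n) ----> 0" by real_asymp
   hence "(%n. en (1 / rs n)) ----> en 0" by (rule tendsto_ennrealI)
   thus "(%n. en (1 / rs n)) ----> 0" by simp
  qed (use le in blast)
  moreover have "occ 1 (%ww. INF i. sg (e i) D ww) (%_. 1) x <= (INF i. en (?rh i x))"
   unfolding occF[symmetric] by (intro INF_greatest occ_mono_T INF_lower) simp
  ultimately have "occ 1 (%ww. INF i. sg (e i) D ww) (%_. 1) x = 0" by simp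
  hence "AE ww in P x. (INF i. sg (e i) D ww) = 0" by (intro occ_1_zero) measurable
  moreover have "AE ww in P x. \<forall>i. exit_time X D ww <= sg (e i) D ww" unfolding AE_all_countable using exit_le_sg[OF D e] by blast
  ultimately have "AE ww in P x. exit_time X D ww = 0"
  proof eventually_elim
   case (elim ww)
   hence "exit_time X D ww <= (INF i. sg (e i) D ww)" by (intro INF_greatest) simp
   thus ?case using elim by simp
  qed
  thus False using x unfolding regular_points_def by simp
 qed
 hence "frontier D - regular_points X D <= E" using E(2) by (auto simp del: UN_iff)
 thus ?thesis by (rule that[OF E(1) _ E(3)])
qed

end

section \<open>Harmonic functions and killing\<close>

lemma neu_mono:
 assumes R: "kop R" and [measurable]: "q : BM" "g : BM" "h : BM" and le: "!!y. g y <= h y"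
 shows "neu R q g j x <= neu R q h j x"
proof (induction j arbitrary: x)
 case (Suc j)
 note [measurable] = neu_measurable[OF R]
 show ?case using Suc le by (simp, intro kop_mono[OF R] add_mono mulL) auto
qed simp

lemma nlim_mono:
 assumes "kop R" "q : BM" "g : BM" "h : BM" "!!y. g y <= h y"
 shows "nlim R q g x <= nlim R q h x"
 unfolding nlim_def using neu_mono[OF assms] by (intro SUP_mono) blast

lemma nlim_subadd:
 assumes R: "kop R" and q [measurable]: "q : BM" and g [measurable]: "g : BM" and h [measurable]: "h : BM"
 shows "nlim R q (%y. g y + h y) x <= nlim R q g x + nlim R q h x"
proof (rule nlim_least[OF R q])
 let ?a = "%y. nlim R q g y + nlim R q h y"
 note [measurable] = nlim_measurable[OF R q g] nlim_measurable[OF R q h]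
 have "R (%y. g y + h y + q y * (?a y)) y = R (%y. (g y + q y * nlim R q g y) + (h y + q y * nlim R q h y)) y" for y
  by (rule arg_cong[where f="%k. R k y"]) (auto simp: distrib_left add.assoc add.left_commute)
 also have "... y = ?a y" for y
  by (subst kop_add[OF R]) (measurable, simp add: nlim_fix[OF R q g, symmetric] nlim_fix[OF R q h, symmetric])
 finally show "R (%y. g y + h y + q y * (?a y)) y <= ?a y" for y by simp
qed (use nlim_measurable[OF R q g] nlim_measurable[OF R q h] in measurable)

lemma nlim_SUP_le:
 assumes R: "kop R" and q [measurable]: "q : BM" and g [measurable]: "!!n::nat. g n : BM" and inc: "incseq g"
 shows "nlim R q (%y. SUP n. g n y) x <= (SUP n. nlim R q (g n) x)"
proof (rule nlim_least[OF R q])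
 let ?a = "%z. (SUP n. g n z) + q z * (SUP n. nlim R q (g n) z)"
 note [measurable] = nlim_measurable[OF R q g]
 have ni: "nlim R q (g i) y <= nlim R q (g n) y" if "i <= n" for i n y
  by (rule nlim_mono[OF R q g g]) (use inc that in "auto simp: incle")
 fix y
 have e: "?a z = (SUP n. g n z + q z * nlim R q (g n) z)" for z
  unfolding SUP_mult_left_ennreal
  by (rule ennreal_SUP_add[symmetric]) (use inc ni in "auto simp: incle intro!: mulL")
 have "R (%z. ?a z) y = (SUP n. R (%z. g n z + q z * nlim R q (g n) z) y)"
  unfolding e using inc ni by (intro kop_SUP[OF R]) (auto simp: incle intro!: add_mono mulL)
 also have "... = (SUP n. nlim R q (g n) y)" by (simp only: nlim_fix[OF R q g, symmetric])
 finally show "R (%z. ?a z) y <= (SUP n. nlim R q (g n) y)" by simp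
qed (use nlim_measurable[OF R q g] in measurable)

context hunt
begin

text \<open>The exit time is positive, so exiting in \<open>E\<close> would be a hit of
  \<open>E\<close> at a positive finite time.\<close>

lemma HD_polar:
 assumes D: "open D" and E: "!!x. AE ww in P x. hitting_time X (Some ` E) ww = iy" and le: "!!y. y ~: D ==> y ~: E ==> g y <= h y"
 shows "HD aa D g x <= HD aa D h x"
proof (cases "x : D")
 case x: True
 have "AE ww in P x. xt g (TD D ww) ww <= xt h (TD D ww) ww"
  using exit_eq[OF D x] E[of x] AE_space
 proof eventually_elim
  case (elim ww)
  show ?case
  proof (cases "TD D ww < iy")
   case True
   then obtain y where y: "pos X (TD D ww) ww = Some y" "y ~: D" using elim by auto
   have "y ~: E"
   proof
    assume "y : E"
    hence "hitting_time X (Some ` E) ww <= TD D ww" using y elim(1) unfolding hitting_time_def by (intro Inf_lower) auto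
    thus False using True elim(2) by simp
   qed
   thus ?thesis using y le by simp
  next
   case False
   hence "TD D ww = iy" by (simp add: less_top[symmetric])
   thus ?thesis using pos_infty[of ww] elim(3) by (simp add: space_law)
  qed
 qed
 thus ?thesis unfolding HD_TD[OF D x] fin_def
  by (intro nn_integral_mono_AE) (auto elim!: eventually_mono intro: mulL)
qed (simp add: HD_outside)

lemma HD_mono_off: "open D ==> (!!y. y ~: D ==> g y <= h y) ==> HD aa D g x <= HD aa D h x"
 by (rule HD_polar[where E="{}"]) (auto simp: hitting_time_def)

lemma RD_sub:
 assumes "open D" "open D'" "D' <= D" "0 <= aa" "g : BM"
 shows "RD aa D' g x <= RD aa D g x"
 using RD_nest[OF assms(1-3) _ assms(4,5), of x] by (cases "x : D'") (auto simp: RD_outside)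

lemma RD_mono_on:
 assumes D: "open D" and le: "!!y. y : D ==> g y <= h y"
 shows "RD aa D g x <= RD aa D h x"
proof -
 have "RD aa D g x = RD aa D (%y. if y : D then g y else 0) x" by (rule RD_cong[OF D]) simp
 also have "... <= RD aa D h x" by (rule RD_mono_params) (auto simp: le)
 finally show ?thesis .
qed

text \<open>With \<open>q <= aa\<close> the series describes additional killing at rate
  \<open>aa - q\<close>; the potential \<open>RD 0 D g\<close> is a supersolution by the resolvent
  equation.\<close>

lemma nlim_le_RD0:
 assumes D: "open D" and aa: "0 < aa" and q [measurable]: "q : BM" and g [measurable]: "g : BM" and le: "!!y. q y <= en aa"
 shows "nlim (RD aa D) q g x <= RD 0 D g x"
proof (rule nlim_least[OF kop_RD[OF D less_imp_le[OF aa]] q g])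
 note k = kop_RD[OF D less_imp_le[OF aa]]
 show m: "RD 0 D g : BM" by (rule RD_measurable[OF D order_refl g])
 note [measurable] = m
 fix x
 have "RD aa D (%y. g y + q y * RD 0 D g y) x <= RD aa D (%y. g y + en aa * RD 0 D g y) x"
  by (intro kop_mono[OF k] add_left_mono mulR le) measurable
 also have "... = RD aa D g x + en aa * RD aa D (RD 0 D g) x"
  by (subst kop_add[OF k]) (measurable, simp add: kop_cmult[OF k])
 also have "... = RD 0 D g x"
  using RD_resolvent_eq[OF D order_refl aa g, of x] RD_commute[OF D order_refl aa g, of x] by simp
 finally show "RD aa D (%y. g y + q y * RD 0 D g y) x <= RD 0 D g x" .
qed

text \<open>The exit time is strictly positive, so the discount at the exit tends to 0 pathwise,
  with the undiscounted value of \<open>w\<close> at the exit as integrable bound.\<close>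

lemma HD_large:
 assumes D: "open D" and y: "y : D" and w [measurable]: "w : BM" and fw: "HD 0 D w y < iy"
  and a: "filterlim a at_top sequentially" "!!n. 0 <= a n"
 shows "(%n. HD (a n) D w y) ----> 0"
proof -
 let ?b = "%n ww. en (exp (- a n * enn2real (TD D ww))) * xt w (TD D ww) ww"
 have f: "(PI y (%ww. xt w (TD D ww) ww)) < iy" using fw unfolding HD_TD[OF D y] fin_def by simp
 have "(%n. PI y (%ww. ?b n ww)) ----> (PI y (%ww. 0))"
 proof (rule nn_integral_dominated_convergence[OF _ _ _ _ f])
  show "AE ww in P y. en (exp (- a n * enn2real (TD D ww))) * xt w (TD D ww) ww <= xt w (TD D ww) ww" for n
  proof (rule AE_I2)
   fix ww
   have "en (exp (- a n * enn2real (TD D ww))) <= 1" using a(2)[of n] by (simp add: ennreal_le_1)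
   from mulR[OF this] show "?b n ww <= xt w (TD D ww) ww" by simp
  qed
  have "AE ww in P y. xt w (TD D ww) ww ~= iy" by (rule nn_integral_PInf_AE) (use f in auto)
  thus "AE ww in P y. (%n. ?b n ww) ----> 0"
   using exit_eq[OF D y] AE_space
  proof eventually_elim
   case (elim ww)
   show ?case
   proof (cases "TD D ww")
    case (real t)
    hence t: "0 < t" using elim by auto
    have "filterlim (%n. a n * t) at_top sequentially" by (rule filterlim_at_top_mult_tendsto_pos[OF tendsto_const t a(1)])
    hence "(%n. exp (- (a n * t))) ----> 0"
     by (intro filterlim_compose[OF exp_at_bot] filterlim_compose[OF filterlim_uminus_at_bot_at_top])
    hence "(%n. en (exp (- a n * enn2real (TD D ww)))) ----> en 0" using real by (intro tendsto_ennrealI) simp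
    hence "(%n. xt w (TD D ww) ww * en (exp (- a n * enn2real (TD D ww)))) ----> xt w (TD D ww) ww * en 0"
     by (intro ennreal_tendsto_cmult) (use elim in "auto simp: less_top")
    thus ?thesis by (simp add: mult.commute)
   next
    case top
    thus ?thesis using pos_infty[of ww] elim by (simp add: space_law)
   qed
  qed
 qed measurable
 thus ?thesis unfolding HD_TD[OF D y] fin_def by simp
qed

context
 fixes D :: "'a set" and w :: "'a => ennreal"
 assumes D: "open D" and w [measurable]: "w : BM" and harm: "!!x. x : D ==> HD 0 D w x = w x" and fw: "!!x. x : D ==> w x < iy"
begin

text \<open>\<open>HD_resolvent\<close> between rates 0 and \<open>aa\<close>: a harmonic function
  is its value at the exit before a clock of rate \<open>aa\<close> rings, plus its value when the
  clock rings first.\<close>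

lemma harm_split: "x : D ==> 0 < aa ==> w x = HD aa D w x + RD aa D (%y. en aa * w y) x"
proof -
 assume x: "x : D" and aa: "0 < aa"
 have "w x = HD aa D w x + en aa * RD aa D (HD 0 D w) x"
  using HD_resolvent[OF D order_refl aa w, of x] harm[OF x] by simp
 also have "RD aa D (HD 0 D w) x = RD aa D w x" by (rule RD_cong[OF D harm])
 also have "en aa * RD aa D w x = RD aa D (%y. en aa * w y) x"
  by (rule kop_cmult[OF kop_RD[OF D less_imp_le[OF aa]], symmetric]) simp
 finally show ?thesis .
qed

lemma harm_le: "0 < aa ==> x : D ==> RD aa D (%y. en aa * w y) x <= w x"
 using harm_split[of x aa] by (metis add_increasing order_refl zero_le)

lemma harm_sub:
 assumes D': "open D'" "D' <= D" and x: "x : D'" shows "HD 0 D' w x = w x"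
proof -
 let ?a = "%y. if y : D then HD 0 D w y else w y"
 have "w x = HD 0 D' ?a x"
  using HD_nest[OF D D' x order_refl w] harm[of x] x D' by auto
 also have "?a = w" using harm by auto
 finally show ?thesis ..
qed

text \<open>The expected value of \<open>w\<close> at the \<open>j\<close>-th ring of a clock of
  rate \<open>aa\<close>, on the event that \<open>D\<close> has not been left by then: the part of
  \<open>w\<close> that \<open>j\<close> applications of \<open>harm_split\<close> leave
  unresolved.\<close>

definition rem :: "real => nat => 'a => ennreal" where
 "rem aa j = ((%h. RD aa D (%y. en aa * h y)) ^^ j) (%x. w x * ix D x)"

lemma rem_Suc: "rem aa (Suc j) = RD aa D (%y. en aa * rem aa j y)" unfolding rem_def by simp

text \<open>A limit \<open>v\<close> of the remainders satisfies \<open>v = bb R\<^sub>D\<^sup>bb v \<le> w - H\<^sub>D\<^sup>bb w\<close> for every \<open>bb\<close>, which vanishes as \<open>bb \<rightarrow> 0\<close>.\<close>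

lemma rem_lim:
 assumes aa: "0 < aa" and x: "x : D"
 shows "rem aa j : BM" and "rem aa j x <= w x" and "(%j. rem aa j x) ----> 0"
proof -
 have Dm [measurable]: "D : sets borel" using D by simp
 have k: "kop (RD b D)" if "0 < b" for b by (rule kop_RD[OF D less_imp_le[OF that]])
 have rm [measurable]: "rem aa j : BM" for j
 proof (induction j)
  case (Suc j)
  hence "(%y. en aa * rem aa j y) : BM" by measurable
  thus ?case unfolding rem_Suc by (rule RD_measurable[OF D less_imp_le[OF aa]])
 qed (simp add: rem_def)
 thus "rem aa j : BM" .
 have dec: "rem aa (Suc j) y <= rem aa j y" for j y
 proof (induction j arbitrary: y)
  case 0
  show ?case
  proof (cases "y : D")
   case True
   have "RD aa D (%y. en aa * (w y * ix D y)) y <= RD aa D (%y. en aa * w y) y"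
    by (intro kop_mono[OF k[OF aa]]) (auto split: splix)
   thus ?thesis using harm_le[OF aa True] True by (simp add: rem_def)
  qed (simp add: rem_def RD_outside)
 next
  case (Suc j)
  have "RD aa D (%y. en aa * rem aa (Suc j) y) y <= RD aa D (%y. en aa * rem aa j y) y"
   by (rule kop_mono[OF k[OF aa] _ _ mulL[OF Suc]]) measurable
  thus ?case by (simp only: rem_Suc)
 qed
 have le: "rem aa j y <= w y" for j y
 proof (induction j)
  case 0
  show ?case by (simp add: rem_def split: splix)
 next
  case (Suc j)
  show ?case using dec[of j y] Suc by (rule order_trans)
 qed
 thus "rem aa j x <= w x" .
 define v where "v y = (INF j. rem aa j y)" for y
 have lim: "(%j. rem aa j y) ----> v y" for y unfolding v_def using dec by (intro LIMSEQ_INF) (simp add: decseq_Suc_iff)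
 have vm [measurable]: "v : BM" unfolding v_def by measurable
 have vw: "v y <= w y" for y unfolding v_def by (rule INF_lower2[of 0]) (simp_all add: le)
 have fin: "RD b D w y < iy" if "y : D" "0 < b" for b y
 proof (rule ccontr)
  assume "\<not> RD b D w y < iy"
  hence "RD b D (%y. en b * w y) y = iy" using that by (simp add: kop_cmult[OF k] less_top[symmetric] ennreal_mult_eq_top_iff)
  thus False using harm_le[OF that(2,1)] fw[OF that(1)] by (simp add: top_unique)
 qed
 have vaa: "v y = en aa * RD aa D v y" if y: "y : D" for y
 proof -
  have "(%j. RD aa D (rem aa j) y) ----> RD aa D v y"
   by (rule kop_lim[OF k[OF aa] rm w vm le fin[OF y aa] lim])
  hence "(%j. en aa * RD aa D (rem aa j) y) ----> en aa * RD aa D v y" by (intro ennreal_tendsto_cmult) auto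
  moreover have "en aa * RD aa D (rem aa j) y = rem aa (Suc j) y" for j unfolding rem_Suc by (rule kop_cmult[OF k[OF aa] rm, symmetric])
  ultimately have "(%j. rem aa (Suc j) y) ----> en aa * RD aa D v y" by simp
  thus ?thesis using LIMSEQ_Suc[OF lim[of y]] by (rule LIMSEQ_unique[rotated])
 qed
 have vbb: "v x <= en b * RD b D v x" if b: "0 < b" "b < aa" for b
 proof -
  have "en aa * RD b D v x = en aa * RD aa D v x + en (aa - b) * RD b D (%y. en aa * RD aa D v y) x"
   using RD_resolvent_eq[OF D less_imp_le[OF b(1)] b(2) vm, of x] kop_cmult[OF k[OF b(1)] RD_measurable[OF D less_imp_le[OF aa] vm], of "en aa"]
   by (simp add: distrib_left mult.left_commute)
  also have "RD b D (%y. en aa * RD aa D v y) x = RD b D v x" by (rule RD_cong[OF D vaa[symmetric]])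
  finally have "en (aa - b) * RD b D v x + en b * RD b D v x = en (aa - b) * RD b D v x + v x"
   using vaa[OF x] b by (simp add: distrib_right[symmetric] add.commute ennreal_plus[symmetric] del: ennreal_plus)
  moreover have "RD b D v x <= RD b D w x" by (rule kop_mono[OF k[OF b(1)] vm w vw])
  hence "en (aa - b) * RD b D v x ~= iy" using fin[OF x b(1)] by (simp add: ennreal_mult_eq_top_iff)
  ultimately show ?thesis using ennreal_cancel by (metis order_refl)
 qed
 have vH: "v x + HD b D w x <= w x" if b: "0 < b" "b < aa" for b
 proof -
  have "v x <= en b * RD b D w x" by (rule order_trans[OF vbb[OF b] mulL[OF kop_mono[OF k[OF b(1)] vm w vw]]]) simp
  hence "v x + HD b D w x <= RD b D (%y. en b * w y) x + HD b D w x" by (simp add: kop_cmult[OF k[OF b(1)]] add_right_mono)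
  thus ?thesis using harm_split[OF x b(1)] by (simp add: add.commute)
 qed
 have "v x + HD (1 / rs n) D w x <= w x" for n
 proof -
  let ?b = "min (1 / rs n) (aa / 2)"
  have "HD (1 / rs n) D w x <= HD ?b D w x" by (rule HD_mono_params) auto
  hence "v x + HD (1 / rs n) D w x <= v x + HD ?b D w x" by (rule add_left_mono)
  also have "... <= w x" by (rule vH) (use aa in auto)
  finally show ?thesis .
 qed
 hence "(SUP n. v x + HD (1 / rs n) D w x) <= w x" by (rule SUP_least)
 hence "v x + (SUP n. HD (1 / rs n) D w x) <= w x" by (subst ennreal_SUP_add_right) auto
 also have "(SUP n. HD (1 / rs n) D w x) = w x"
  using HD_SUP_params[OF D, of "%_. w" w 0 x] harm[OF x] by simp
 finally have "w x + v x <= w x + 0" by (simp add: add.commute)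
 hence "v x <= 0" using fw[OF x] by (subst (asm) ennreal_add_left_cancel_le) auto
 thus "(%j. rem aa j x) ----> 0" using lim[of x] by simp
qed

end

end

section \<open>Positivity of potentials and local finiteness of the measure\<close>

lemma ball_cl_ball: "ball z r <= cl_ball z r" "cl_ball z r <= cball z r" for z :: "'a::metric_space"
 unfolding cl_ball_def using closure_subset by (blast, intro closure_minimal ball_subset_cball closed_cball)

context hunt
begin

lemma RD_positive:
 assumes D: "open D" and x: "x : D" and g [measurable]: "g : BM" and pos: "!!y. y : D ==> 0 < g y"
 shows "0 < RD 0 D g x"
proof (rule ccontr)
 assume "\<not> 0 < RD 0 D g x"
 hence z: "RD 0 D g x = 0" by (simp add: not_less)
 have "RD 1 D (%_. 1) x <= RD 0 D (%_. 1) x" by (rule RD_mono_params) auto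
 \<comment> \<open>Multiplication by infinity leaves a vanishing potential at 0 and makes the
   strictly positive \<open>g\<close> dominate 1.\<close>
 also have "... <= RD 0 D (%y. iy * g y) x"
 proof (rule RD_mono_on[OF D])
  fix y assume "y : D"
  hence "iy * g y = iy" using pos[of y] by (simp add: ennreal_top_mult)
  thus "1 <= iy * g y" by simp
 qed
 also have "... = iy * RD 0 D g x" by (rule kop_cmult[OF kop_RD[OF D order_refl] g])
 finally have "occ 1 (TD D) (%_. 1) x = 0" using z RD_TD[OF D x] by simp
 hence "AE ww in P x. TD D ww = 0" by (intro occ_1_zero) simp
 hence "AE ww in P x. False" using exit_eq[OF D x] by eventually_elim auto
 thus False using prob_space.AE_False[OF prob_law] by blast
qed

end

context dualp
begin

text \<open>Take a strictly positive integrable \<open>h\<close>. By duality and conservativeness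
  the dual resolvent of \<open>min (h x) 1\<close> is integrable. It is strictly positive and, by
  the strong Feller property and Fatou's lemma, lower semicontinuous, hence bounded away from 0 on a
  compact set, which therefore has finite measure.\<close>

lemma finite_on_compact:
 assumes sfY: "strongly_feller Y" and K: "compact K" shows "emeasure m K < iy"
proof (cases "K = {}")
 case False
 interpret sigma_finite_measure m by (rule sigma_m)
 obtain h where h [measurable]: "h : bm m" and hi: "(NI m (%x. h x)) ~= iy" and hp: "!!x. 0 < h x & h x < iy"
  using Ex_finite_integrable_function by auto
 define f where "f x = enn2real (min (h x) 1)" for x
 have fe: "en (f x) = min (h x) 1" for x unfolding f_def using hp[of x] by (intro ennreal_enn2real) (simp add: min_def)
 have fm [measurable]: "f : BM" using h unfolding f_def by measurable
 have f01: "0 <= f x" "f x <= 1" for x using fe[of x] unfolding f_def by (auto simp: enn2real_leI)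
 let ?F = "Y.R 1 (%y. en (f y))"
 have mF [measurable]: "?F : BM" by measurable
 have "(NI m (%x. ?F x * 1)) = (NI m (%x. en (f x) * R 1 (%_. 1) x))"
  by (rule res_dual[symmetric]) simp_all
 also have "... <= (NI m (%x. h x))"
  by (intro nnmono) (simp add: R_const fe)
 finally have int: "(NI m (%x. ?F x)) < iy" using hi by (auto simp: less_top intro: le_less_trans)
 have pos: "0 < ?F x" for x
 proof (rule ccontr)
  assume "\<not> 0 < ?F x"
  hence z: "?F x = 0" by (simp add: not_less)
  have "Y.R 1 (%_. 1) x <= Y.R 1 (%y. iy * en (f y)) x"
   by (rule kop_mono[OF Y.kop_R]) (simp_all add: fe min_def hp ennreal_top_mult less_imp_neq[OF hp[THEN conjunct1], symmetric])
  also have "... = iy * ?F x" by (rule kop_cmult[OF Y.kop_R]) simp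
  finally show False using z by (simp add: Y.R_const)
 qed
 have Fi: "?F x = (SI lborel {0..} (%s. xp 1 s * en (semigroup Y s f x)))" for x
  by (subst Y.R_eq_trans) (simp_all add: Y.nn_integral_trans Y.semigroup_nn[OF fm f01])
 have Fm: "(%s. xp 1 s * en (semigroup Y s f x)) : BM" for x
 proof -
  have "(%s. NI (Y.trans (en s) (Some x)) (%z. ext0 (%y. en (f y)) z)) : BM"
   using Y.trans_joint Some_measurable by measurable
  thus ?thesis by (simp add: Y.nn_integral_trans Y.semigroup_nn[OF fm f01])
 qed
 have "\<exists>n. \<forall>x\<in>K. en (1 / rs n) <= ?F x"
 proof (rule ccontr)
  assume "\<nexists>n. \<forall>x\<in>K. en (1 / rs n) <= ?F x"
  hence "\<forall>n. \<exists>x\<in>K. ?F x < en (1 / rs n)" by (meson not_le)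
  then obtain x where x: "!!n. x n : K" "!!n. ?F (x n) < en (1 / rs n)" by metis
  obtain l s where l: "l : K" "strict_mono s" "(x \<circ> s) ----> l"
   using K x(1) unfolding compact_def by metis
  have "?F l <= (LI (%t. liminf (%n. xp 1 t * en (semigroup Y t f (x (s n))) * ix {0..} t)))"
   unfolding Fi
  proof (rule nn_integral_mono_AE)
   show "AE t in lborel. xp 1 t * en (semigroup Y t f l) * ix {0..} t <= liminf (%n. xp 1 t * en (semigroup Y t f (x (s n))) * ix {0..} t)"
    using AE_lborel_singleton[of 0]
   proof eventually_elim
    case (elim t)
    show ?case
    proof (cases "0 <= t")
     case True
     have "bounded (range f)" unfolding bounded_iff using f01 by (intro exI[of _ 1]) auto
     hence "continuous_on UNIV (semigroup Y t f)" using sfY elim True fm unfolding strongly_feller_def by auto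
     hence "(%n. semigroup Y t f ((x \<circ> s) n)) ----> semigroup Y t f l"
      by (rule continuous_on_tendsto_compose[OF _ l(3)]) auto
     hence "(%n. xp 1 t * en (semigroup Y t f (x (s n)))) ----> xp 1 t * en (semigroup Y t f l)"
      by (intro ennreal_tendsto_cmult tendsto_ennrealI) (auto simp: o_def)
     thus ?thesis using True by (simp add: lim_imp_Liminf)
    qed simp
   qed
  qed
  also have "... <= liminf (%n. ?F (x (s n)))" unfolding Fi by (rule nn_integral_liminf) (use Fm in measurable)
  also have "... = 0"
  proof (rule lim_imp_Liminf)
   show "(%n. ?F (x (s n))) ----> 0"
   proof (rule tendsto_sandwich[OF _ _ tendsto_const])
    have "(%n. 1 / rs n) ----> 0" by real_asymp
    hence "(%n. en (1 / rs n)) ----> en 0" by (rule tendsto_ennrealI)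
    from LIMSEQ_subseq_LIMSEQ[OF this l(2)] show "(%n. en (1 / real (Suc (s n)))) ----> 0" by (simp add: o_def del: of_nat_Suc)
    show "\<forall>\<^sub>F n in sequentially. ?F (x (s n)) <= en (1 / real (Suc (s n)))" using less_imp_le[OF x(2)] by simp
   qed simp
  qed simp
  finally show False using pos[of l] by simp
 qed
 then obtain n where n: "!!x. x : K ==> en (1 / rs n) <= ?F x" by blast
 have [measurable]: "K : sets borel" using K by (simp add: compact_imp_closed)
 have "en (1 / rs n) * emeasure m K = (NI m (%x. en (1 / rs n) * ix K x))"
  by (simp add: nn_integral_cmult_indicator)
 also have "... <= (NI m (%x. ?F x))" by (intro nnmono) (auto split: splix intro: n simp del: of_nat_Suc)
 finally have "en (1 / rs n) * emeasure m K < iy" using int by (rule le_less_trans)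
 thus ?thesis by (auto simp: ennreal_mult_less_top)
qed simp

end

section \<open>The assumptions at infinity as inequalities for potentials and jump densities\<close>

locale bhp = levy X m j \<D> + Y: levy Y m jh \<D> + d: dualp X Y m
 for X :: "('w, 'a::heine_borel) process" and Y :: "('v, 'a) process" and m :: "'a measure"
  and j jh :: "'a => 'a => real" and \<D> :: "('a => real) set" +
 fixes \<Phi> :: "real => real" and z0 :: 'a and r0 :: real
 assumes jdual: "!!x y. x ~= y ==> j x y = jh y x"
  and supp: "!!U. open U ==> U ~= {} ==> 0 < emeasure m U"
  and unbounded: "!!(x::'a) r. - ball x (2 * r) ~= {}"
  and sf: "strongly_feller X" "strongly_feller Y" and pol: "!!B. semi_polar X B ==> polar X B"
  and r0: "0 < r0" and V1: "assumption_V1 m z0" and Phi: "assumption_Phi \<Phi>"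
  and B2a: "assumption_B2a m X Y \<D> \<Phi> z0 r0" and B2b: "assumption_B2b m X Y \<D> j z0 r0"
  and C2: "assumption_C2 m j jh \<Phi> z0 r0" and D2: "assumption_D2 m X Y \<Phi> z0 r0"
begin

abbreviation "V \<equiv> vol m z0"

lemma V_ball: "emeasure m (ball z0 r) = en (V r)"
proof -
 have "emeasure m (ball z0 r) <= emeasure m (cball z0 r)" by (rule emeasure_mono) (auto simp: sets_m)
 also have "... < iy" by (rule d.finite_on_compact[OF sf(2)]) simp
 finally show ?thesis unfolding vol_def by (simp add: emeasure_eq_ennreal_measure)
qed

lemma V_mono: "s <= r ==> V s <= V r"
proof -
 assume "s <= r"
 hence "emeasure m (ball z0 s) <= emeasure m (ball z0 r)" by (intro emeasure_mono) (auto simp: sets_m)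
 thus ?thesis unfolding V_ball by (simp add: vol_def)
qed

lemma V_pos: "0 < r ==> 0 < V r"
 using supp[of "ball z0 r"] unfolding V_ball by simp

lemma doubling: obtains c where "1 <= c" "!!r. 0 < r ==> V (2 * r) <= c * V r"
 using V1 unfolding assumption_V1_def by (auto intro: less_imp_le)

lemma Phi_doubling: obtains c where "1 <= c" "!!r. 0 < r ==> \<Phi> (2 * r) <= c * \<Phi> r"
 using Phi unfolding assumption_Phi_def by (auto intro: less_imp_le)

lemma Phi_mono: "0 <= s ==> s <= r ==> \<Phi> s <= \<Phi> r" and Phi_nonneg: "0 <= r ==> 0 <= \<Phi> r"
 using Phi unfolding assumption_Phi_def mono_on_def by auto

text \<open>If \<open>\<Phi>\<close> vanished at \<open>r\<close>, doubling and monotonicity would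
  make it vanish everywhere. The lower bound in (C2) would then be infinite on a nonempty annulus,
  whereas \<open>j\<close> is real-valued.\<close>

lemma Phi_pos: assumes "r0 <= r" shows "0 < \<Phi> r"
proof (rule ccontr)
 let ?a = "\<lambda>r. INF y\<in>cl_annulus z0 r (2 * r). en (min (j z0 y) (jh z0 y))"
 assume "\<not> 0 < \<Phi> r"
 hence z: "\<Phi> r = 0" using Phi_nonneg[of r] assms r0 by simp
 obtain c where c: "1 <= c" "!!r. 0 < r ==> \<Phi> (2 * r) <= c * \<Phi> r" by (rule Phi_doubling) blast
 have zk: "\<Phi> (2 ^ k * r) = 0" for k
 proof (induction k)
  case (Suc k)
  have "\<Phi> (2 * (2 ^ k * r)) <= c * \<Phi> (2 ^ k * r)" using assms r0 by (intro c) auto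
  thus ?case using Suc Phi_nonneg[of "2 ^ Suc k * r"] assms r0 by (simp add: mult.assoc)
 qed (simp add: z)
 have za: "\<Phi> s = 0" if "0 <= s" for s
 proof -
  obtain k where "s / r < 2 ^ k" using real_arch_pow[of 2 "s / r"] by auto
  hence "\<Phi> s <= \<Phi> (2 ^ k * r)" using assms r0 that by (intro Phi_mono) (auto simp: field_simps)
  thus ?thesis using zk Phi_nonneg[OF that] by simp
 qed
 obtain y where y: "2 * r0 <= dist z0 y" using unbounded[of z0 r0] by (auto simp: not_less)
 \<comment> \<open>Any divisor between 1 and 2 places \<open>y\<close> strictly inside the annulus
   from \<open>?s\<close> to \<open>2 * ?s\<close>; with 1.5, \<open>?s\<close> also stays above
   \<open>r0\<close>.\<close>
 let ?s = "dist z0 y / 1.5"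
 have s: "r0 <= ?s" "?s < dist z0 y" "dist z0 y < 2 * ?s" using y r0 by auto
 obtain c' where c': "0 < c'" "!!r. r0 <= r ==> (?a r) \<ge> en c' / en (V r * \<Phi> r)"
  using C2[unfolded assumption_C2_def, rule_format, of 2] by auto
 have "en c' / 0 = \<top>" using c'(1) by (simp add: ennreal_divide_zero)
 hence "(?a ?s) = \<top>"
  using c'(2)[OF s(1)] za[of ?s] y r0 by (simp add: top_unique)
 moreover have "y : cl_annulus z0 ?s (2 * ?s)" unfolding cl_annulus_def using s closure_subset by fastforce
 hence "(?a ?s) <= en (min (j z0 y) (jh z0 y))" by (rule INF_lower)
 ultimately show False by (simp add: top_unique)
qed

text \<open>(C2) compares \<open>jh x y\<close> with \<open>jh z0 y\<close> for \<open>x\<close> in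
  the ball. The duality \<open>j y x = jh x y\<close> turns this into a comparison of jumps from the
  outer point \<open>y\<close> into the ball, the direction in which it is used below.\<close>

lemma C2_j:
 assumes "1 < a" "a <= 2"
 obtains c where "1 <= c" "!!r x y. r0 <= r ==> dist z0 x < r ==> a * r <= dist z0 y ==> en (j y x) <= en c * en (j y z0) & en (j y z0) <= en c * en (j y x)"
proof -
 obtain c where c: "1 <= c" and h: "!!r x y. r0 <= r ==> x : ball z0 r ==> y \<in> - ball z0 (a * r) ==> inverse c * jh z0 y <= jh x y & jh x y <= c * jh z0 y"
  using C2[unfolded assumption_C2_def, rule_format, of a] assms by auto
 show ?thesis
 proof (rule that[OF c])
  fix r x y assume a: "r0 <= r" "dist z0 x < r" "a * r <= dist z0 y"
  have "1 * r < a * r" using a(1) r0 assms by (intro mult_strict_right_mono) auto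
  hence "dist z0 x < dist z0 y" "0 < dist z0 y" using a(1-3) r0 by linarith+
  hence ne: "y ~= x" "y ~= z0" by auto
  have "inverse c * j y z0 <= j y x & j y x <= c * j y z0" using h[OF a(1), of x y] a ne by (auto simp: jdual)
  hence "j y x <= c * j y z0" "j y z0 <= c * j y x" using c by (auto simp: field_simps)
  thus "en (j y x) <= en c * en (j y z0) & en (j y z0) <= en c * en (j y x)"
   using c by (auto simp: ennreal_mult'[symmetric] intro: ennreal_leI)
 qed
qed

lemma D_dist: "D <= - cl_ball z0 r ==> y : D ==> r <= dist z0 y"
 using ball_cl_ball(1)[of z0 r] by (force simp: not_less[symmetric])

text \<open>By (C2) at radius \<open>r / 2\<close>, which is why \<open>2 * r0 <= r\<close> is
  required, \<open>j z z0\<close> is comparable to an average of \<open>j z\<close> over the ball of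
  that radius. The potential of the rate of jumping into this ball is, by Ikeda-Watanabe, the
  probability of leaving \<open>D\<close> into it, hence at most 1.\<close>

lemma jump_potential:
 obtains c where "0 < c" "!!r D x. 2 * r0 <= r ==> open D ==> D <= - cl_ball z0 r ==> RD 0 D (%z. en (j z z0)) x <= en (c / V r)"
proof -
 obtain c where c: "1 <= c" and cj: "!!r x y. r0 <= r ==> dist z0 x < r ==> 2 * r <= dist z0 y ==> en (j y z0) <= en c * en (j y x)"
  by (rule C2_j[of 2]) (simp, simp, blast)
 obtain cv where cv: "1 <= cv" "!!r. 0 < r ==> V (2 * r) <= cv * V r" by (rule doubling) blast
 show ?thesis
 proof (rule that[of "c * cv"])
  show "0 < c * cv" using c cv by simp
  fix r D x assume r: "2 * r0 <= r" and D: "open D" "D <= - cl_ball z0 r"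
  let ?B = "ball z0 (r / 2)"
  have rp: "0 < r" using r r0 by simp
  have Vp: "0 < V (r / 2)" using rp by (intro V_pos) simp
  have k: "kop (RD 0 D)" by (rule kop_RD[OF D(1) order_refl])
  have [measurable]: "?B : sets borel" by (rule borel_open[OF open_ball])
  have im: "(ix ?B :: 'a => ennreal) : BM" by (rule borel_measurable_indicator) fact
  have jm: "jop (ix ?B) : BM" by (rule kopm[OF kop_jop im])
  have "en (j z z0) <= en (c / V (r / 2)) * jop (ix ?B) z" if z: "z : D" for z
  proof -
   have "en (j z z0) * emeasure m ?B = (NI m (%w. en (j z z0) * ix ?B w))" by (simp add: nn_integral_cmult_indicator sets_m)
   also have "... <= (NI m (%w. en c * (en (j z w) * ix ?B w)))"
    using D_dist[OF D(2) z] r by (intro nnmono) (auto split: splix intro: cj[of "r / 2"])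
   also have "... = en c * jop (ix ?B) z" unfolding jop_def by (rule nncmult) measurable
   finally have e: "en (j z z0) * en (V (r / 2)) <= en c * jop (ix ?B) z" unfolding V_ball .
   have "en (j z z0) = en (1 / V (r / 2)) * (en (j z z0) * en (V (r / 2)))"
    using Vp by (simp add: mult.left_commute ennreal_mult'[symmetric])
   also have "... <= en (1 / V (r / 2)) * (en c * jop (ix ?B) z)" by (rule mulL[OF e]) simp
   also have "... = en (c / V (r / 2)) * jop (ix ?B) z"
    using c Vp by (simp add: mult.assoc[symmetric] ennreal_mult'[symmetric])
   finally show ?thesis .
  qed
  hence "RD 0 D (%z. en (j z z0)) x <= RD 0 D (%z. en (c / V (r / 2)) * jop (ix ?B) z) x"
   by (rule RD_mono_on[OF D(1)])
  also have "... = en (c / V (r / 2)) * RD 0 D (jop (ix ?B)) x" by (rule kop_cmult[OF k jm])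
  also have "RD 0 D (jop (ix ?B)) x = HD 0 D (ix ?B) x"
  proof (rule ikeda_watanabe[OF D(1) order_refl, symmetric])
   fix y assume "y : closure D"
   moreover have "closure D <= {y. r <= dist z0 y}"
    by (rule closure_minimal) (use D_dist[OF D(2)] in "auto intro!: closed_Collect_le continuous_intros")
   ultimately show "ix ?B y = 0" using rp by auto
  qed (rule im)
  also have "en (c / V (r / 2)) * HD 0 D (ix ?B) x <= en (c / V (r / 2)) * 1"
   by (intro mulL HD_bound) (auto split: splix)
  also have "... <= en (c * cv / V r)"
  proof -
   have "V r <= cv * V (r / 2)" using cv(2)[of "r / 2"] rp by simp
   thus ?thesis using c Vp V_pos[OF rp] by (simp, intro ennreal_leI) (simp add: field_simps)
  qed
  finally show "RD 0 D (%z. en (j z z0)) x <= en (c * cv / V r)" .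
 qed
qed

lemma B2a_bump:
 obtains c where "0 < c" "!!r. r0 <= r ==> \<exists>f\<in>bump m \<D> (cl_ball z0 r) (ball z0 (1.5 * r)). \<forall>x. - gen C0 X f x <= c / \<Phi> r & - gen C0 Y f x <= c / \<Phi> r"
proof -
 let ?a = "%f x. max (gen C_inf X (%y. 1 - f y) x) (gen C_inf Y (%y. 1 - f y) x)"
 obtain c where c: "0 < c" and h: "!!r. r0 <= r ==> (INF f\<in>bump m \<D> (cl_ball z0 r) (ball z0 (1.5 * r)).
   SUP x. ereal (?a f x)) <= ereal c / ereal (\<Phi> r)"
  using B2a[unfolded assumption_B2a_def, rule_format, of "1.5"] by auto
 show ?thesis
 \<comment> \<open>The factor 2 makes the inequality strict, so that the infimum yields an actual
   bump function.\<close>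
 proof (rule that[of "2 * c"])
  fix r assume r: "r0 <= r"
  have p: "0 < \<Phi> r" by (rule Phi_pos[OF r])
  have "ereal c / ereal (\<Phi> r) < ereal (2 * c / \<Phi> r)" using c p by (simp add: field_simps)
  then obtain f where f: "f : bump m \<D> (cl_ball z0 r) (ball z0 (1.5 * r))"
   "(SUP x. ereal (?a f x)) < ereal (2 * c / \<Phi> r)"
   using le_less_trans[OF h[OF r]] unfolding INF_less_iff by auto
  have "- gen C0 X f x <= 2 * c / \<Phi> r & - gen C0 Y f x <= 2 * c / \<Phi> r" for x
  proof -
   have "ereal (?a f x) <= ereal (2 * c / \<Phi> r)"
    by (rule order_trans[OF SUP_upper less_imp_le[OF f(2)]]) simp
   thus ?thesis unfolding generates_C_inf(2)[OF bump_gen[OF f(1)]] Y.generates_C_inf(2)[OF Y.bump_gen[OF f(1)]] by simp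
  qed
  thus "\<exists>f\<in>bump m \<D> (cl_ball z0 r) (ball z0 (1.5 * r)). \<forall>x. - gen C0 X f x <= 2 * c / \<Phi> r & - gen C0 Y f x <= 2 * c / \<Phi> r" using f(1) by blast
 qed (use c in simp)
qed

lemma B2b_gen:
 obtains c where "0 < c" "!!r f x. r0 <= r ==> f : bump m \<D> (cl_ball z0 r) (ball z0 (2 * r)) ==> r < dist z0 x ==> dist z0 x < 3 * r ==> gen C0 X f x <= c * V r * j x z0"
proof -
 obtain c where c: "0 < c" and h: "!!r f x. r0 <= r ==> f : bump m \<D> (cl_ball z0 r) (ball z0 (2 * r)) ==> x : cl_annulus z0 r ((2 + 1) * r) ==> max (gen C_inf X f x) (gen C_inf Y f x) <= c * V r * j x z0"
  using B2b[unfolded assumption_B2b_def, rule_format, of 2] by auto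
 show ?thesis
 proof (rule that[OF c])
  fix r f x assume a: "r0 <= r" "f : bump m \<D> (cl_ball z0 r) (ball z0 (2 * r))" "r < dist z0 x" "dist z0 x < 3 * r"
  have "x : cl_annulus z0 r ((2 + 1) * r)" unfolding cl_annulus_def using a closure_subset by fastforce
  from h[OF a(1,2) this] show "gen C0 X f x <= c * V r * j x z0" unfolding generates_C_inf(1)[OF bump_gen[OF a(2)]] by simp
 qed
qed

text \<open>Enlarging \<open>D\<close> to the complement of the closed ball only increases the
  potential, which is then an integral against the dual Green function; with sources in the shell,
  (D2) for \<open>a = 1.9\<close> bounds that function.\<close>

lemma D2_potential:
 obtains c where "0 < c" "!!r D f z. r0 <= r ==> open D ==> D <= - cl_ball z0 r ==> f : BM ==>
   (!!y. \<not> (2 * r < dist z0 y & dist z0 y < 4 * r) ==> f y = 0) ==> dist z0 z < 1.9 * r ==>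
   Y.RD 0 D f z <= en (c * \<Phi> r / V r) * (NI m (%y. f y))"
proof -
 interpret S: dualp Y X m by (rule d.sym)
 obtain c where c: "0 < c" and h: "!!r. r0 <= r ==> (SUP x\<in>cl_ball z0 (1.9 * r). SUP y\<in>cl_annulus z0 (2 * r) (4 * r).
      max (green m X Y (- cl_ball z0 r) x y) (green m Y X (- cl_ball z0 r) x y)) <= en (c * \<Phi> r / V r)"
  using D2[unfolded assumption_D2_def, THEN conjunct2, rule_format, of "1.9"] by auto
 show ?thesis
 proof (rule that[OF c])
  fix r D z and f :: "'a => ennreal" assume r: "r0 <= r" and D: "open D" "D <= - cl_ball z0 r" and f [measurable]: "f : BM"
   and f0: "!!y. \<not> (2 * r < dist z0 y & dist z0 y < 4 * r) ==> f y = 0" and z: "dist z0 z < 1.9 * r"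
  let ?B = "- cl_ball z0 r"
  have oB: "open ?B" unfolding cl_ball_def by (simp add: open_Compl)
  show "Y.RD 0 D f z <= en (c * \<Phi> r / V r) * (NI m (%y. f y))"
  proof (cases "z : D")
   case True
   hence zB: "z : ?B" using D by auto
   have "z : cl_ball z0 (1.9 * r)" using z ball_cl_ball(1)[of z0 "1.9 * r"] by auto
   hence g: "green m Y X ?B z y <= en (c * \<Phi> r / V r)" if "y : cl_annulus z0 (2 * r) (4 * r)" for y
   proof -
    let ?M = "%x y. max (green m X Y ?B x y) (green m Y X ?B x y)"
    have "?M z y <= (SUP y\<in>cl_annulus z0 (2 * r) (4 * r). ?M z y)" using that by (rule SUP_upper)
    also have "... <= (SUP x\<in>cl_ball z0 (1.9 * r). SUP y\<in>cl_annulus z0 (2 * r) (4 * r). ?M x y)" by (rule SUP_upper) fact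
    also note h[OF r]
    finally show ?thesis by simp
   qed
   have "Y.RD 0 D f z <= Y.RD 0 ?B f z" by (rule Y.RD_sub[OF oB D order_refl f])
   also have "... = (NI m (%y. f y * green m Y X ?B z y))" by (rule S.RD_green(1)[OF oB f zB])
   also have "... <= (NI m (%y. en (c * \<Phi> r / V r) * f y))"
   proof (rule nnmono)
    fix y
    show "f y * green m Y X ?B z y <= en (c * \<Phi> r / V r) * f y"
    proof (cases "2 * r < dist z0 y & dist z0 y < 4 * r")
     case True
     hence "y : cl_annulus z0 (2 * r) (4 * r)" unfolding cl_annulus_def using closure_subset by fastforce
     from mulL[OF g[OF this], of "f y"] show ?thesis by (simp add: mult.commute)
    qed (simp add: f0)
   qed
   also have "... = en (c * \<Phi> r / V r) * (NI m (%y. f y))" by (rule nncmult) measurable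
   finally show ?thesis .
  qed (simp add: Y.RD_outside)
 qed
qed

end

section \<open>The shell estimate with \<open>ee\<close> fixed\<close>

context bhp
begin

text \<open>The process killed on leaving \<open>D\<close> and at the rate \<open>ps = 2 d / k\<close> on \<open>ball z0 (1.8 r)\<close>, where \<open>k = 1 - f + ee\<close>. Since
\<open>A k \<le> d\<close>, the function \<open>k\<close> is superharmonic for the dual of this process in that ball, where it therefore controls potentials.\<close>

context
 fixes r c1 cD cJ kk d ee :: real and D :: "'a set" and f :: "'a => real"
 assumes r: "2 * r0 <= r" and D: "open D" "D <= - cl_ball z0 r"
  and c1: "0 < c1" "!!x. RD 0 D (%z. en (j z z0)) x <= en (c1 / V r)"
  and cD: "!!g z. g : BM ==> (!!y. \<not> (2 * r < dist z0 y & dist z0 y < 4 * r) ==> g y = 0) ==> dist z0 z < 1.9 * r ==>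
   Y.RD 0 D g z <= en (cD * \<Phi> r / V r) * (NI m (%y. g y))"
  and cJ: "1 <= cJ" "!!x y. dist z0 x < 1.8 * r ==> 1.9 * r <= dist z0 y ==> en (j y x) <= en cJ * en (j y z0)"
  and f: "f : bump m \<D> (cl_ball z0 (1.2 * r)) (ball z0 (1.8 * r))" and d: "0 < d" "!!x. - gen C0 Y f x <= d"
  and kk: "cD <= kk" "cJ * c1 <= kk * \<Phi> r * d" and ee: "0 < ee" "ee <= 1"
begin

definition kf :: "'a => real" where "kf y = 1 - f y + ee"

text \<open>The largest value of the killing rate \<open>2 * d / kf y\<close>, attained where
  \<open>f y = 1\<close>.\<close>

definition al :: real where "al = 2 * d / ee"

text \<open>\<open>al\<close> minus the killing rate. With this weight,
  \<open>nlim (RD al D) qf\<close> is the potential operator of the process killed on leaving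
  \<open>D\<close> and at rate \<open>2 * d / kf y\<close> in the ball.\<close>

definition qf :: "'a => ennreal" where "qf y = (if y : ball z0 (1.8 * r) then en (al - 2 * d / kf y) else en al)"

abbreviation "W \<equiv> ball z0 (1.8 * r)"
abbreviation "NN \<equiv> {y. 2 * r < dist z0 y & dist z0 y < 4 * r}"
abbreviation "K0 \<equiv> en (kk * \<Phi> r / V r)"

lemma r_pos: "0 < r" using r r0 by simp

lemma VPhi: "0 < V r" "0 < \<Phi> r" using V_pos[OF r_pos] Phi_pos[of r] r r0 by auto

lemma al_pos: "0 < al" unfolding al_def using d ee by simp

lemma kf_bounds: "ee <= kf y" "0 < kf y" "kf y <= 2" "kf y + f y = 1 + ee" "0 <= f y" "y ~: W ==> 1 <= kf y"
 using bumpD(3)[OF f, of y] bumpD(4,5)[OF f, of y] ee unfolding kf_def by auto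

lemma kf_measurable [measurable]: "kf : BM" and f_measurable [measurable]: "f : BM"
 using bump_measurable(1)[OF f] unfolding kf_def[abs_def] by auto

lemma open_NN: "open NN" by (intro open_Collect_conj open_Collect_less continuous_intros)

lemma W_sets [measurable]: "W : sets borel" and D_sets [measurable]: "D : sets borel" and NN_sets [measurable]: "NN : sets borel"
 using D(1) borel_open[OF open_NN] by auto

lemma qf_measurable [measurable]: "qf : BM" unfolding qf_def[abs_def] by measurable

lemma div_le_al: "2 * d / kf y <= al"
 unfolding al_def using kf_bounds(1)[of y] d ee by (intro divide_left_mono) auto

lemma qf_le: "qf y <= en al"
 unfolding qf_def using d kf_bounds(2)[of y] by (auto intro!: ennreal_leI)

lemma qf_split: "y : W ==> qf y + en (2 * d / kf y) = en al"
 unfolding qf_def using div_le_al[of y] d kf_bounds(2)[of y] by (simp flip: ennreal_plus)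

lemma qf_k: "y : W ==> qf y * en (kf y) + en d + en d = en al * en (kf y)"
proof -
 assume y: "y : W"
 have "qf y * en (kf y) + en (2 * d / kf y) * en (kf y) = en al * en (kf y)"
  by (simp add: distrib_right[symmetric] qf_split[OF y])
 moreover have "en (2 * d / kf y) * en (kf y) = en d + en d"
  using kf_bounds(2)[of y] d by (simp add: ennreal_mult'[symmetric] flip: ennreal_plus)
 ultimately show ?thesis by (simp add: add.assoc)
qed

lemma qf_inner: "dist z0 y < 1.2 * r ==> qf y = 0"
proof -
 assume y: "dist z0 y < 1.2 * r"
 hence "f y = 1" using ball_cl_ball(1)[of z0 "1.2 * r"] by (intro bumpD(2)[OF f]) auto
 thus ?thesis using y r_pos unfolding qf_def kf_def al_def by simp
qed

text \<open>Dynkin's formula for \<open>f\<close>, rewritten for \<open>kf = 1 + ee - f\<close> by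
  conservativeness. By \<open>qf_k\<close> the killing supplies \<open>d\<close> twice: one copy
  absorbs the bound on \<open>- gen C0 Y f\<close>, the other is left over as a surplus that later
  absorbs the far jumps.\<close>

lemma superharmonic_k:
 assumes U: "open U" "U <= W" and x: "x : U"
 shows "Y.RD al U (%y. qf y * en (kf y) + en d) x + Y.HD al U (%y. en (kf y)) x <= en (kf x)"
proof -
 note kR = Y.kop_RD[OF U(1) less_imp_le[OF al_pos]] and kH = Y.kop_HD[OF U(1) less_imp_le[OF al_pos]]
 note [measurable] = Y.bump_measurable(2)[OF f]
 let ?R = "%g. Y.RD al U g x" and ?H = "%g. Y.HD al U g x"
 let ?p = "%y. en (gen C0 Y f y)" and ?n = "%y. en (- gen C0 Y f y)"
 let ?af = "%y. en al * en (f y)" and ?ak = "%y. en al * en (kf y)"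
 have E1: "en (f x) + ?R ?p = ?R ?af + ?R ?n + ?H (%y. en (f y))"
  using Y.dynkin_bump[OF f U(1) x al_pos] kop_add[OF kR, of ?af ?n x] by simp
 have kf1: "en (kf y) + en (f y) = en (1 + ee)" for y
  using kf_bounds(2,4,5)[of y] by (simp flip: ennreal_plus)
 have e1: "(%_. en (1 + ee) * en al) = (%y. ?ak y + ?af y)"
 proof
  fix y show "en (1 + ee) * en al = ?ak y + ?af y"
   unfolding kf1[of y, symmetric] distrib_right by (simp only: mult.commute)
 qed
 have e2: "(%_. en (1 + ee) * 1) = (%y. en (kf y) + en (f y))" by (simp only: kf1 mult_1_right)
 have "en (1 + ee) * ?R (%_. en al) = ?R (%_. en (1 + ee) * en al)" by (rule kop_cmult[OF kR, symmetric]) simp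
 hence h1: "en (1 + ee) * ?R (%_. en al) = ?R ?ak + ?R ?af"
  unfolding e1 by (subst (asm) kop_add[OF kR]) measurable
 have "en (1 + ee) * ?H (%_. 1) = ?H (%_. en (1 + ee) * 1)" by (rule kop_cmult[OF kH, symmetric]) simp
 hence h2: "en (1 + ee) * ?H (%_. 1) = ?H (%y. en (kf y)) + ?H (%y. en (f y))"
  unfolding e2 by (subst (asm) kop_add[OF kH]) measurable
 have "en (1 + ee) = en (1 + ee) * (?R (%_. en al) + ?H (%_. 1))"
  by (simp only: Y.HD_RD_const[OF U(1) x al_pos] mult_1_right)
 hence E2: "en (kf x) + en (f x) = ?R ?ak + ?R ?af + (?H (%y. en (kf y)) + ?H (%y. en (f y)))"
  by (simp only: kf1 distrib_left h1 h2)
 have "en (f x) + (en (kf x) + ?R ?n) = (en (kf x) + en (f x)) + ?R ?n" by (simp only: ac_simps)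
 also have "... = ?R ?ak + ?H (%y. en (kf y)) + (?R ?af + ?R ?n + ?H (%y. en (f y)))" unfolding E2 by (simp only: ac_simps)
 also have "... = en (f x) + (?R ?ak + ?H (%y. en (kf y)) + ?R ?p)" unfolding E1[symmetric] by (simp only: ac_simps)
 finally have "en (kf x) + ?R ?n = ?R ?ak + ?H (%y. en (kf y)) + ?R ?p" by (rule ennreal_cancel) simp
 hence 1: "?R ?ak + ?H (%y. en (kf y)) <= en (kf x) + ?R ?n" by simp
 have 2: "?R ?n <= ?R (%_. en d)" by (rule kop_mono[OF kR]) (use d in "auto intro: ennreal_leI")
 have "?R ?ak = ?R (%y. (qf y * en (kf y) + en d) + en d)"
  by (rule Y.RD_cong[OF U(1)]) (use U(2) in "auto simp: qf_k")
 also have "... = ?R (%y. qf y * en (kf y) + en d) + ?R (%_. en d)" by (rule kop_add[OF kR]) measurable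
 finally have "?R (%_. en d) + (?R (%y. qf y * en (kf y) + en d) + ?H (%y. en (kf y))) <= ?R (%_. en d) + en (kf x)"
  using order_trans[OF 1 add_left_mono[OF 2]] by (simp add: add.commute add.left_commute)
 moreover have "?R (%_. en d) ~= iy" by (rule Y.RD_finite[OF al_pos U(1)]) auto
 ultimately show ?thesis by (subst (asm) ennreal_add_left_cancel_le) auto
qed

lemmas kTX = kop_RD[OF D(1) less_imp_le[OF al_pos]] and kTY = Y.kop_RD[OF D(1) less_imp_le[OF al_pos]]

lemma dual_S:
 assumes "g : BM" "h : BM"
 shows "(NI m (%x. h x * nlim (RD al D) qf g x)) = (NI m (%x. nlim (Y.RD al D) qf h x * g x))"
 by (rule nlim_dual[OF kTX kTY sets_m d.RD_dual[OF D(1) less_imp_le[OF al_pos]] qf_measurable assms(2,1)])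

text \<open>The candidate bound \<open>B * kf\<close> is preserved by the recursion in the ball. At
  exit points within \<open>1.9 * r\<close> the Green function bound gives \<open>n <= B\<close>, by
  \<open>cD <= kk\<close>. Points farther away are reached from the ball only by jumps, whose total
  contribution is at most the surplus \<open>B * d\<close>, by the second condition on
  \<open>kk\<close>.\<close>

lemma nhat_bound:
 assumes g [measurable]: "g : BM" and g0: "!!y. y ~: NN ==> g y = 0" and x: "x : W"
 shows "nlim (Y.RD al D) qf g x <= K0 * (NI m (%y. g y)) * en (kf x)"
proof -
 define T where "T = Y.RD al D"
 define n where "n = nlim T qf g"
 define B where "B = K0 * (NI m (%y. g y))"
 define far where "far y = n y * ix (- ball z0 (1.9 * r)) y" for y
 let ?U = "W Int D"
 let ?k = "%y. en (kf y)"
 have U: "open ?U" "?U <= D" "?U <= W" using D(1) by auto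
 have kT: "kop T" unfolding T_def by (rule kTY)
 have nm [measurable]: "n : BM" unfolding n_def by (rule nlim_measurable[OF kT]) measurable
 have [measurable]: "ball z0 (1.9 * r) : sets borel" by (rule borel_open[OF open_ball])
 have fm [measurable]: "far : BM" unfolding far_def by measurable
 note kR = Y.kop_RD[OF U(1) less_imp_le[OF al_pos]] and kH = Y.kop_HD[OF U(1) less_imp_le[OF al_pos]]
 have n0: "n y <= Y.RD 0 D g y" for y
  unfolding n_def T_def by (rule Y.nlim_le_RD0[OF D(1) al_pos qf_measurable g qf_le])
 have near: "n y <= B * ?k y + far y" if "y ~: ?U" for y
 proof (cases "y : D")
  case True
  show ?thesis
  proof (cases "dist z0 y < 1.9 * r")
   case near: True
   have "n y <= en (cD * \<Phi> r / V r) * (NI m (%y. g y))" by (rule order_trans[OF n0 cD[OF g g0 near]]) simp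
   also have "... <= B" unfolding B_def using kk(1) VPhi by (intro mulR ennreal_leI divide_right_mono mulR) auto
   also have "B * 1 <= B * ?k y" using kf_bounds(6)[of y] that True by (intro mulL) auto
   finally show ?thesis by (simp add: add_increasing2)
  next
   case False
   hence "far y = n y" unfolding far_def by simp
   thus ?thesis by (simp add: add_increasing)
  qed
 next
  case False
  thus ?thesis using n0[of y] by (simp add: Y.RD_outside)
 qed
 \<comment> \<open>The values of \<open>n\<close> far away are not bounded pointwise. By duality the
   integral of \<open>n\<close> against \<open>j _ z0\<close> equals that of \<open>g\<close>
   against a potential of \<open>j _ z0\<close>, which \<open>jump_potential\<close> bounds.\<close>
 have jump: "Y.jop far y <= B * en d" if y: "y : ?U" for y
 proof -
  let ?g = "%z. en (j z z0) * ix (- ball z0 (1.9 * r)) z"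
  have gm [measurable]: "?g : BM" by measurable
  have "Y.jop far y <= (NI m (%z. en cJ * (n z * ?g z)))"
   unfolding Y.jop_def
  proof (rule nnmono)
   fix z
   show "en (jh y z) * far z <= en cJ * (n z * ?g z)"
   proof (cases "1.9 * r <= dist z0 z")
    case True
    hence "z ~= y" using y r_pos by auto
    hence "en (jh y z) <= en cJ * en (j z z0)" using cJ(2)[of y z] y True by (simp add: jdual)
    from mulR[OF this, of "n z"] show ?thesis using True by (simp add: far_def mult.assoc mult.commute[of "n z"])
   qed (simp add: far_def)
  qed
  also have "... = en cJ * (NI m (%z. n z * ?g z))" by (rule nncmult) measurable
  also have "(NI m (%z. n z * ?g z)) = (NI m (%z. g z * nlim (RD al D) qf ?g z))"
   unfolding n_def T_def by (rule dual_S[OF gm g, symmetric])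
  also have "... <= (NI m (%z. g z * en (c1 / V r)))"
  proof (intro nnmono mulL)
   fix z
   have "nlim (RD al D) qf ?g z <= RD 0 D ?g z" by (rule nlim_le_RD0[OF D(1) al_pos qf_measurable gm qf_le])
   also have "... <= RD 0 D (%z. en (j z z0)) z" by (rule RD_mono_params) (auto split: splix)
   finally show "nlim (RD al D) qf ?g z <= en (c1 / V r)" using c1(2) by (rule order_trans)
  qed simp
  also have "... = (NI m (%z. g z)) * en (c1 / V r)" by (rule nn_integral_multc) measurable
  also have "en cJ * ((NI m (%z. g z)) * en (c1 / V r)) = en (cJ * c1 / V r) * (NI m (%z. g z))"
  proof -
   have "en (cJ * c1 / V r) = en cJ * en (c1 / V r)" using cJ by (simp add: ennreal_mult'[symmetric])
   thus ?thesis by (simp only: mult.assoc mult.commute[of "integral\<^sup>N m g"])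
  qed
  also have "en (cJ * c1 / V r) <= en (kk * \<Phi> r / V r * d)"
   using kk(2) VPhi by (intro ennreal_leI) (simp add: divide_right_mono mult.commute mult.left_commute)
  also have "en (kk * \<Phi> r / V r * d) = K0 * en d" by (rule ennreal_mult'') (use d in simp)
  finally show ?thesis unfolding B_def by (simp add: mulL mulR mult.assoc mult.commute[of "en d"])
 qed
 \<comment> \<open>The induction is on partial sums of the series; off the set \<open>?U\<close>
   they are compared with the full limit \<open>n\<close>, for which the exit values are already
   bounded.\<close>
 have main: "neu T qf g i x <= B * ?k x" if "x : ?U" for i x
  using that
 proof (induction i arbitrary: x)
  case (Suc i)
  note [measurable] = neu_measurable[OF kT qf_measurable g]
  define G where "G y = g y + qf y * neu T qf g i y" for y
  have Gm [measurable]: "G : BM" unfolding G_def by measurable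
  have "neu T qf g (Suc i) x = T G x" unfolding G_def by simp
  also have "... = Y.RD al ?U G x + Y.HD al ?U (T G) x"
   unfolding T_def by (rule Y.RD_nest[OF D(1) U(1,2) Suc.prems less_imp_le[OF al_pos] Gm])
  also have "Y.RD al ?U G x <= Y.RD al ?U (%y. B * (qf y * ?k y)) x"
  proof (rule Y.RD_mono_on[OF U(1)])
   fix y assume y: "y : ?U"
   have "g y = 0" using y r_pos by (intro g0) auto
   thus "G y <= B * (qf y * ?k y)" using mulL[OF Suc.IH[OF y], of "qf y"] by (simp add: G_def mult.left_commute)
  qed
  also have "Y.HD al ?U (T G) x <= Y.HD al ?U (%y. B * ?k y + far y) x"
  proof (rule Y.HD_mono_off[OF U(1)])
   fix y assume y: "y ~: ?U"
   have "T G y = neu T qf g (Suc i) y" unfolding G_def by simp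
   also have "... <= n y" unfolding n_def nlim_def by (rule SUP_upper) simp
   finally show "T G y <= B * ?k y + far y" using near[OF y] by (rule order_trans)
  qed
  also have "... = B * Y.HD al ?U ?k x + Y.HD al ?U far x"
   by (subst kop_add[OF kH]) (measurable, subst kop_cmult[OF kH], measurable)
  also have "Y.HD al ?U far x = Y.RD al ?U (Y.jop far) x"
  proof (rule Y.ikeda_watanabe[OF U(1) less_imp_le[OF al_pos] fm])
   fix y assume "y : closure ?U"
   moreover have "closure ?U <= cball z0 (1.8 * r)" by (rule closure_minimal) auto
   ultimately show "far y = 0" using r_pos by (auto simp: far_def)
  qed
  also have "... <= Y.RD al ?U (%_. B * en d) x" by (rule Y.RD_mono_on[OF U(1) jump])
  finally have "neu T qf g (Suc i) x <= Y.RD al ?U (%y. B * (qf y * ?k y)) x + (B * Y.HD al ?U ?k x + Y.RD al ?U (%_. B * en d) x)"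
   by (simp add: add_mono)
  also have "... = B * (Y.RD al ?U (%y. qf y * ?k y + en d) x + Y.HD al ?U ?k x)"
  proof -
   have "Y.RD al ?U (%y. qf y * ?k y + en d) x = Y.RD al ?U (%y. qf y * ?k y) x + Y.RD al ?U (%_. en d) x"
    by (rule kop_add[OF kR]) measurable
   moreover have "Y.RD al ?U (%y. B * (qf y * ?k y)) x = B * Y.RD al ?U (%y. qf y * ?k y) x" by (rule kop_cmult[OF kR]) measurable
   moreover have "Y.RD al ?U (%_. B * en d) x = B * Y.RD al ?U (%_. en d) x" by (rule kop_cmult[OF kR]) measurable
   ultimately show ?thesis by (simp only: distrib_left ac_simps)
  qed
  also have "... <= B * ?k x" by (rule mulL[OF superharmonic_k[OF U(1,3) Suc.prems]]) simp
  finally show ?case .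
 qed simp
 have "n x <= B * ?k x"
 proof (cases "x : D")
  case True
  thus ?thesis unfolding n_def nlim_def using main x by (intro SUP_least) auto
 next
  case False
  thus ?thesis using n0[of x] by (simp add: Y.RD_outside)
 qed
 thus ?thesis unfolding n_def T_def B_def .
qed

text \<open>Duality with \<open>nhat_bound\<close> gives the inequality almost everywhere in the
  shell. A resolvent of large rate, started at a point of the open shell, ignores null sets and
  hardly sees the complement, which extends it to every point. For this \<open>g\<close> is first
  taken bounded, so that the potential is bounded too.\<close>

lemma S_bound:
 assumes g [measurable]: "g : BM" and g0: "!!y. y ~: W ==> g y = 0" and x: "x : NN" "x : D"
 shows "nlim (RD al D) qf g x <= K0 * (NI m (%y. g y * en (kf y)))"
proof -
 let ?a = "%g. K0 * (NI m (%y. g y * en (kf y)))"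
 let ?f = "%K K1 M. K * en (1 / K1) + en M * R K1 (ix (- NN)) x"
 have bd: "nlim (RD al D) qf g x <= ?a g"
  if g [measurable]: "g : BM" and g0: "!!y. y ~: W ==> g y = 0" and gb: "!!y. g y <= en b" and b: "0 <= b" for g b
 proof -
  define s where "s = nlim (RD al D) qf g"
  define K where "K = ?a g"
  have sm [measurable]: "s : BM" unfolding s_def by (rule nlim_measurable[OF kTX]) measurable
  have "(NI m (%y. h y * (s y * ix NN y))) <= (NI m (%y. h y * (K * ix NN y)))" if [measurable]: "h : BM" for h
  proof -
   let ?h = "%y. h y * ix NN y"
   have hm: "?h : BM" by measurable
   have "(NI m (%y. h y * (s y * ix NN y))) = (NI m (%y. ?h y * s y))" by (simp only: mult.assoc mult.commute[of "s _"])
   also have "... = (NI m (%y. nlim (Y.RD al D) qf ?h y * g y))" unfolding s_def by (rule dual_S[OF g hm])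
   also have "... <= (NI m (%y. K0 * (NI m (%y. ?h y)) * (g y * en (kf y))))"
   proof (rule nnmono)
    fix y
    show "nlim (Y.RD al D) qf ?h y * g y <= K0 * (NI m (%y. ?h y)) * (g y * en (kf y))"
    proof (cases "y : W")
     case True
     from mulR[OF nhat_bound[OF hm _ True], of "g y"] show ?thesis by (simp add: mult.assoc mult.commute[of "g y"])
    qed (simp add: g0)
   qed
   also have "... = (NI m (%y. ?h y)) * K" unfolding K_def by (subst nncmult) (measurable, simp only: mult.assoc mult.left_commute)
   also have "... = (NI m (%y. ?h y * K))" by (rule nn_integral_multc[symmetric]) measurable
   also have "... = (NI m (%y. h y * (K * ix NN y)))" by (simp only: mult.assoc mult.commute[of K])
   finally show ?thesis .
  qed
  hence ae: "AE y in m. s y * ix NN y <= K * ix NN y" by (intro d.AE_le_of_integral) measurable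
  \<comment> \<open>Since \<open>kf <= 2\<close>, the killing rate in the ball is at least
    \<open>d\<close>; a source in the ball bounded by \<open>b\<close> thus has potential at most
    \<open>b / d\<close>.\<close>
  define M where "M = b / d"
  have M: "0 <= M" unfolding M_def using b d by simp
  have sM: "s y <= en M" for y
   unfolding s_def
  proof (rule nlim_least[OF kTX qf_measurable g])
   fix y
   have "g z + qf z * en M <= en M * en al" for z
   proof (cases "z : W")
    case True
    have "b <= 2 * d / kf z * M" unfolding M_def using kf_bounds(2,3)[of z] d b by (simp add: field_simps mulL)
    hence "g z <= en (2 * d / kf z) * en M"
     using gb[of z] M kf_bounds(2)[of z] d by (simp add: ennreal_mult''[symmetric]) (meson ennreal_leI order_trans)
    hence "g z + qf z * en M <= (qf z + en (2 * d / kf z)) * en M" by (simp add: distrib_right add.commute add_right_mono)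
    thus ?thesis unfolding qf_split[OF True] by (simp only: mult.commute)
   qed (simp add: g0 qf_def mult.commute)
   hence "RD al D (%z. g z + qf z * en M) y <= RD al D (%_. en M * en al) y" by (intro kop_mono[OF kTX]) measurable
   also have "... <= en M * en al * en (1 / al)" by (rule RD_bound[OF al_pos D(1)]) simp_all
   also have "... = en M" using al_pos by (simp add: mult.assoc ennreal_mult'[symmetric])
   finally show "RD al D (%z. g z + qf z * en M) y <= en M" .
  qed simp
  define G where "G y = g y + qf y * s y" for y
  define b' where "b' = b + al * M"
  have Gm [measurable]: "G : BM" unfolding G_def by measurable
  have Gb: "G y <= en b'" for y
  proof -
   have "G y <= en b + en al * en M" unfolding G_def by (intro add_mono gb mult_mono qf_le sM) simp_all
   thus ?thesis unfolding b'_def using b M al_pos by (simp add: ennreal_mult' ennreal_plus)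
  qed
  have sG: "s y = RD al D G y" for y unfolding s_def G_def by (rule nlim_fix[OF kTX qf_measurable g])
  let ?N = "%n. rs n"
  let ?u = "%n. en (b' / ?N n) + (K + en M * (en (?N n) * R (al + ?N n) (ix (- NN)) x))"
  have le: "s x <= ?u n" for n
  proof -
   let ?b = "al + ?N n"
   have bp: "0 < ?b" "al < ?b" using al_pos by auto
   \<comment> \<open>The excess of \<open>s\<close> over \<open>K\<close> inside the shell is
     supported on a null set and has resolvent 0; outside the shell the crude bound \<open>M\<close>
     is used.\<close>
   define e where "e = (%y. s y * ix (NN Int {y. K < s y}) y)"
   have [measurable]: "{y. K < s y} \<in> sets borel" using borel_measurable_less[of "%_. K" borel s] by simp
   have [measurable]: "NN Int {y. K < s y} \<in> sets borel" by (rule sets.Int[OF NN_sets]) fact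
   have em: "e : BM" unfolding e_def by measurable
   have e0: "R ?b e x = 0"
    by (rule d.R_ac[OF em _ bp(1)]) (use ae in eventually_elim, auto simp: e_def split: splix)
   have cm: "(%y. K + en M * ix (- NN) y) : BM" by measurable
   have c: "R ?b (%y. K + en M * ix (- NN) y) x = ?f K ?b M"
    by (subst kop_add[OF kop_R]) (measurable, simp add: R_const[OF bp(1)] kop_cmult[OF kop_R] del: of_nat_Suc)
   have "R ?b s x <= R ?b (%y. (K + en M * ix (- NN) y) + e y) x"
   proof (rule kop_mono[OF kop_R])
    fix y
    show "s y <= (K + en M * ix (- NN) y) + e y"
    proof (cases "y : NN")
     case True
     thus ?thesis unfolding e_def by (cases "K < s y") (auto simp: not_less intro: add_increasing)
    next
     case False
     hence "s y <= en M * ix (- NN) y" using sM[of y] by simp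
     thus ?thesis by (simp add: add_increasing add_increasing2)
    qed
   qed (use cm em in measurable)
   hence "R ?b s x <= ?f K ?b M"
    unfolding kop_add[OF kop_R cm em] c e0 by simp
   moreover have "RD ?b D s x <= R ?b s x" unfolding RD_def using occ_le_R by simp
   ultimately have Rs: "RD ?b D s x <= ?f K ?b M" by (rule order_trans[rotated])
   have "RD ?b D G x <= en b' * en (1 / ?b)" by (rule RD_bound[OF bp(1) D(1) Gm Gb])
   also have "... <= en (b' / ?N n)"
   proof -
    have "b' * (1 / ?b) <= b' / ?N n" unfolding b'_def using b M al_pos by (simp add: frac_le del: of_nat_Suc)
    thus ?thesis using bp by (simp add: ennreal_mult''[symmetric] ennreal_leI del: of_nat_Suc)
   qed
   finally have RG: "RD ?b D G x <= en (b' / ?N n)" .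
   have "s x = RD ?b D G x + en (?N n) * RD ?b D s x"
    using RD_resolvent_eq[OF D(1) less_imp_le[OF al_pos] bp(2) Gm, of x] RD_commute[OF D(1) less_imp_le[OF al_pos] bp(2) Gm, of x]
     sG[of x] ext[of s "RD al D G", OF sG] by simp
   also have "... <= en (b' / ?N n) + en (?N n) * (?f K ?b M)"
    by (intro add_mono RG mulL Rs) simp
   also have "... <= ?u n"
   proof -
    have "en (?N n) * en (1 / ?b) <= 1"
     using al_pos by (simp add: ennreal_mult'[symmetric] ennreal_le_1 del: of_nat_Suc)
    from mulL[OF this, of K] show ?thesis
     unfolding distrib_left by (intro add_left_mono add_mono) (simp_all only: mult.left_commute mult_1_right zero_le order_refl)
   qed
   finally show ?thesis .
  qed
  have "?u ----> en 0 + (K + en M * 0)"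
  proof (intro tendsto_add tendsto_const)
   have "(%n. b' / ?N n) ----> 0" by real_asymp
   thus "(%n. en (b' / ?N n)) ----> en 0" by (rule tendsto_ennrealI)
   show "(%n. en M * (en (?N n) * R (al + ?N n) (ix (- NN)) x)) ----> en M * 0"
    by (intro ennreal_tendsto_cmult resolvent_leave_lim open_NN x(1) al_pos) simp
  qed
  hence "s x <= en 0 + (K + en M * 0)" by (rule LIMSEQ_le_const) (use le in blast)
  thus ?thesis unfolding s_def K_def by simp
 qed
 let ?g = "%n y. min (g y) (en (real n))"
 have "nlim (RD al D) qf g x <= (SUP n. nlim (RD al D) qf (?g n) x)"
  using nlim_SUP_le[OF kTX qf_measurable truncate(1,2)[OF g], of x] by (simp add: truncate(3)[OF g])
 also have "... <= ?a g"
 proof (rule SUP_least)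
  fix n
  have "nlim (RD al D) qf (?g n) x <= K0 * (NI m (%y. ?g n y * en (kf y)))"
   by (rule bd[of _ "real n", OF truncate(1)[OF g]]) (simp_all add: g0)
  also have "... <= ?a g" by (intro mulL nnmono mulR) auto
  finally show "nlim (RD al D) qf (?g n) x <= ?a g" .
 qed
 finally show ?thesis .
qed

text \<open>Killing at rate \<open>ps\<close> splits \<open>w\<close> into the part collected where
  the process is killed, in \<open>W\<close>, and the part collected when it leaves \<open>D\<close>
  alive. The latter comes from jumps out of \<open>D4\<close> into the closed ball of radius
  \<open>r\<close>, or from paths first entering \<open>D - D4\<close>. That set lies in
  \<open>D5\<close>, where the killing rate has its full value \<open>al\<close>; this part is kept
  as the last term and removed when \<open>ee\<close> tends to 0.\<close>

lemma harmonic_eps_bound: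
 fixes w :: "'a => ennreal" and tt cJ2 :: real
 defines "D4 \<equiv> D Int {y. 1.1 * r < dist z0 y}" and "D5 \<equiv> D Int ball z0 (1.2 * r)" and "I \<equiv> NI m (%z. w z * ix (cball z0 r) z)"
 assumes w [measurable]: "w : BM" and harm: "!!x. x : D ==> HD 0 D w x = w x" and fw: "!!x. x : D ==> w x < iy"
  and w0: "!!x. x ~: D ==> r < dist z0 x ==> w x = 0"
  and tt: "0 <= tt" "!!z. dist z0 z <= r ==> (NI m (%y. en (j y z) * ix {y. 1.1 * r < dist z0 y} y)) <= en tt"
  and cJ2: "1 <= cJ2" "!!x y. dist z0 x < 1.2 * r ==> 1.8 * r <= dist z0 y ==> en (j y x) <= en cJ2 * en (j y z0)"
  and x: "x : NN" "x : D"
 shows "w x <= K0 * (en (2 * d) * (NI m (%z. w z * ix W z))) + (K0 * (en (d + ee * tt) * I) + en (cJ2 * c1 / V r) * I)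
  + HD 0 D4 (%y. HD al D5 w y * ix (D - D4) y) x"
proof -
 let ?c = "%y z K2. en (j y z) * (w z * ix (cball z0 r) z) * (en (kf y) * ix K2 y)"
 let ?k = "%z E i. qf z * E i z + en al * rem D w al i z"
 let ?l = "en (2 * d) * (NI m (%z. w z * ix W z))"
 let ?o = "%z. en (d + ee * tt) * (w z * ix (cball z0 r) z)"
 let ?p = "%z y K2 K3. en (jh z y) * en (K2 y) + en ee * (en (j y z) * ix K3 y)"
 let ?q = "%y z K2. en (j y z) * (en (kf y) * ix K2 y)"
 let ?s = "%i. %z. en al * rem D w al i z"
 define T where "T = RD al D"
 have kT: "kop T" unfolding T_def by (rule kTX)
 note al0 = less_imp_le[OF al_pos]
 have D4: "open D4" "D4 <= D" and D5: "open D5" "D5 <= D"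
  unfolding D4_def D5_def using D(1) by (auto intro!: open_Int open_Collect_less continuous_intros)
 have [measurable]: "D4 : sets borel" "D5 : sets borel" "cball z0 r : sets borel" "{y. 1.1 * r < dist z0 y} \<in> sets borel"
  using D4 D5 by (auto intro!: borel_open open_Collect_less continuous_intros)
 define ps where "ps y = (if y : W then en (2 * d / kf y) else 0)" for y
 have psm [measurable]: "ps : BM" unfolding ps_def[abs_def] by measurable
 have qps: "qf y + ps y = en al" for y unfolding ps_def using qf_split[of y] by (simp add: qf_def)
 \<comment> \<open>Partial sums of the exit part: the expected value of \<open>w\<close> on leaving
   \<open>D\<close>, on the event of not having been killed at rate \<open>ps\<close>.\<close>
 define E where "E = rec_nat (%_. 0) (%_ e y. HD al D w y + T (%z. qf z * e z) y)"
 have E0: "E 0 = (%_. 0)" and ES: "E (Suc i) = (%y. HD al D w y + T (%z. qf z * E i z) y)" for i unfolding E_def by simp_all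
 have HDm [measurable]: "HD a U g : BM" if "open U" "0 <= a" "g : BM" for a U g
  by (rule kopm[OF kop_HD[OF that(1,2)] that(3)])
 have Hw [measurable]: "HD al D w : BM" by (rule HDm[OF D(1) al0 w])
 have Em [measurable]: "E i : BM" for i
 proof (induction i)
  case (Suc i)
  note [measurable] = Suc
  have [measurable]: "T (%z. qf z * E i z) : BM" by (rule kopm[OF kT]) measurable
  show ?case unfolding ES by measurable
 qed (simp add: E0)
 have qEm: "(%z. qf z * E i z) : BM" for i by measurable
 have Tm [measurable]: "T (%z. qf z * E i z) : BM" for i by (rule kopm[OF kT qEm])
 have split: "w y = HD al D w y + RD al D (%y. en al * w y) y" if "y : D" for y
  by (rule harm_split[OF D(1) w harm fw that al_pos])
 have remm [measurable]: "rem D w al i : BM" for i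
  by (rule rem_lim(1)[OF D(1) w harm fw al_pos x(2)])
 have Ew: "E i y <= w y" if "y : D" for i y
  using that
 proof (induction i arbitrary: y)
  case (Suc i)
  have "T (%z. qf z * E i z) y <= T (%z. en al * w z) y"
   unfolding T_def by (rule RD_mono_on[OF D(1)]) (intro mult_mono qf_le Suc.IH, simp_all)
  thus ?case unfolding ES split[OF Suc.prems] T_def by (rule add_left_mono)
 qed (simp add: E0)
 have rem0: "rem D w al 0 z = w z * ix D z" for z by (subst rem_def[OF D(1) w harm fw]) simp_all
 have remS: "rem D w al (Suc i) = T (?s i)" for i unfolding T_def by (rule rem_Suc[OF D(1) w harm fw])
 let ?S = "nlim T qf"
 \<comment> \<open>Each application of \<open>harm_split\<close> resolves one more term. The weight
   \<open>al\<close> is split as \<open>ps + qf\<close> on the first two parts and bounded below by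
   nothing but \<open>qf <= al\<close> on the remainder.\<close>
 have wle: "w y <= neu T qf (%y. ps y * w y) i y + E i y + rem D w al i y" if "y : D" for i y
  using that
 proof (induction i arbitrary: y)
  case 0
  thus ?case by (simp add: rem0 E0)
 next
  case (Suc i)
  let ?n = "neu T qf (%y. ps y * w y) i"
  have nm [measurable]: "?n : BM" by (rule neu_measurable[OF kT]) measurable
  have "T (%z. en al * w z) y <= T (%z. (ps z * w z + qf z * ?n z) + (?k z E i)) y"
   unfolding T_def
  proof (rule RD_mono_on[OF D(1)])
   fix z assume z: "z : D"
   have "en al * w z = ps z * w z + qf z * w z" by (simp add: qps[of z, symmetric] distrib_right add.commute)
   also have "... <= ps z * w z + qf z * (?n z + E i z + rem D w al i z)" using Suc.IH[OF z] by (intro add_left_mono mulL) (auto simp: T_def)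
   also have "... <= ps z * w z + (qf z * ?n z + qf z * E i z + en al * rem D w al i z)"
    unfolding distrib_left by (intro add_left_mono mulR qf_le) simp
   finally show "en al * w z <= (ps z * w z + qf z * neu (RD al D) qf (%y. ps y * w y) i z) + (?k z E i)"
    by (simp add: T_def add.assoc)
  qed
  also have "... = T (%z. ps z * w z + qf z * ?n z) y + (T (%z. qf z * E i z) y + T (?s i) y)"
  proof -
   have "T (%z. (ps z * w z + qf z * ?n z) + (?k z E i)) y
    = T (%z. ps z * w z + qf z * ?n z) y + T (%z. ?k z E i) y"
    by (rule kop_add[OF kT]) measurable
   moreover have "T (%z. ?k z E i) y = T (%z. qf z * E i z) y + T (?s i) y"
    by (rule kop_add[OF kT]) measurable
   ultimately show ?thesis by (simp only:)
  qed
  finally have "HD al D w y + T (%z. en al * w z) y <= HD al D w y + (neu T qf (%y. ps y * w y) (Suc i) y + (T (%z. qf z * E i z) y + rem D w al (Suc i) y))"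
   unfolding remS neu.simps by (rule add_left_mono)
  thus ?case unfolding ES split[OF Suc.prems, folded T_def] by (simp only: ac_simps)
 qed
 \<comment> \<open>The rate of jumping into the closed ball of radius \<open>r\<close>, weighted by
   the value of \<open>w\<close> at the landing point.\<close>
 define Ju where "Ju = jop (%z. w z * ix (cball z0 r) z)"
 have wBm: "(%z. w z * ix (cball z0 r) z) : BM" by measurable
 have Jm [measurable]: "Ju : BM" unfolding Ju_def by (rule kopm[OF kop_jop wBm])
 define g where "g y = Ju y * ix D4 y" for y
 have gm [measurable]: "g : BM" unfolding g_def[abs_def] by measurable
 define b where "b y = HD al D5 w y * ix (D - D4) y" for y
 have H5 [measurable]: "HD al D5 w : BM" by (rule HDm[OF D5(1) al0 w])
 have bm [measurable]: "b : BM" unfolding b_def[abs_def] by measurable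
 let ?H = "HD 0 D4 b"
 have Hm [measurable]: "?H : BM" by (rule HDm[OF D4(1) order_refl bm])
 have nest: "E (Suc i) y = RD al D' (%z. qf z * E i z) y + HD al D' (%z. if z : D then E (Suc i) z else w z) y"
  if D': "open D'" "D' <= D" "y : D'" for D' y i
 proof -
  let ?h = "%z. if z : D then HD al D w z else w z"
  have hm: "?h : BM" by measurable
  have "E (Suc i) y = HD al D' ?h y + (RD al D' (%z. qf z * E i z) y + HD al D' (T (%z. qf z * E i z)) y)"
   unfolding ES T_def using HD_nest[OF D(1) D' al0 w] RD_nest[OF D(1) D' al0 qEm] by simp
  also have "... = RD al D' (%z. qf z * E i z) y + (HD al D' ?h y + HD al D' (T (%z. qf z * E i z)) y)" by (simp only: ac_simps)
  also have "HD al D' ?h y + HD al D' (T (%z. qf z * E i z)) y = HD al D' (%z. ?h z + T (%z. qf z * E i z) z) y"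
   by (rule kop_add[OF kop_HD[OF D'(1) al0] hm Tm, symmetric])
  also have "(%z. ?h z + T (%z. qf z * E i z) z) = (%z. if z : D then E (Suc i) z else w z)"
   unfolding ES T_def by (auto simp: RD_outside)
  finally show ?thesis .
 qed
 \<comment> \<open>On \<open>D5\<close> the weight \<open>qf\<close> vanishes, so surviving paths
   must leave \<open>D5\<close> before a clock of rate \<open>al\<close> rings, and at their exit
   \<open>E\<close> is at most \<open>w\<close>.\<close>
 have E5: "E (Suc i) y <= HD al D5 w y" if y: "y : D5" for i y
 proof -
  have "RD al D5 (%z. qf z * E i z) y = RD al D5 (%_. 0) y" by (rule RD_cong[OF D5(1)]) (simp add: D5_def qf_inner)
  also have "... = 0" by (rule kop_zero[OF kop_RD[OF D5(1) al0]])
  finally show ?thesis unfolding nest[OF D5 y] by (simp, intro HD_mono_params) (simp_all add: Ew)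
 qed
 \<comment> \<open>The jump part keeps its killing and becomes a partial sum with source
   \<open>g\<close>. For paths entering \<open>D - D4\<close> the killing in \<open>D4\<close> is
   given up by \<open>qf <= al\<close>; the recursion then reassembles \<open>HD 0 D4 b\<close>
   through \<open>HD_resolvent\<close>.\<close>
 have E4: "E i y <= neu T qf g i y + ?H y" if "y : D4" for i y
  using that
 proof (induction i arbitrary: y)
  case (Suc i)
  note kR = kop_RD[OF D4(1) al0] and kH = kop_HD[OF D4(1) al0]
  have nm [measurable]: "neu T qf g i : BM" by (rule neu_measurable[OF kT qf_measurable gm])
  have "HD al D4 (%z. if z : D then E (Suc i) z else w z) y <= HD al D4 (%z. b z + w z * ix (cball z0 r) z) y"
  proof (rule HD_mono_off[OF D4(1)])
   fix z assume z: "z ~: D4"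
   show "(if z : D then E (Suc i) z else w z) <= b z + w z * ix (cball z0 r) z"
   proof (cases "z : D")
    case True
    hence "z : D5" using z r_pos unfolding D4_def D5_def by auto
    thus ?thesis using True z E5[of z i] by (simp add: b_def add_increasing2)
   next
    case False
    thus ?thesis using w0[OF False] by (cases "r < dist z0 z") (auto simp: add_increasing)
   qed
  qed
  also have "... = HD al D4 b y + HD al D4 (%z. w z * ix (cball z0 r) z) y" by (rule kop_add[OF kH bm wBm])
  also have "HD al D4 (%z. w z * ix (cball z0 r) z) y = RD al D4 Ju y"
   unfolding Ju_def
  proof (rule ikeda_watanabe[OF D4(1) al0 wBm])
   fix z assume "z : closure D4"
   moreover have "closure D4 <= {y. 1.1 * r <= dist z0 y}"
    by (rule closure_minimal) (auto simp: D4_def intro!: closed_Collect_le continuous_intros)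
   ultimately show "w z * ix (cball z0 r) z = 0" using r_pos by auto
  qed
  also have "RD al D4 Ju y = RD al D4 g y" by (rule RD_cong[OF D4(1)]) (simp add: g_def)
  finally have 1: "HD al D4 (%z. if z : D then E (Suc i) z else w z) y <= HD al D4 b y + RD al D4 g y" .
  have "RD al D4 (%z. qf z * E i z) y <= RD al D4 (%z. qf z * neu T qf g i z + en al * ?H z) y"
  proof (rule RD_mono_on[OF D4(1)])
   fix z assume "z : D4"
   from mulL[OF Suc.IH[OF this], of "qf z"] show "qf z * E i z <= qf z * neu T qf g i z + en al * ?H z"
    unfolding distrib_left using mulR[OF qf_le[of z], of "?H z"] by (meson add_left_mono order_trans zero_le)
  qed
  also have "... = RD al D4 (%z. qf z * neu T qf g i z) y + en al * RD al D4 ?H y"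
   by (subst kop_add[OF kR]) (measurable, simp add: kop_cmult[OF kR])
  finally have "E (Suc i) y <= (RD al D4 (%z. qf z * neu T qf g i z) y + en al * RD al D4 ?H y) + (HD al D4 b y + RD al D4 g y)"
   unfolding nest[OF D4 Suc.prems] using 1 by (rule add_mono)
  also have "... = (RD al D4 g y + RD al D4 (%z. qf z * neu T qf g i z) y) + (HD al D4 b y + en al * RD al D4 ?H y)" by (simp only: ac_simps)
  also have "HD al D4 b y + en al * RD al D4 ?H y = ?H y" using HD_resolvent[OF D4(1) order_refl al_pos bm, of y] by simp
  also have "RD al D4 g y + RD al D4 (%z. qf z * neu T qf g i z) y = RD al D4 (%z. g z + qf z * neu T qf g i z) y"
   by (rule kop_add[OF kR, symmetric]) measurable
  also have "... <= T (%z. g z + qf z * neu T qf g i z) y"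
   unfolding T_def using nm gm by (intro RD_sub[OF D(1) D4 al0]) (simp add: T_def)
  finally show ?case by (simp add: add_right_mono)
 qed (simp add: E0)
 have x4: "x : D4" using x r_pos unfolding D4_def by auto
 have psw: "?S (%y. ps y * w y) x <= K0 * ?l"
 proof -
  have "?S (%y. ps y * w y) x <= K0 * (NI m (%y. ps y * w y * en (kf y)))"
   unfolding T_def by (rule S_bound[OF _ _ x]) (measurable, simp add: ps_def)
  also have "(NI m (%y. ps y * w y * en (kf y))) = (NI m (%y. en (2 * d) * (w y * ix W y)))"
  proof (rule nncong)
   fix y
   \<comment> \<open>The weight \<open>kf\<close> in \<open>S_bound\<close> cancels the denominator
     of the rate, so this term stays bounded as \<open>ee\<close> tends to 0.\<close>
   have "en (2 * d / kf y) * en (kf y) = en (2 * d)" using kf_bounds(2)[of y] d by (simp add: ennreal_mult'[symmetric])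
   hence "en (2 * d / kf y) * w y * en (kf y) = en (2 * d) * w y" by (simp only: mult.assoc mult.commute[of "w y"]) (simp only: mult.assoc[symmetric])
   thus "ps y * w y * en (kf y) = en (2 * d) * (w y * ix W y)"
    unfolding ps_def by auto
  qed
  also have "... = ?l" by (rule nncmult) measurable
  finally show ?thesis .
 qed
 \<comment> \<open>By duality of the jump densities the integral of \<open>1 - f\<close> is the dual
   generator of \<open>1 - f\<close> at \<open>z\<close>, where this function vanishes; it is at
   most \<open>d\<close>. The constant \<open>ee\<close> in \<open>kf\<close> contributes the tail
   mass \<open>tt\<close>.\<close>
 have inner: "(NI m (%y. en (j y z) * (en (kf y) * ix {y. 1.1 * r < dist z0 y} y))) <= en (d + ee * tt)" if z: "dist z0 z <= r" for z
 proof -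
  let ?h = "%y. 1 - f y" and ?A = "{y. 1.1 * r < dist z0 y}"
  have hb: "0 <= ?h y" "?h y <= 1" for y using bumpD(4,5)[OF f, of y] by auto
  have "ball z0 (1.2 * r) <= {y. ?h y = 0}" using bumpD(2)[OF f] ball_cl_ball(1)[of z0 "1.2 * r"] by auto
  hence "closure {y. ?h y ~= 0} <= - ball z0 (1.2 * r)" by (intro closure_minimal) auto
  hence zc: "z ~: closure {y. ?h y ~= 0}" using z r_pos by auto
  hence hz: "?h z = 0" using closure_subset[of "{y. ?h y ~= 0}"] by blast
  have hc: "continuous_on UNIV ?h" using bump_C0(1)[OF f] unfolding C0_def by (auto intro!: continuous_intros)
  have hbd: "bounded (range ?h)" unfolding bounded_iff using hb by (intro exI[of _ 1]) auto
  note L = Y.levy_lim[OF hc hbd zc hb(1)]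
  have "((%t. semigroup Y t ?h z / t) \<longlongrightarrow> - gen C0 Y f z) (at_right 0)"
   using Y.gen_lim[OF Y.generates_C_inf(3)[OF Y.bump_gen[OF f]], of z] hz by (simp add: Y.generates_C_inf(2)[OF Y.bump_gen[OF f]])
  hence "enn2real (Y.jop (%y. en (?h y)) z) = - gen C0 Y f z"
   by (rule tendsto_unique[OF trivial_limit_at_right_real L(1)])
  hence jd: "Y.jop (%y. en (?h y)) z <= en d" using d(2)[of z] L(2) by (metis ennreal_enn2real ennreal_leI infinity_ennreal_def)
  have "(NI m (%y. ?q y z ?A)) <= (NI m (%y. ?p z y ?h ?A))"
  proof (rule nnmono)
   fix y
   show "?q y z ?A <= ?p z y ?h ?A"
   proof (cases "y : ?A")
    case True
    hence "y ~= z" using z r_pos by auto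
    moreover have "en (kf y) = en (?h y) + en ee" unfolding kf_def using hb ee by (simp flip: ennreal_plus)
    ultimately show ?thesis using True by (simp add: jdual distrib_left mult.commute)
   qed simp
  qed
  also have "... = Y.jop (%y. en (?h y)) z + en ee * (NI m (%y. en (j y z) * ix ?A y))"
  proof -
   have "(NI m (%y. en ee * (en (j y z) * ix ?A y))) = en ee * (NI m (%y. en (j y z) * ix ?A y))"
    by (rule nncmult) measurable
   moreover have "(NI m (%y. ?p z y ?h ?A))
    = (NI m (%y. en (jh z y) * en (?h y))) + (NI m (%y. en ee * (en (j y z) * ix ?A y)))"
    by (rule nn_integral_add) measurable
   ultimately show ?thesis unfolding Y.jop_def by (simp only:)
  qed
  also have "... <= en d + en ee * en tt" by (intro add_mono jd mulL tt(2) z) simp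
  also have "... = en (d + ee * tt)" using d ee tt(1) by (simp add: ennreal_mult' ennreal_plus)
  finally show ?thesis .
 qed
 let ?gW = "%y. g y * ix W y" and ?gV = "%y. g y * ix (- W) y"
 have gWm: "?gW : BM" and gVm: "?gV : BM" by measurable
 \<comment> \<open>Landing in \<open>W\<close>: the double integral is exchanged, so that
   \<open>inner\<close> bounds the jump mass for each point \<open>z\<close> of the closed
   ball.\<close>
 have S1: "?S ?gW x <= K0 * (en (d + ee * tt) * I)"
 proof -
  interpret sigma_finite_measure m by (rule sigma_m)
  interpret PM: pair_sigma_finite m m ..
  let ?A = "{y. 1.1 * r < dist z0 y}"
  have "(NI m (%y. ?gW y * en (kf y))) <= (NI m (%y. Ju y * (en (kf y) * ix ?A y)))"
   unfolding g_def D4_def by (intro nnmono) (auto split: splix)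
  also have "... = (NI m (%y. (NI m (%z. ?c y z ?A))))"
   unfolding Ju_def jop_def by (intro nncong nn_integral_multc[symmetric]) measurable
  also have "... = (NI m (%z. (NI m (%y. ?c y z ?A))))"
   by (rule PM.Fubini') measurable
  also have "... <= (NI m (%z. ?o z))"
  proof (rule nnmono)
   fix z
   have "(NI m (%y. ?c y z ?A))
    = (NI m (%y. (w z * ix (cball z0 r) z) * (?q y z ?A)))"
    by (intro nncong) (simp only: ac_simps)
   also have "... = (w z * ix (cball z0 r) z) * (NI m (%y. ?q y z ?A))"
    by (rule nncmult) measurable
   also have "... <= ?o z"
    using mulL[OF inner[of z], of "w z"] by (auto simp: mult.commute split: splix)
   finally show "(NI m (%y. ?c y z ?A)) <= ?o z" .
  qed
  also have "... = en (d + ee * tt) * I" unfolding I_def by (rule nncmult) measurable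
  finally have "K0 * (NI m (%y. ?gW y * en (kf y))) <= K0 * (en (d + ee * tt) * I)" by (rule mulL) simp
  thus ?thesis unfolding T_def by (intro order_trans[OF S_bound[OF gWm _ x]]) simp_all
 qed
 \<comment> \<open>From points outside \<open>W\<close> the jump density into the closed ball is
   comparable to \<open>j _ z0\<close>, and the potential of the latter is known.\<close>
 have S2: "?S ?gV x <= en (cJ2 * c1 / V r) * I"
 proof -
  have "?S ?gV x <= RD 0 D ?gV x" unfolding T_def by (rule nlim_le_RD0[OF D(1) al_pos qf_measurable gVm qf_le])
  also have "... <= RD 0 D (%y. en cJ2 * I * en (j y z0)) x"
  proof (rule RD_mono_params[OF order_refl])
   fix y
   show "?gV y <= en cJ2 * I * en (j y z0)"
   proof (cases "y : W")
    case False
    have "Ju y <= (NI m (%z. en cJ2 * en (j y z0) * (w z * ix (cball z0 r) z)))"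
     unfolding Ju_def jop_def
    proof (rule nnmono)
     fix z
     show "en (j y z) * (w z * ix (cball z0 r) z) <= en cJ2 * en (j y z0) * (w z * ix (cball z0 r) z)"
      using cJ2(2)[of z y] False r_pos by (cases "z : cball z0 r") (auto intro: mulR)
    qed
    also have "... = en cJ2 * en (j y z0) * I" unfolding I_def by (rule nncmult) measurable
    finally have "Ju y <= en cJ2 * I * en (j y z0)" by (simp only: mult.assoc mult.commute[of I])
    thus ?thesis unfolding g_def by (auto split: splix)
   qed simp
  qed
  also have "... = en cJ2 * I * RD 0 D (%y. en (j y z0)) x" by (rule kop_cmult[OF kop_RD[OF D(1) order_refl]]) measurable
  also have "... <= en cJ2 * I * en (c1 / V r)" by (intro mulL c1) simp
  also have "... = en (cJ2 * c1 / V r) * I"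
  proof -
   have "en (cJ2 * c1 / V r) = en cJ2 * en (c1 / V r)" using cJ2 by (simp add: ennreal_mult'[symmetric])
   thus ?thesis by (simp only: mult.assoc mult.commute[of I])
  qed
  finally show ?thesis .
 qed
 have gsum: "?S g x <= ?S ?gW x + ?S ?gV x"
 proof -
  have "g = (%y. ?gW y + ?gV y)" by (auto split: splix)
  thus ?thesis using nlim_subadd[OF kT qf_measurable gWm gVm, of x] by simp
 qed
 have le: "w x <= ?S (%y. ps y * w y) x + (?S g x + ?H x) + rem D w al i x" for i
 proof -
  have "neu T qf h i x <= ?S h x" for h unfolding nlim_def by (rule SUP_upper) simp
  thus ?thesis by (intro order_trans[OF wle[OF x(2), of i]] add_mono order_trans[OF E4[OF x4]]) auto
 qed
 have "(%i. ?S (%y. ps y * w y) x + (?S g x + ?H x) + rem D w al i x) ----> ?S (%y. ps y * w y) x + (?S g x + ?H x) + 0"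
  by (intro tendsto_add tendsto_const rem_lim(3)[OF D(1) w harm fw al_pos x(2)])
 hence "w x <= ?S (%y. ps y * w y) x + (?S g x + ?H x) + 0" by (rule LIMSEQ_le_const) (use le in blast)
 also have "... = ?S (%y. ps y * w y) x + ?S g x + ?H x" by (simp add: add.assoc)
 also have "... <= K0 * ?l + (K0 * (en (d + ee * tt) * I) + en (cJ2 * c1 / V r) * I) + ?H x"
  by (intro add_mono psw order_refl order_trans[OF gsum] S1 S2)
 finally show ?thesis unfolding b_def .
qed

end

end

section \<open>The limit in \<open>ee\<close>, the factorization and the boundary Harnack
  principle\<close>

context bhp
begin

text \<open>In \<open>harmonic_eps_bound\<close> let \<open>ee\<close> tend to 0. The rate
  \<open>2 * d / ee\<close> on \<open>D5\<close> becomes infinite, so the last term vanishes by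
  \<open>HD_large\<close> and dominated convergence, and the tail \<open>ee * tt\<close> disappears.
  What remains involves only \<open>\<Phi> r * d\<close>, which is bounded because \<open>d\<close>
  is of order \<open>1 / \<Phi> r\<close>.\<close>

lemma harmonic_sup_bound:
 obtains C where "0 < C" "!!r D w x. 2 * r0 <= r ==> open D ==> D <= - cl_ball z0 r ==> w : BM ==>
  (!!x. x : D ==> HD 0 D w x = w x) ==> (!!x. x : D ==> w x < iy) ==> (!!x. x ~: D ==> r < dist z0 x ==> w x = 0) ==>
  x : D ==> 2 * r < dist z0 x ==> dist z0 x < 4 * r ==> w x <= en (C / V r) * (NI m (%z. w z * ix (ball z0 (1.8 * r)) z))"
proof -
 let ?b = "%kk r d cJ2 c1. kk * \<Phi> r / V r * (2 * d) + (kk * \<Phi> r / V r * d + cJ2 * c1 / V r)"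
 let ?c = "%c3 h. en c3 * Y.jop (%y. en (h y)) z0"
 let ?g = "%z K1. NI m (%y. en (j y z) * ix K1 y)"
 obtain c1 where c1: "0 < c1" "!!r D x. 2 * r0 <= r ==> open D ==> D <= - cl_ball z0 r ==> RD 0 D (%z. en (j z z0)) x <= en (c1 / V r)"
  by (rule jump_potential) blast
 obtain cB where cB: "0 < cB" "!!r. r0 <= r ==> \<exists>f\<in>bump m \<D> (cl_ball z0 r) (ball z0 (1.5 * r)). \<forall>x. - gen C0 X f x <= cB / \<Phi> r & - gen C0 Y f x <= cB / \<Phi> r"
  by (rule B2a_bump) blast
 obtain cD where cD: "0 < cD" "!!r D f z. r0 <= r ==> open D ==> D <= - cl_ball z0 r ==> f : BM ==>
   (!!y. \<not> (2 * r < dist z0 y & dist z0 y < 4 * r) ==> f y = 0) ==> dist z0 z < 1.9 * r ==>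
   Y.RD 0 D f z <= en (cD * \<Phi> r / V r) * (NI m (%y. f y))"
  by (rule D2_potential) blast
 \<comment> \<open>The ratio of the radii \<open>1.9 * r\<close> and \<open>1.8 * r\<close>.\<close>
 obtain cJ where cJ: "1 <= cJ" "!!r x y. r0 <= r ==> dist z0 x < r ==> 19 / 18 * r <= dist z0 y ==> en (j y x) <= en cJ * en (j y z0) & en (j y z0) <= en cJ * en (j y x)"
  by (rule C2_j[of "19 / 18"]) (simp, simp, blast)
 \<comment> \<open>The ratio of the radii \<open>1.8 * r\<close> and \<open>1.2 * r\<close>.\<close>
 obtain cJ2 where cJ2: "1 <= cJ2" "!!r x y. r0 <= r ==> dist z0 x < r ==> 1.5 * r <= dist z0 y ==> en (j y x) <= en cJ2 * en (j y z0) & en (j y z0) <= en cJ2 * en (j y x)"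
  by (rule C2_j[of "1.5"]) (simp, simp, blast)
 \<comment> \<open>The ratio of the radii \<open>1.1 * r\<close> and \<open>1.05 * r\<close>; the
   latter makes the open ball in (C2) contain the closed ball of radius \<open>r\<close>.\<close>
 obtain c3 where c3: "1 <= c3" "!!r x y. r0 <= r ==> dist z0 x < r ==> 22 / 21 * r <= dist z0 y ==> en (j y x) <= en c3 * en (j y z0) & en (j y z0) <= en c3 * en (j y x)"
  by (rule C2_j[of "22 / 21"]) (simp, simp, blast)
 obtain cP where cP: "1 <= cP" "!!r. 0 < r ==> \<Phi> (2 * r) <= cP * \<Phi> r" by (rule Phi_doubling) blast
 \<comment> \<open>The two entries meet the two conditions on \<open>kk\<close>; the second uses
   \<open>\<Phi> r * d >= cB / cP\<close>, which follows from the doubling of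
   \<open>\<Phi>\<close>.\<close>
 define kk where "kk = max cD (cJ * c1 * cP / cB)"
 have kk0: "0 < kk" unfolding kk_def using cD(1) by simp
 show ?thesis
 proof (rule that[of "3 * kk * cB + cJ2 * c1"])
  show "0 < 3 * kk * cB + cJ2 * c1" using kk0 cB(1) cJ2(1) c1(1) by (intro add_pos_pos mult_pos_pos) auto
  fix r D x and w :: "'a => ennreal"
  assume r: "2 * r0 <= r" and D: "open D" "D <= - cl_ball z0 r" and w [measurable]: "w : BM"
   and harm: "!!x. x : D ==> HD 0 D w x = w x" and fw: "!!x. x : D ==> w x < iy" and w0: "!!x. x ~: D ==> r < dist z0 x ==> w x = 0"
   and x: "x : D" "2 * r < dist z0 x" "dist z0 x < 4 * r"
  have rp: "0 < r" "r0 <= r" using r r0 by auto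
  have Vp: "0 < V r" by (rule V_pos[OF rp(1)])
  have Pp: "0 < \<Phi> r" "0 < \<Phi> (1.2 * r)" using rp by (auto intro!: Phi_pos)
  define d where "d = cB / \<Phi> (1.2 * r)"
  have d0: "0 < d" unfolding d_def using cB Pp by simp
  have "\<Phi> r <= \<Phi> (1.2 * r)" using rp by (intro Phi_mono) auto
  hence Pd: "\<Phi> r * d <= cB" unfolding d_def using cB Pp by (simp add: field_simps)
  have "\<Phi> (1.2 * r) <= \<Phi> (2 * r)" using rp by (intro Phi_mono) auto
  hence "\<Phi> (1.2 * r) <= cP * \<Phi> r" using cP(2)[OF rp(1)] by linarith
  hence Pd2: "cB / cP <= \<Phi> r * d" unfolding d_def using cB Pp cP by (simp add: field_simps)
  have kkd: "cJ * c1 <= kk * \<Phi> r * d"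
  proof -
   have "cJ * c1 = (cJ * c1 * cP / cB) * (cB / cP)" using cB cP by simp
   also have "... <= kk * (\<Phi> r * d)" using Pd2 kk0 cB cP by (intro mult_mono) (auto simp: kk_def)
   finally show ?thesis by (simp add: mult.assoc)
  qed
  obtain f where f: "f : bump m \<D> (cl_ball z0 (1.2 * r)) (ball z0 (1.5 * (1.2 * r)))" "!!x. - gen C0 Y f x <= d"
   using cB(2)[of "1.2 * r"] rp unfolding d_def by auto
  have f': "f : bump m \<D> (cl_ball z0 (1.2 * r)) (ball z0 (1.8 * r))" using f(1) by simp
  let ?A = "{y. 1.1 * r < dist z0 y}"
  have Am [measurable]: "?A : sets borel" by (intro borel_open open_Collect_less continuous_intros)
  obtain tt where tt: "0 <= tt" "!!z. dist z0 z <= r ==> (?g z ?A) <= en tt"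
  proof -
   \<comment> \<open>A continuous function vanishing near \<open>z0\<close> and equal to 1 beyond
     \<open>1.05 * r\<close>. Its Levy integral at \<open>z0\<close> is finite, and (C2) transfers
     the finiteness to all \<open>z\<close> in the closed ball of radius \<open>r\<close>.\<close>
   define h where "h y = min 1 (max 0 (dist z0 y / r - 1 / 20))" for y
   have hc: "continuous_on UNIV h" unfolding h_def using rp by (intro continuous_intros) auto
   have hb: "0 <= h y" "h y <= 1" for y unfolding h_def by auto
   have [measurable]: "h : BM" using hc by (rule borel_measurable_continuous_onI)
   have hbd: "bounded (range h)" unfolding bounded_iff using hb by (intro exI[of _ 1]) auto
   have "closure {y. h y ~= 0} <= {y. r / 20 <= dist z0 y}"
    by (rule closure_minimal) (use rp in "auto simp: h_def field_simps max_def split: if_splits intro!: closed_Collect_le continuous_intros")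
   hence "z0 ~: closure {y. h y ~= 0}" using rp by auto
   note L = Y.levy_lim(2)[OF hc hbd this hb(1)]
   have "(?g z ?A) <= ?c c3 h" if z: "dist z0 z <= r" for z
   proof -
    have "(?g z ?A) <= (NI m (%y. en c3 * (en (jh z0 y) * en (h y))))"
    proof (rule nnmono)
     fix y
     show "en (j y z) * ix ?A y <= en c3 * (en (jh z0 y) * en (h y))"
     proof (cases "y : ?A")
      case True
      hence h1: "h y = 1" using rp unfolding h_def by (simp add: field_simps min_def max_def)
      have "y ~= z0" using True rp by auto
      moreover have "en (j y z) <= en c3 * en (j y z0)" using c3(2)[of "1.05 * r" z y] True z rp by auto
      ultimately show ?thesis using h1 by (simp add: jdual indicator_def)
     qed simp
    qed
    also have "... = ?c c3 h" unfolding Y.jop_def by (rule nncmult) measurable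
    finally show ?thesis .
   qed
   moreover have "?c c3 h < \<top>" using L by (simp add: ennreal_mult_less_top)
   then obtain t where "0 <= t" "?c c3 h = en t" by (cases "en c3 * Y.jop (%y. en (h y)) z0") auto
   ultimately show ?thesis using that by metis
  qed
  let ?D4 = "D Int ?A" and ?D5 = "D Int ball z0 (1.2 * r)"
  let ?I = "NI m (%z. w z * ix (cball z0 r) z)" and ?J = "NI m (%z. w z * ix (ball z0 (1.8 * r)) z)"
  let ?K = "en (kk * \<Phi> r / V r)"
  define e where "e n = 1 / rs n" for n
  have e: "0 < e n" "e n <= 1" for n unfolding e_def by auto
  have le: "w x <= ?K * (en (2 * d) * ?J) + (?K * (en (d + e n * tt) * ?I) + en (cJ2 * c1 / V r) * ?I)
   + HD 0 ?D4 (%y. HD (2 * d / e n) ?D5 w y * ix (D - ?D4) y) x" for n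
  proof -
   have "w x <= ?K * (en (2 * d) * ?J) + (?K * (en (d + e n * tt) * ?I) + en (cJ2 * c1 / V r) * ?I)
    + HD 0 ?D4 (%y. HD (al d (e n)) ?D5 w y * ix (D - ?D4) y) x"
   proof (rule harmonic_eps_bound[OF r D c1(1) c1(2)[OF r D] cD(2)[OF rp(2) D] cJ(1) _ f' d0 f(2) _ kkd e w harm fw w0 tt cJ2(1)])
    show "en (j y x) <= en cJ * en (j y z0)" if "dist z0 x < 1.8 * r" "1.9 * r <= dist z0 y" for x y
     using cJ(2)[of "1.8 * r" x y] that rp by auto
    show "en (j y x) <= en cJ2 * en (j y z0)" if "dist z0 x < 1.2 * r" "1.8 * r <= dist z0 y" for x y
     using cJ2(2)[of "1.2 * r" x y] that rp by auto
   qed (use x in "auto simp: kk_def")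
   moreover have "al d (e n) = 2 * d / e n" using al_def[OF r D c1(1) c1(2)[OF r D] cD(2)[OF rp(2) D] cJ(1) _ f' d0 f(2) _ kkd e] cJ(2)[of "1.8 * r"] rp by (auto simp: kk_def)
   ultimately show ?thesis by simp
  qed
  have D4: "open ?D4" "?D4 <= D" and D5: "open ?D5" "?D5 <= D"
   using D(1) by (auto intro!: open_Int open_Collect_less continuous_intros)
  have [measurable]: "D : sets borel" "?D4 : sets borel" using D D4 by auto
  have sub: "HD 0 D' w y = w y" if "open D'" "D' <= D" "y : D'" for D' y by (rule harm_sub[OF D(1) w harm fw that])
  have a0: "0 <= 2 * d / e n" for n using d0 e(1)[of n] by simp
  have H0: "(%n. HD 0 ?D4 (%y. HD (2 * d / e n) ?D5 w y * ix (D - ?D4) y) x) ----> HD 0 ?D4 (%_. 0) x"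
  proof (rule kop_lim[OF kop_HD[OF D4(1) order_refl] _ w])
   show "(%y. HD (2 * d / e n) ?D5 w y * ix (D - ?D4) y) : BM" for n
    using kopm[OF kop_HD[OF D5(1) a0] w] by measurable
   show "HD 0 ?D4 w x < iy" using sub[OF D4, of x] fw[OF x(1)] x rp by auto
   have s5: "HD 0 ?D5 w y = w y" if "y : ?D5" for y by (rule sub[OF D5 that])
   show "HD (2 * d / e n) ?D5 w y * ix (D - ?D4) y <= w y" for n y
   proof (cases "y : ?D5")
    case True
    have "HD (2 * d / e n) ?D5 w y <= HD 0 ?D5 w y" by (rule HD_mono_params[OF a0 order_refl])
    thus ?thesis using s5[OF True] by (auto split: splix)
   qed (simp add: HD_outside)
   show "(%n. HD (2 * d / e n) ?D5 w y * ix (D - ?D4) y) ----> 0" for y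
   proof (cases "y : D - ?D4")
    case True
    hence y: "y : ?D5" using rp by auto
    have "(%n. HD (2 * d / e n) ?D5 w y) ----> 0"
    proof (rule HD_large[OF D5(1) y w _ _ a0])
     show "HD 0 ?D5 w y < iy" using s5[OF y] fw[of y] y by auto
     show "filterlim (%n. 2 * d / e n) at_top sequentially" unfolding e_def using d0 by real_asymp
    qed
    thus ?thesis using True by simp
   qed simp
  qed simp
  show "w x <= en ((3 * kk * cB + cJ2 * c1) / V r) * ?J"
  proof (cases "?I < iy")
   case True
   have "(%n. ?K * (en (2 * d) * ?J) + (?K * (?I * en (d + e n * tt)) + en (cJ2 * c1 / V r) * ?I)
    + HD 0 ?D4 (%y. HD (2 * d / e n) ?D5 w y * ix (D - ?D4) y) x) ----> ?K * (en (2 * d) * ?J) + (?K * (?I * en d) + en (cJ2 * c1 / V r) * ?I) + HD 0 ?D4 (%_. 0) x"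
   proof (intro tendsto_add tendsto_const H0 ennreal_tendsto_cmult tendsto_ennrealI)
    show "(%n. d + e n * tt) ----> d" unfolding e_def by real_asymp
   qed (use True in auto)
   hence "w x <= ?K * (en (2 * d) * ?J) + (?K * (?I * en d) + en (cJ2 * c1 / V r) * ?I) + HD 0 ?D4 (%_. 0) x"
    by (rule LIMSEQ_le_const) (use le in \<open>auto simp: mult.commute[of _ "?I"]\<close>)
   also have "... = ?K * (en (2 * d) * ?J) + (?K * (?I * en d) + en (cJ2 * c1 / V r) * ?I)"
    unfolding kop_zero[OF kop_HD[OF D4(1) order_refl]] add_0_right ..
   also have "?I <= ?J" using rp by (intro nnmono mulL) (auto split: splix)
   hence "?K * (en (2 * d) * ?J) + (?K * (?I * en d) + en (cJ2 * c1 / V r) * ?I) <=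
    ?K * (en (2 * d) * ?J) + (?K * (?J * en d) + en (cJ2 * c1 / V r) * ?J)"
    by (intro add_mono mulL mulR) simp_all
   also have "... = (?K * en (2 * d) + (?K * en d + en (cJ2 * c1 / V r))) * ?J"
    by (simp only: distrib_right mult.assoc mult.commute[of ?J])
   also have "?K * en (2 * d) + (?K * en d + en (cJ2 * c1 / V r)) = en (?b kk r d cJ2 c1)"
    using kk0 Pp Vp d0 cJ2(1) c1(1) by (simp add: ennreal_mult'[symmetric] ennreal_mult''[symmetric] flip: ennreal_plus)
   also have "... <= en ((3 * kk * cB + cJ2 * c1) / V r)"
   proof (rule ennreal_leI)
    have "kk * (\<Phi> r * d) <= kk * cB" using Pd kk0 by (intro mulL) auto
    hence "3 * (kk * (\<Phi> r * d)) + cJ2 * c1 <= 3 * kk * cB + cJ2 * c1" by simp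
    hence "(3 * (kk * (\<Phi> r * d)) + cJ2 * c1) / V r <= (3 * kk * cB + cJ2 * c1) / V r" using Vp by (intro divide_right_mono) auto
    moreover have "?b kk r d cJ2 c1 = (3 * (kk * (\<Phi> r * d)) + cJ2 * c1) / V r"
     using Vp by (simp add: field_simps)
    ultimately show "?b kk r d cJ2 c1 <= (3 * kk * cB + cJ2 * c1) / V r" by simp
   qed
   finally show ?thesis by (simp add: mulR)
  next
   \<comment> \<open>The limit was taken with \<open>?I\<close> finite; if \<open>?I\<close> is
     infinite, so is the right-hand side of the claim.\<close>
   case False
   have "?I <= ?J" using rp by (intro nnmono mulL) (auto split: splix)
   hence "?J = iy" using False by (simp add: top_unique less_top[symmetric])
   have "0 < (3 * kk * cB + cJ2 * c1) / V r" using kk0 cB(1) cJ2(1) c1(1) Vp by (intro divide_pos_pos add_pos_pos mult_pos_pos) auto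
   hence "en ((3 * kk * cB + cJ2 * c1) / V r) * iy = iy" by (simp only: infinity_ennreal_def ennreal_mult_top ennreal_eq_0_iff not_le[symmetric] if_False)
   thus ?thesis unfolding `?J = iy` by simp
  qed
 qed
qed

text \<open>A finite measure on the line has at most countably many atoms. Neither the closure of
  the ball nor that of the annulus need contain every point of the sphere, so a null sphere is
  chosen for the bump function of \<open>exit_bound\<close>.\<close>

lemma null_sphere:
 assumes r: "0 < r" obtains R where "3 * r < R" "R < 4 * r" "emeasure m {y. dist z0 y = R} = 0"
proof -
 let ?N = "distr (density m (ix (ball z0 (4 * r)))) borel (dist z0)"
 have [measurable]: "ball z0 (4 * r) : sets borel" "dist z0 : BM"
  by (simp, intro borel_measurable_continuous_onI continuous_intros)
 have e: "emeasure ?N {R} = emeasure m {y. dist z0 y = R}" if "R < 4 * r" for R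
 proof -
  have s: "{y. dist z0 y = R} \<in> sets borel" by (intro borel_closed closed_Collect_eq continuous_intros)
  have "emeasure ?N {R} = emeasure (density m (ix (ball z0 (4 * r)))) {y. dist z0 y = R}"
   by (subst emeasure_distr) (auto simp: d.space_m vimage_def)
  also have "... = (NI m (%y. ix (ball z0 (4 * r)) y * ix {y. dist z0 y = R} y))"
   using s by (subst emeasure_density) auto
  also have "... = (NI m (%y. ix {y. dist z0 y = R} y))" using that by (intro nncong) (auto split: splix)
  finally show ?thesis using s by simp
 qed
 have "emeasure ?N UNIV = en (V (4 * r))"
  by (subst emeasure_distr) (auto simp: emeasure_density d.space_m V_ball)
 hence "finite_measure ?N" by (intro finite_measureI) simp
 then interpret N: finite_measure ?N .
 have "\<not> {3 * r<..<4 * r} <= {R. measure ?N {R} ~= 0}"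
  using N.countable_support uncountable_open_interval[of "3 * r" "4 * r"] r countable_subset by auto
 then obtain R where "3 * r < R" "R < 4 * r" "measure ?N {R} = 0" by auto
 thus thesis using that e[of R] by (simp add: N.emeasure_eq_measure)
qed

text \<open>A bump function dominating the indicator of the ball vanishes at \<open>x\<close>, so
  Dynkin's formula bounds the exit probability by the potential of its generator. Off the sphere of
  radius \<open>R\<close> the generator is at most a multiple of \<open>V r * j y z0\<close>: inside
  by the maximum principle, in the annulus by (B2-b), beyond \<open>3 * R\<close> by the Levy kernel
  and (C2).\<close>

lemma exit_bound:
 obtains C where "0 < C" "!!r D x. 2 * r0 <= r ==> open D ==> D <= {y. 3 * r < dist z0 y} ==> x : D ==> 8 * r <= dist z0 x ==>
  HD 0 D (ix (cball z0 (3 * r))) x <= en (C * V r) * RD 0 D (%y. en (j y z0)) x"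
proof -
 obtain cb where cb: "0 < cb" "!!r f x. r0 <= r ==> f : bump m \<D> (cl_ball z0 r) (ball z0 (2 * r)) ==> r < dist z0 x ==> dist z0 x < 3 * r ==> gen C0 X f x <= cb * V r * j x z0"
  by (rule B2b_gen) blast
 obtain cj where cj: "1 <= cj" "!!r x y. r0 <= r ==> dist z0 x < r ==> 1.5 * r <= dist z0 y ==> en (j y x) <= en cj * en (j y z0) & en (j y z0) <= en cj * en (j y x)"
  by (rule C2_j[of "1.5"]) (simp, simp, blast)
 obtain cv where cv: "1 <= cv" "!!r. 0 < r ==> V (2 * r) <= cv * V r" by (rule doubling) blast
 \<comment> \<open>The powers of \<open>cv\<close> come from \<open>V (4 * r)\<close> in the annulus
   and \<open>V (8 * r)\<close> for far points, as \<open>R < 4 * r\<close>.\<close>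
 define C where "C = cb * cv\<^sup>2 + cj * cv ^ 3"
 show ?thesis
 proof (rule that[of C])
  show "0 < C" unfolding C_def using cb cj cv by (intro add_pos_pos mult_pos_pos zero_less_power) auto
  fix r D x
  assume r: "2 * r0 <= r" and D: "open D" "D <= {y. 3 * r < dist z0 y}" and x: "x : D" "8 * r <= dist z0 x"
  have rp: "0 < r" using r r0 by simp
  have Vp: "0 < V r" by (rule V_pos[OF rp])
  have V4: "V (4 * r) <= cv\<^sup>2 * V r" and V8: "V (8 * r) <= cv ^ 3 * V r"
  proof -
   have 2: "cv * V (2 * r) <= cv * (cv * V r)" using cv rp by (intro mulL) auto
   thus 4: "V (4 * r) <= cv\<^sup>2 * V r" using cv(2)[of "2 * r"] rp by (simp add: power2_eq_square mult.assoc)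
   have "cv * V (4 * r) <= cv * (cv\<^sup>2 * V r)" using 4 cv by (intro mulL) auto
   thus "V (8 * r) <= cv ^ 3 * V r" using cv(2)[of "4 * r"] rp by (simp add: power2_eq_square power3_eq_cube mult.assoc)
  qed
  obtain R where R: "3 * r < R" "R < 4 * r" "emeasure m {y. dist z0 y = R} = 0" using null_sphere[OF rp] by blast
  have Rp: "0 < R" "r0 <= R" using R rp r r0 by auto
  have "compact (cl_ball z0 R)" unfolding cl_ball_def by (simp add: compact_eq_bounded_closed bounded_closure)
  moreover have "cl_ball z0 R <= ball z0 (2 * R)" using ball_cl_ball(2)[of z0 R] Rp by auto
  ultimately obtain f where f: "f : bump m \<D> (cl_ball z0 R) (ball z0 (2 * R))" using bump_ex[of "cl_ball z0 R" "ball z0 (2 * R)"] by auto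
  note [measurable] = bump_measurable[OF f]
  let ?A = "%y. en (gen C0 X f y)"
  have gb: "?A y <= en (C * V r) * en (j y z0)" if y: "y : D" "dist z0 y ~= R" for y
  proof -
   have yz: "y ~= z0" using y D rp by auto
   hence jp: "0 < j y z0" by (rule j_pos)
   consider "dist z0 y < R" | "R < dist z0 y" "dist z0 y < 3 * R" | "3 * R <= dist z0 y" using y by linarith
   thus ?thesis
   proof cases
    case 1
    hence "f y = 1" using ball_cl_ball(1)[of z0 R] by (intro bumpD(2)[OF f]) auto
    thus ?thesis using gen_max[OF f] by (simp add: ennreal_neg)
   next
    case 2
    have "cb * V R <= cb * (cv\<^sup>2 * V r)" using V_mono[of R "4 * r"] V4 R cb by (intro mulL) auto
    also have "... <= C * V r" unfolding C_def using cj cv Vp by (simp add: distrib_right)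
    finally have "cb * V R * j y z0 <= C * V r * j y z0" using jp by (intro mulR) auto
    hence "?A y <= en (C * V r * j y z0)" using cb(2)[OF Rp(2) f 2] by (intro ennreal_leI) simp
    thus ?thesis using jp by (simp add: ennreal_mult'')
   next
    case 3
    have "closure (ball z0 (2 * R)) <= cball z0 (2 * R)" by (rule closure_minimal) auto
    hence "y ~: closure (ball z0 (2 * R))" using 3 Rp by auto
    hence "?A y = jop (%z. en (f z)) y" by (rule gen_far(1)[OF f])
    also have "... <= (NI m (%z. en cj * en (j y z0) * ix (ball z0 (2 * R)) z))"
     unfolding jop_def
    proof (rule nnmono)
     fix z
     show "en (j y z) * en (f z) <= en cj * en (j y z0) * ix (ball z0 (2 * R)) z"
     proof (cases "z : ball z0 (2 * R)")
      case True
      have "en (j y z) * en (f z) <= (en cj * en (j y z0)) * 1"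
       using cj(2)[of "2 * R" z y] True 3 Rp bumpD(5)[OF f, of z] by (intro mult_mono) (auto simp: ennreal_le_1)
      thus ?thesis using True by simp
     qed (simp add: bumpD(3)[OF f])
    qed
    also have "... = en cj * en (j y z0) * en (V (2 * R))" unfolding V_ball[symmetric] by (rule nn_integral_cmult_indicator) (simp add: sets_m)
    also have "... = en (cj * j y z0 * V (2 * R))" using cj jp V_pos[of "2 * R"] Rp by (simp add: ennreal_mult'[symmetric] ennreal_mult''[symmetric])
    also have "... <= en (C * V r * j y z0)"
    proof (rule ennreal_leI)
     have "cj * V (2 * R) <= cj * (cv ^ 3 * V r)" using V_mono[of "2 * R" "8 * r"] V8 R cj by (intro mulL) auto
     also have "... <= C * V r" unfolding C_def using cb cv Vp by (simp add: distrib_right)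
     finally have "cj * V (2 * R) * j y z0 <= C * V r * j y z0" using jp by (intro mulR) auto
     thus "cj * j y z0 * V (2 * R) <= C * V r * j y z0" by (simp add: mult.assoc mult.commute[of "j y z0"])
    qed
    finally show ?thesis using jp by (simp add: ennreal_mult'')
   qed
  qed
  have fx: "f x = 0" using x R by (intro bumpD(3)[OF f]) auto
  have "HD 0 D (ix (cball z0 (3 * r))) x <= HD 0 D (%y. en (f y)) x"
  proof (rule HD_mono_params[OF order_refl])
   fix y
   show "ix (cball z0 (3 * r)) y <= en (f y)"
   proof (cases "y : cball z0 (3 * r)")
    case True
    hence "f y = 1" using R(1) ball_cl_ball(1)[of z0 R] by (intro bumpD(2)[OF f]) auto
    thus ?thesis using True by simp
   qed simp
  qed
  also have "... = (SUP n. HD (0 + 1 / rs n) D (%y. en (f y)) x)" by (rule HD_SUP_params[OF D(1)]) auto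
  also have "... <= RD 0 D ?A x"
  proof (rule SUP_least)
   fix n
   let ?a = "0 + 1 / rs n"
   have "HD ?a D (%y. en (f y)) x <= RD ?a D (%y. en ?a * en (f y) + en (- gen C0 X f y)) x + HD ?a D (%y. en (f y)) x" by (simp add: add_increasing)
   also have "... = RD ?a D ?A x" using dynkin_bump[OF f D(1) x(1), of ?a] fx by simp
   also have "... <= RD 0 D ?A x" by (rule RD_mono_params) auto
   finally show "HD ?a D (%y. en (f y)) x <= RD 0 D ?A x" .
  qed
  also have "... <= RD 0 D (%y. en (C * V r) * en (j y z0)) x"
  proof (rule d.RD_mono_AE[OF D(1) order_refl])
   have "{y. dist z0 y = R} \<in> null_sets m" using R(3) by (intro null_setsI) (auto simp: sets_m intro!: borel_closed closed_Collect_eq continuous_intros)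
   hence "AE y in m. y ~: {y. dist z0 y = R}" by (rule AE_not_in)
   thus "AE y in m. y : D --> ?A y <= en (C * V r) * en (j y z0)" by eventually_elim (use gb in auto)
  qed measurable
  also have "... = en (C * V r) * RD 0 D (%y. en (j y z0)) x" by (rule kop_cmult[OF kop_RD[OF D(1) order_refl]]) measurable
  finally show "HD 0 D (ix (cball z0 (3 * r))) x <= en (C * V r) * RD 0 D (%y. en (j y z0)) x" .
 qed
qed

text \<open>Landing in the ball of radius \<open>2.5 * r\<close> gives both inequalities, since it
  can occur only by a jump. The other landing points with \<open>w\<close> nonzero lie in the shell,
  where \<open>w\<close> is at most its integral over the ball divided by \<open>V r\<close>; the
  factor \<open>V r\<close> in \<open>exit_bound\<close> cancels this denominator.\<close>

lemma harmonic_factorization: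
 obtains C where "1 <= C" "!!r D w x. 2 * r0 <= r ==> open D ==> D <= - cl_ball z0 r ==> w : BM ==>
  (!!x. x : D ==> HD 0 D w x = w x) ==> (!!x. x : D ==> w x < iy) ==> (!!x. x ~: D ==> r < dist z0 x ==> w x = 0) ==>
  x : D ==> 8 * r <= dist z0 x ==>
  w x <= en C * ((NI m (%z. w z * ix (ball z0 (2.5 * r)) z)) * RD 0 (D Int {y. 3 * r < dist z0 y}) (%y. en (j y z0)) x) &
  (NI m (%z. w z * ix (ball z0 (2.5 * r)) z)) * RD 0 (D Int {y. 3 * r < dist z0 y}) (%y. en (j y z0)) x <= en C * w x"
proof -
 let ?b = "%y z w K3. en (j y z) * (w z * ix K3 z)"
 obtain c4 where c4: "0 < c4" "!!r D w x. 2 * r0 <= r ==> open D ==> D <= - cl_ball z0 r ==> w : BM ==>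
  (!!x. x : D ==> HD 0 D w x = w x) ==> (!!x. x : D ==> w x < iy) ==> (!!x. x ~: D ==> r < dist z0 x ==> w x = 0) ==>
  x : D ==> 2 * r < dist z0 x ==> dist z0 x < 4 * r ==> w x <= en (c4 / V r) * (NI m (%z. w z * ix (ball z0 (1.8 * r)) z))"
  by (rule harmonic_sup_bound) blast
 obtain c5 where c5: "0 < c5" "!!r D x. 2 * r0 <= r ==> open D ==> D <= {y. 3 * r < dist z0 y} ==> x : D ==> 8 * r <= dist z0 x ==>
  HD 0 D (ix (cball z0 (3 * r))) x <= en (c5 * V r) * RD 0 D (%y. en (j y z0)) x"
  by (rule exit_bound) blast
 \<comment> \<open>The ratio of the radii \<open>3 * r\<close> and \<open>2.5 * r\<close>.\<close>
 obtain cj where cj: "1 <= cj" "!!r x y. r0 <= r ==> dist z0 x < r ==> 1.2 * r <= dist z0 y ==> en (j y x) <= en cj * en (j y z0) & en (j y z0) <= en cj * en (j y x)"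
  by (rule C2_j[of "1.2"]) (simp, simp, blast)
 show ?thesis
 proof (rule that[of "cj + c4 * c5"])
  show "1 <= cj + c4 * c5" using cj(1) c4(1) c5(1) by (simp add: add_increasing2)
  fix r D x and w :: "'a => ennreal"
  assume r: "2 * r0 <= r" and D: "open D" "D <= - cl_ball z0 r" and w [measurable]: "w : BM"
   and harm: "!!x. x : D ==> HD 0 D w x = w x" and fw: "!!x. x : D ==> w x < iy" and w0: "!!x. x ~: D ==> r < dist z0 x ==> w x = 0"
   and x: "x : D" "8 * r <= dist z0 x"
  have rp: "0 < r" using r r0 by simp
  have Vp: "0 < V r" by (rule V_pos[OF rp])
  let ?D' = "D Int {y. 3 * r < dist z0 y}" and ?B = "ball z0 (2.5 * r)"
  have D': "open ?D'" "?D' <= D" using D(1) by (auto intro!: open_Int open_Collect_less continuous_intros)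
  have x': "x : ?D'" using x rp by auto
  define I where "I = (NI m (%z. w z * ix ?B z))"
  define rh where "rh = RD 0 ?D' (%y. en (j y z0)) x"
  have [measurable]: "?B : sets borel" "cball z0 (3 * r) : sets borel" by (auto intro: borel_open borel_closed)
  have wBm: "(%z. w z * ix ?B z) : BM" by measurable
  define p where "p = HD 0 ?D' (%z. w z * ix ?B z) x"
  have wx: "HD 0 ?D' w x = w x" by (rule harm_sub[OF D(1) w harm fw D' x'])
  have pR: "p = RD 0 ?D' (jop (%z. w z * ix ?B z)) x"
   unfolding p_def
  proof (rule ikeda_watanabe[OF D'(1) order_refl wBm])
   fix y assume "y : closure ?D'"
   moreover have "closure ?D' <= {y. 3 * r <= dist z0 y}" by (rule closure_minimal) (auto intro!: closed_Collect_le continuous_intros)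
   ultimately show "w y * ix ?B y = 0" using rp by auto
  qed
  note k = kop_RD[OF D'(1) order_refl]
  have cjI: "(NI m (%z. c * (w z * ix ?B z))) = c * I" for c unfolding I_def by (rule nncmult) measurable
  have jj: "?b y z w ?B <= (en cj * en (j y z0)) * (w z * ix ?B z)"
   "en (j y z0) * (w z * ix ?B z) <= en cj * (?b y z w ?B)" if "y : ?D'" for y z
  proof -
   have "en (j y z) <= en cj * en (j y z0)" "en (j y z0) <= en cj * en (j y z)" if "z : ?B"
    using cj(2)[of "2.5 * r" z y] that `y : ?D'` r r0 by auto
   thus "?b y z w ?B <= (en cj * en (j y z0)) * (w z * ix ?B z)"
    "en (j y z0) * (w z * ix ?B z) <= en cj * (?b y z w ?B)"
    by (cases "z : ?B"; simp add: mulR mult.assoc[symmetric])+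
  qed
  have "p <= RD 0 ?D' (%y. en cj * I * en (j y z0)) x"
   unfolding pR
  proof (rule RD_mono_on[OF D'(1)])
   fix y assume y: "y : ?D'"
   have "jop (%z. w z * ix ?B z) y <= en cj * en (j y z0) * I"
    unfolding jop_def cjI[symmetric] by (rule nnmono) (rule jj(1)[OF y])
   thus "jop (%z. w z * ix ?B z) y <= en cj * I * en (j y z0)" by (simp only: mult.assoc mult.commute[of I])
  qed
  also have "... = en cj * I * rh" unfolding rh_def by (rule kop_cmult[OF k]) measurable
  finally have p_up: "p <= en cj * (I * rh)" by (simp only: mult.assoc)
  have "I * rh = RD 0 ?D' (%y. I * en (j y z0)) x" unfolding rh_def by (rule kop_cmult[OF k, symmetric]) measurable
  also have "... <= RD 0 ?D' (%y. en cj * jop (%z. w z * ix ?B z) y) x"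
  proof (rule RD_mono_on[OF D'(1)])
   fix y assume y: "y : ?D'"
   have "I * en (j y z0) = (NI m (%z. en (j y z0) * (w z * ix ?B z)))" unfolding cjI by (simp only: mult.commute)
   also have "... <= (NI m (%z. en cj * (?b y z w ?B)))" by (rule nnmono) (rule jj(2)[OF y])
   also have "... = en cj * jop (%z. w z * ix ?B z) y" unfolding jop_def by (rule nncmult) measurable
   finally show "I * en (j y z0) <= en cj * jop (%z. w z * ix ?B z) y" .
  qed
  also have "... = en cj * p" unfolding pR by (rule kop_cmult[OF k kopm[OF kop_jop wBm]])
  also have "p <= w x" unfolding p_def wx[symmetric] by (rule HD_mono_params) (auto split: splix)
  finally have low: "I * rh <= en cj * w x" by (simp add: mulL)
  let ?K = "en (c4 / V r) * I"
  have "w x <= HD 0 ?D' (%z. w z * ix ?B z + ?K * ix (cball z0 (3 * r)) z) x"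
   unfolding wx[symmetric]
  proof (rule HD_mono_off[OF D'(1)])
   fix y assume y: "y ~: ?D'"
   show "w y <= w y * ix ?B y + ?K * ix (cball z0 (3 * r)) y"
   proof (cases "y : ?B")
    case False
    show ?thesis
    proof (cases "y : D")
     case True
     hence d: "dist z0 y <= 3 * r" "2 * r < dist z0 y" "dist z0 y < 4 * r" using y False rp by auto
     have "w y <= en (c4 / V r) * (NI m (%z. w z * ix (ball z0 (1.8 * r)) z))"
      by (rule c4(2)[OF r D w harm fw w0 True d(2,3)])
     also have "... <= ?K" unfolding I_def using rp by (intro mulL nnmono) (auto split: splix)
     finally show ?thesis using d by (simp add: add_increasing)
    next
     case nD: False
     thus ?thesis using w0[OF nD] False rp by auto
    qed
   qed (simp add: add_increasing2)
  qed
  also have "... = p + ?K * HD 0 ?D' (ix (cball z0 (3 * r))) x"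
   unfolding p_def by (subst kop_add[OF kop_HD[OF D'(1) order_refl]]) (measurable, simp add: kop_cmult[OF kop_HD[OF D'(1) order_refl]])
  also have "HD 0 ?D' (ix (cball z0 (3 * r))) x <= en (c5 * V r) * rh"
   unfolding rh_def by (rule c5(2)[OF r D'(1) _ x' x(2)]) auto
  finally have "w x <= p + ?K * (en (c5 * V r) * rh)" by (simp add: add_left_mono mulL)
  also have "?K * (en (c5 * V r) * rh) = en (c4 * c5) * (I * rh)"
  proof -
   have "en (c4 / V r) * en (c5 * V r) = en (c4 * c5)" using Vp c4(1) c5(1) by (simp add: ennreal_mult'[symmetric])
   thus ?thesis by (metis mult.assoc mult.left_commute)
  qed
  also have "p + en (c4 * c5) * (I * rh) <= en cj * (I * rh) + en (c4 * c5) * (I * rh)" by (rule add_right_mono[OF p_up])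
  also have "... = en (cj + c4 * c5) * (I * rh)" using cj(1) c4(1) c5(1) by (simp add: distrib_right[symmetric] flip: ennreal_plus)
  finally have up: "w x <= en (cj + c4 * c5) * (I * rh)" .
  have "en cj * w x <= en (cj + c4 * c5) * w x" using c4(1) c5(1) by (intro mulR ennreal_leI) auto
  with low have "I * rh <= en (cj + c4 * c5) * w x" by (rule order_trans)
  with up show "w x <= en (cj + c4 * c5) * ((NI m (%z. w z * ix ?B z)) * RD 0 ?D' (%y. en (j y z0)) x) &
   (NI m (%z. w z * ix ?B z)) * RD 0 ?D' (%y. en (j y z0)) x <= en (cj + c4 * c5) * w x" unfolding I_def rh_def by blast
 qed
qed

text \<open>At irregular boundary points \<open>u\<close> may be nonzero, whereas \<open>w\<close>
  is 0 there. These points form a polar set, so the modification does not change the value at the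
  exit, and \<open>w\<close> satisfies the vanishing condition of the estimates at every point off
  \<open>D\<close> beyond radius \<open>r\<close>.\<close>

lemma regular_harmonic_HD:
 assumes D: "open D" "D <= - cl_ball z0 r" and u: "u : BM" "!!x. 0 <= u x" and harm: "regular_harmonic X D u"
  and zero: "!!x. x \<in> - cl_ball z0 r Int (- closure D Un regular_points X D) ==> u x = 0" and x: "x : D"
 defines "w \<equiv> %y. if y : D Un cl_ball z0 r then en (u y) else 0"
 shows "HD 0 D w x = w x"
proof -
 obtain E where E: "frontier D - regular_points X D <= E" "!!x. AE ww in P x. hitting_time X (Some ` E) ww = iy"
  by (rule irregular_polar[OF D(1) sf(1) pol]) blast+
 have "HD 0 D w x <= HD 0 D (%y. en (u y)) x" by (rule HD_mono_params) (auto simp: w_def)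
 moreover have "HD 0 D (%y. en (u y)) x <= HD 0 D w x"
 proof (rule HD_polar[OF D(1) E(2)])
  fix y assume y: "y ~: D" "y ~: E"
  show "en (u y) <= w y"
  proof (cases "y : cl_ball z0 r")
   case False
   have "y \<in> - closure D Un regular_points X D"
   proof (cases "y : closure D")
    case True
    hence "y : frontier D" using y D(1) by (simp add: frontier_def interior_open)
    thus ?thesis using E(1) y by auto
   qed simp
   thus ?thesis using zero[of y] False by simp
  qed (simp add: w_def)
 qed
 moreover have "HD 0 D (%y. en (u y)) x = en (u x)"
  using harm x unfolding regular_harmonic_def HD_def fin_def by (simp add: ext0_ennreal)
 ultimately show ?thesis using x by (simp add: w_def)
qed

text \<open>The common factor \<open>rh\<close> cancels in a cross product of four factorization
  inequalities, which gives \<open>C ^ 4\<close>; adding 1 makes the constant strictly greater than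
  1. The lower bound is the upper one with the points exchanged.\<close>

theorem boundary_harnack:
 "\<exists>C2>1. \<forall>r\<ge>2 * r0. \<forall>D u v.
  open D & D <= - cl_ball z0 r & u : BM & v : BM &
  (\<forall>x. 0 <= u x) & (\<forall>x. 0 <= v x) & regular_harmonic X D u & regular_harmonic X D v &
  (\<forall>x\<in>- cl_ball z0 r Int (- closure D Un regular_points X D). u x = 0 & v x = 0) -->
  (\<forall>x\<in>D Int - cl_ball z0 (8 * r). \<forall>y\<in>D Int - cl_ball z0 (8 * r).
    inverse C2 * (u y / v y) <= u x / v x & u x / v x <= C2 * (u y / v y))"
proof -
 let ?b = "%K0 u r. NI m (%z. K0 u z * ix (ball z0 (2.5 * r)) z)"
 obtain C where C: "1 <= C" and fac: "!!r D w x. 2 * r0 <= r ==> open D ==> D <= - cl_ball z0 r ==> w : BM ==>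
  (!!x. x : D ==> HD 0 D w x = w x) ==> (!!x. x : D ==> w x < iy) ==> (!!x. x ~: D ==> r < dist z0 x ==> w x = 0) ==>
  x : D ==> 8 * r <= dist z0 x ==>
  w x <= en C * ((NI m (%z. w z * ix (ball z0 (2.5 * r)) z)) * RD 0 (D Int {y. 3 * r < dist z0 y}) (%y. en (j y z0)) x) &
  (NI m (%z. w z * ix (ball z0 (2.5 * r)) z)) * RD 0 (D Int {y. 3 * r < dist z0 y}) (%y. en (j y z0)) x <= en C * w x"
  by (rule harmonic_factorization) blast
 have main: "u x / v x <= (C ^ 4 + 1) * (u y / v y)"
  if r: "2 * r0 <= r" and D: "open D" "D <= - cl_ball z0 r" and u: "u : BM" "!!x. 0 <= u x" and v: "v : BM" "!!x. 0 <= v x"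
   and harm: "regular_harmonic X D u" "regular_harmonic X D v"
   and zero: "!!x. x \<in> - cl_ball z0 r Int (- closure D Un regular_points X D) ==> u x = 0" "!!x. x \<in> - cl_ball z0 r Int (- closure D Un regular_points X D) ==> v x = 0"
   and x: "x : D" "x ~: cl_ball z0 (8 * r)" and y: "y : D" "y ~: cl_ball z0 (8 * r)" for r D u v x y
 proof -
  have rp: "0 < r" using r r0 by simp
  let ?ext = "%u y. if y : D Un cl_ball z0 r then en (u y) else 0"
  define rh where "rh = RD 0 (D Int {y. 3 * r < dist z0 y}) (%y. en (j y z0))"
  have cl [measurable]: "D Un cl_ball z0 r : sets borel" unfolding cl_ball_def using D(1) by auto
  have "\<exists>I. \<forall>x\<in>D - cl_ball z0 (8 * r). en (u x) <= en C * (I * rh x) & I * rh x <= en C * en (u x)"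
   if u [measurable]: "u : BM" and u0: "!!x. 0 <= u x" and h: "regular_harmonic X D u"
    and z: "!!x. x \<in> - cl_ball z0 r Int (- closure D Un regular_points X D) ==> u x = 0" for u
  proof (intro exI ballI)
   fix x assume x: "x : D - cl_ball z0 (8 * r)"
   have wm: "?ext u : BM" by measurable
   have "8 * r <= dist z0 x" using x ball_cl_ball(1)[of z0 "8 * r"] by (force simp: not_less[symmetric])
   moreover have "x : D" using x by simp
   moreover have "?ext u y = 0" if "y ~: D" "r < dist z0 y" for y using that ball_cl_ball(2)[of z0 r] by auto
   moreover have "HD 0 D (?ext u) y = ?ext u y" if "y : D" for y by (rule regular_harmonic_HD[OF D u u0 h z that])
   ultimately have "?ext u x <= en C * ((?b ?ext u r) * rh x) &
    (?b ?ext u r) * rh x <= en C * ?ext u x"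
    unfolding rh_def by (intro fac[OF r D wm]) auto
   thus "en (u x) <= en C * ((?b ?ext u r) * rh x) &
    (?b ?ext u r) * rh x <= en C * en (u x)" using x by simp
  qed
  from this[OF u harm(1) zero(1)] this[OF v harm(2) zero(2)] obtain I J where
   I: "!!x. x : D ==> x ~: cl_ball z0 (8 * r) ==> en (u x) <= en C * (I * rh x) & I * rh x <= en C * en (u x)" and
   J: "!!x. x : D ==> x ~: cl_ball z0 (8 * r) ==> en (v x) <= en C * (J * rh x) & J * rh x <= en C * en (v x)"
   by (metis DiffI)
  \<comment> \<open>\<open>rh\<close> is strictly positive far away, so a single zero of
    \<open>v\<close> there forces its factor \<open>J\<close> to vanish, and with it
    \<open>v\<close> at all such points. Both quotients are then 0 by the convention for division by
    zero.\<close>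
  have zero_iff: "v y = 0" if "v x = 0" "x : D" "x ~: cl_ball z0 (8 * r)" "y : D" "y ~: cl_ball z0 (8 * r)" for x y
  proof -
   have "8 * r <= dist z0 x" using that ball_cl_ball(1)[of z0 "8 * r"] by (force simp: not_less[symmetric])
   hence "0 < rh x" unfolding rh_def using that(2) rp D(1)
    by (intro RD_positive) (auto intro!: open_Int open_Collect_less continuous_intros j_pos)
   moreover have "J * rh x = 0" using J[OF that(2,3)] that(1) by simp
   ultimately have "J = 0" by auto
   thus ?thesis using J[OF that(4,5)] v(2)[of y] by (simp add: ennreal_le_iff2)
  qed
  show ?thesis
  proof (cases "v x = 0")
   case True
   thus ?thesis using u(2)[of y] v(2)[of y] C by simp
  next
   case vx: False
   hence vy: "v y ~= 0" using zero_iff[OF _ y x] by blast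
   hence pos: "0 < v x" "0 < v y" using vx v(2)[of x] v(2)[of y] by linarith+
   have "en (u x * v y) = en (u x) * en (v y)" using v(2) by (simp add: ennreal_mult'')
   also have "... <= (en C * (I * rh x)) * (en C * (J * rh y))" by (intro mult_mono[OF conjunct1[OF I[OF x]] conjunct1[OF J[OF y]]]) simp_all
   also have "... = (en C * en C) * ((I * rh y) * (J * rh x))" by (simp only: ac_simps)
   also have "... <= (en C * en C) * ((en C * en (u y)) * (en C * en (v x)))"
    by (intro mulL mult_mono[OF conjunct2[OF I[OF y]] conjunct2[OF J[OF x]]]) simp_all
   also have "... = en (C ^ 4 * (u y * v x))"
    using C u(2) v(2) by (simp add: ennreal_mult'[symmetric] ennreal_mult''[symmetric] power4_eq_xxxx ac_simps)
   finally have "u x * v y <= C ^ 4 * (u y * v x)" using C u(2) v(2) by (subst (asm) ennreal_le_iff) auto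
   also have "... <= (C ^ 4 + 1) * (u y * v x)" using u(2)[of y] v(2)[of x] by (intro mulR) auto
   finally show ?thesis using pos by (simp add: field_simps)
  qed
 qed
 show ?thesis
 proof (intro exI[of _ "C ^ 4 + 1"] conjI allI impI ballI)
  show "1 < C ^ 4 + 1" using C by simp
  fix r D u v x y
  assume r: "2 * r0 <= r" and a: "open D & D <= - cl_ball z0 r & u : BM & v : BM &
   (\<forall>x. 0 <= u x) & (\<forall>x. 0 <= v x) & regular_harmonic X D u & regular_harmonic X D v &
   (\<forall>x\<in>- cl_ball z0 r Int (- closure D Un regular_points X D). u x = 0 & v x = 0)"
   and x: "x : D Int - cl_ball z0 (8 * r)" and y: "y : D Int - cl_ball z0 (8 * r)"
  have m: "u x / v x <= (C ^ 4 + 1) * (u y / v y)" if "x : D Int - cl_ball z0 (8 * r)" "y : D Int - cl_ball z0 (8 * r)" for x y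
   by (rule main[OF r]) (use a that in auto)
  show "u x / v x <= (C ^ 4 + 1) * (u y / v y)" by (rule m[OF x y])
  have "0 < C ^ 4 + 1" using C by (simp add: add_pos_pos)
  thus "inverse (C ^ 4 + 1) * (u y / v y) <= u x / v x" using m[OF y x] by (simp only: pos_divide_le_eq[symmetric] divide_inverse mult.commute[of "inverse (C ^ 4 + 1)"] mult.commute[of "C ^ 4 + 1"])
 qed
qed

end

theorem corollary2p2:
  fixes m :: "'a::heine_borel measure"
    and X :: "('w, 'a) process" and Xh :: "('v, 'a) process"
    and \<D> :: "('a \<Rightarrow> real) set"
    and j jh :: "'a \<Rightarrow> 'a \<Rightarrow> real"
    and \<Phi> :: "real \<Rightarrow> real"
    and z0 :: 'a and r0 :: real
  assumes "sets m = sets borel" and "sigma_finite_measure m"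
    and full_support: "\<forall>U. open U \<and> U \<noteq> {} \<longrightarrow> emeasure m U > 0"
    and localization_radius_infinite: "\<forall>(x::'a) r. - ball x (2 * r) \<noteq> {}"
    and "assumption_A m X Xh"
    and "conservative X" and "conservative Xh"
    and "assumption_B m X Xh \<D>"
    and "assumption_C m X Xh j jh"
    and "r0 > 0"
    and "assumption_V1 m z0" and "assumption_V2 m z0 r0"
    and "assumption_Phi \<Phi>"
    and "assumption_B2a m X Xh \<D> \<Phi> z0 r0"
    and "assumption_B2b m X Xh \<D> j z0 r0"
    and "assumption_C2 m j jh \<Phi> z0 r0"
    and "assumption_D2 m X Xh \<Phi> z0 r0"
  shows "\<exists>C2>1. \<forall>r\<ge>2 * r0. \<forall>D u v.
    open D \<and> D \<subseteq> - cl_ball z0 r \<and>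
    u \<in> borel_measurable borel \<and> v \<in> borel_measurable borel \<and>
    (\<forall>x. 0 \<le> u x) \<and> (\<forall>x. 0 \<le> v x) \<and>
    regular_harmonic X D u \<and> regular_harmonic X D v \<and>
    (\<forall>x\<in>- cl_ball z0 r \<inter> (- closure D \<union> regular_points X D). u x = 0 \<and> v x = 0) \<longrightarrow>
    (\<forall>x\<in>D \<inter> - cl_ball z0 (8 * r). \<forall>y\<in>D \<inter> - cl_ball z0 (8 * r).
       inverse C2 * (u y / v y) \<le> u x / v x \<and> u x / v x \<le> C2 * (u y / v y))"
proof -
 note A = `assumption_A m X Xh`[unfolded assumption_A_def] and B = `assumption_B m X Xh \<D>`[unfolded assumption_B_def]
  and C = `assumption_C m X Xh j jh`[unfolded assumption_C_def]
 note sfm = sigma_finite_measure.sigma_finite_countable[OF assms(2)]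
 have jp: "0 < j x y" "j x y = jh y x" "0 < jh x y" if "x ~= y" for x y using C that by metis+
 interpret levy X m j \<D> by unfold_locales (use assms A B C jp sfm in "simp_all")
 interpret Y: levy Xh m jh \<D> by unfold_locales (use assms A B C jp sfm in "simp_all")
 interpret d: dualp X Xh m by unfold_locales (use assms A sfm in "simp_all")
 interpret bhp X Xh m j jh \<D> \<Phi> z0 r0 by unfold_locales (use assms A jp in "simp_all")
 show ?thesis by (rule boundary_harnack)
qed

end
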